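(* Let $d\ge1$, $s,s_0\in\mathbb R$ with $s_0>s/2$, and $1\le p,q\le\infty$. Let $B^s_{p,q}(H)$ be the Besov spaces associated with the harmonic oscillator $H=-\Delta+|x|^2$ on $\mathbb R^d$, and let $j_0=-1$. Let $X$ be either $L^p(\mathbb R^d)$ or $B^0_{p,r}(H)$ with some $1\le r\le\infty$. Then there exists a constant $C>0$ such that $$C^{-1}\|f\|_{B^s_{p,q}(H)}\le\Big\{\int_0^{2^{-2j_0}}\Big(t^{-\frac s2}\|(tH)^{s_0}e^{-tH}f\|_X\Big)^q\frac{dt}t\Big\}^{\frac1q}\le C\|f\|_{B^s_{p,q}(H)}$$ for any $f\in B^s_{p,q}(H)$.
   Context: $H=-\Delta+|x|^2$ is the self-adjoint operator on $L^2(\mathbb R^d)$ with domain $\{f\in L^2: \Delta f,\ |x|^2f\in L^2\}$. Its spectrum consists of the eigenvalues $2n+d$, $n=0,1,2,\dots$, with Hermite functions as eigenfunctions. Functions of $H$ are defined on $L^2$ by the spectral theorem; $\phi_j(\sqrt H)$, $e^{-tH}$ and $(tH)^{s_0}e^{-tH}$ ($t>0$) are extended to $\mathcal S'(\mathbb R^d)$ by duality (they map $\mathcal S(\mathbb R^d)$ to itself). Fix a non-negative $\phi_0\in C_0^\infty(\mathbb R)$ with $\operatorname{supp}\phi_0\subset[2^{-1},2]$ and $\sum_{j\in\mathbb Z}\phi_0(2^{-j}\lambda)=1$ for all $\lambda>0$, and put $\phi_j(\lambda)=\phi_0(2^{-j}\lambda)$ for $j\in\mathbb Z$. One has $\phi_j(\sqrt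 H)=0$ for $j<-1$. For $s\in\mathbb R$ and $1\le p,q\le\infty$, $$\|f\|_{B^s_{p,q}(H)}=\Big\|\big\{2^{sj}\|\phi_j(\sqrt H)f\|_{L^p(\mathbb R^d)}\big\}_{j=-1}^\infty\Big\|_{\ell^q},\qquad B^s_{p,q}(H)=\{f\in\mathcal S'(\mathbb R^d):\|f\|_{B^s_{p,q}(H)}<\infty\}.$$ When $q=\infty$, the expression $\{\int_0^{2^{-2j_0}}(\cdot)^q\,dt/t\}^{1/q}$ is understood as the essential supremum over $0<t<2^{-2j_0}$. *)

theory Defs
  imports "HOL-Analysis.Analysis" "HOL-Probability.Essential_Supremum"
begin

section \<open>Extended \<open>L\<^sup>p\<close> norms\<close>

definition epowr :: "ennreal \<Rightarrow> real \<Rightarrow> ennreal" where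
  "epowr x a = (if x = top then top else ennreal (enn2real x powr a))"

text \<open>The exponent \<open>p\<close> is an extended number in \<open>[1, \<infinity>]\<close>. On a counting measure this is the
  \<open>\<ell>\<^sup>p\<close> norm of a sequence.\<close>

definition eLp_norm :: "ennreal \<Rightarrow> 'a measure \<Rightarrow> ('a \<Rightarrow> ennreal) \<Rightarrow> ennreal" where
  "eLp_norm p M a =
     (if p = top then esssup M a
      else epowr (\<integral>\<^sup>+ x. epowr (a x) (enn2real p) \<partial>M) (1 / enn2real p))"


section \<open>Schwartz functions and tempered distributions\<close>

definition partial_deriv :: "'n::finite \<Rightarrow> (real^'n \<Rightarrow> complex) \<Rightarrow> real^'n \<Rightarrow> complex" where
  "partial_deriv i f x = vector_derivative (\<lambda>t. f (x + t *\<^sub>R axis i 1)) (at 0)"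

definition partials :: "'n::finite list \<Rightarrow> (real^'n \<Rightarrow> complex) \<Rightarrow> real^'n \<Rightarrow> complex" where
  "partials is f = foldr partial_deriv is f"

definition schwartz :: "(real^'n::finite \<Rightarrow> complex) set" where
  "schwartz = {f. (\<forall>is x. partials is f differentiable (at x)) \<and>
                  (\<forall>is N. bounded (range (\<lambda>x. (1 + norm x) ^ N *\<^sub>R partials is f x)))}"

definition schwartz_norm :: "nat \<Rightarrow> (real^'n::finite \<Rightarrow> complex) \<Rightarrow> real" where
  "schwartz_norm N f =
     (SUP (is, x) \<in> {is. length is \<le> N} \<times> UNIV. (1 + norm x) ^ N * cmod (partials is f x))"

text \<open>Tempered distributions are functionals whose values outside \<^const>\<open>schwartz\<close> are
  irrelevant; everything below evaluates them on Schwartz functions only.\<close>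

type_synonym 'n dist = "(real^'n \<Rightarrow> complex) \<Rightarrow> complex"

definition tempered :: "'n::finite dist set" where
  "tempered = {u. (\<forall>f\<in>schwartz. \<forall>g\<in>schwartz. u (\<lambda>x. f x + g x) = u f + u g) \<and>
                  (\<forall>c. \<forall>f\<in>schwartz. u (\<lambda>x. c * f x) = c * u f) \<and>
                  (\<exists>C N. \<forall>f\<in>schwartz. cmod (u f) \<le> C * schwartz_norm N f)}"

definition represents :: "(real^'n::finite \<Rightarrow> complex) \<Rightarrow> 'n dist \<Rightarrow> bool" where
  "represents g u \<longleftrightarrow> (\<forall>f\<in>schwartz. u f = (\<integral>x. g x * f x \<partial>lborel))"

text \<open>The \<open>L\<^sup>p\<close> norm of a distribution is \<open>\<infinity>\<close> (the infimum of the empty set) if the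
  distribution is not given by an \<open>L\<^sup>p\<close> function.\<close>

definition dist_Lp_norm :: "ennreal \<Rightarrow> 'n::finite dist \<Rightarrow> ennreal" where
  "dist_Lp_norm p u =
     (INF g \<in> {g \<in> borel_measurable lborel.
                 eLp_norm p lborel (\<lambda>x. ennreal (cmod (g x))) < top \<and> represents g u}.
        eLp_norm p lborel (\<lambda>x. ennreal (cmod (g x))))"


section \<open>Spectral resolutions and functional calculus on \<open>L\<^sup>2\<close>\<close>

text \<open>Elements of \<open>L\<^sup>2\<close> are functions, identified almost everywhere where needed; an
  unbounded operator is given by its graph, closed under almost-everywhere equality.\<close>

definition L2 :: "('a::euclidean_space \<Rightarrow> complex) set" where
  "L2 = {f \<in> borel_measurable lborel. integrable lborel (\<lambda>x. (cmod (f x))\<^sup>2)}"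

definition L2_inner :: "('a::euclidean_space \<Rightarrow> complex) \<Rightarrow> ('a \<Rightarrow> complex) \<Rightarrow> complex" where
  "L2_inner f g = (\<integral>x. f x * cnj (g x) \<partial>lborel)"

definition AE_eq :: "('a::euclidean_space \<Rightarrow> complex) \<Rightarrow> ('a \<Rightarrow> complex) \<Rightarrow> bool" where
  "AE_eq f g \<longleftrightarrow> (AE x in lborel. f x = g x)"

type_synonym 'a proj_measure = "real set \<Rightarrow> ('a \<Rightarrow> complex) \<Rightarrow> ('a \<Rightarrow> complex)"

text \<open>Symmetry on all of \<open>L\<^sup>2\<close> already makes each \<open>E A\<close> linear and compatible with
  almost-everywhere equality, so that \<open>E A\<close> is an orthogonal projection.\<close>

definition is_proj_measure :: "'a::euclidean_space proj_measure \<Rightarrow> bool" where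
  "is_proj_measure E \<longleftrightarrow>
     (\<forall>A\<in>sets borel. \<forall>f\<in>L2. E A f \<in> L2) \<and>
     (\<forall>A\<in>sets borel. \<forall>f\<in>L2. \<forall>g\<in>L2. L2_inner (E A f) g = L2_inner f (E A g)) \<and>
     (\<forall>A\<in>sets borel. \<forall>B\<in>sets borel. \<forall>f\<in>L2. AE_eq (E (A \<inter> B) f) (E A (E B f))) \<and>
     (\<forall>f\<in>L2. AE_eq (E UNIV f) f) \<and>
     (\<forall>A :: nat \<Rightarrow> real set. range A \<subseteq> sets borel \<longrightarrow> disjoint_family A \<longrightarrow>
        (\<forall>f\<in>L2. (\<lambda>i. L2_inner (E (A i) f) f) sums L2_inner (E (\<Union>i. A i) f) f))"

text \<open>The measure \<open>\<mu>\<^sub>f(A) = \<langle>E(A)f, f\<rangle> = \<parallel>E(A)f\<parallel>\<^sup>2\<close>.\<close>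

definition spectral_measure ::
    "'a::euclidean_space proj_measure \<Rightarrow> ('a \<Rightarrow> complex) \<Rightarrow> real measure" where
  "spectral_measure E f =
     measure_of UNIV (sets borel) (\<lambda>A. ennreal (Re (L2_inner (E A f) f)))"

text \<open>\<open>\<integral> m d\<langle>E f, g\<rangle>\<close>, where the complex measure \<open>\<langle>E f, g\<rangle>\<close> is expressed by polarization as
  \<open>(\<Sum>k<4. \<i>\<^sup>k \<mu>\<^sub>h) / 4\<close> with \<open>h = f + \<i>\<^sup>k g\<close>.\<close>

definition spectral_integral ::
    "'a::euclidean_space proj_measure \<Rightarrow> (real \<Rightarrow> real) \<Rightarrow> ('a \<Rightarrow> complex) \<Rightarrow> ('a \<Rightarrow> complex) \<Rightarrow> complex"
  where
  "spectral_integral E m f g =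
     (\<Sum>k<4. \<i> ^ k * complex_of_real (\<integral>l. m l \<partial>spectral_measure E (\<lambda>x. f x + \<i> ^ k * g x))) / 4"

text \<open>\<open>T = \<integral> \<lambda> dE(\<lambda>)\<close>, including the equality of domains.\<close>

definition is_spectral_resolution ::
    "(('a::euclidean_space \<Rightarrow> complex) \<times> ('a \<Rightarrow> complex)) set \<Rightarrow> 'a proj_measure \<Rightarrow> bool" where
  "is_spectral_resolution T E \<longleftrightarrow>
     is_proj_measure E \<and>
     Domain T = {f \<in> L2. (\<integral>\<^sup>+ l. ennreal (l\<^sup>2) \<partial>spectral_measure E f) < top} \<and>
     (\<forall>(f, h)\<in>T. \<forall>g\<in>Domain T. L2_inner h g = spectral_integral E (\<lambda>l. l) f g)"

text \<open>A self-adjoint \<open>T\<close> has a spectral resolution, unique up to almost-everywhere equality.\<close>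

definition spectral_resolution ::
    "(('a::euclidean_space \<Rightarrow> complex) \<times> ('a \<Rightarrow> complex)) set \<Rightarrow> 'a proj_measure" where
  "spectral_resolution T = (SOME E. is_spectral_resolution T E)"

text \<open>A representative of \<open>m(T) f = \<integral> m dE f\<close>, for \<open>m\<close> bounded on the spectrum of \<open>T\<close>.\<close>

definition fun_calc ::
    "(('a::euclidean_space \<Rightarrow> complex) \<times> ('a \<Rightarrow> complex)) set \<Rightarrow> (real \<Rightarrow> real) \<Rightarrow>
       ('a \<Rightarrow> complex) \<Rightarrow> ('a \<Rightarrow> complex)" where
  "fun_calc T m f =
     (SOME u. u \<in> L2 \<and> (\<forall>g\<in>L2. L2_inner u g = spectral_integral (spectral_resolution T) m f g))"


section \<open>The harmonic oscillator\<close>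

definition laplacian :: "(real^'n::finite \<Rightarrow> complex) \<Rightarrow> real^'n \<Rightarrow> complex" where
  "laplacian f x = (\<Sum>i\<in>UNIV. partial_deriv i (partial_deriv i f) x)"

definition weak_laplacian :: "(real^'n::finite \<Rightarrow> complex) \<Rightarrow> (real^'n \<Rightarrow> complex) \<Rightarrow> bool" where
  "weak_laplacian f u \<longleftrightarrow>
     (\<forall>\<phi>\<in>schwartz. (\<integral>x. f x * laplacian \<phi> x \<partial>lborel) = (\<integral>x. u x * \<phi> x \<partial>lborel))"

definition oscillator :: "((real^'n::finite \<Rightarrow> complex) \<times> (real^'n \<Rightarrow> complex)) set" where
  "oscillator = {(f, h). f \<in> L2 \<and> (\<lambda>x. (norm x)\<^sup>2 *\<^sub>R f x) \<in> L2 \<and> h \<in> L2 \<and>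
     (\<exists>u\<in>L2. weak_laplacian f u \<and> AE_eq h (\<lambda>x. - u x + (norm x)\<^sup>2 *\<^sub>R f x))}"

text \<open>The Schwartz function in the almost-everywhere class of \<open>m(H) g\<close>, for \<open>g\<close> Schwartz.\<close>

definition oscillator_calc_schwartz ::
    "(real \<Rightarrow> real) \<Rightarrow> (real^'n::finite \<Rightarrow> complex) \<Rightarrow> real^'n \<Rightarrow> complex" where
  "oscillator_calc_schwartz m g = (THE v. v \<in> schwartz \<and> AE_eq v (fun_calc oscillator m g))"

text \<open>\<open>m(H) u\<close> for a tempered distribution \<open>u\<close>. As \<open>m\<close> is real and \<open>H\<close> commutes with complex
  conjugation, \<open>m(H)\<close> is its own transpose for the bilinear pairing, so this extends \<open>m(H)\<close>
  from \<open>L\<^sup>2\<close>.\<close>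

definition oscillator_calc :: "(real \<Rightarrow> real) \<Rightarrow> 'n::finite dist \<Rightarrow> 'n dist" where
  "oscillator_calc m u = (\<lambda>g. u (oscillator_calc_schwartz m g))"


section \<open>Besov spaces\<close>

definition dyadic_partition :: "(real \<Rightarrow> real) \<Rightarrow> bool" where
  "dyadic_partition \<phi>0 \<longleftrightarrow>
     (\<forall>n x. (deriv ^^ n) \<phi>0 differentiable (at x)) \<and>
     (\<forall>x. 0 \<le> \<phi>0 x) \<and>
     closure {x. \<phi>0 x \<noteq> 0} \<subseteq> {1/2..2} \<and>
     (\<forall>l>0. ((\<lambda>j::int. \<phi>0 (2 powr (- real_of_int j) * l)) has_sum 1) UNIV)"

text \<open>The multiplier of \<open>\<phi>\<^sub>j(\<surd>H)\<close> as a function of \<open>H\<close>.\<close>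

definition dyadic_mult :: "(real \<Rightarrow> real) \<Rightarrow> int \<Rightarrow> real \<Rightarrow> real" where
  "dyadic_mult \<phi>0 j l = \<phi>0 (2 powr (- real_of_int j) * sqrt l)"

definition besov_norm ::
    "(real \<Rightarrow> real) \<Rightarrow> real \<Rightarrow> ennreal \<Rightarrow> ennreal \<Rightarrow> 'n::finite dist \<Rightarrow> ennreal" where
  "besov_norm \<phi>0 s p q f =
     eLp_norm q (count_space {-1..})
       (\<lambda>j. ennreal (2 powr (s * real_of_int j)) *
            dist_Lp_norm p (oscillator_calc (dyadic_mult \<phi>0 j) f))"

definition besov_space ::
    "(real \<Rightarrow> real) \<Rightarrow> real \<Rightarrow> ennreal \<Rightarrow> ennreal \<Rightarrow> 'n::finite dist set" where
  "besov_space \<phi>0 s p q = {f \<in> tempered. besov_norm \<phi>0 s p q f < top}"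

text \<open>The multiplier of \<open>(tH)\<^sup>a e\<^sup>-\<^sup>t\<^sup>H\<close>; only its values at \<open>l > 0\<close> matter, the spectrum of
  \<open>H\<close> being positive.\<close>

definition heat_mult :: "real \<Rightarrow> real \<Rightarrow> real \<Rightarrow> real" where
  "heat_mult a t l = (t * l) powr a * exp (- (t * l))"

text \<open>The measure \<open>dt/t\<close> on \<open>(0, 2\<^sup>-\<^sup>2\<^sup>k)\<close>.\<close>

definition time_measure :: "int \<Rightarrow> real measure" where
  "time_measure k =
     density (restrict_space lborel {0<..<2 powr (- 2 * real_of_int k)}) (\<lambda>t. ennreal (1 / t))"

definition heat_norm ::
    "real \<Rightarrow> real \<Rightarrow> ennreal \<Rightarrow> int \<Rightarrow> ('n::finite dist \<Rightarrow> ennreal) \<Rightarrow> 'n dist \<Rightarrow> ennreal" where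
  "heat_norm s s0 q j0 X_norm f =
     eLp_norm q (time_measure j0)
       (\<lambda>t. ennreal (t powr (- s / 2)) * X_norm (oscillator_calc (heat_mult s0 t) f))"

end

theory Submission
 imports Defs "HOL-Probability.Probability"
begin

text \<open>The spectral resolution of \<open>H\<close> is the Hermite expansion, so that \<open>m(H)\<close> acts on tempered
  distributions coefficientwise. If \<open>m\<close> vanishes beyond level \<open>R\<close>, the ladder relations and summation
  by parts turn multiplication of the kernel of \<open>m(H)\<close> by \<open>x\<^sub>i - y\<^sub>i\<close> into a finite difference of \<open>m\<close>.
  Together with \<open>\<Sum> h\<^sub>n(x)\<^sup>2 = O(\<surd>N)\<close> for the sum over \<open>n < N\<close>, this bounds the \<open>L\<^sup>1\<close> norm of the kernel
  in one variable as soon as \<open>R\<^sup>k \<Delta>\<^sup>k m\<close> is bounded for all \<open>k \<le> d\<close>, and then \<open>m(H)\<close> is bounded on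
  every \<open>L\<^sup>p\<close>. Applied to \<open>(tH)\<^sup>a e\<^sup>-\<^sup>t\<^sup>H\<close> and to its inverse, cut off around the support of \<open>\<phi>\<^sub>j\<close>, this
  yields \<open>\<parallel>\<phi>\<^sub>j(\<surd>H) (tH)\<^sup>a e\<^sup>-\<^sup>t\<^sup>H f\<parallel> \<le> C u\<^sup>a e\<^sup>-\<^sup>u\<^sup>/\<^sup>3\<^sup>2 \<parallel>\<phi>\<^sub>j(\<surd>H) f\<parallel>\<close> with \<open>u = 4\<^sup>j t\<close>, and the reverse inequality
  for \<open>1/4 \<le> u \<le> 1\<close>. Both halves of the theorem follow by Schur's test between \<open>\<ell>\<^sup>q\<close> and
  \<open>L\<^sup>q(dt/t)\<close>; the kernel \<open>u\<^sup>b e\<^sup>-\<^sup>u\<^sup>/\<^sup>3\<^sup>2\<close> with \<open>b = s0 - s/2 > 0\<close> is integrable for \<open>du/u\<close> and summable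
  over the scales.\<close>

text \<open>Two features of the definitions shape the argument. The calculus rests on choice
  operators, so exhibiting one spectral resolution is not enough: every resolution of H has to be
  diagonal in the Hermite basis, which requires the exact domain of H and a test with the vectors
  \<open>E B f\<close>. Moreover the norm of a distribution is an infimum over representatives,
  whose measurability in t is not evident although the Schur test integrates over t. It is obtained
  from continuity in t, where membership of f in the Besov space bounds the dyadic pieces and the
  exponential factor makes them summable. The sizes in the kernel estimate are those of a kernel
  concentrated at distance 1/sqrt R from the diagonal with square integral of order R^(d/2) in y.
  The weight is a product over coordinates, so at most one commutator per coordinate occurs and d
  differences of the multiplier suffice. All constants stay uniform because the dilations 4^(-j)
  with j \<ge> -1 never exceed 4.\<close>

abbreviation bmeas :: "('a::topological_space => 'b::topological_space) set" where
 "bmeas == borel_measurable borel"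

abbreviation cplx :: "real => complex" where
 "cplx == complex_of_real"

abbreviation scales :: "int measure" where
 "scales == count_space {-1..}"

abbreviation tmeas :: "real measure" where
 "tmeas == time_measure (-1)"

abbreviation calc :: "(real => real) => 'n::finite dist => 'n dist" where
 "calc == oscillator_calc"

abbreviation heat :: "real => real => 'n::finite dist => 'n dist" where
 "heat a t == oscillator_calc (heat_mult a t)"

abbreviation dnorm :: "ennreal => 'n::finite dist => ennreal" where
 "dnorm == dist_Lp_norm"

section \<open>Square integrable functions\<close>

definition nrm2 :: "('a::euclidean_space => complex) => real" where
 "nrm2 f = (LBINT x. (cmod (f x))^2)"

lemma nrm2_nonneg [simp]: "0 <= nrm2 f" unfolding nrm2_def by simp

lemma L2_measurable: "f \<in> L2 ==> f \<in> bmeas" by (simp add: L2_def)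

lemma L2_integrable: "f \<in> L2 ==> integrable lborel (%x. (cmod (f x))^2)" by (simp add: L2_def)

lemma L2I:
 "f \<in> bmeas ==> integrable lborel (%x. (cmod (f x))^2) ==> f \<in> L2" by (simp add: L2_def)

lemma L2I_bound:
 fixes f :: "'a::euclidean_space => complex"
 assumes "f \<in> bmeas" "integrable lborel b" "!!x. (cmod (f x))^2 <= b x" shows "f \<in> L2"
proof (rule L2I)
 show "integrable lborel (%x. (cmod (f x))^2)" by (rule Bochner_Integration.integrable_bound[OF assms(2)])
    (use assms in \<open>auto intro!: AE_I2 intro: order_trans[OF _ abs_ge_self]\<close>)
qed fact

lemma norm_add_sq_le: "(norm (a + b :: 'b::real_normed_vector))^2 <= 2 * (norm a)^2 + 2 * (norm b)^2"
proof -
 have "(norm (a + b))^2 <= (norm a + norm b)^2" by (intro power_mono norm_triangle_ineq) simp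
 also have "... <= 2 * (norm a)^2 + 2 * (norm b)^2"
  using sum_squares_ge_zero[of "norm a - norm b" 0] by (simp add: power2_eq_square algebra_simps)
 finally show ?thesis .
qed

lemma L2_zero [simp]: "(%_. 0) \<in> L2" by (simp add: L2_def)

declare L2_integrable [simp]

lemma L2_add:
 assumes "f \<in> L2" "g \<in> L2" shows "(%x. f x + g x) \<in> L2"
proof (rule L2I_bound[where b="%x. 2 * (cmod (f x))^2 + 2 * (cmod (g x))^2"])
 show "(%x. f x + g x) \<in> bmeas" using assms[THEN L2_measurable] by measurable
qed (use assms norm_add_sq_le in auto)

lemma L2_scale:
 assumes "f \<in> L2" shows "(%x. c * f x) \<in> L2"
proof (rule L2I)
 show "(%x. c * f x) \<in> bmeas" using L2_measurable[OF assms] by measurable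
qed (use assms in \<open>simp add: norm_mult power_mult_distrib\<close>)

lemma L2_uminus: "f \<in> L2 ==> (%x. - f x) \<in> L2" using L2_scale[of f "-1"] by simp

lemma L2_diff: "f \<in> L2 ==> g \<in> L2 ==> (%x. f x - g x) \<in> L2" using L2_add[of f "%x. - g x"] L2_uminus[of g] by simp

lemma L2_sum: "(!!i. i \<in> I ==> f i \<in> L2) ==> (%x. \<Sum>i\<in>I. f i x) \<in> L2"
 by (induction I rule: infinite_finite_induct) (auto intro: L2_add)

lemma L2_cnj:
 assumes "f \<in> L2" shows "(%x. cnj (f x)) \<in> L2"
proof (rule L2I)
 show "(%x. cnj (f x)) \<in> bmeas" by (rule measurable_compose[OF L2_measurable[OF assms]])
    (intro borel_measurable_continuous_onI continuous_intros)
qed (use assms in simp)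

lemma integrable_mult_L2:
 assumes "f \<in> L2" "g \<in> L2" shows "integrable lborel (%x. f x * g x)"
proof (rule Bochner_Integration.integrable_bound)
 show "integrable lborel (%x. (cmod (f x))^2 + (cmod (g x))^2)" using assms by auto
 show "(%x. f x * g x) \<in> borel_measurable lborel" using assms[THEN L2_measurable] by measurable
 show "AE x in lborel. norm (f x * g x) <= norm ((cmod (f x))^2 + (cmod (g x))^2)"
 proof (rule AE_I2)
  fix x
  have "cmod (f x) * cmod (g x) <= (cmod (f x))^2 + (cmod (g x))^2" using sum_squares_bound[of "cmod (f x)" "cmod (g x)"]
    mult_nonneg_nonneg[OF norm_ge_zero[of "f x"] norm_ge_zero[of "g x"]] by linarith
  then show "norm (f x * g x) <= norm ((cmod (f x))^2 + (cmod (g x))^2)" by (simp add: norm_mult)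
 qed
qed

lemma integrable_norm_mult_L2:
 assumes "f \<in> L2" "g \<in> L2" shows "integrable lborel (%x. cmod (f x) * cmod (g x))"
 using integrable_norm[OF integrable_mult_L2[OF assms]] by (simp add: norm_mult)

lemma cauchy_schwarz_norm:
 assumes f: "f \<in> L2" and g: "g \<in> L2"
 shows "(LBINT x. cmod (f x) * cmod (g x)) <= sqrt (nrm2 f) * sqrt (nrm2 g)"
proof -
 have [measurable]: "f \<in> bmeas" "g \<in> bmeas" using f g by (auto dest: L2_measurable)
 let ?I = "\<integral>x. cmod (f x) * cmod (g x) \<partial>lborel"
 have sq: "(\<integral>\<^sup>+x. (ennreal (cmod (h x)))^2 \<partial>lborel) = ennreal (nrm2 h)" if "h \<in> L2" for h :: "'a => complex"
  using nn_integral_eq_integral[OF L2_integrable[OF that]] by (simp add: nrm2_def ennreal_power)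
 have "(\<integral>\<^sup>+x. ennreal (cmod (f x)) * ennreal (cmod (g x)) \<partial>lborel) = ennreal ?I"
  using nn_integral_eq_integral[OF integrable_norm_mult_L2[OF f g]] by (simp add: ennreal_mult)
 then have "ennreal (?I^2) <= ennreal (nrm2 f * nrm2 g)"
  using Cauchy_Schwarz_nn_integral[of "%x. ennreal (cmod (f x))" lborel "%x. ennreal (cmod (g x))"] sq[OF f] sq[OF g]
  by (simp add: ennreal_power ennreal_mult)
 then show ?thesis by (simp add: real_le_rsqrt flip: real_sqrt_mult)
qed

lemma cauchy_schwarz:
 assumes "f \<in> L2" "g \<in> L2" shows "cmod (LBINT x. f x * g x) <= sqrt (nrm2 f) * sqrt (nrm2 g)"
proof -
 have "cmod (LBINT x. f x * g x) <= (LBINT x. cmod (f x) * cmod (g x))"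
  using integral_norm_bound[of lborel "%x. f x * g x"] by (simp add: norm_mult)
 with cauchy_schwarz_norm[OF assms] show ?thesis by linarith
qed

lemma nrm2_add_le:
 assumes "f \<in> L2" "g \<in> L2" shows "nrm2 (%x. f x + g x) <= 2 * nrm2 f + 2 * nrm2 g"
proof -
 have "nrm2 (%x. f x + g x) <= (LBINT x. 2 * (cmod (f x))^2 + 2 * (cmod (g x))^2)" unfolding nrm2_def
  by (rule integral_mono) (use assms norm_add_sq_le in \<open>auto simp: L2_add\<close>)
 also have "... = 2 * nrm2 f + 2 * nrm2 g" using assms L2_integrable by (simp add: nrm2_def)
 finally show ?thesis .
qed

lemma nrm2_commute: "nrm2 (%x. f x - g x) = nrm2 (%x. g x - f x)" by (simp add: nrm2_def norm_minus_commute)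

lemma nrm2_zero_AE:
 assumes "f \<in> L2" "nrm2 f = 0" shows "AE x in lborel. f x = 0"
proof -
 have "AE x in lborel. (cmod (f x))^2 = 0" using integral_nonneg_eq_0_iff_AE[OF L2_integrable[OF assms(1)]] assms(2)
  by (auto simp: nrm2_def)
 then show ?thesis by auto
qed

lemma integral_mult_tendsto:
 assumes "!!n. f n \<in> L2" "h \<in> L2" "g \<in> L2" and lim: "(%n. nrm2 (%x. h x - f n x)) \<longlonglongrightarrow> 0"
 shows "(%n. \<integral>x. f n x * g x \<partial>lborel) \<longlonglongrightarrow> (LBINT x. h x * g x)"
proof (rule LIM_zero_cancel, rule Lim_null_comparison)
 show "eventually (%n. norm ((LBINT x. f n x * g x) - (LBINT x. h x * g x)) \<le>
   sqrt (nrm2 (%x. h x - f n x)) * sqrt (nrm2 g)) sequentially"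
 proof (rule always_eventually, rule allI)
  fix n
  have "(LBINT x. f n x * g x) - (LBINT x. h x * g x) = (LBINT x. (f n x - h x) * g x)"
   using assms by (simp add: integrable_mult_L2 left_diff_distrib)
  then show "norm ((LBINT x. f n x * g x) - (LBINT x. h x * g x)) \<le>
   sqrt (nrm2 (%x. h x - f n x)) * sqrt (nrm2 g)"
   using cauchy_schwarz[OF L2_diff[OF assms(1)[of n] assms(2)] assms(3)] nrm2_commute by metis
 qed
 show "(%n. sqrt (nrm2 (%x. h x - f n x)) * sqrt (nrm2 g)) \<longlonglongrightarrow> 0"
  using tendsto_mult_right[OF tendsto_real_sqrt[OF lim]] by simp
qed

text \<open>Passing to a subsequence with \<open>nrm2\<close> of the increments at most \<open>4\<^sup>-\<^sup>k\<close>, the weighted sum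
  \<open>\<Sum> 2\<^sup>k \<bar>increment\<bar>\<^sup>2\<close> is integrable, hence finite almost everywhere.\<close>

theorem riesz_fischer:
 fixes f :: "nat => 'a::euclidean_space => complex"
 assumes f: "!!n. f n \<in> L2" and cauchy: "!!e. e > 0 ==> \<exists>N. \<forall>m\<ge>N. \<forall>n\<ge>N. nrm2 (%x. f m x - f n x) < e"
 shows "\<exists>h\<in>L2. (%n. nrm2 (%x. h x - f n x)) \<longlonglongrightarrow> 0"
proof -
 have [measurable]: "f n \<in> bmeas" for n using f L2_measurable by blast
 obtain N where N: "!!k m n. m >= N k ==> n >= N k ==> nrm2 (%x. f m x - f n x) < (1/4)^k"
  using cauchy[of "(1/4)^_"] by (auto simp: ) metis
 \<comment> \<open>Partial sums of N are monotone and still dominate N, so admissible indices are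
   found without choosing a subsequence recursively.\<close>
 define r where "r k = (\<Sum>i\<le>k. N i)" for k
 have rN: "r k >= N k" for k unfolding r_def by (intro member_le_sum) auto
 have rmono: "r k <= r (Suc k)" for k by (simp add: r_def)
 have rN': "r (Suc k) >= N k" for k using rN[of k] rmono[of k] by simp
 define d where "d k x = f (r (Suc k)) x - f (r k) x" for k x
 have dL2: "d k \<in> L2" for k unfolding d_def by (intro L2_diff f)
 have [measurable]: "d k \<in> bmeas" for k using dL2 L2_measurable by blast
 have dn: "nrm2 (d k) <= (1/4)^k" for k using N[OF rN'[of k] rN[of k]] unfolding d_def by (rule less_imp_le)
 have "(\<integral>\<^sup>+x. (\<Sum>k. ennreal (2^k * (cmod (d k x))^2)) \<partial>lborel) = (\<Sum>k. \<integral>\<^sup>+x. ennreal (2^k * (cmod (d k x))^2) \<partial>lborel)"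
  by (rule nn_integral_suminf) measurable
 also have "... = (\<Sum>k. ennreal (2^k * nrm2 (d k)))"
 proof (rule suminf_cong)
  fix k
  show "(\<integral>\<^sup>+x. ennreal (2^k * (cmod (d k x))^2) \<partial>lborel) = ennreal (2^k * nrm2 (d k))"
   using L2_integrable[OF dL2[of k]] by (subst nn_integral_eq_integral) (auto simp: nrm2_def)
 qed
 also have "... <= (\<Sum>k. ennreal ((1/2)^k))"
 proof (intro suminf_le ennreal_leI)
  fix k
  have "2^k * nrm2 (d k) <= 2^k * (1/4)^k" using dn by simp
  also have "... = (1/2)^k" by (simp flip: power_mult_distrib)
  finally show "2^k * nrm2 (d k) <= (1/2)^k" .
 qed auto
 also have "... < \<infinity>" using summable_geometric[of "1/2::real"] by (subst suminf_ennreal2) auto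
 finally have "AE x in lborel. (\<Sum>k. ennreal (2^k * (cmod (d k x))^2)) ~= \<infinity>" by (intro nn_integral_noteq_infinite) auto
 then have AEconv: "AE x in lborel. convergent (%k. f (r k) x)"
 proof eventually_elim
  case (elim x)
  have s: "summable (%k. 2^k * (cmod (d k x))^2)" by (rule summable_suminf_not_top) (use elim in auto)
  have "summable (%k. d k x)"
  proof (rule summable_comparison_test')
   show "summable (%k. 2^k * (cmod (d k x))^2 + (1/2)^k)" by (intro summable_add s summable_geometric) auto
   fix k :: nat
   \<comment> \<open>AM-GM against 2^(-k) turns the weighted square sum into absolute convergence of
     the increments.\<close>
   have "2 * cmod (d k x) = 2 * (sqrt (2^k) * cmod (d k x)) * sqrt ((1/2)^k)" by (simp add: real_sqrt_mult[symmetric] power_one_over)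
   also have "... <= (sqrt (2^k) * cmod (d k x))^2 + (sqrt ((1/2)^k))^2" by (rule sum_squares_bound)
   also have "... = 2^k * (cmod (d k x))^2 + (1/2)^k" by (simp add: power_mult_distrib)
   finally show "norm (d k x) <= 2^k * (cmod (d k x))^2 + (1/2)^k" using norm_ge_zero[of "d k x"] by linarith
  qed
  then have "convergent (%n. (\<Sum>k<n. d k x) + f (r 0) x)"
   by (intro convergent_add convergent_const) (simp add: summable_iff_convergent)
  moreover have "(\<Sum>k<n. d k x) + f (r 0) x = f (r n) x" for n
   using sum_lessThan_telescope[of "%k. f (r k) x" n] by (simp add: d_def)
  ultimately show ?case by simp
 qed
 define h where "h x = lim (%k. f (r k) x)" for x
 have [measurable]: "h \<in> bmeas" unfolding h_def by (rule borel_measurable_lim_metric) measurable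
 have AElim: "AE x in lborel. (%k. f (r k) x) \<longlonglongrightarrow> h x"
  using AEconv by eventually_elim (simp add: h_def convergent_LIMSEQ_iff)
 \<comment> \<open>Fatou carries the Cauchy estimate for \<open>f (r j) - f n\<close> over to the
   limit h, before h - f n is known to be square integrable.\<close>
 have est: "(\<integral>\<^sup>+x. ennreal ((cmod (h x - f n x))^2) \<partial>lborel) <= ennreal ((1/4)^k)" if "n >= N k" for n k
 proof -
  have "(\<integral>\<^sup>+x. ennreal ((cmod (h x - f n x))^2) \<partial>lborel) =
    (\<integral>\<^sup>+x. liminf (%j. ennreal ((cmod (f (r j) x - f n x))^2)) \<partial>lborel)"
  proof (rule nn_integral_cong_AE)
   show "AE x in lborel. ennreal ((cmod (h x - f n x))^2) = liminf (%j. ennreal ((cmod (f (r j) x - f n x))^2))" using AElim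
   proof eventually_elim
    case (elim x)
    have "(%j. ennreal ((cmod (f (r j) x - f n x))^2)) \<longlonglongrightarrow> ennreal ((cmod (h x - f n x))^2)"
     by (intro tendsto_ennrealI tendsto_intros elim)
    from lim_imp_Liminf[OF _ this] show ?case by simp
   qed
  qed
  also have "... <= liminf (%j. \<integral>\<^sup>+x. ennreal ((cmod (f (r j) x - f n x))^2) \<partial>lborel)"
   by (rule nn_integral_liminf) measurable
  also have "... <= ennreal ((1/4)^k)"
  proof (rule Liminf_le)
   show "eventually (%j. (\<integral>\<^sup>+x. ennreal ((cmod (f (r j) x - f n x))^2) \<partial>lborel) <= ennreal ((1/4)^k)) sequentially"
    using eventually_ge_at_top[of k]
   proof eventually_elim
    case (elim j)
    have "r k <= r j" by (rule lift_Suc_mono_le[of r, OF rmono elim])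
    then have "nrm2 (%x. f (r j) x - f n x) <= (1/4)^k" using N[of k "r j" n] rN[of k] that by simp
    moreover have "(\<integral>\<^sup>+x. ennreal ((cmod (f (r j) x - f n x))^2) \<partial>lborel) = ennreal (nrm2 (%x. f (r j) x - f n x))"
     unfolding nrm2_def by (rule nn_integral_eq_integral) (use L2_integrable[OF L2_diff[OF f f]] in auto)
    ultimately show ?case by (simp add: ennreal_leI)
   qed
  qed simp
  finally show ?thesis .
 qed
 have hfL2: "(%x. h x - f n x) \<in> L2" if "n >= N 0" for n
 proof (rule L2I)
  show "integrable lborel (%x. (cmod (h x - f n x))^2)" by (rule integrableI_bounded)
     (use est[OF that] in \<open>auto simp: order_le_less_trans\<close>)
 qed measurable
 have hL2: "h \<in> L2" using L2_add[OF hfL2[OF order_refl] f[of "N 0"]] by simp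
 have "(%n. nrm2 (%x. h x - f n x)) \<longlonglongrightarrow> 0"
 proof (rule LIMSEQ_I)
  fix e :: real assume "e > 0"
  then obtain k where k: "(1/4)^k < e" using real_arch_pow_inv[of e "1/4"] by auto
  have "norm (nrm2 (%x. h x - f n x) - 0) < e" if "n >= N k" for n
  proof -
   have "ennreal (nrm2 (%x. h x - f n x)) <= ennreal ((1/4)^k)" using est[OF that] unfolding nrm2_def
    by (subst nn_integral_eq_integral[symmetric])
      (use L2_integrable[OF L2_diff[OF hL2 f]] in auto)
   then show ?thesis using k by (simp add: ennreal_le_iff)
  qed
  then show "\<exists>no. \<forall>n\<ge>no. norm (nrm2 (%x. h x - f n x) - 0) < e" by blast
 qed
 with hL2 show ?thesis by blast
qed

subsection \<open>Orthonormal families with finite levels\<close>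

definition fcoef :: "('i => 'a::euclidean_space => real) => ('a => complex) => 'i => complex" where
 "fcoef e f i = (LBINT x. f x * cplx (e i x))"

definition fcomb :: "('i => 'a => real) => 'i set => ('i => complex) => 'a => complex" where
 "fcomb e I c x = (\<Sum>i\<in>I. c i * cplx (e i x))"

text \<open>The levels \<open>lev\<close> split an arbitrary index set into finite blocks, so that
  all expansions become ordinary series over \<open>nat\<close>. For multi-indices the level is the
  degree, and H is constant on each block.\<close>

locale orthonormal =
 fixes e :: "'i => 'a::euclidean_space => real" and lev :: "'i => nat"
 assumes fin: "finite {i. lev i = n}" and meas: "e i \<in> bmeas" and int: "integrable lborel (%x. e i x * e j x)"
  and orth: "(LBINT x. e i x * e j x) = of_bool (i = j)"
begin

lemma fin_less: "finite {i. lev i < N}"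
proof -
 have "{i. lev i < N} = (\<Union>n<N. {i. lev i = n})" by auto
 then show ?thesis by (simp add: fin)
qed

lemma basis_L2: "(%x. cplx (e i x)) \<in> L2"
 by (rule L2I) (use meas int[of i i] in \<open>auto simp: power2_eq_square\<close>)

lemma fcomb_L2: "fcomb e I c \<in> L2" unfolding fcomb_def by (intro L2_sum L2_scale basis_L2)

lemma fcoef_basis: "fcoef e (%x. cplx (e i x)) j = of_bool (i = j)"
proof -
 have "fcoef e (%x. cplx (e i x)) j = (LBINT x. cplx (e i x * e j x))"
  by (simp add: fcoef_def)
 then show ?thesis by (simp only: integral_complex_of_real orth) simp
qed

lemma fcoef_add: "f \<in> L2 ==> g \<in> L2 ==> fcoef e (%x. f x + g x) i = fcoef e f i + fcoef e g i"
 by (simp add: fcoef_def distrib_right integrable_mult_L2 basis_L2)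

lemma fcoef_diff: "f \<in> L2 ==> g \<in> L2 ==> fcoef e (%x. f x - g x) i = fcoef e f i - fcoef e g i"
 by (simp add: fcoef_def left_diff_distrib integrable_mult_L2 basis_L2)

lemma fcoef_scale: "fcoef e (%x. c * f x) i = c * fcoef e f i" by (simp add: fcoef_def mult.assoc)

lemma integral_fcomb_mult:
 assumes "g \<in> L2" shows "(LBINT x. fcomb e I c x * g x) = (\<Sum>i\<in>I. c i * fcoef e g i)"
proof -
 have *: "integrable lborel (%x. c i * (cplx (e i x) * g x))" for i
  by (intro integrable_mult_right integrable_mult_L2 basis_L2 assms)
 have "(LBINT x. fcomb e I c x * g x) = (LBINT x. (\<Sum>i\<in>I. c i * (cplx (e i x) * g x)))"
  by (simp add: fcomb_def sum_distrib_right mult.assoc)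
 also have "... = (\<Sum>i\<in>I. c i * fcoef e g i)"
  by (subst Bochner_Integration.integral_sum[OF *]) (simp add: fcoef_def mult.commute)
 finally show ?thesis .
qed

lemma fcoef_fcomb:
 assumes "finite I" shows "fcoef e (fcomb e I c) j = (if j \<in> I then c j else 0)"
 using integral_fcomb_mult[OF basis_L2[of j], of I c] assms
 by (simp add: fcoef_def[of e "fcomb e I c"] fcoef_basis of_bool_def if_distrib cong: if_cong)

lemma nrm2_eq_integral: "cplx (nrm2 f) = (LBINT x. f x * cnj (f x))"
 by (simp add: nrm2_def complex_norm_square[symmetric] flip: integral_complex_of_real)

lemma fcoef_cnj: "fcoef e (%x. cnj (f x)) i = cnj (fcoef e f i)"
 unfolding fcoef_def by (subst Bochner_Integration.integral_cnj[symmetric]) simp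

lemma nrm2_fcomb:
 assumes "finite I" shows "nrm2 (fcomb e I c) = (\<Sum>i\<in>I. (cmod (c i))^2)"
proof -
 have "cplx (nrm2 (fcomb e I c)) = (\<Sum>i\<in>I. c i * fcoef e (%x. cnj (fcomb e I c x)) i)"
  by (simp only: nrm2_eq_integral integral_fcomb_mult L2_cnj fcomb_L2)
 also have "... = (\<Sum>i\<in>I. cplx ((cmod (c i))^2))"
  by (intro sum.cong) (auto simp: fcoef_cnj fcoef_fcomb[OF assms] simp flip: complex_norm_square)
 also have "... = cplx (\<Sum>i\<in>I. (cmod (c i))^2)" by simp
 finally show ?thesis by (simp only: of_real_eq_iff)
qed

lemma nrm2_diff_fcomb:
 assumes "finite I" "f \<in> L2" shows "nrm2 (%x. f x - fcomb e I (fcoef e f) x) = nrm2 f - (\<Sum>i\<in>I. (cmod (fcoef e f i))^2)"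
proof -
 let ?S = "fcomb e I (fcoef e f)"
 have i: "integrable lborel (%x. f x * cnj (f x))" "integrable lborel (%x. f x * cnj (?S x))"
   "integrable lborel (%x. ?S x * cnj (f x))" "integrable lborel (%x. ?S x * cnj (?S x))"
  by (intro integrable_mult_L2 L2_cnj fcomb_L2 assms)+
 have a: "(LBINT x. ?S x * cnj (f x)) = cplx (\<Sum>i\<in>I. (cmod (fcoef e f i))^2)"
  by (simp add: integral_fcomb_mult L2_cnj assms fcoef_cnj flip: complex_norm_square)
 have b: "(LBINT x. f x * cnj (?S x)) = cplx (\<Sum>i\<in>I. (cmod (fcoef e f i))^2)"
 proof -
  have "(LBINT x. f x * cnj (?S x)) = (LBINT x. cnj (?S x * cnj (f x)))"
   by (simp add: mult.commute)
  also have "... = cnj (LBINT x. ?S x * cnj (f x))" by (rule Bochner_Integration.integral_cnj)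
  finally show ?thesis unfolding a by simp
 qed
 have "cplx (nrm2 (%x. f x - ?S x)) =
   (LBINT x. (f x * cnj (f x) - f x * cnj (?S x)) - (?S x * cnj (f x) - ?S x * cnj (?S x)))"
  unfolding nrm2_eq_integral by (simp add: algebra_simps)
 also have "... = cplx (nrm2 f) - (LBINT x. f x * cnj (?S x))
   - ((LBINT x. ?S x * cnj (f x)) - cplx (nrm2 ?S))" using i by (simp add: nrm2_eq_integral)
 also have "... = cplx (nrm2 f - (\<Sum>i\<in>I. (cmod (fcoef e f i))^2))" unfolding a b nrm2_fcomb[OF assms(1)] by simp
 finally show ?thesis by (simp only: of_real_eq_iff)
qed

lemma bessel:
 assumes "finite I" "f \<in> L2" shows "(\<Sum>i\<in>I. (cmod (fcoef e f i))^2) <= nrm2 f"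
 using nrm2_diff_fcomb[OF assms] nrm2_nonneg[of "%x. f x - fcomb e I (fcoef e f) x"] by linarith

lemma sum_levels: "(\<Sum>n<N. \<Sum>i | lev i = n. g i) = (\<Sum>i | lev i < N. g i :: 'c::comm_monoid_add)"
proof (induction N)
 case (Suc N)
 have "{i. lev i < Suc N} = {i. lev i < N} \<union> {i. lev i = N}" by auto
 then have "(\<Sum>i | lev i < Suc N. g i) = (\<Sum>i | lev i < N. g i) + (\<Sum>i | lev i = N. g i)"
  using fin fin_less by (simp, subst sum.union_disjoint) auto
 with Suc show ?case by simp
qed simp

text \<open>The difference of two partial sums is again a finite combination, and its norm is a
  block of the given convergent series; Riesz-Fischer then supplies the limit.\<close>

lemma expansion_exists:
 assumes "summable (%n. \<Sum>i | lev i = n. (cmod (c i))^2)"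
 shows "\<exists>f\<in>L2. (\<forall>i. fcoef e f i = c i) & (%N. nrm2 (%x. f x - fcomb e {i. lev i < N} c x)) \<longlonglongrightarrow> 0"
proof -
 let ?a = "%n. \<Sum>i | lev i = n. (cmod (c i))^2" and ?S = "%N. fcomb e {i. lev i < N} c"
 have diff: "nrm2 (%x. ?S m x - ?S n x) = (\<Sum>k\<in>{n..<m}. ?a k)" if "n <= m" for m n
 proof -
  have split: "{i. lev i < m} = {i. lev i < n} \<union> {i. lev i < m & n <= lev i}" using that by auto
  have f: "finite {i. lev i < m & n <= lev i}" using fin_less[of m] by (rule rev_finite_subset) auto
  have "(%x. ?S m x - ?S n x) = fcomb e {i. lev i < m & n <= lev i} c"
   unfolding fcomb_def by (rule ext, subst split, subst sum.union_disjoint) (use fin_less f in auto)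
  then have "nrm2 (%x. ?S m x - ?S n x) = (\<Sum>i | lev i < m & n <= lev i. (cmod (c i))^2)" using nrm2_fcomb[OF f] by simp
  also have "... = (\<Sum>i | lev i < m. (cmod (c i))^2) - (\<Sum>i | lev i < n. (cmod (c i))^2)"
  proof -
   have "(\<Sum>i | lev i < m. (cmod (c i))^2) =
     (\<Sum>i | lev i < n. (cmod (c i))^2) + (\<Sum>i | lev i < m & n <= lev i. (cmod (c i))^2)"
    unfolding split by (rule sum.union_disjoint) (use fin_less f in auto)
   then show ?thesis by simp
  qed
  also have "... = (\<Sum>k<m. ?a k) - (\<Sum>k<n. ?a k)" by (simp add: sum_levels)
  also have "... = (\<Sum>k\<in>{n..<m}. ?a k)"  using sum_diff_nat_ivl[of 0 n m ?a] that by (simp add: lessThan_atLeast0)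
  finally show ?thesis .
 qed
 have "\<exists>h\<in>L2. (%n. nrm2 (%x. h x - ?S n x)) \<longlonglongrightarrow> 0"
 proof (rule riesz_fischer[OF fcomb_L2])
  fix d :: real assume "d > 0"
  then obtain N where N: "!!m n. m >= N ==> norm (\<Sum>k\<in>{m..<n}. ?a k) < d" using assms unfolding summable_Cauchy by blast
  have "nrm2 (%x. ?S m x - ?S n x) < d" if "m >= N" "n >= N" for m n
  proof (cases "n <= m")
   case True
   then show ?thesis using N[OF that(2), of m] diff[OF True] by simp
  next
   case False
   then show ?thesis using N[OF that(1), of n] diff[of m n] nrm2_commute[of "?S m" "?S n"] by simp
  qed
  then show "\<exists>N. \<forall>m\<ge>N. \<forall>n\<ge>N. nrm2 (%x. ?S m x - ?S n x) < d" by blast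
 qed
 then obtain h where h: "h \<in> L2" "(%n. nrm2 (%x. h x - ?S n x)) \<longlonglongrightarrow> 0" by blast
 have "fcoef e h i = c i" for i
 proof (rule LIMSEQ_unique)
  show "(%n. fcoef e (?S n) i) \<longlonglongrightarrow> fcoef e h i"
   unfolding fcoef_def by (rule integral_mult_tendsto[OF fcomb_L2 h(1) basis_L2 h(2)])
  show "(%n. fcoef e (?S n) i) \<longlonglongrightarrow> c i"
   by (rule tendsto_eventually, rule eventually_mono[OF eventually_gt_at_top[of "lev i"]])
     (simp add: fcoef_fcomb[OF fin_less])
 qed
 with h show ?thesis by blast
qed

lemma summable_coef:
 assumes "f \<in> L2" shows "summable (%n. \<Sum>i | lev i = n. (cmod (fcoef e f i))^2)"
proof (rule summableI_nonneg_bounded)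
 fix n
 show "(\<Sum>k<n. \<Sum>i | lev i = k. (cmod (fcoef e f i))^2) <= nrm2 f" unfolding sum_levels by (rule bessel[OF fin_less assms])
qed (simp add: sum_nonneg)

end

locale orthonormal_basis = orthonormal e lev
 for e :: "'i => 'a::euclidean_space => real" and lev :: "'i => nat" +
 assumes complete: "f \<in> L2 ==> (!!i. fcoef e f i = 0) ==> AE x in lborel. f x = 0"
begin

lemma coef_eq_AE:
 assumes "f \<in> L2" "g \<in> L2" "!!i. fcoef e f i = fcoef e g i" shows "AE x in lborel. f x = g x"
 using complete[OF L2_diff[OF assms(1,2)]] assms by (simp add: fcoef_diff)

text \<open>The coefficients of f produce some h to which the partial sums converge; completeness
  identifies h with f almost everywhere.\<close>

lemma expansion_tendsto:
 assumes "f \<in> L2" shows "(%N. nrm2 (%x. f x - fcomb e {i. lev i < N} (fcoef e f) x)) \<longlonglongrightarrow> 0"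
proof -
 obtain h where h: "h \<in> L2" "!!i. fcoef e h i = fcoef e f i"
  "(%N. nrm2 (%x. h x - fcomb e {i. lev i < N} (fcoef e f) x)) \<longlonglongrightarrow> 0"
  using expansion_exists[OF summable_coef[OF assms]] by blast
 have ae: "AE x in lborel. h x = f x" by (rule coef_eq_AE) (use h assms in auto)
 have [measurable]: "h \<in> bmeas" "f \<in> bmeas"
  "fcomb e I c \<in> bmeas" for I c using h(1) assms fcomb_L2 by (auto dest: L2_measurable)
 have "nrm2 (%x. h x - fcomb e {i. lev i < N} (fcoef e f) x) =
   nrm2 (%x. f x - fcomb e {i. lev i < N} (fcoef e f) x)" for N unfolding nrm2_def by (rule integral_cong_AE) (use ae in auto)
 with h(3) show ?thesis by simp
qed

lemma parseval_bilinear: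
 assumes "f \<in> L2" "g \<in> L2"
 shows "(%n. \<Sum>i | lev i = n. fcoef e f i * fcoef e g i) sums (LBINT x. f x * g x)"
 using integral_mult_tendsto[OF fcomb_L2 assms(1,2) expansion_tendsto[OF assms(1)]]
 unfolding sums_def sum_levels by (simp add: integral_fcomb_mult[OF assms(2)])

end

section \<open>Hermite functions on the line\<close>

text \<open>This is (1 + y/k)^k \<le> exp y with y = x^2/8. The constant 1/8 leaves room: multiplied
  by exp(-x^2/2), the right side is still below a multiple of exp(-x^2/4), the decay recorded for
  Hermite functions.\<close>

lemma power_le_exp_sq:
 "\<exists>C>0. \<forall>x::real. \<bar>x\<bar> ^ k <= C * exp (x^2 / 8)"
proof (cases "k = 0")
 case True
 then show ?thesis by (intro exI[of _ 1]) auto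
next
 case False
 have "\<bar>x\<bar> ^ k <= (1 + (8 * real k) ^ k) * exp (x^2 / 8)" for x :: real
 proof (cases "\<bar>x\<bar> <= 1")
  case True
  have "\<bar>x\<bar> ^ k <= 1" using True by (intro power_le_one) auto
  also have "1 <= (1 + (8 * real k) ^ k) * exp (x^2 / 8)" by (rule order_trans[OF _ mult_mono[of 1 _ 1]]) auto
  finally show ?thesis .
 next
  case big: False
  have "\<bar>x\<bar> ^ k <= (x^2) ^ k"
  proof (rule power_mono)
   have "\<bar>x\<bar> * 1 <= \<bar>x\<bar> * \<bar>x\<bar>" using big by (intro mult_left_mono) auto
   then show "\<bar>x\<bar> <= x^2" by (simp add: power2_eq_square)
  qed simp
  also have "... = (8 * real k) ^ k * ((x^2 / 8) / real k) ^ k" unfolding power_mult_distrib[symmetric] using False by simp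
  also have "... <= (8 * real k) ^ k * (1 + (x^2 / 8) / real k) ^ k" by (intro mult_left_mono power_mono) auto
  also have "... <= (8 * real k) ^ k * exp (x^2 / 8)" using False by (intro mult_left_mono exp_ge_one_plus_x_over_n_power_n)
    (auto intro: order_trans[of _ 0])
  also have "... <= (1 + (8 * real k) ^ k) * exp (x^2 / 8)" by (intro mult_right_mono) auto
  finally show ?thesis .
 qed
 then show ?thesis by (intro exI[of _ "1 + (8 * real k) ^ k"]) (auto intro: add_pos_nonneg)
qed

lemma integrable_gauss:
 assumes c: "c > 0" shows "integrable lborel (%x::real. exp (- x\<^sup>2 / c))"
proof -
 have *: "(%x::real. exp (- x\<^sup>2 / c)) = (%x. sqrt (pi * c) * normal_density 0 (sqrt (c / 2)) x)"
  using c by (auto simp: normal_density_def)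
 show ?thesis unfolding * by (rule integrable_mult_right) (rule integrable_normal_density, use c in simp)
qed

text \<open>The difference quotients of \<open>F\<close> have integral zero by translation invariance.\<close>

lemma integral_directional_derivative_zero:
 fixes F D :: "'a::euclidean_space => 'b::{banach, second_countable_topology}"
 assumes der: "!!x s. ((%s. F (x + s *\<^sub>R v)) has_vector_derivative D (x + s *\<^sub>R v)) (at s)"
  and F: "integrable lborel F" and b: "integrable lborel b"
  and bound: "!!x s. \<bar>s\<bar> <= 1 ==> norm (D (x + s *\<^sub>R v)) <= b x" and D [measurable]: "D \<in> bmeas"
 shows "(LBINT x. D x) = 0"
proof -
 have [measurable]: "F \<in> bmeas" using F by auto
 define h where "h n = 1 / real (Suc n)" for n
 have h: "0 < h n" "h n <= 1" for n by (auto simp: h_def)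
 have h0: "h \<longlonglongrightarrow> 0" unfolding h_def by (rule LIMSEQ_Suc[OF lim_1_over_n])
 define q where "q n x = (F (x + h n *\<^sub>R v) - F x) /\<^sub>R h n" for n x
 have shift: "integrable lborel (%x. F (x + c))" "(LBINT x. F (x + c)) = (LBINT x. F x)" for c
 proof -
  have "integrable (distr lborel borel ((+) c)) F" using F by (simp add: lborel_distr_plus)
  then show "integrable lborel (%x. F (x + c))" by (subst (asm) integrable_distr_eq) (auto simp: add.commute)
  have "(\<integral>x. F x \<partial>distr lborel borel ((+) c)) = (LBINT x. F (x + c))"
   by (subst integral_distr) (auto simp: add.commute)
  then show "(LBINT x. F (x + c)) = (LBINT x. F x)" by (simp add: lborel_distr_plus)
 qed
 have q0: "(LBINT x. q n x) = 0" for n unfolding q_def using shift F by simp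
 have "(%n. \<integral>x. q n x \<partial>lborel) \<longlonglongrightarrow> (LBINT x. D x)"
 proof (rule integral_dominated_convergence[where w=b])
  show "AE x in lborel. (%n. q n x) \<longlonglongrightarrow> D x"
  proof (rule AE_I2)
   fix x
   have "((%s. F (x + s *\<^sub>R v)) has_vector_derivative D x) (at 0)" using der[of x 0] by simp
   then have "((%t. (F (x + t *\<^sub>R v) - F x) /\<^sub>R t) \<longlongrightarrow> D x) (at 0)"
   proof -
    assume "((%s. F (x + s *\<^sub>R v)) has_vector_derivative D x) (at 0)"
    then have l: "((%t. norm (F (x + t *\<^sub>R v) - F x - t *\<^sub>R D x) / \<bar>t\<bar>) \<longlongrightarrow> 0) (at 0)"
     unfolding has_vector_derivative_def has_derivative_at by simp
    have "((%t. norm ((F (x + t *\<^sub>R v) - F x) /\<^sub>R t - D x)) \<longlongrightarrow> 0) (at 0)"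
    proof (rule Lim_transform_eventually[OF l])
     have "norm (F (x + t *\<^sub>R v) - F x - t *\<^sub>R D x) / \<bar>t\<bar> = norm ((F (x + t *\<^sub>R v) - F x) /\<^sub>R t - D x)"
      if "t ~= 0" for t
     proof -
      have "(F (x + t *\<^sub>R v) - F x) /\<^sub>R t - D x = (F (x + t *\<^sub>R v) - F x - t *\<^sub>R D x) /\<^sub>R t"
       using that by (simp add: scaleR_diff_right)
      then show ?thesis by (simp add: divide_inverse)
     qed
     then show "\<forall>\<^sub>F t in at 0. norm (F (x + t *\<^sub>R v) - F x - t *\<^sub>R D x) / \<bar>t\<bar> = norm ((F (x + t *\<^sub>R v) - F x) /\<^sub>R t - D x)"
      by (auto simp: eventually_at intro!: exI[of _ 1])
    qed
    then show ?thesis by (simp add: tendsto_norm_zero_iff LIM_zero_iff)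
   qed
   then show "(%n. q n x) \<longlonglongrightarrow> D x" unfolding q_def by (rule filterlim_compose)
     (use h(1) h0 in \<open>auto simp: filterlim_at less_imp_neq[symmetric]\<close>)
  qed
  show "AE x in lborel. norm (q n x) <= b x" for n
  proof (rule AE_I2)
   fix x
   \<comment> \<open>Mean value inequality on a segment of length \<open>h n\<close>, which is at
     most 1, so that the bound b applies along all of it.\<close>
   have "norm (F (x + h n *\<^sub>R v) - F (x + 0 *\<^sub>R v)) <= b x * h n - b x * 0"
   proof (rule differentiable_bound_general[where \<phi>'="%_. b x" and f'="%s. D (x + s *\<^sub>R v)"])
    show "continuous_on {0..h n} (%s. F (x + s *\<^sub>R v))"
     by (rule continuous_at_imp_continuous_on) (use der has_vector_derivative_continuous in blast)
    show "norm (D (x + s *\<^sub>R v)) <= b x" if "0 < s" "s < h n" for s using bound[of s x] that h(2)[of n] by simp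
   qed (use h[of n] der in \<open>auto intro!: continuous_intros derivative_eq_intros simp: has_vector_derivative_def\<close>)
   then show "norm (q n x) <= b x" using h[of n] by (simp add: q_def divide_simps mult.commute)
  qed
  show "q n \<in> borel_measurable lborel" for n unfolding q_def by measurable
 qed (use b in auto)
 then show ?thesis by (simp add: q0 LIMSEQ_const_iff)
qed

text \<open>The ladder coefficient of the normalised Hermite functions. Since
  \<open>lad 0 = 0\<close>, terms with index \<open>n - 1\<close> vanish at n = 0 and truncated
  subtraction does no harm.\<close>

definition lad :: "nat => real" where
 "lad n = sqrt (real n / 2)"

lemma lad_0 [simp]: "lad 0 = 0" and lad_pos: "0 < lad (Suc n)" and lad_nonneg [simp]: "0 <= lad n" and lad_neq [simp]: "lad (Suc n) ~= 0"
 by (simp_all add: lad_def)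

lemma lad_sq: "lad n * lad n = real n / 2" by (simp add: lad_def)

lemma lad_sq': "lad n * (lad n * a) = real n / 2 * a" by (simp add: lad_sq flip: mult.assoc)

lemma lad_mono: "m <= n ==> lad m <= lad n" by (simp add: lad_def)

text \<open>The L^2-normalised Hermite functions, defined by their three-term recurrence rather than
  through polynomials: multiplication by x, the operation used throughout, is then given by
  construction. The factor pi^(-1/4) normalises the Gaussian.\<close>

fun herm :: "nat => real => real" where
 "herm 0 x = pi powr (- 1 / 4) * exp (- x\<^sup>2 / 2)"
| "herm (Suc 0) x = x * herm 0 x / lad 1"
| "herm (Suc (Suc n)) x = (x * herm (Suc n) x - lad (Suc n) * herm n x) / lad (Suc (Suc n))"

lemma mult_herm: "x * herm n x = lad (Suc n) * herm (Suc n) x + lad n * herm (n - 1) x" by (cases n) (auto simp: field_simps)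

definition hderiv :: "nat => real => real" where
 "hderiv n x = lad n * herm (n - 1) x - lad (Suc n) * herm (Suc n) x"

text \<open>Differentiating the recurrence leaves products x h_k, which \<open>mult_herm\<close>
  turns back into neighbours. The coefficients agree because lad(n)^2 = n/2 is linear in n.\<close>

lemma DERIV_herm: "(herm n has_real_derivative hderiv n x) (at x)"
proof (induction n x rule: herm.induct)
 case (1 x)
 have "((%x. pi powr (- 1 / 4) * exp (- x\<^sup>2 / 2)) has_real_derivative - (x * herm 0 x)) (at x)"
  by (auto intro!: derivative_eq_intros)
 moreover have "herm 0 = (%x. pi powr (- 1 / 4) * exp (- x\<^sup>2 / 2))" by (rule ext) simp
 moreover have "- (x * herm 0 x) = hderiv 0 x" by (simp add: hderiv_def)
 ultimately show ?case by (simp only:)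
next
 case (2 x)
 have e: "herm (Suc 0) = (%x. x * herm 0 x / lad 1)" by (rule ext) simp

 have "((%x. x * herm 0 x / lad 1) has_real_derivative (1 * herm 0 x + hderiv 0 x * x) / lad 1) (at x)"
  by (intro DERIV_cdivide DERIV_mult DERIV_ident 2)
 moreover have "(1 * herm 0 x + hderiv 0 x * x) / lad 1 = hderiv (Suc 0) x"
 proof -
  have m: "x * herm (Suc 0) x = lad (Suc (Suc 0)) * herm (Suc (Suc 0)) x + lad (Suc 0) * herm 0 x"
   using mult_herm[of x "Suc 0"] by (simp only: diff_Suc_1)
  have "1 * herm 0 x + hderiv 0 x * x = 2 * (lad (Suc 0) * lad (Suc 0)) * herm 0 x - lad (Suc 0) * (x * herm (Suc 0) x)"
   unfolding lad_sq by (simp add: hderiv_def del: herm.simps)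
  also have "... = lad (Suc 0) * hderiv (Suc 0) x" unfolding m hderiv_def by (simp add: algebra_simps del: herm.simps)
  finally show ?thesis by simp
 qed
 ultimately show ?case unfolding e by simp
next
 case (3 n x)
 have e: "herm (Suc (Suc n)) = (%x. (x * herm (Suc n) x - lad (Suc n) * herm n x) / lad (Suc (Suc n)))" by (rule ext) simp
 have "((%x. (x * herm (Suc n) x - lad (Suc n) * herm n x) / lad (Suc (Suc n))) has_real_derivative
   ((1 * herm (Suc n) x + hderiv (Suc n) x * x) - lad (Suc n) * hderiv n x) / lad (Suc (Suc n))) (at x)"
  by (intro DERIV_cdivide DERIV_diff DERIV_mult DERIV_ident DERIV_cmult 3)
 moreover have "((1 * herm (Suc n) x + hderiv (Suc n) x * x) - lad (Suc n) * hderiv n x) / lad (Suc (Suc n))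
   = hderiv (Suc (Suc n)) x"
 proof -
  have a: "x * herm n x = lad (Suc n) * herm (Suc n) x + lad n * herm (n - 1) x" by (rule mult_herm)
  have b: "x * herm (Suc (Suc n)) x = lad (Suc (Suc (Suc n))) * herm (Suc (Suc (Suc n))) x
    + lad (Suc (Suc n)) * herm (Suc n) x" using mult_herm[of x "Suc (Suc n)"] by simp
  have "(1 * herm (Suc n) x + hderiv (Suc n) x * x) - lad (Suc n) * hderiv n x =
    herm (Suc n) x + lad (Suc n) * (x * herm n x) - lad (Suc (Suc n)) * (x * herm (Suc (Suc n)) x)
    - lad (Suc n) * (lad n * herm (n - 1) x) + lad (Suc n) * lad (Suc n) * herm (Suc n) x"
   by (simp add: hderiv_def algebra_simps del: herm.simps)
  also have "... = (1 + 2 * (lad (Suc n) * lad (Suc n)) - lad (Suc (Suc n)) * lad (Suc (Suc n))) * herm (Suc n) x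
    - lad (Suc (Suc n)) * lad (Suc (Suc (Suc n))) * herm (Suc (Suc (Suc n))) x"
   unfolding a b by (simp add: algebra_simps del: herm.simps)
  also have "1 + 2 * (lad (Suc n) * lad (Suc n)) - lad (Suc (Suc n)) * lad (Suc (Suc n)) =
    lad (Suc (Suc n)) * lad (Suc (Suc n))" unfolding lad_sq by (simp add: field_simps)
  finally show ?thesis by (simp add: hderiv_def field_simps del: herm.simps)
 qed
 ultimately show ?case unfolding e by simp
qed

declare herm.simps [simp del]

lemma mult_herm':
 "x * (lad n * herm (n - 1) x) = lad n * (lad n * herm n x + lad (n - 1) * herm (n - 2) x)"
 by (cases n) (use mult_herm[of x "n - 1"] in \<open>auto simp: numeral_2_eq_2\<close>)

text \<open>The eigenvalue equation on the line. Two ladder steps express both h_n'' and x^2 h_n by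
  h_(n+2), h_n and h_(n-2); the outer terms coincide, and the two differ only by a multiple of
  h_n.\<close>

lemma DERIV_hderiv: "(hderiv n has_real_derivative (x^2 - (2 * real n + 1)) * herm n x) (at x)"
proof -
 have "(hderiv n has_real_derivative (lad n * hderiv (n - 1) x - lad (Suc n) * hderiv (Suc n) x)) (at x)"
 proof -
  have e: "hderiv n = (%x. lad n * herm (n - 1) x - lad (Suc n) * herm (Suc n) x)" by (rule ext) (simp add: hderiv_def)
  show ?thesis unfolding e by (intro DERIV_diff DERIV_cmult DERIV_herm)
 qed
 moreover have "lad n * hderiv (n - 1) x - lad (Suc n) * hderiv (Suc n) x = (x^2 - (2 * real n + 1)) * herm n x"
 proof -
  have "x^2 * herm n x = x * (x * herm n x)" by (simp add: power2_eq_square)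
  also have "... = lad (Suc n) * (x * herm (Suc n) x) + x * (lad n * herm (n - 1) x)"
   unfolding mult_herm[of x n] by (simp add: algebra_simps)
  also have "... = lad (Suc n) * (lad (Suc (Suc n)) * herm (Suc (Suc n)) x + lad (Suc n) * herm n x)
    + lad n * (lad n * herm n x + lad (n - 1) * herm (n - 2) x)" unfolding mult_herm' using mult_herm[of x "Suc n"] by simp
  finally have x2: "x^2 * herm n x = ..." .
  show ?thesis unfolding left_diff_distrib x2 hderiv_def
   by (cases n) (simp_all add: algebra_simps lad_sq lad_sq' numeral_2_eq_2 add_divide_distrib)
 qed
 ultimately show ?thesis by simp
qed

lemma continuous_herm: "continuous_on UNIV (herm n)" by (rule continuous_at_imp_continuous_on) (use DERIV_herm DERIV_isCont in blast)

lemma borel_measurable_herm [measurable]: "herm n \<in> bmeas"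
 by (rule borel_measurable_continuous_onI[OF continuous_herm])

text \<open>All powers k are treated at once because the recurrence costs a factor x: level n with
  power k calls for a lower level with power k + 1.\<close>

lemma herm_decay: "\<exists>C\<ge>0. \<forall>x. \<bar>x\<bar> ^ k * \<bar>herm n x\<bar> <= C * exp (- x\<^sup>2 / 4)"
proof (induction n arbitrary: k rule: less_induct)
 case (less n)
 consider "n = 0" | "n = 1" | m where "n = Suc (Suc m)" by (metis One_nat_def not0_implies_Suc)
 then show ?case
 proof cases
  case 1
  obtain C where C: "C > 0" "!!x::real. \<bar>x\<bar> ^ k <= C * exp (x^2 / 8)" using power_le_exp_sq by blast
  show ?thesis
  proof (intro exI conjI allI)
   show "0 <= C * pi powr (- 1 / 4)" using C by simp
   fix x :: real
   have "\<bar>x\<bar> ^ k * \<bar>herm n x\<bar> <= (C * exp (x^2 / 8)) * (pi powr (- 1 / 4) * exp (- x\<^sup>2 / 2))"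
    using 1 by (intro mult_mono C) (auto simp: herm.simps less_imp_le C)
   also have "... = C * pi powr (- 1 / 4) * exp (x^2 / 8 + - x\<^sup>2 / 2)" by (simp only: exp_add mult_ac)
   also have "... <= C * pi powr (- 1 / 4) * exp (- x\<^sup>2 / 4)" using C by (intro mult_left_mono) auto
   finally show "\<bar>x\<bar> ^ k * \<bar>herm n x\<bar> <= ..." .
  qed
 next
  case 2
  obtain C where C: "C >= 0" "!!x::real. \<bar>x\<bar> ^ Suc k * \<bar>herm 0 x\<bar> <= C * exp (- x\<^sup>2 / 4)"
   using less[of 0 "Suc k"] 2 by auto
  have "\<bar>x\<bar> ^ k * \<bar>herm n x\<bar> <= C / lad 1 * exp (- x\<^sup>2 / 4)" for x
  proof -
   have "\<bar>x\<bar> ^ k * \<bar>herm n x\<bar> = \<bar>x\<bar> ^ Suc k * \<bar>herm 0 x\<bar> / lad 1"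
    using 2 lad_pos[of 0] by (simp add: herm.simps(2) abs_mult)
   also have "... <= C * exp (- x\<^sup>2 / 4) / lad 1" using C(2)[of x] by (rule divide_right_mono) simp
   finally show ?thesis by simp
  qed
  then show ?thesis using C lad_pos[of 0] by (intro exI[of _ "C / lad 1"]) auto
 next
  case 3
  obtain C where C: "C >= 0" "!!x::real. \<bar>x\<bar> ^ Suc k * \<bar>herm (Suc m) x\<bar> <= C * exp (- x\<^sup>2 / 4)"
   using less[of "Suc m" "Suc k"] 3 by auto
  obtain D where D: "D >= 0" "!!x::real. \<bar>x\<bar> ^ k * \<bar>herm m x\<bar> <= D * exp (- x\<^sup>2 / 4)"
   using less[of m k] 3 by auto
  have "\<bar>x\<bar> ^ k * \<bar>herm n x\<bar> <= (C + lad (Suc m) * D) / lad n * exp (- x\<^sup>2 / 4)" for x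
  proof -
   have "\<bar>x\<bar> ^ k * \<bar>herm n x\<bar> = \<bar>x\<bar> ^ k * \<bar>x * herm (Suc m) x - lad (Suc m) * herm m x\<bar> / lad n"
    using 3 by (simp add: herm.simps(3) abs_mult)
   also have "... <= \<bar>x\<bar> ^ k * (\<bar>x * herm (Suc m) x\<bar> + \<bar>lad (Suc m) * herm m x\<bar>) / lad n"
    by (intro divide_right_mono mult_left_mono abs_triangle_ineq4) auto
   also have "... = (\<bar>x\<bar> ^ Suc k * \<bar>herm (Suc m) x\<bar> + lad (Suc m) * (\<bar>x\<bar> ^ k * \<bar>herm m x\<bar>)) / lad n"
    by (simp add: abs_mult algebra_simps)
   also have "... <= (C * exp (- x\<^sup>2 / 4) + lad (Suc m) * (D * exp (- x\<^sup>2 / 4))) / lad n"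
    by (intro divide_right_mono add_mono C D mult_left_mono) auto
   finally show ?thesis by (simp add: algebra_simps)
  qed
  then show ?thesis using C D by (intro exI[of _ "(C + lad (Suc m) * D) / lad n"]) auto
 qed
qed

lemma herm_le_gauss: "\<exists>C\<ge>0. \<forall>x. \<bar>herm n x\<bar> <= C * exp (- x\<^sup>2 / 4)" using herm_decay[of 0 n] by simp

lemma hderiv_le_gauss: "\<exists>C\<ge>0. \<forall>x. \<bar>hderiv n x\<bar> <= C * exp (- x\<^sup>2 / 4)"
proof -
 obtain C where C: "C >= 0" "!!x. \<bar>herm (n - 1) x\<bar> <= C * exp (- x\<^sup>2 / 4)" using herm_le_gauss by blast
 obtain D where D: "D >= 0" "!!x. \<bar>herm (Suc n) x\<bar> <= D * exp (- x\<^sup>2 / 4)" using herm_le_gauss by blast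
 have "\<bar>hderiv n x\<bar> <= (lad n * C + lad (Suc n) * D) * exp (- x\<^sup>2 / 4)" for x
 proof -
  have "\<bar>hderiv n x\<bar> <= lad n * \<bar>herm (n - 1) x\<bar> + lad (Suc n) * \<bar>herm (Suc n) x\<bar>"
   unfolding hderiv_def by (rule order_trans[OF abs_triangle_ineq4]) (simp add: abs_mult)
  also have "... <= lad n * (C * exp (- x\<^sup>2 / 4)) + lad (Suc n) * (D * exp (- x\<^sup>2 / 4))"
   by (intro add_mono mult_left_mono C D) auto
  finally show ?thesis by (simp add: algebra_simps)
 qed
 then show ?thesis using C D by (intro exI[of _ "lad n * C + lad (Suc n) * D"]) auto
qed

lemma herm_bounded: "\<exists>C\<ge>0. \<forall>x. \<bar>herm n x\<bar> <= C"
proof -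
 obtain C where C: "C >= 0" "!!x. \<bar>herm n x\<bar> <= C * exp (- x\<^sup>2 / 4)" using herm_le_gauss by blast
 have "C * exp (- x\<^sup>2 / 4) <= C" for x :: real using C(1) by (simp add: mult_left_le)
 with C show ?thesis by (meson order_trans)
qed

lemma integrable_herm_mult: "integrable lborel (%x. herm m x * herm n x)"
proof -
 obtain C where C: "C >= 0" "!!x. \<bar>herm m x\<bar> <= C" using herm_bounded by blast
 obtain D where D: "D >= 0" "!!x. \<bar>herm n x\<bar> <= D * exp (- x\<^sup>2 / 4)" using herm_le_gauss by blast
 show ?thesis
 proof (rule Bochner_Integration.integrable_bound)
  show "integrable lborel (%x::real. C * (D * exp (- x\<^sup>2 / 4)))" by (intro integrable_mult_right integrable_gauss) simp
  show "AE x in lborel. norm (herm m x * herm n x) <= norm (C * (D * exp (- x\<^sup>2 / 4)))"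
   using C D by (intro AE_I2) (auto simp: abs_mult intro!: mult_mono)
 qed measurable
qed

text \<open>The Wronskian W of h_m and h_n has derivative (2n - 2m) h_m h_n by the eigenvalue
  equation, and the integral of W' is zero.\<close>

lemma herm_orthogonal:
 assumes "m ~= n" shows "(LBINT x. herm m x * herm n x) = 0"
proof -
 define W where "W x = hderiv m x * herm n x - hderiv n x * herm m x" for x
 have DW: "(W has_real_derivative (2 * real n - 2 * real m) * (herm m x * herm n x)) (at x)" for x unfolding W_def
  by (rule derivative_eq_intros DERIV_herm DERIV_hderiv refl)+ (simp add: algebra_simps)
 obtain C where C: "C >= 0" "!!x. \<bar>herm m x\<bar> <= C" using herm_bounded by blast
 obtain C' where C': "C' >= 0" "!!x. \<bar>herm n x\<bar> <= C'" using herm_bounded by blast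
 obtain D where D: "D >= 0" "!!x. \<bar>herm n x\<bar> <= D * exp (- x\<^sup>2 / 4)" using herm_le_gauss by blast
 obtain E where E: "E >= 0" "!!x. \<bar>hderiv m x\<bar> <= E * exp (- x\<^sup>2 / 4)" using hderiv_le_gauss by blast
 obtain E' where E': "E' >= 0" "!!x. \<bar>hderiv n x\<bar> <= E' * exp (- x\<^sup>2 / 4)" using hderiv_le_gauss by blast
 have [measurable]: "hderiv k \<in> bmeas" for k unfolding hderiv_def by measurable
 have "(LBINT x. (2 * real n - 2 * real m) * (herm m x * herm n x)) = 0"
 proof (rule integral_directional_derivative_zero[of W 1])
  show "((%s. W (x + s *\<^sub>R 1)) has_vector_derivative
    (2 * real n - 2 * real m) * (herm m (x + s *\<^sub>R 1) * herm n (x + s *\<^sub>R 1))) (at s)" for x s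
   unfolding has_real_derivative_iff_has_vector_derivative[symmetric]
   using DW[of "s + x"] DERIV_shift[of W _ s x] by (simp add: add.commute)
  show "integrable lborel W"
  proof (rule Bochner_Integration.integrable_bound)
   show "integrable lborel (%x::real. (E * C' + E' * C) * exp (- x\<^sup>2 / 4))"
    by (intro integrable_mult_right integrable_gauss) simp
   show "W \<in> borel_measurable lborel" unfolding W_def by measurable
   show "AE x in lborel. norm (W x) <= norm ((E * C' + E' * C) * exp (- x\<^sup>2 / 4))"
   proof (rule AE_I2)
    fix x
    have "\<bar>W x\<bar> <= \<bar>hderiv m x\<bar> * \<bar>herm n x\<bar> + \<bar>hderiv n x\<bar> * \<bar>herm m x\<bar>"
     unfolding W_def by (rule order_trans[OF abs_triangle_ineq4]) (simp add: abs_mult)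
    also have "... <= (E * exp (- x\<^sup>2 / 4)) * C' + (E' * exp (- x\<^sup>2 / 4)) * C"
     by (intro add_mono mult_mono C C' E E') (use E E' in auto)
    finally show "norm (W x) <= norm ((E * C' + E' * C) * exp (- x\<^sup>2 / 4))"
     using E(1) E'(1) C(1) C'(1) by (simp add: algebra_simps)
   qed
  qed
  let ?K = "\<bar>2 * real n - 2 * real m\<bar> * (C * (D * exp (1/4)))"
  show "integrable lborel (%x::real. ?K * exp (- x\<^sup>2 / 8))" by (intro integrable_mult_right integrable_gauss) simp
  show "norm ((2 * real n - 2 * real m) * (herm m (x + s *\<^sub>R 1) * herm n (x + s *\<^sub>R 1)))
    <= ?K * exp (- x\<^sup>2 / 8)" if "\<bar>s\<bar> <= 1" for x s
  proof -
   \<comment> \<open>A shift by at most 1 is absorbed by halving the Gaussian exponent, at the price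
     of a factor exp(1/4).\<close>
   have "s^2 <= 1" using that by (simp add: abs_square_le_1)
   moreover have "x^2 <= 2 * (x + s)^2 + 2 * s^2" using norm_add_sq_le[of "x + s" "- s"] by simp
   ultimately have "- (x + s)\<^sup>2 / 4 <= 1/4 + - x\<^sup>2 / 8" by simp
   then have "exp (- (x + s)\<^sup>2 / 4) <= exp (1/4) * exp (- x\<^sup>2 / 8)"
    unfolding exp_add[symmetric] by (simp only: exp_le_cancel_iff)
   then have "\<bar>herm n (x + s)\<bar> <= D * (exp (1/4) * exp (- x\<^sup>2 / 8))"
    using D(2)[of "x + s"] D(1) by (meson mult_left_mono order_trans)
   then have "\<bar>herm m (x + s)\<bar> * \<bar>herm n (x + s)\<bar> <= C * (D * (exp (1/4) * exp (- x\<^sup>2 / 8)))"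
    by (intro mult_mono C) (use C in auto)
   then have "\<bar>2 * real n - 2 * real m\<bar> * (\<bar>herm m (x + s)\<bar> * \<bar>herm n (x + s)\<bar>)
     <= \<bar>2 * real n - 2 * real m\<bar> * (C * (D * (exp (1/4) * exp (- x\<^sup>2 / 8))))" by (rule mult_left_mono) simp
   then show ?thesis by (simp add: abs_mult mult.assoc)
  qed
 qed measurable
 then show ?thesis using assms by simp
qed

text \<open>The integral of x h_n h_(n+1) is computed twice, with the recurrence applied to either
  factor; this carries the normalisation from n to n + 1.\<close>

lemma herm_norm: "(LBINT x. herm n x * herm n x) = 1"
proof (induction n)
 case 0
 have "herm 0 x * herm 0 x = normal_density 0 (1 / sqrt 2) x" for x
 proof -
  have "pi powr (- 1 / 4) * pi powr (- 1 / 4) = pi powr (- 1 / 2)" by (simp flip: powr_add)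
  also have "... = 1 / sqrt pi" by (simp add: powr_minus_divide powr_half_sqrt)
  finally have p: "pi powr (- 1 / 4) * pi powr (- 1 / 4) = 1 / sqrt pi" .
  have "herm 0 x * herm 0 x = (pi powr (- 1 / 4) * pi powr (- 1 / 4)) * (exp (- x\<^sup>2 / 2) * exp (- x\<^sup>2 / 2))"
   by (simp add: herm.simps)
  also have "exp (- x\<^sup>2 / 2) * exp (- x\<^sup>2 / 2) = exp (- x\<^sup>2)" by (simp flip: exp_add)
  finally show ?thesis unfolding p by (simp add: normal_density_def power_divide)
 qed
 then show ?case by (simp add: integral_normal_density)
next
 case (Suc n)
 have "(LBINT x. (x * herm n x) * herm (Suc n) x) =
   (LBINT x. lad (Suc n) * (herm (Suc n) x * herm (Suc n) x) + lad n * (herm (n - 1) x * herm (Suc n) x))"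
  by (simp only: mult_herm distrib_right mult.assoc)
 also have "... = lad (Suc n) * (LBINT x. herm (Suc n) x * herm (Suc n) x)"
  using herm_orthogonal[of "n - 1" "Suc n"] by (simp add: integrable_herm_mult)
 finally have a: "(LBINT x. (x * herm n x) * herm (Suc n) x) =
  lad (Suc n) * (LBINT x. herm (Suc n) x * herm (Suc n) x)" .
 have "(LBINT x. herm n x * (x * herm (Suc n) x)) =
   (LBINT x. lad (Suc (Suc n)) * (herm n x * herm (Suc (Suc n)) x) + lad (Suc n) * (herm n x * herm n x))"
  using mult_herm[of _ "Suc n"] by (simp add: algebra_simps)
 also have "... = lad (Suc n)" using herm_orthogonal[of n "Suc (Suc n)"] Suc by (simp add: integrable_herm_mult)
 finally have "(LBINT x. herm n x * (x * herm (Suc n) x)) = lad (Suc n)" .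
 with a show ?case by (simp add: algebra_simps)
qed

interpretation herm: orthonormal herm "%n. n" by standard (auto simp: integrable_herm_mult herm_orthogonal herm_norm)

subsection \<open>The Christoffel function\<close>

text \<open>With \<open>p(y) = \<Sum> h\<^sub>n(x) h\<^sub>n(y)\<close> one has \<open>p(x) = \<parallel>p\<parallel>\<^sup>2\<close> and \<open>p(x)\<^sup>2 \<le> 2 \<parallel>p\<parallel> \<parallel>p'\<parallel>\<close>.\<close>

lemma sum_herm_sq_le: "(\<Sum>n<N. (herm n x)^2) <= 4 * sqrt (real N)"
proof -
 define Q where "Q = (\<Sum>n<N. (herm n x)^2)"
 have Q0: "0 <= Q" unfolding Q_def by (intro sum_nonneg) simp
 define p where "p y = (\<Sum>n<N. herm n x * herm n y)" for y
 define p' where "p' y = (\<Sum>n<N. herm n x * hderiv n y)" for y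
 have px: "p x = Q" by (simp add: p_def Q_def power2_eq_square)
 have Dp: "(p has_real_derivative p' y) (at y)" for y unfolding p_def[abs_def] p'_def by (intro DERIV_sum DERIV_cmult DERIV_herm)
 have pc: "(%y. cplx (p y)) = fcomb herm {..<N} (%n. cplx (herm n x))" by (rule ext) (simp add: p_def fcomb_def)
 \<comment> \<open>A and B are the lowering and the raising half of p'. After reindexing each is a
   combination of distinct basis functions, so its norm is explicit; every ladder coefficient in it
   has square at most N/2.\<close>
 define A where "A = fcomb herm ((%n. n - 1) ` {1..<N}) (%k. cplx (lad (Suc k) * herm (Suc k) x))"
 define B where "B = fcomb herm (Suc ` {..<N}) (%k. - cplx (lad k * herm (k - 1) x))"
 have A: "A y = cplx (\<Sum>n<N. herm n x * (lad n * herm (n - 1) y))" for y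
 proof -
  have "A y = (\<Sum>n\<in>{1..<N}. cplx (herm n x * (lad n * herm (n - 1) y)))"
   unfolding A_def fcomb_def by (subst sum.reindex) (auto simp: inj_on_def mult.commute intro!: sum.cong)
  also have "... = (\<Sum>n<N. cplx (herm n x * (lad n * herm (n - 1) y)))"
  proof (rule sum.mono_neutral_left)
   have "i = 0" if "i \<in> {..<N} - {1..<N}" for i using that by auto
   then show "\<forall>i\<in>{..<N} - {1..<N}. cplx (herm i x * (lad i * herm (i - 1) y)) = 0" by fastforce
  qed auto
  finally show ?thesis by simp
 qed
 have B: "B y = cplx (\<Sum>n<N. - (herm n x * (lad (Suc n) * herm (Suc n) y)))" for y
  unfolding B_def fcomb_def by (subst sum.reindex) (auto simp: mult_ac intro!: sum.cong)
 have p'c: "(%y. cplx (p' y)) = (%y. A y + B y)" by (rule ext, simp only: A B flip: of_real_add)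
    (simp add: p'_def hderiv_def sum_negf right_diff_distrib flip: sum_subtractf)
 have p2: "nrm2 (%y. cplx (p y)) = Q" unfolding pc by (subst herm.nrm2_fcomb) (auto simp: Q_def)
 have le: "(lad (Suc n) * herm n x)^2 <= real N / 2 * (herm n x)^2" if "n < N" for n
  using that unfolding power_mult_distrib by (intro mult_right_mono) (auto simp: lad_def)
 have le': "(lad n * herm n x)^2 <= real N / 2 * (herm n x)^2" if "n < N" for n
  using that unfolding power_mult_distrib by (intro mult_right_mono) (auto simp: lad_def)
 have "nrm2 A = (\<Sum>n\<in>{1..<N}. (lad n * herm n x)^2)" unfolding A_def by (subst herm.nrm2_fcomb, simp, subst sum.reindex)
   (auto simp: inj_on_def norm_mult power_mult_distrib intro!: sum.cong)
 also have "... <= (\<Sum>n<N. (lad n * herm n x)^2)" by (rule sum_mono2) auto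
 also have "... <= (\<Sum>n<N. real N / 2 * (herm n x)^2)" by (rule sum_mono) (use le' in auto)
 finally have nA: "nrm2 A <= real N / 2 * Q" by (simp add: Q_def sum_distrib_left)
 have "nrm2 B = (\<Sum>n<N. (lad (Suc n) * herm n x)^2)" unfolding B_def by (subst herm.nrm2_fcomb, simp, subst sum.reindex)
   (auto simp: norm_mult power_mult_distrib intro!: sum.cong)
 also have "... <= (\<Sum>n<N. real N / 2 * (herm n x)^2)" by (rule sum_mono) (use le in auto)
 finally have nB: "nrm2 B <= real N / 2 * Q" by (simp add: Q_def sum_distrib_left)
 have AL2: "A \<in> L2" "B \<in> L2" unfolding A_def B_def by (rule herm.fcomb_L2)+
 have p'2: "nrm2 (%y. cplx (p' y)) <= 2 * real N * Q" unfolding p'c using nrm2_add_le[OF AL2] nA nB by simp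
 have pL2: "(%y. cplx (p y)) \<in> L2" unfolding pc by (rule herm.fcomb_L2)
 have p'L2: "(%y. cplx (p' y)) \<in> L2" unfolding p'c by (rule L2_add[OF AL2])
 have int: "integrable lborel (%y. \<bar>p y\<bar> * \<bar>p' y\<bar>)" using integrable_norm_mult_L2[OF pL2 p'L2] by simp
 have "(LBINT y. \<bar>p y\<bar> * \<bar>p' y\<bar>) <= sqrt Q * sqrt (2 * real N * Q)"
  using cauchy_schwarz_norm[OF pL2 p'L2] p'2 Q0 unfolding p2
  by (simp add: order_trans[OF _ mult_left_mono[OF real_sqrt_le_mono[OF p'2]]])
 also have "... = sqrt 2 * sqrt (real N) * Q" using Q0 by (simp add: real_sqrt_mult)
 finally have I: "(LBINT y. \<bar>p y\<bar> * \<bar>p' y\<bar>) <= sqrt 2 * sqrt (real N) * Q" .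
 have cp': "isCont p' y" for y unfolding p'_def hderiv_def by (intro continuous_intros DERIV_isCont[OF DERIV_herm])
 \<comment> \<open>Fundamental theorem for p^2 on [-L, x]. The boundary term at -L disappears as L
   grows, because each h_n tends to zero there.\<close>
 have step: "(p x)^2 <= (p (- L))^2 + 2 * (LBINT y. \<bar>p y\<bar> * \<bar>p' y\<bar>)" if L: "- L <= x" for L
 proof -
  have FTC: "has_bochner_integral lborel (%y. (2 * (p y * p' y)) * indicator {- L..x} y) ((p x)^2 - (p (- L))^2)"
  proof (rule has_bochner_integral_FTC_Icc_real[OF L])
   show "((%y. (p y)^2) has_real_derivative 2 * (p y * p' y)) (at y)" for y by (rule derivative_eq_intros Dp refl)+ simp
   show "isCont (%y. 2 * (p y * p' y)) y" for y by (intro continuous_intros cp' DERIV_isCont[OF Dp])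
  qed
  have "(p x)^2 - (p (- L))^2 = (LBINT y. (2 * (p y * p' y)) * indicator {- L..x} y)"
   using has_bochner_integral_integral_eq[OF FTC] by simp
  also have "... <= (LBINT y. 2 * (\<bar>p y\<bar> * \<bar>p' y\<bar>))"
  proof (rule integral_mono)
   show "integrable lborel (%y. (2 * (p y * p' y)) * indicator {- L..x} y)" using FTC by (rule integrable.intros)
   show "(2 * (p y * p' y)) * indicator {- L..x} y <= 2 * (\<bar>p y\<bar> * \<bar>p' y\<bar>)" for y
    using abs_ge_self[of "p y * p' y"] by (auto simp: indicator_def abs_mult)
  qed (use int in simp)
  finally show ?thesis by simp
 qed
 have h0: "(%k. herm n (- real k)) \<longlonglongrightarrow> 0" for n
 proof -
  obtain C where C: "C >= 0" "!!x. \<bar>x\<bar> ^ 1 * \<bar>herm n x\<bar> <= C * exp (- x\<^sup>2 / 4)" using herm_decay by blast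
  have "\<bar>herm n (- real k)\<bar> <= C / real k" if "k > 0" for k
  proof -
   have "real k * \<bar>herm n (- real k)\<bar> <= C * exp (- (- real k)\<^sup>2 / 4)" using C(2)[of "- real k"] by simp
   also have "... <= C" using C(1) by (simp add: mult_left_le)
   finally show ?thesis using that by (simp add: field_simps)
  qed
  then have "eventually (%k. norm (herm n (- real k)) <= C / real k) sequentially"
   by (auto intro!: eventually_mono[OF eventually_gt_at_top[of 0]])
  then show ?thesis by (rule Lim_null_comparison) (rule lim_const_over_n)
 qed
 have "(%k. (p (- real k))^2 + 2 * (LBINT y. \<bar>p y\<bar> * \<bar>p' y\<bar>)) \<longlonglongrightarrow> (\<Sum>n<N. herm n x * 0)^2 + 2 * (LBINT y. \<bar>p y\<bar> * \<bar>p' y\<bar>)"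
  unfolding p_def[of "- real _"] by (intro tendsto_intros h0)
 moreover have "eventually (%k. (p x)^2 <= (p (- real k))^2 + 2 * (LBINT y. \<bar>p y\<bar> * \<bar>p' y\<bar>)) sequentially"
  using eventually_ge_at_top[of "nat \<lceil>- x\<rceil>"] 
 proof eventually_elim
  case (elim k)
  then have "- real k <= x" by linarith
  from step[OF this] show ?case .
 qed
 ultimately have "(p x)^2 <= (\<Sum>n<N. herm n x * 0)^2 + 2 * (LBINT y. \<bar>p y\<bar> * \<bar>p' y\<bar>)"
  by (rule tendsto_lowerbound) simp
 then have Q2: "Q * Q <= 2 * sqrt 2 * sqrt (real N) * Q" using I by (simp add: px power2_eq_square)
 have "Q <= 2 * sqrt 2 * sqrt (real N)"
 proof (cases "Q = 0")
  case False
  then show ?thesis using Q2 Q0 by (simp add: mult_le_cancel_right)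
 qed simp
 also have "... <= 4 * sqrt (real N)" using real_sqrt_le_mono[of 2 4] by (intro mult_right_mono) auto
 finally show ?thesis by (simp add: Q_def)
qed

text \<open>A single term of the Christoffel sum. For the Schwartz estimates any bound polynomial in
  n is good enough.\<close>

lemma abs_herm_le: "\<bar>herm n x\<bar> <= 2 * (1 + real n)"
proof (rule power2_le_imp_le)
 have "\<bar>herm n x\<bar>^2 <= (\<Sum>k<Suc n. (herm k x)^2)" by simp (intro sum_nonneg, simp)
 also have "... <= 4 * sqrt (real (Suc n))" by (rule sum_herm_sq_le)
 also have "... <= 4 * (real (Suc n))^2"
 proof (rule mult_left_mono)
  have "sqrt (real (Suc n)) <= real (Suc n)" by (rule real_le_lsqrt) (auto intro!: self_le_power simp del: of_nat_Suc)
  also have "... <= (real (Suc n))^2" by (rule self_le_power) auto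
  finally show "sqrt (real (Suc n)) <= (real (Suc n))^2" .
 qed simp
 also have "... = (2 * (1 + real n))^2" by (simp add: power2_eq_square algebra_simps)
 finally show "\<bar>herm n x\<bar>^2 <= (2 * (1 + real n))^2" .
qed simp

subsection \<open>Completeness on the line\<close>

lemma L2_of_real:
 fixes g :: "'a::euclidean_space => real"
 assumes "g \<in> bmeas" "integrable lborel b" "!!x. (g x)^2 <= b x" shows "(%x. cplx (g x)) \<in> L2"
 by (rule L2I_bound[OF _ assms(2)]) (use assms in auto)

lemma power_herm_L2: "(%y. cplx (y ^ k * herm n y)) \<in> L2"
proof -
 obtain C where C: "C >= 0" "!!x. \<bar>x\<bar> ^ k * \<bar>herm n x\<bar> <= C * exp (- x\<^sup>2 / 4)" using herm_decay by blast
 show ?thesis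
 proof (rule L2_of_real)
  show "integrable lborel (%x::real. C^2 * exp (- x\<^sup>2 / 2))" by (intro integrable_mult_right integrable_gauss) simp
  show "(x ^ k * herm n x)^2 <= C^2 * exp (- x\<^sup>2 / 2)" for x
  proof -
   have "\<bar>x ^ k * herm n x\<bar>^2 <= (C * exp (- x\<^sup>2 / 4))^2"
    using C(2)[of x] by (intro power_mono) (auto simp: abs_mult power_abs)
   also have "... = C^2 * (exp (- x\<^sup>2 / 4) * exp (- x\<^sup>2 / 4))" by (simp add: power2_eq_square)
   also have "exp (- x\<^sup>2 / 4) * exp (- x\<^sup>2 / 4) = exp (- x\<^sup>2 / 2)" by (simp flip: exp_add)
   finally show ?thesis by simp
  qed
 qed measurable
qed

text \<open>Each factor y is traded for neighbouring Hermite functions by \<open>mult_herm\<close>.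
  With n = 0 this yields the vanishing of all moments against the Gaussian.\<close>

lemma orthogonal_power_herm:
 assumes f: "f \<in> L2" and z: "!!n. fcoef herm f n = 0"
 shows "(LBINT y. f y * cplx (y ^ k * herm n y)) = 0"
proof (induction k arbitrary: n)
 case 0
 then show ?case using z[of n] by (simp add: fcoef_def)
next
 case (Suc k)
 have "y ^ Suc k * herm n y = lad (Suc n) * (y ^ k * herm (Suc n) y) + lad n * (y ^ k * herm (n - 1) y)" for y
 proof -
  have "y ^ Suc k * herm n y = y ^ k * (y * herm n y)" by simp
  then show ?thesis unfolding mult_herm by (simp add: algebra_simps)
 qed
 then have "(LBINT y. f y * cplx (y ^ Suc k * herm n y)) =
   (\<integral>y. of_real (lad (Suc n)) * (f y * cplx (y ^ k * herm (Suc n) y))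
    + of_real (lad n) * (f y * cplx (y ^ k * herm (n - 1) y)) \<partial>lborel)"
  by (simp only: of_real_add of_real_mult) (simp add: algebra_simps)
 also have "... = 0" by (subst Bochner_Integration.integral_add)
    (use Suc in \<open>auto intro!: integrable_mult_right integrable_mult_L2 f power_herm_L2 simp del: of_real_mult\<close>)
 finally show ?case .
qed

lemma norm_exp_partial_sum_le: "norm (\<Sum>k<n. z ^ k /\<^sub>R fact k) <= exp (norm (z::complex))"
proof -
 have "norm (\<Sum>k<n. z ^ k /\<^sub>R fact k) <= (\<Sum>k<n. norm z ^ k /\<^sub>R fact k)"
  by (rule order_trans[OF norm_sum]) (simp add: norm_power)
 also have "... <= (\<Sum>k. norm z ^ k /\<^sub>R fact k)" by (rule sum_le_suminf) (use summable_exp_generic[of "norm z"] in auto)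
 also have "... = exp (norm z)" by (simp add: exp_def)
 finally show ?thesis .
qed

lemma exp_eq_herm_0: "exp (- y\<^sup>2 / 2) = pi powr (1/4) * herm 0 y" by (simp add: herm.simps powr_add[symmetric] flip: mult.assoc)

text \<open>The Gaussian gives F = g exp(-y^2/2) exponential moments of every order, so its Fourier
  transform may be expanded in powers of t and vanishes with the moments. Uniqueness of
  characteristic functions then gives F = 0.\<close>

lemma moments_zero_imp_AE_zero:
 fixes g :: "real => real"
 assumes g: "(%x. cplx (g x)) \<in> L2" and gm [measurable]: "g \<in> bmeas"
  and mom: "!!k. (LBINT y. g y * (y ^ k * exp (- y\<^sup>2 / 2))) = 0" shows "AE x in lborel. g x = 0"
proof -
 define F where "F y = g y * exp (- y\<^sup>2 / 2)" for y
 have Fm [measurable]: "F \<in> bmeas" unfolding F_def by measurable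
 \<comment> \<open>This is the integrable majorant for the partial sums of the exponential series
   below.\<close>
 have intexp: "integrable lborel (%y. \<bar>F y\<bar> * exp (\<bar>t\<bar> * \<bar>y\<bar>))" for t
 proof -
  have "(%y. cplx (exp (- y\<^sup>2 / 2 + \<bar>t\<bar> * \<bar>y\<bar>))) \<in> L2"
  proof (rule L2_of_real)
   show "integrable lborel (%y::real. exp (2 * t^2) * exp (- y\<^sup>2 / 2))" by (intro integrable_mult_right integrable_gauss) simp
   show "(exp (- y\<^sup>2 / 2 + \<bar>t\<bar> * \<bar>y\<bar>))^2 <= exp (2 * t^2) * exp (- y\<^sup>2 / 2)" for y :: real
   proof -
    have "2 * (- y\<^sup>2 / 2 + \<bar>t\<bar> * \<bar>y\<bar>) <= 2 * t^2 + - y\<^sup>2 / 2"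
     using sum_squares_bound[of "2 * \<bar>t\<bar>" "\<bar>y\<bar>"] by (simp add: power_mult_distrib)
    then show ?thesis unfolding exp_double[symmetric] exp_add[symmetric] by (simp only: exp_le_cancel_iff)
   qed
  qed measurable
  moreover have "cmod (cplx (g y)) * cmod (cplx (exp (- y\<^sup>2 / 2 + \<bar>t\<bar> * \<bar>y\<bar>)))
    = \<bar>F y\<bar> * exp (\<bar>t\<bar> * \<bar>y\<bar>)" for y unfolding exp_add by (simp add: F_def abs_mult norm_mult)
  ultimately show ?thesis using integrable_norm_mult_L2[OF g, of "%y. cplx (exp (- y\<^sup>2 / 2 + \<bar>t\<bar> * \<bar>y\<bar>))"]
   by (simp only:)
 qed
 have intF: "integrable lborel F" by (rule Bochner_Integration.integrable_bound[OF intexp[of 0]]) auto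
 have char0: "(LBINT y. cplx (F y) * iexp (t * y)) = 0" for t
 proof -
  let ?s = "%n y. \<Sum>k<n. cplx (F y) * ((\<i> * cplx (t * y)) ^ k /\<^sub>R fact k)"
  have intk: "integrable lborel (%y. g y * (y ^ k * exp (- y\<^sup>2 / 2)))" for k
  proof -
   have "integrable lborel (%y. Re (cplx (g y) * cplx (y ^ k * herm 0 y)))"
    by (rule integrable_Re[OF integrable_mult_L2[OF g power_herm_L2]])
   then have "integrable lborel (%y. pi powr (1/4) * (g y * (y ^ k * herm 0 y)))" by simp
   then show ?thesis unfolding exp_eq_herm_0 by (simp add: mult_ac)
  qed
  have "(%n. \<integral>y. ?s n y \<partial>lborel) \<longlonglongrightarrow> (LBINT y. cplx (F y) * iexp (t * y))"
  proof (rule integral_dominated_convergence[where w="%y. \<bar>F y\<bar> * exp (\<bar>t\<bar> * \<bar>y\<bar>)"])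
   show "AE y in lborel. (%n. ?s n y) \<longlonglongrightarrow> cplx (F y) * iexp (t * y)"
    using exp_converges[of "\<i> * cplx (t * _)"]
    by (intro AE_I2, unfold sum_distrib_left[symmetric], intro tendsto_mult_left) (auto simp: sums_def)
   show "AE y in lborel. norm (?s n y) <= \<bar>F y\<bar> * exp (\<bar>t\<bar> * \<bar>y\<bar>)" for n
   proof (rule AE_I2)
    fix y
    show "norm (?s n y) <= \<bar>F y\<bar> * exp (\<bar>t\<bar> * \<bar>y\<bar>)" unfolding sum_distrib_left[symmetric] norm_mult
     using norm_exp_partial_sum_le[of "\<i> * cplx (t * y)" n] by (intro mult_mono) (auto simp: norm_mult abs_mult)
   qed
  qed (use intexp[of t] in auto)
  moreover have "(LBINT y. ?s n y) = 0" for n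
  proof -
   have e: "cplx (F y) * ((\<i> * cplx (t * y)) ^ k /\<^sub>R fact k) =
     ((\<i> * cplx t) ^ k /\<^sub>R fact k) * cplx (g y * (y ^ k * exp (- y\<^sup>2 / 2)))" for k y
    by (simp add: F_def power_mult_distrib scaleR_conv_of_real mult_ac)
   have "(LBINT y. ?s n y) = (\<Sum>k<n. \<integral>y. ((\<i> * cplx t) ^ k /\<^sub>R fact k) * cplx (g y * (y ^ k * exp (- y\<^sup>2 / 2))) \<partial>lborel)"
    unfolding e by (rule Bochner_Integration.integral_sum) (intro integrable_mult_right integrable_of_real intk)
   also have "... = 0" by (simp only: integral_mult_right_zero integral_complex_of_real mom) simp
   finally show ?thesis .
  qed
  ultimately show ?thesis by (simp add: LIMSEQ_const_iff)
 qed
 \<comment> \<open>Levy's theorem compares probability measures, hence the split into positive and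
   negative part and the normalisation by their common mass c. If c = 0, both parts vanish at
   once.\<close>
 define P where "P y = max 0 (F y)" for y
 define N where "N y = max 0 (- F y)" for y
 have [measurable]: "P \<in> bmeas" "N \<in> bmeas" unfolding P_def N_def by measurable
 have FPN: "F y = P y - N y" "\<bar>F y\<bar> = P y + N y" "0 <= P y" "0 <= N y" for y by (auto simp: P_def N_def)
 have intPN: "integrable lborel P" "integrable lborel N" by (rule Bochner_Integration.integrable_bound[OF intF]; auto simp: P_def N_def)+
 define c where "c = (LBINT y. P y)"
 have iexp_int: "integrable lborel (%y. cplx (h y) * iexp (t * y))"
  if "integrable lborel h" for h t by (rule Bochner_Integration.integrable_bound[OF integrable_of_real[OF that, where 'a=complex]])
    (use that in \<open>auto simp: norm_mult\<close>)
 have eqchar: "(LBINT y. cplx (P y) * iexp (t * y)) = (LBINT y. cplx (N y) * iexp (t * y))" for t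
  using char0[of t] iexp_int[OF intPN(1), of t] iexp_int[OF intPN(2), of t] by (simp add: FPN(1) left_diff_distrib)
 have cN: "c = (LBINT y. N y)" using eqchar[of 0] unfolding c_def by simp
 have AEPN: "AE y in lborel. P y = N y"
 proof (cases "c = 0")
  case True
  have "AE y in lborel. P y = 0" "AE y in lborel. N y = 0"
   using True cN integral_nonneg_eq_0_iff_AE[OF intPN(1)] integral_nonneg_eq_0_iff_AE[OF intPN(2)] by (auto simp: FPN c_def)
  then show ?thesis by eventually_elim simp
 next
  case False
  have "c >= 0" unfolding c_def by (simp add: FPN)
  with False have c: "c > 0" by simp
  define Me where "Me h = density lborel (%y. ennreal (h y / c))" for h :: "real => real"
  have distr: "real_distribution (Me h)"
   if h: "integrable lborel h" "!!y. 0 <= h y" "(LBINT y. h y) = c" for h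
  proof -
   have [measurable]: "h \<in> bmeas" using h(1) by auto
   have "emeasure (Me h) (space (Me h)) = (\<integral>\<^sup>+y. ennreal (h y / c) \<partial>lborel)"
    unfolding Me_def by (simp add: emeasure_density)
   also have "... = ennreal (LBINT y. h y / c)" by (rule nn_integral_eq_integral) (use h c in auto)
   also have "... = 1" using h c by simp
   finally have "prob_space (Me h)" by (rule prob_spaceI)
   then show ?thesis by (simp add: real_distribution_def real_distribution_axioms_def Me_def)
  qed
  have char: "char (Me h) t = (LBINT y. cplx (h y) * iexp (t * y)) / c"
   if h: "integrable lborel h" "!!y. 0 <= h y" for h t
  proof -
   have [measurable]: "h \<in> bmeas" using h(1) by auto
   have "char (Me h) t = (LBINT y. (h y / c) *\<^sub>R iexp (t * y))"
    unfolding char_def Me_def by (rule integral_density) (use h c in auto)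
   also have "... = (LBINT y. cplx (h y) * iexp (t * y) / c)"
    by (simp add: scaleR_conv_of_real mult.commute)
   finally show ?thesis by simp
  qed
  have "Me P = Me N"
  proof (rule Levy_uniqueness[OF distr distr])
   show "char (Me P) = char (Me N)" by (rule ext, subst char[OF intPN(1) FPN(3)], subst char[OF intPN(2) FPN(4)]) (simp only: eqchar)
  qed (auto simp: intPN FPN c_def[symmetric] cN[symmetric])
  then have "AE y in lborel. ennreal (P y / c) = ennreal (N y / c)"
   unfolding Me_def by (intro sigma_finite_measure.density_unique[OF sigma_finite_lborel]) auto
  then show ?thesis by eventually_elim (use c in \<open>simp add: FPN\<close>)
 qed
 then show ?thesis
 proof eventually_elim
  case (elim x)
  then have "F x = 0" using FPN(1)[of x] by simp
  then show ?case by (simp add: F_def)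
 qed
qed

lemma herm_complete:
 assumes f: "f \<in> L2" and z: "!!n. fcoef herm f n = 0" shows "AE x in lborel. f x = 0"
proof -
 have [measurable]: "f \<in> bmeas" by (rule L2_measurable[OF f])
 have fi: "complex_integrable lborel (%y. f y * cplx (y ^ k * herm 0 y))" for k
  by (rule integrable_mult_L2[OF f power_herm_L2])
 have sq: "integrable lborel (%x. (Re (f x))^2)" "integrable lborel (%x. (Im (f x))^2)"
  by (rule Bochner_Integration.integrable_bound[OF L2_integrable[OF f]]; auto simp: cmod_def)+

 have "AE x in lborel. Re (f x) = 0"
 proof (rule moments_zero_imp_AE_zero)
  have "(LBINT y. Re (f y) * (y ^ k * herm 0 y)) = 0" for k
   using arg_cong[OF orthogonal_power_herm[OF f z, of k 0], of Re] integral_Re[OF fi[of k]] by simp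
  then have "(LBINT y. pi powr (1/4) * (Re (f y) * (y ^ k * herm 0 y))) = 0" for k by simp
  then show "(LBINT y. Re (f y) * (y ^ k * exp (- y\<^sup>2 / 2))) = 0" for k
   unfolding exp_eq_herm_0 by (simp add: mult_ac)
 qed (auto intro!: L2_of_real[OF _ sq(1)])
 moreover have "AE x in lborel. Im (f x) = 0"
 proof (rule moments_zero_imp_AE_zero)
  have "(LBINT y. Im (f y) * (y ^ k * herm 0 y)) = 0" for k
   using arg_cong[OF orthogonal_power_herm[OF f z, of k 0], of Im] integral_Im[OF fi[of k]] by simp
  then have "(LBINT y. pi powr (1/4) * (Im (f y) * (y ^ k * herm 0 y))) = 0" for k by simp
  then show "(LBINT y. Im (f y) * (y ^ k * exp (- y\<^sup>2 / 2))) = 0" for k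
   unfolding exp_eq_herm_0 by (simp add: mult_ac)
 qed (auto intro!: L2_of_real[OF _ sq(2)])
 ultimately show ?thesis by eventually_elim (simp add: complex_eq_iff)
qed

interpretation herm: orthonormal_basis herm "%n. n" by standard (rule herm_complete)

section \<open>Products on \<open>\<real>\<^sup>n\<close>\<close>

text \<open>Lebesgue measure on \<open>real^'n\<close> is an image of a product measure indexed by
  \<open>Basis\<close>; the product formula is transported along the bijection sending i to
  \<open>axis i 1\<close>.\<close>

lemma lborel_vec_prod:
 fixes f :: "'n::finite => real => 'b::{real_normed_field, banach, second_countable_topology}"
 assumes f: "!!i. integrable lborel (f i)" shows integrable_vec_prod: "integrable lborel (%x::real^'n. \<Prod>i\<in>UNIV. f i (x $ i))"
  and integral_vec_prod: "(\<integral>x. (\<Prod>i\<in>UNIV. f i (x $ i)) \<partial>(lborel :: (real^'n) measure)) = (\<Prod>i\<in>UNIV. integral\<^sup>L lborel (f i))"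
proof -
 have [measurable]: "f i \<in> bmeas" for i using f[of i] by auto
 let ?ax = "%i::'n. axis i (1::real)"
 have inj: "inj ?ax" by (auto simp: inj_def axis_eq_axis)
 have B: "(Basis :: (real^'n) set) = range ?ax" by (auto simp: Basis_vec_def)
 interpret product_sigma_finite "%_::real^'n. lborel :: real measure" by standard
 define T where "T = (%g. \<Sum>b\<in>(Basis :: (real^'n) set). g b *\<^sub>R b)"
 define f' where "f' b = f (inv ?ax b)" for b
 have f'ax: "f' (?ax i) = f i" for i by (simp add: f'_def inv_f_f[OF inj])
 have f'int: "integrable lborel (f' b)" for b by (simp add: f'_def f)
 have Tnth: "T g $ i = g (?ax i)" for g i
 proof -
  have "T g $ i = (\<Sum>j\<in>UNIV. g (?ax j) * ?ax j $ i)" unfolding T_def B by (simp add: sum.reindex[OF inj])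
  also have "... = g (?ax i)" by (simp add: axis_def if_distrib cong: if_cong)
  finally show ?thesis .
 qed
 have comp: "(\<Prod>i\<in>UNIV. f i (T g $ i)) = (\<Prod>b\<in>Basis. f' b (g b))" for g
  unfolding Tnth B by (simp add: prod.reindex[OF inj] f'ax)
 have prodB: "(\<Prod>i\<in>UNIV. integral\<^sup>L lborel (f i)) = (\<Prod>b\<in>Basis. integral\<^sup>L lborel (f' b))"
  unfolding B by (simp add: prod.reindex[OF inj] f'ax)
 have [measurable]: "T \<in> borel_measurable (\<Pi>\<^sub>M b\<in>Basis. lborel)" unfolding T_def by measurable
 have l: "lborel = distr (\<Pi>\<^sub>M b\<in>Basis. lborel) borel T" unfolding T_def by (rule lborel_eq)
 show "integrable lborel (%x::real^'n. \<Prod>i\<in>UNIV. f i (x $ i))"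
  by (subst l, subst integrable_distr_eq) (use product_integrable_prod[OF finite_Basis f'int] in \<open>auto simp: comp\<close>)
 show "(\<integral>x. (\<Prod>i\<in>UNIV. f i (x $ i)) \<partial>(lborel :: (real^'n) measure)) = (\<Prod>i\<in>UNIV. integral\<^sup>L lborel (f i))"
  by (subst l, subst integral_distr) (use product_integral_prod[OF finite_Basis f'int] in \<open>auto simp: comp prodB\<close>)
qed

definition vprod :: "('n::finite => real => complex) => real^'n => complex" where
 "vprod g x = (\<Prod>i\<in>UNIV. g i (x $ i))"

lemma vprod_L2:
 assumes "!!i. g i \<in> L2" shows "vprod g \<in> L2" and nrm2_vprod: "nrm2 (vprod g) = (\<Prod>i\<in>UNIV. nrm2 (g i))"
proof -
 have [measurable]: "g i \<in> bmeas" for i by (rule L2_measurable[OF assms])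
 have e: "(cmod (vprod g x))^2 = (\<Prod>i\<in>UNIV. (cmod (g i (x $ i)))^2)" for x
  by (simp add: vprod_def prod_norm[symmetric] prod_power_distrib)
 show "vprod g \<in> L2"
 proof (rule L2I)
  show "vprod g \<in> bmeas" unfolding vprod_def[abs_def] by measurable
  show "integrable lborel (%x. (cmod (vprod g x))^2)" unfolding e by (rule integrable_vec_prod) (rule L2_integrable[OF assms])
 qed
 show "nrm2 (vprod g) = (\<Prod>i\<in>UNIV. nrm2 (g i))" unfolding nrm2_def e by (rule integral_vec_prod) (rule L2_integrable[OF assms])
qed

lemma vprod_upd: "vprod (g(j := u)) x = u (x $ j) * (\<Prod>i\<in>UNIV - {j}. g i (x $ i))"
proof -
 have "vprod (g(j := u)) x = (g(j := u)) j (x $ j) * (\<Prod>i\<in>UNIV - {j}. (g(j := u)) i (x $ i))"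
  unfolding vprod_def by (rule prod.remove) auto
 also have "(\<Prod>i\<in>UNIV - {j}. (g(j := u)) i (x $ i)) = (\<Prod>i\<in>UNIV - {j}. g i (x $ i))" by (rule prod.cong) auto
 finally show ?thesis by (simp only: fun_upd_same)
qed

text \<open>For real u, the measures with densities u^+ and u^- agree on boxes, which form an
  intersection-stable generator of the Borel sets; hence they are equal and so are their
  densities.\<close>

lemma AE_zero_if_box_integrals_zero:
 fixes f :: "'a::euclidean_space => complex"
 assumes f: "f \<in> L2" and z: "!!a b. (LBINT x. f x * indicator (box a b) x) = 0" shows "AE x in lborel. f x = 0"
proof -
 have [measurable]: "f \<in> bmeas" by (rule L2_measurable[OF f])
 have indL2: "(indicator (box a b) :: 'a => complex) \<in> L2" for a b
 proof (rule L2I)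
  have "(cmod (indicator (box a b) x))^2 = indicator (box a b) x" for x by (simp add: indicator_def)
  then show "integrable lborel (%x. (cmod (indicator (box a b) x))^2)"
   by (simp only:) (rule integrable_real_indicator, auto simp: emeasure_lborel_box_eq)
 qed measurable
 have fi: "complex_integrable lborel (%x. f x * indicator (box a b) x)" for a b by (rule integrable_mult_L2[OF f indL2])
 have real: "AE x in lborel. u x = 0"
  if u [measurable]: "u \<in> bmeas" and ui: "!!a b. integrable lborel (%x. u x * indicator (box a b) x)"
   and uz: "!!a b. (LBINT x. u x * indicator (box a b) x) = 0" for u :: "'a => real"
 proof -
  \<comment> \<open>\<open>ennreal\<close> sends negative numbers to 0, so the density
    \<open>ennreal (h x)\<close> is the positive part of h.\<close>
  have em: "emeasure (density lborel (%x. ennreal (h x))) (box a b) = ennreal (LBINT x. max 0 (h x) * indicator (box a b) x)"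
   if [measurable]: "h \<in> bmeas" and hi: "integrable lborel (%x. h x * indicator (box a b) x)" for h :: "'a => real" and a b
  proof -
   have "emeasure (density lborel (%x. ennreal (h x))) (box a b) = (\<integral>\<^sup>+x. ennreal (max 0 (h x) * indicator (box a b) x) \<partial>lborel)"
    by (subst emeasure_density) (auto simp: ennreal_indicator ennreal_mult' max_def ennreal_neg intro!: nn_integral_cong split: split_indicator)
   also have "... = ennreal (LBINT x. max 0 (h x) * indicator (box a b) x)" by (rule nn_integral_eq_integral)
      (auto intro!: Bochner_Integration.integrable_bound[OF hi] split: split_indicator)
   finally show ?thesis .
  qed
  have nui: "integrable lborel (%x. - u x * indicator (box a b) x)" for a b using ui[of a b] by simp
  have "density lborel (%x. ennreal (u x)) = density lborel (%x. ennreal (- u x))"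
  proof (rule measure_eqI_generator_eq)
   let ?E = "range (%(a, b). box a b::'a set)"
   show "Int_stable ?E" by (auto simp: Int_stable_def box_Int_box)
   show "?E \<subseteq> Pow UNIV" "sets (density lborel (%x. ennreal (u x))) = sigma_sets UNIV ?E"
    "sets (density lborel (%x. ennreal (- u x))) = sigma_sets UNIV ?E" by (simp_all add: borel_eq_box)
   let ?A = "%n::nat. box (- (real n *\<^sub>R One)) (real n *\<^sub>R One) :: 'a set"
   show "range ?A \<subseteq> ?E" "(\<Union>i. ?A i) = UNIV" unfolding UN_box_eq_UNIV by auto
   show "emeasure (density lborel (%x. ennreal (u x))) (?A i) ~= \<infinity>" for i by (simp add: em[OF u ui])
   fix X assume "X \<in> ?E"
   then obtain a b where X: "X = box a b" by auto
   have mi: "integrable lborel (%x. max 0 (u x) * indicator (box a b) x)" "integrable lborel (%x. max 0 (- u x) * indicator (box a b) x)"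
    by (auto intro!: Bochner_Integration.integrable_bound[OF ui[of a b]] split: split_indicator)
   have "(LBINT x. max 0 (u x) * indicator (box a b) x) - (LBINT x. max 0 (- u x) * indicator (box a b) x) =
    (LBINT x. max 0 (u x) * indicator (box a b) x - max 0 (- u x) * indicator (box a b) x)" using mi by simp
   also have "... = (LBINT x. u x * indicator (box a b) x)"
    by (rule Bochner_Integration.integral_cong) (auto split: split_indicator)
   finally show "emeasure (density lborel (%x. ennreal (u x))) X = emeasure (density lborel (%x. ennreal (- u x))) X"
    unfolding X using uz[of a b] by (simp add: em[OF u ui] em[OF _ nui])
  qed
  then have "AE x in lborel. ennreal (u x) = ennreal (- u x)"
   by (intro sigma_finite_measure.density_unique[OF sigma_finite_lborel]) auto
  then show ?thesis
  proof eventually_elim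
   case (elim x)
   then show ?case by (cases "u x >= 0") (auto simp: ennreal_neg dest: ennreal_eq_0_iff[THEN iffD1] ennreal_eq_0_iff[THEN iffD1, OF sym])
  qed
 qed
 have ind: "Re (indicator A x) = indicator A x" "Im (indicator A x) = 0" for A and x :: 'a by (auto simp: indicator_def)
 have "AE x in lborel. Re (f x) = 0" using integrable_Re[OF fi] integral_Re[OF fi] z by (intro real) (auto simp: ind)
 moreover have "AE x in lborel. Im (f x) = 0" using integrable_Im[OF fi] integral_Im[OF fi] z by (intro real) (auto simp: ind)
 ultimately show ?thesis by eventually_elim (simp add: complex_eq_iff)
qed

section \<open>Hermite functions on \<open>\<real>\<^sup>n\<close>\<close>

definition hermv :: "('n::finite => nat) => real^'n => real" where
 "hermv \<nu> x = (\<Prod>i\<in>UNIV. herm (\<nu> i) (x $ i))"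

definition mdeg :: "('n::finite => nat) => nat" where
 "mdeg \<nu> = (\<Sum>i\<in>UNIV. \<nu> i)"

lemma le_mdeg: "a i <= mdeg a" unfolding mdeg_def by (rule member_le_sum) auto

lemma finite_mdeg_le: "finite {a::'n::finite => nat. mdeg a <= n}"
proof (rule finite_subset)
 show "{a::'n => nat. mdeg a <= n} \<subseteq> UNIV \<rightarrow>\<^sub>E {..n}"
  using le_mdeg order_trans by (fastforce simp: PiE_def)
qed (auto intro: finite_PiE)

lemma vprod_herm: "vprod (%i x. cplx (herm (a i) x)) x = cplx (hermv a x)"
 by (simp add: vprod_def hermv_def)

text \<open>One factor is replaced at a time: with the others fixed, the product is linear and
  continuous in that factor, which is the limit of its Hermite expansion. The induction runs over
  the set S of coordinates whose factor is not yet a Hermite function.\<close>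

lemma vprod_zero_if_orthogonal:
 fixes f :: "real^'n::finite => complex"
 assumes f: "f \<in> L2" and z: "!!a. fcoef hermv f a = 0" and g: "!!i. g i \<in> L2"
 shows "(LBINT x. f x * vprod g x) = 0"
proof -
 let ?h = "%n x. cplx (herm n x)"
 have step: "(LBINT x. f x * vprod (g(j := u)) x) = 0"
  if g: "!!i. g i \<in> L2" and u: "u \<in> L2" and zero: "!!n. (LBINT x. f x * vprod (g(j := ?h n)) x) = 0" for g j u
 proof -
  let ?p = "%N. fcomb herm {n. n < N} (fcoef herm u)"
  have gL2: "vprod (g(j := v)) \<in> L2" if "v \<in> L2" for v by (rule vprod_L2) (use g that in auto)
  have "(%N. \<integral>x. vprod (g(j := ?p N)) x * f x \<partial>lborel) \<longlonglongrightarrow> (LBINT x. vprod (g(j := u)) x * f x)"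
  proof (rule integral_mult_tendsto[OF gL2 gL2 f])
   have "nrm2 (%x. vprod (g(j := u)) x - vprod (g(j := ?p N)) x) = nrm2 (%x. u x - ?p N x) * (\<Prod>i\<in>UNIV - {j}. nrm2 (g i))" for N
   proof -
    have e: "(%x. vprod (g(j := u)) x - vprod (g(j := ?p N)) x) = vprod (g(j := %x. u x - ?p N x))"
     by (rule ext) (simp add: vprod_upd algebra_simps)
    have "nrm2 (%x. vprod (g(j := u)) x - vprod (g(j := ?p N)) x) = (\<Prod>i\<in>UNIV. nrm2 ((g(j := %x. u x - ?p N x)) i))"
     unfolding e by (rule nrm2_vprod) (use g u herm.fcomb_L2 in \<open>auto intro: L2_diff\<close>)
    also have "... = nrm2 (%x. u x - ?p N x) * (\<Prod>i\<in>UNIV - {j}. nrm2 ((g(j := %x. u x - ?p N x)) i))"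
     by (subst prod.remove[of _ j]) auto
    also have "(\<Prod>i\<in>UNIV - {j}. nrm2 ((g(j := %x. u x - ?p N x)) i)) = (\<Prod>i\<in>UNIV - {j}. nrm2 (g i))"
     by (rule prod.cong) auto
    finally show ?thesis by (simp only: fun_upd_same)
   qed
   then show "(%N. nrm2 (%x. vprod (g(j := u)) x - vprod (g(j := ?p N)) x)) \<longlonglongrightarrow> 0"
    using tendsto_mult_left_zero[OF herm.expansion_tendsto[OF u]] by simp
  qed (use u herm.fcomb_L2 in auto)
  moreover have "(LBINT x. vprod (g(j := ?p N)) x * f x) = 0" for N
  proof -
   have "vprod (g(j := ?p N)) x * f x = (\<Sum>n | n < N. fcoef herm u n * (f x * vprod (g(j := ?h n)) x))" for x
    by (simp add: vprod_upd fcomb_def sum_distrib_right sum_distrib_left mult_ac)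
   then have "(LBINT x. vprod (g(j := ?p N)) x * f x) =
     (\<Sum>n | n < N. \<integral>x. fcoef herm u n * (f x * vprod (g(j := ?h n)) x) \<partial>lborel)"
    by (simp only:) (rule Bochner_Integration.integral_sum, intro integrable_mult_right integrable_mult_L2 f gL2 herm.basis_L2)
   then show ?thesis by (simp add: zero)
  qed
  ultimately show ?thesis by (simp add: LIMSEQ_const_iff mult.commute)
 qed
 have "(\<forall>i. g i \<in> L2) --> (\<forall>i\<in>-S. \<exists>n. g i = ?h n) --> (LBINT x. f x * vprod g x) = 0"
  if "finite S" for S :: "'n set" and g using that
 proof (induction S arbitrary: g)
  case empty
  show ?case
  proof (intro impI)
   assume "\<forall>i\<in>- {}. \<exists>n. g i = ?h n"
   then obtain a where "!!i. g i = ?h (a i)" by (metis Compl_empty_eq UNIV_I)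
   then have "g = (%i. ?h (a i))" by auto
   then show "(LBINT x. f x * vprod g x) = 0" using z[of a] by (simp add: vprod_herm fcoef_def)
  qed
 next
  case (insert j S)
  show ?case
  proof (intro impI)
   assume g: "\<forall>i. g i \<in> L2" and h: "\<forall>i\<in>- insert j S. \<exists>n. g i = ?h n"
   have "(LBINT x. f x * vprod (g(j := g j)) x) = 0"
   proof (rule step)
    show "(LBINT x. f x * vprod (g(j := ?h n)) x) = 0" for n
    proof -
     have "\<forall>i. (g(j := ?h n)) i \<in> L2" using g herm.basis_L2 by auto
     moreover have "\<forall>i\<in>- S. \<exists>m. (g(j := ?h n)) i = ?h m" using h by auto
     ultimately show ?thesis using insert.IH by blast
    qed
   qed (use g in auto)
   then show "(LBINT x. f x * vprod g x) = 0" by simp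
  qed
 qed
 from this[of UNIV g] g show ?thesis by auto
qed

lemma hermv_complete:
 fixes f :: "real^'n::finite => complex"
 assumes f: "f \<in> L2" and z: "!!m. fcoef hermv f m = 0" shows "AE x in lborel. f x = 0"
proof (rule AE_zero_if_box_integrals_zero[OF f])
 fix a b :: "real^'n"
 have e: "indicator (box a b) x = vprod (%i. indicator {a $ i<..<b $ i}) x" for x
  by (auto simp: vprod_def indicator_def mem_box_cart prod_zero_iff)
 show "(LBINT x. f x * indicator (box a b) x) = 0" unfolding e
 proof (rule vprod_zero_if_orthogonal[OF f z])
  fix i
  show "(indicator {a $ i<..<b $ i} :: real => complex) \<in> L2"
  proof (rule L2I)
   have "(cmod (indicator {a $ i<..<b $ i} x))^2 = indicator {a $ i<..<b $ i} x" for x by (simp add: indicator_def)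
   then show "integrable lborel (%x. (cmod (indicator {a $ i<..<b $ i} x))^2)" by (simp add: emeasure_lborel_box_eq flip: box_real)
  qed measurable
 qed
qed

interpretation hermv: orthonormal_basis "hermv :: ('n::finite => nat) => _" mdeg
proof
 show "finite {a::'n => nat. mdeg a = n}" for n by (rule finite_subset[OF _ finite_mdeg_le[of n]]) auto
 show "hermv a \<in> bmeas" for a :: "'n => nat" unfolding hermv_def[abs_def] by measurable
 have e: "hermv a x * hermv b x = (\<Prod>i\<in>UNIV. herm (a i) (x $ i) * herm (b i) (x $ i))" for a b :: "'n => nat" and x
  by (simp add: hermv_def prod.distrib)
 show "integrable lborel (%x. hermv a x * hermv b x)" for a b :: "'n => nat"
  unfolding e by (rule integrable_vec_prod) (rule integrable_herm_mult)
 show "(LBINT x. hermv a x * hermv b x) = of_bool (a = b)" for a b :: "'n => nat"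
  unfolding e by (subst integral_vec_prod[OF integrable_herm_mult])
    (auto simp: herm.orth fun_eq_iff prod_zero_iff)
qed (rule hermv_complete)

section \<open>Schwartz functions\<close>

subsection \<open>Iterated partial derivatives\<close>

lemma has_vector_derivative_line:
 assumes "(f has_derivative f') (at (x + s *\<^sub>R v))" shows "((%t. f (x + t *\<^sub>R v)) has_vector_derivative f' v) (at s)"
proof -
 have "((%t. f (x + t *\<^sub>R v)) has_derivative (%h. f' (h *\<^sub>R v))) (at s)"
 proof (rule has_derivative_compose[of "%t. x + t *\<^sub>R v" "%h. h *\<^sub>R v"])
  show "((%t. x + t *\<^sub>R v) has_derivative (%h. h *\<^sub>R v)) (at s)" by (auto intro!: derivative_eq_intros)
 qed (use assms in simp)
 moreover have "f' (h *\<^sub>R v) = h *\<^sub>R f' v" for h using has_derivative_bounded_linear[OF assms] by (simp add: linear_simps)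
 ultimately show ?thesis by (simp add: has_vector_derivative_def)
qed

lemma partial_deriv_eq:
 "(f has_derivative f') (at x) ==> partial_deriv i f x = f' (axis i 1)" unfolding partial_deriv_def
 by (rule vector_derivative_at) (use has_vector_derivative_line[of f f' x 0 "axis i 1"] in simp)

lemma partial_deriv_line:
 assumes "f differentiable (at (x + s *\<^sub>R axis i 1))"
 shows "((%t. f (x + t *\<^sub>R axis i 1)) has_vector_derivative partial_deriv i f (x + s *\<^sub>R axis i 1)) (at s)"
proof -
 obtain f' where "(f has_derivative f') (at (x + s *\<^sub>R axis i 1))" using assms by (auto simp: differentiable_def)
 then show ?thesis using has_vector_derivative_line partial_deriv_eq by metis
qed

lemma has_derivative_partials:
 fixes f :: "real^'n::finite => complex"
 assumes "f differentiable (at x)" shows "(f has_derivative (%h. \<Sum>i\<in>UNIV. h $ i *\<^sub>R partial_deriv i f x)) (at x)"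
proof -
 obtain f' where f': "(f has_derivative f') (at x)" using assms by (auto simp: differentiable_def)
 have "f' h = (\<Sum>i\<in>UNIV. h $ i *\<^sub>R partial_deriv i f x)" for h
 proof -
  have lin: "linear f'" using f' by (rule has_derivative_linear)
  have "f' h = f' (\<Sum>i\<in>UNIV. h $ i *\<^sub>R axis i 1)" using basis_expansion[of h] by (simp add: scalar_mult_eq_scaleR)
  also have "... = (\<Sum>i\<in>UNIV. h $ i *\<^sub>R f' (axis i 1))" using lin by (simp add: linear_sum linear_scale)
  finally show ?thesis by (simp add: partial_deriv_eq[OF f'])
 qed
 then have "f' = (%h. \<Sum>i\<in>UNIV. h $ i *\<^sub>R partial_deriv i f x)" by (rule ext)
 with f' show ?thesis by simp
qed

lemma partial_deriv_add:
 assumes "f differentiable (at x)" "g differentiable (at x)"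
 shows "partial_deriv i (%x. f x + g x) x = partial_deriv i f x + partial_deriv i g x"
proof -
 obtain f' g' where *: "(f has_derivative f') (at x)" "(g has_derivative g') (at x)" using assms by (auto simp: differentiable_def)
 show ?thesis by (simp add: partial_deriv_eq[OF has_derivative_add[OF *]] partial_deriv_eq[OF *(1)] partial_deriv_eq[OF *(2)])
qed

lemma partial_deriv_mult:
 assumes "f differentiable (at x)" "g differentiable (at x)"
 shows "partial_deriv i (%x. f x * g x) x = f x * partial_deriv i g x + partial_deriv i f x * g x"
proof -
 obtain f' g' where *: "(f has_derivative f') (at x)" "(g has_derivative g') (at x)" using assms by (auto simp: differentiable_def)
 show ?thesis by (simp add: partial_deriv_eq[OF has_derivative_mult[OF *]] partial_deriv_eq[OF *(1)] partial_deriv_eq[OF *(2)])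
qed

lemma partial_deriv_const: "partial_deriv i (%_. c) x = 0" by (subst partial_deriv_eq[OF has_derivative_const]) simp

lemma partial_deriv_cmult:
 assumes "f differentiable (at x)" shows "partial_deriv i (%x. c * f x) x = c * partial_deriv i f x"
 by (subst partial_deriv_mult) (auto simp: assms partial_deriv_const)

lemma has_derivative_coord: "((%x::real^'n::finite. cplx (x $ i)) has_derivative (%h. cplx (h $ i))) (at x)"
 by (intro bounded_linear.has_derivative[OF bounded_linear_of_real] bounded_linear.has_derivative[OF bounded_linear_vec_nth] has_derivative_ident)

lemma differentiable_coord: "(%x::real^'n::finite. cplx (x $ i)) differentiable (at x)"
 using has_derivative_coord by (auto simp: differentiable_def)

lemma partial_deriv_coord: "partial_deriv j (%x::real^'n::finite. cplx (x $ i)) x = of_bool (i = j)"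
 by (simp add: partial_deriv_eq[OF has_derivative_coord] axis_def)

lemma partials_Nil [simp]: "partials [] f = f" and partials_Cons: "partials (i # is) f = partial_deriv i (partials is f)"
 and partials_snoc: "partials (is @ [i]) f = partials is (partial_deriv i f)" by (simp_all add: partials_def)

definition smooth :: "(real^'n::finite => complex) => bool" where
 "smooth f \<longleftrightarrow> (\<forall>is x. partials is f differentiable (at x))"

lemma smooth_partials: "smooth f ==> partials is f differentiable (at x)" by (simp add: smooth_def)

lemma smooth_differentiable: "smooth f ==> f differentiable (at x)" using smooth_partials[of f "[]"] by simp

lemma partials_add:
 assumes "smooth f" "smooth g" shows "partials is (%x. f x + g x) = (%x. partials is f x + partials is g x)"
proof (induction "is")
 case (Cons i "is")
 show ?case unfolding partials_Cons Cons.IH by (rule ext) (simp add: partial_deriv_add smooth_partials assms)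
qed simp

lemma smooth_add: "smooth f ==> smooth g ==> smooth (%x. f x + g x)" by (simp add: smooth_def partials_add)

lemma partials_cmult:
 assumes "smooth f" shows "partials is (%x. c * f x) = (%x. c * partials is f x)"
proof (induction "is")
 case (Cons i "is")
 show ?case unfolding partials_Cons Cons.IH by (rule ext) (simp add: partial_deriv_cmult smooth_partials assms)
qed simp

lemma smooth_cmult: "smooth f ==> smooth (%x. c * f x)" by (simp add: smooth_def partials_cmult)

lemma partials_zero: "partials is (%_. 0) = (%_. 0)"
proof (induction "is")
 case (Cons i "is")
 show ?case unfolding partials_Cons Cons.IH by (rule ext) (rule partial_deriv_const)
qed simp

lemma smooth_sum_partials:
 assumes "!!i. i \<in> A ==> smooth (f i)"
 shows "smooth (%x. \<Sum>i\<in>A. f i x) & partials is (%x. \<Sum>i\<in>A. f i x) = (%x. \<Sum>i\<in>A. partials is (f i) x)"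
 using assms
proof (induction A rule: infinite_finite_induct)
 case (insert j A)
 then show ?case by (simp add: smooth_add partials_add)
qed (auto simp: partials_zero smooth_def)

lemmas smooth_sum = smooth_sum_partials[THEN conjunct1] and partials_sum = smooth_sum_partials[THEN conjunct2]

text \<open>Leibniz rule for multiplication by a coordinate. The terms in which the coordinate
  itself was differentiated are collected in a list L of index lists; that there are finitely many
  of them is enough for the Schwartz bounds.\<close>

lemma partials_coord_mult:
 assumes "smooth f" shows "\<exists>L. \<forall>x. partials is (%x. cplx (x $ i) * f x) x =
  cplx (x $ i) * partials is f x + (\<Sum>k<length L. partials (L ! k) f x)"
proof (induction "is")
 case Nil
 show ?case by (rule exI[of _ "[]"]) simp
next
 case (Cons j "is")
 then obtain L where L: "partials is (%x. cplx (x $ i) * f x) =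
  (%x. cplx (x $ i) * partials is f x + (\<Sum>k<length L. partials (L ! k) f x))" by blast
 have d: "(%x. cplx (x $ i) * partials is f x) differentiable (at x)" for x
  by (intro differentiable_mult differentiable_coord smooth_partials assms)
 have sm: "smooth (%x. \<Sum>k<length L. partials (L ! k) f x)"
  by (rule smooth_sum) (use assms in \<open>auto simp: smooth_def partials_def simp flip: foldr_append\<close>)
 have e: "partials (j # is) (%x. cplx (x $ i) * f x) x = 
   cplx (x $ i) * partials (j # is) f x + of_bool (i = j) * partials is f x
   + (\<Sum>k<length L. partials (j # (L ! k)) f x)" for x
 proof -
  have "partial_deriv j (%x. \<Sum>k<length L. partials (L ! k) f x) x = (\<Sum>k<length L. partials (j # (L ! k)) f x)"
  proof -
   have "partials [j] (%x. \<Sum>k<length L. partials (L ! k) f x) = (%x. \<Sum>k<length L. partials [j] (partials (L ! k) f) x)"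
    by (rule partials_sum) (use assms in \<open>auto simp: smooth_def partials_def simp flip: foldr_append\<close>)
   then show ?thesis by (simp add: partials_Cons fun_eq_iff)
  qed
  then show ?thesis unfolding partials_Cons[of j "is"] L
   by (simp add: partial_deriv_add d smooth_differentiable[OF sm] partial_deriv_mult differentiable_coord
     smooth_partials[OF assms] partial_deriv_coord partials_Cons)
 qed
 show ?case
 proof (cases "i = j")
  case True
  show ?thesis by (rule exI[of _ "map ((#) j) L @ [is]"], rule allI, subst e) (simp add: True nth_append)
 next
  case False
  show ?thesis by (rule exI[of _ "map ((#) j) L"]) (auto simp: e False)
 qed
qed

subsection \<open>The Schwartz space\<close>

lemma schwartz_smooth: "f \<in> schwartz ==> smooth f" by (simp add: schwartz_def smooth_def)

lemma schwartz_bound: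
 assumes "f \<in> schwartz"
 obtains C where "C >= 0" "!!x. (1 + norm x) ^ N * cmod (partials is f x) <= C"
proof -
 have "bounded (range (%x. (1 + norm x) ^ N *\<^sub>R partials is f x))" using assms by (simp add: schwartz_def)
 then obtain C where "!!x. norm ((1 + norm x) ^ N *\<^sub>R partials is f x) <= C" by (auto simp: bounded_iff)
 then have C: "!!x. (1 + norm x) ^ N * cmod (partials is f x) <= C" by (simp add: abs_of_nonneg)
 then have "C >= 0" by (rule order_trans[rotated]) simp
 with C show ?thesis using that by blast
qed

lemma schwartzI:
 assumes "smooth f" "!!is N. \<exists>C. \<forall>x. (1 + norm x) ^ N * cmod (partials is f x) <= C" shows "f \<in> schwartz"
 using assms by (auto simp: schwartz_def smooth_def bounded_iff)

lemma schwartz_add: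
 assumes "f \<in> schwartz" "g \<in> schwartz" shows "(%x. f x + g x) \<in> schwartz"
proof (rule schwartzI)
 fix "is" N
 obtain C where C: "!!x. (1 + norm x) ^ N * cmod (partials is f x) <= C" using schwartz_bound[OF assms(1)] by metis
 obtain D where D: "!!x. (1 + norm x) ^ N * cmod (partials is g x) <= D" using schwartz_bound[OF assms(2)] by metis
 have "(1 + norm x) ^ N * cmod (partials is f x + partials is g x) <= C + D" for x
 proof -
  have "(1 + norm x) ^ N * cmod (partials is f x + partials is g x) \<le>
   (1 + norm x) ^ N * (cmod (partials is f x) + cmod (partials is g x))" by (intro mult_left_mono norm_triangle_ineq) simp
  also have "... <= C + D" using C[of x] D[of x] by (simp add: distrib_left)
  finally show ?thesis .
 qed
 then show "\<exists>C. \<forall>x. (1 + norm x) ^ N * cmod (partials is (%x. f x + g x) x) <= C"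
  by (auto simp: partials_add schwartz_smooth assms)
qed (simp add: smooth_add schwartz_smooth assms)

lemma schwartz_cmult:
 assumes "f \<in> schwartz" shows "(%x. c * f x) \<in> schwartz"
proof (rule schwartzI)
 fix "is" N
 obtain C where C: "!!x. (1 + norm x) ^ N * cmod (partials is f x) <= C" using schwartz_bound[OF assms(1)] by metis
 have "(1 + norm x) ^ N * cmod (c * partials is f x) <= cmod c * C" for x
  using mult_left_mono[OF C[of x] norm_ge_zero[of c]] by (simp add: norm_mult mult_ac)
 then show "\<exists>C. \<forall>x. (1 + norm x) ^ N * cmod (partials is (%x. c * f x) x) <= C"
  by (auto simp: partials_cmult schwartz_smooth assms)
qed (simp add: smooth_cmult schwartz_smooth assms)

lemma schwartz_zero: "(%_. 0) \<in> schwartz" by (rule schwartzI) (auto simp: smooth_def partials_zero)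

lemma schwartz_sum: "(!!i. i \<in> A ==> f i \<in> schwartz) ==> (%x. \<Sum>i\<in>A. f i x) \<in> schwartz"
 by (induction A rule: infinite_finite_induct) (auto intro: schwartz_add schwartz_zero)

lemma schwartz_diff: "f \<in> schwartz ==> g \<in> schwartz ==> (%x. f x - g x) \<in> schwartz"
 using schwartz_add[OF _ schwartz_cmult[of g "-1"], of f] by simp

lemma schwartz_partial_deriv:
 assumes "f \<in> schwartz" shows "partial_deriv i f \<in> schwartz" using assms unfolding schwartz_def by (simp flip: partials_snoc)

lemma schwartz_coord_mult:
 assumes "f \<in> schwartz" shows "(%x. cplx (x $ i) * f x) \<in> schwartz"
proof (rule schwartzI)
 note sm = schwartz_smooth[OF assms]
 show "smooth (%x. cplx (x $ i) * f x)" unfolding smooth_def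
 proof (intro allI)
  fix "is" x
  obtain L where L: "partials is (%x. cplx (x $ i) * f x) =
   (%x. cplx (x $ i) * partials is f x + (\<Sum>k<length L. partials (L ! k) f x))"
   using partials_coord_mult[OF sm] by blast
  show "partials is (%x. cplx (x $ i) * f x) differentiable (at x)"
   unfolding L by (intro differentiable_add differentiable_mult differentiable_coord smooth_partials sm differentiable_sum ballI) auto
 qed
 fix "is" N
 obtain L where L: "!!x. partials is (%x. cplx (x $ i) * f x) x =
   cplx (x $ i) * partials is f x + (\<Sum>k<length L. partials (L ! k) f x)" using partials_coord_mult[OF sm] by blast
 obtain C where C: "!!x. (1 + norm x) ^ Suc N * cmod (partials is f x) <= C" using schwartz_bound[OF assms(1)] by metis
 have "\<exists>D. \<forall>x. (1 + norm x) ^ N * cmod (partials (L ! k) f x) <= D" for k using schwartz_bound[OF assms(1)] by metis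
 then obtain D where D: "!!k x. (1 + norm x) ^ N * cmod (partials (L ! k) f x) <= D k" by metis
 have "(1 + norm x) ^ N * cmod (partials is (%x. cplx (x $ i) * f x) x) <= C + (\<Sum>k<length L. D k)" for x
 proof -
  have "cmod (cplx (x $ i) * partials is f x + (\<Sum>k<length L. partials (L ! k) f x)) \<le>
    (1 + norm x) * cmod (partials is f x) + (\<Sum>k<length L. cmod (partials (L ! k) f x))" using component_le_norm_cart[of x i]
   by (intro norm_triangle_le add_mono norm_sum) (auto simp: norm_mult intro!: mult_right_mono)
  then have "(1 + norm x) ^ N * cmod (partials is (%x. cplx (x $ i) * f x) x) \<le>
    (1 + norm x) ^ N * ((1 + norm x) * cmod (partials is f x) + (\<Sum>k<length L. cmod (partials (L ! k) f x)))"
   unfolding L by (rule mult_left_mono) simp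
  also have "... = (1 + norm x) ^ Suc N * cmod (partials is f x) + (\<Sum>k<length L. (1 + norm x) ^ N * cmod (partials (L ! k) f x))"
   by (simp add: distrib_left sum_distrib_left mult_ac)
  also have "... <= C + (\<Sum>k<length L. D k)" by (intro add_mono C sum_mono D)
  finally show ?thesis .
 qed
 then show "\<exists>C. \<forall>x. (1 + norm x) ^ N * cmod (partials is (%x. cplx (x $ i) * f x) x) <= C" by blast
qed

lemma continuous_schwartz: "f \<in> schwartz ==> continuous_on UNIV f" using smooth_differentiable[OF schwartz_smooth]
 by (auto intro!: continuous_at_imp_continuous_on differentiable_imp_continuous_within)

lemma borel_measurable_schwartz: "f \<in> schwartz ==> f \<in> bmeas"
 by (rule borel_measurable_continuous_onI[OF continuous_schwartz])

lemma integrable_inverse_1_plus_sq: "integrable lborel (%x::real. inverse (1 + x^2))"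
 using integrable_inverse_1_plus_square by (simp add: set_integrable_def)

text \<open>The exponent provides one factor (1 + norm x)^(-2) per coordinate, so that a product of
  one-dimensional functions 1/(1 + x_i^2) dominates and integrability follows from the product
  formula.\<close>

definition weight :: "real^'n::finite => real" where
 "weight x = inverse ((1 + norm x) ^ (2 * CARD('n)))"

lemma weight_pos: "0 < weight x" by (simp add: weight_def add_pos_nonneg)

lemma integrable_weight: "integrable lborel (weight :: real^'n::finite => real)"
proof (rule Bochner_Integration.integrable_bound)
 show "integrable lborel (%x::real^'n. \<Prod>i\<in>UNIV. inverse (1 + (x $ i)^2))"
  by (rule integrable_vec_prod[OF integrable_inverse_1_plus_sq])
 show "(weight :: real^'n => real) \<in> borel_measurable lborel" unfolding weight_def[abs_def] by measurable
 have le: "weight x <= (\<Prod>i\<in>UNIV. inverse (1 + (x $ i)^2))" for x :: "real^'n"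
 proof -
  have "inverse ((1 + norm x)^2) <= inverse (1 + (x $ i)^2)" for i
  proof (rule le_imp_inverse_le)
   have "(x $ i)^2 <= (norm x)^2" using component_le_norm_cart[of x i] by (simp add: abs_le_square_iff[symmetric])
   then have "1 + (x $ i)^2 <= 1 + (norm x)^2 + 2 * norm x" using norm_ge_zero[of x] by linarith
   then show "1 + (x $ i)^2 <= (1 + norm x)^2" by (simp add: power2_sum)
   show "0 < 1 + (x $ i)^2" by (simp add: add_pos_nonneg)
  qed
  then have "(\<Prod>i\<in>(UNIV::'n set). inverse ((1 + norm x)^2)) <= (\<Prod>i\<in>UNIV. inverse (1 + (x $ i)^2))"
   by (intro prod_mono) auto
  then show ?thesis by (simp add: weight_def power_mult power_inverse)
 qed
 show "AE x in (lborel :: (real^'n) measure). norm (weight x) <= norm (\<Prod>i\<in>UNIV. inverse (1 + (x $ i)^2))"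
  unfolding real_norm_def abs_of_pos[OF weight_pos] by (rule AE_I2) (rule order_trans[OF le abs_ge_self])
qed

lemma schwartz_weight_bound:
 fixes f :: "real^'n::finite => complex"
 assumes "f \<in> schwartz"
 obtains C where "C >= 0" "!!x. cmod (partials is f x) <= C * weight x"
proof -
 obtain C where C: "C >= 0" "!!x. (1 + norm x) ^ (2 * CARD('n)) * cmod (partials is f x) <= C" using schwartz_bound[OF assms(1)] by metis
 have "cmod (partials is f x) <= C * weight x" for x
 proof -
  have "(1 + norm x) ^ (2 * CARD('n)) > 0" by (simp add: add_pos_nonneg)
  then show ?thesis using C(2)[of x] by (simp add: weight_def divide_simps mult.commute)
 qed
 with C that show ?thesis by blast
qed

lemma schwartz_bounded:
 assumes "f \<in> schwartz"
 obtains C where "C >= 0" "!!x. cmod (f x) <= C" using schwartz_bound[OF assms, of 0 "[]"] by auto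

lemma integrable_schwartz:
 assumes "f \<in> schwartz" shows "integrable lborel f"
proof -
 obtain C where C: "C >= 0" "!!x. cmod (f x) <= C * weight x" using schwartz_weight_bound[OF assms, of "[]"] by auto
 show ?thesis by (rule Bochner_Integration.integrable_bound[OF integrable_mult_right[OF integrable_weight, of C]])
    (use C borel_measurable_schwartz[OF assms] in \<open>auto intro!: AE_I2 order_trans[OF _ abs_ge_self]\<close>)
qed

lemma schwartz_L2:
 assumes "f \<in> schwartz" shows "f \<in> L2"
proof -
 obtain C where C: "C >= 0" "!!x. cmod (f x) <= C * weight x" using schwartz_weight_bound[OF assms, of "[]"] by auto
 obtain D where D: "D >= 0" "!!x. cmod (f x) <= D" using schwartz_bounded[OF assms] by blast
 show ?thesis
 proof (rule L2I_bound[OF borel_measurable_schwartz[OF assms]])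
  show "integrable lborel (%x::real^'a. D * (C * weight x))" by (intro integrable_mult_right integrable_weight)
  show "(cmod (f x))^2 <= D * (C * weight x)" for x unfolding power2_eq_square by (intro mult_mono C D) (use D in auto)
 qed
qed

lemma integral_partial_deriv_mult:
 fixes u v :: "real^'n::finite => complex"
 assumes u: "u \<in> schwartz" and v: "v \<in> schwartz"
 shows "(LBINT x. partial_deriv i u x * v x) = - (LBINT x. u x * partial_deriv i v x)"
proof -
 have int: "complex_integrable lborel (%x. partial_deriv i u x * v x)" "complex_integrable lborel (%x. u x * partial_deriv i v x)"
  using u v by (auto intro!: integrable_mult_L2 schwartz_L2 schwartz_partial_deriv)
 have [measurable]: "u \<in> bmeas" "v \<in> bmeas"
  "partial_deriv i u \<in> bmeas" "partial_deriv i v \<in> bmeas"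
  using u v by (auto intro!: borel_measurable_schwartz schwartz_partial_deriv)
 obtain U where U: "U >= 0" "!!x. cmod (u x) <= U * weight x" using schwartz_weight_bound[OF u, of "[]"] by auto
 obtain V where V: "V >= 0" "!!x. cmod (v x) <= V" using schwartz_bounded[OF v] by auto
 obtain U' where U': "U' >= 0" "!!x. cmod (partial_deriv i u x) <= U' * weight x"
  using schwartz_weight_bound[OF u, of "[i]"] by (auto simp: partials_Cons)
 obtain V' where V': "V' >= 0" "!!x. cmod (partial_deriv i v x) <= V'" using schwartz_bounded[OF schwartz_partial_deriv[OF v]] by auto
 have "(LBINT x. u x * partial_deriv i v x + partial_deriv i u x * v x) = 0"
 proof (rule integral_directional_derivative_zero[of "%x. u x * v x" "axis i 1"])
  show "((%s. u (x + s *\<^sub>R axis i 1) * v (x + s *\<^sub>R axis i 1)) has_vector_derivative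
    u (x + s *\<^sub>R axis i 1) * partial_deriv i v (x + s *\<^sub>R axis i 1)
    + partial_deriv i u (x + s *\<^sub>R axis i 1) * v (x + s *\<^sub>R axis i 1)) (at s)" for x s
   by (intro has_vector_derivative_mult partial_deriv_line smooth_differentiable schwartz_smooth u v)
  show "complex_integrable lborel (%x. u x * v x)" by (intro integrable_mult_L2 schwartz_L2 u v)
  show "integrable lborel (%x::real^'n. (U * V' + U' * V) * 4 ^ CARD('n) * weight x)" by (intro integrable_mult_right integrable_weight)
  show "cmod (u (x + s *\<^sub>R axis i 1) * partial_deriv i v (x + s *\<^sub>R axis i 1)
    + partial_deriv i u (x + s *\<^sub>R axis i 1) * v (x + s *\<^sub>R axis i 1)) <= (U * V' + U' * V) * 4 ^ CARD('n) * weight x"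
   if s: "\<bar>s\<bar> <= 1" for x s
  proof -
   let ?y = "x + s *\<^sub>R axis i 1"
   \<comment> \<open>A unit shift changes 1 + norm x by a factor of at most 2, hence
     \<open>weight\<close> by at most 4^d.\<close>
   have "norm x <= norm ?y + \<bar>s\<bar>" using norm_triangle_ineq4[of ?y "s *\<^sub>R axis i 1"] by simp
   also have "... <= norm ?y + 1" using s by simp
   finally have "1 + norm x <= 2 * (1 + norm ?y)" using norm_ge_zero[of ?y] by argo
   then have "(1 + norm x) ^ (2 * CARD('n)) <= (2 * (1 + norm ?y)) ^ (2 * CARD('n))" by (rule power_mono) simp
   also have "... = 4 ^ CARD('n) * (1 + norm ?y) ^ (2 * CARD('n))" unfolding power_mult_distrib by (simp add: power_mult)
   finally have w: "weight ?y <= 4 ^ CARD('n) * weight x" unfolding weight_def by (simp add: divide_simps add_pos_nonneg mult.commute)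
   have "cmod (u ?y * partial_deriv i v ?y + partial_deriv i u ?y * v ?y) \<le>
    (U * weight ?y) * V' + (U' * weight ?y) * V" by (intro norm_triangle_le add_mono; unfold norm_mult; intro mult_mono U V U' V')
      (use U U' weight_pos[of ?y] in \<open>auto intro: less_imp_le\<close>)
   also have "... = (U * V' + U' * V) * weight ?y" by (simp add: algebra_simps)
   also have "... <= (U * V' + U' * V) * (4 ^ CARD('n) * weight x)" by (intro mult_left_mono w) (use U V U' V' in auto)
   finally show ?thesis by (simp add: mult.assoc)
  qed
 qed measurable
 then show ?thesis using int by (simp add: add_eq_0_iff)
qed

lemma schwartz_norm_bdd:
 assumes "f \<in> schwartz"
 shows "bdd_above ((%(is, x). (1 + norm x) ^ N * cmod (partials is f x)) ` ({is. length is <= N} \<times> UNIV))"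
proof -
 have fin: "finite {is :: 'a list. length is <= N}" using finite_lists_length_le[of "UNIV :: 'a set" N] by simp
 have "\<exists>C\<ge>0. \<forall>x. (1 + norm x) ^ N * cmod (partials is f x) <= C" for "is" using schwartz_bound[OF assms] by metis
 then obtain C where C: "!!is. C is >= 0" "!!is x. (1 + norm x) ^ N * cmod (partials is f x) <= C is" by metis
 show ?thesis
 proof (rule bdd_aboveI2, clarsimp)
  fix "is" :: "'a list" and x assume "length is <= N"
  then have "C is <= (\<Sum>is | length is <= N. C is)" by (intro member_le_sum) (use fin C in auto)
  with C(2)[of x "is"] show "(1 + norm x) ^ N * cmod (partials is f x) <= (\<Sum>is | length is <= N. C is)" by simp
 qed
qed

lemma schwartz_norm_nonneg:
 assumes "f \<in> schwartz" shows "0 <= schwartz_norm N f"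
proof -
 have "(%(is, x). (1 + norm x) ^ N * cmod (partials is f x)) ([], 0) <= schwartz_norm N f"
  unfolding schwartz_norm_def by (rule cSUP_upper[OF _ schwartz_norm_bdd[OF assms]]) auto
 then show ?thesis by (rule order_trans[rotated]) simp
qed

lemma schwartz_norm_le:
 assumes "!!is x. length is <= N ==> (1 + norm x) ^ N * cmod (partials is f x) <= B" shows "schwartz_norm N f <= B"
 unfolding schwartz_norm_def by (rule cSUP_least) (use assms in \<open>auto intro!: exI[of _ "[]"]\<close>)

subsection \<open>Termwise differentiation\<close>

lemma series_partial_deriv:
 fixes g :: "nat => real^'n::finite => complex"
 assumes diff: "!!n x. g n differentiable (at x)" and s0: "!!x. summable (%n. g n x)"
  and B: "!!i n x. cmod (partial_deriv i (g n) x) <= B i n" "!!i. summable (B i)" shows "(%x. \<Sum>n. g n x) differentiable (at x)"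
  and "partial_deriv i (%x. \<Sum>n. g n x) x = (\<Sum>n. partial_deriv i (g n) x)"
proof -
 define g' where "g' x h = (\<Sum>i\<in>UNIV. h $ i *\<^sub>R (\<Sum>n. partial_deriv i (g n) x))" for x h :: "real^'n"
 have sp: "summable (%n. partial_deriv i (g n) x)" for i x by (rule summable_comparison_test'[OF B(2)[of i]]) (rule B(1))
 define T where "T n = (\<Sum>i\<in>(UNIV::'n set). \<Sum>k. B i (k + n))" for n
 have tail: "cmod ((\<Sum>k<n. partial_deriv i (g k) x) - (\<Sum>k. partial_deriv i (g k) x)) <= (\<Sum>k. B i (k + n))" for i n x
 proof -
  have "(\<Sum>k<n. partial_deriv i (g k) x) - (\<Sum>k. partial_deriv i (g k) x) = - (\<Sum>k. partial_deriv i (g (k + n)) x)"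
   using suminf_split_initial_segment[OF sp[of i x], of n] by simp
  then have "cmod ((\<Sum>k<n. partial_deriv i (g k) x) - (\<Sum>k. partial_deriv i (g k) x)) = cmod (\<Sum>k. partial_deriv i (g (k + n)) x)"
   by (simp only: norm_minus_cancel)
  also have "... <= (\<Sum>k. B i (k + n))"
  proof (rule norm_suminf_le)
   show "cmod (partial_deriv i (g (k + n)) x) <= B i (k + n)" for k by (rule B(1))
   show "summable (%k. B i (k + n))" by (rule summable_ignore_initial_segment[OF B(2)])
  qed
  finally show ?thesis .
 qed
 have "T \<longlonglongrightarrow> (\<Sum>i\<in>(UNIV::'n set). 0)" unfolding T_def by (intro tendsto_sum suminf_exist_split2 B(2))
 then have T0: "T \<longlonglongrightarrow> 0" by simp
 have "\<exists>G. \<forall>x\<in>UNIV. (%n. g n x) sums (G x) & (G has_derivative g' x) (at x within UNIV)"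
 proof (rule has_derivative_series)
  show "(g n has_derivative (%h. \<Sum>i\<in>UNIV. h $ i *\<^sub>R partial_deriv i (g n) x)) (at x within UNIV)" for n x
   by (rule has_derivative_partials[OF diff])
  show "(%n. g n 0) sums (\<Sum>n. g n 0)" by (rule summable_sums[OF s0])
  fix e :: real assume "e > 0"
  then have "eventually (%n. T n < e) sequentially" using order_tendstoD(2)[OF T0] by blast
  then show "\<forall>\<^sub>F n in sequentially. \<forall>x\<in>UNIV. \<forall>h.
    norm ((\<Sum>k<n. \<Sum>i\<in>UNIV. h $ i *\<^sub>R partial_deriv i (g k) x) - g' x h) <= e * norm h"
  proof eventually_elim
   case (elim n)
   have "norm ((\<Sum>k<n. \<Sum>i\<in>UNIV. h $ i *\<^sub>R partial_deriv i (g k) x) - g' x h) <= e * norm h" for x h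
   proof -
   have "(\<Sum>k<n. \<Sum>i\<in>UNIV. h $ i *\<^sub>R partial_deriv i (g k) x) - g' x h =
    (\<Sum>i\<in>UNIV. h $ i *\<^sub>R ((\<Sum>k<n. partial_deriv i (g k) x) - (\<Sum>k. partial_deriv i (g k) x)))"
    unfolding g'_def by (subst sum.swap) (simp add: scaleR_sum_right scaleR_diff_right sum_subtractf)
   also have "norm ... <= (\<Sum>i\<in>UNIV. \<bar>h $ i\<bar> * (\<Sum>k. B i (k + n)))"
    by (rule sum_norm_le) (auto intro!: mult_left_mono tail)
   also have "... <= (\<Sum>i\<in>UNIV. norm h * (\<Sum>k. B i (k + n)))" using order_trans[OF norm_ge_zero tail]
    by (intro sum_mono mult_right_mono component_le_norm_cart)
   also have "... = norm h * T n" by (simp add: T_def sum_distrib_left)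
   also have "... <= e * norm h" using elim by (subst mult.commute) (intro mult_right_mono, auto)
   finally show ?thesis .
   qed
   then show ?case by blast
  qed
 qed auto
 then obtain G where G: "!!x. (%n. g n x) sums (G x)" "!!x. (G has_derivative g' x) (at x)" by auto
 have Ge: "G = (%x. \<Sum>n. g n x)" using G(1) by (auto simp: fun_eq_iff sums_iff)
 show "(%x. \<Sum>n. g n x) differentiable (at x)" using G(2)[of x] unfolding Ge differentiable_def by blast
 show "partial_deriv i (%x. \<Sum>n. g n x) x = (\<Sum>n. partial_deriv i (g n) x)"
  using partial_deriv_eq[OF G(2)[of x, unfolded Ge], of i]
  by (simp add: g'_def axis_def if_distrib[of "%c. c *\<^sub>R _"] cong: if_cong)
qed

lemma smooth_series:
 fixes f :: "nat => real^'n::finite => complex"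
 assumes sm: "!!n. smooth (f n)" and b: "!!is n x. cmod (partials is (f n) x) <= b is n" "!!is. summable (b is)"
 shows "smooth (%x. \<Sum>n. f n x)" and "partials is (%x. \<Sum>n. f n x) x = (\<Sum>n. partials is (f n) x)"
proof -
 have sp: "summable (%n. partials is (f n) x)" for "is" x by (rule summable_comparison_test'[OF b(2)[of "is"]]) (rule b(1))
 note step = series_partial_deriv[of "%n. partials _ (f n)" "%i. b (i # _)"]
 have p: "partials is (%x. \<Sum>n. f n x) = (%x. \<Sum>n. partials is (f n) x)" for "is"
 proof (induction "is")
  case (Cons i "is")
  show ?case unfolding partials_Cons Cons.IH by (rule ext, rule step(2)) (auto intro: smooth_partials sm sp b simp flip: partials_Cons)
 qed simp
 show "partials is (%x. \<Sum>n. f n x) x = (\<Sum>n. partials is (f n) x)" by (simp add: p)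
 show "smooth (%x. \<Sum>n. f n x)" unfolding smooth_def p
  by (intro allI step(1)) (auto intro: smooth_partials sm sp b simp flip: partials_Cons)
qed

subsection \<open>Hermite functions as Schwartz functions\<close>

abbreviation hermc :: "('n::finite => nat) => real^'n => complex" where
 "hermc \<nu> \<equiv> (%x. cplx (hermv \<nu> x))"

text \<open>Stated additively so that no subtraction of naturals occurs; raising and lowering an
  index are both instances.\<close>

lemma mdeg_upd: "mdeg (a(i := n)) + a i = mdeg a + n"
proof -
 have "mdeg (a(i := n)) = n + (\<Sum>j\<in>UNIV - {i}. (a(i := n)) j)" unfolding mdeg_def by (subst sum.remove[of _ i]) auto
 also have "(\<Sum>j\<in>UNIV - {i}. (a(i := n)) j) = (\<Sum>j\<in>UNIV - {i}. a j)" by (rule sum.cong) auto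
 finally have "mdeg (a(i := n)) = n + (\<Sum>j\<in>UNIV - {i}. a j)" .
 moreover have "mdeg a = a i + (\<Sum>j\<in>UNIV - {i}. a j)" unfolding mdeg_def by (subst sum.remove[of _ i]) auto
 ultimately show ?thesis by simp
qed

lemma mdeg_Suc: "mdeg (a(i := Suc (a i))) = Suc (mdeg a)" using mdeg_upd[of a i "Suc (a i)"] by simp

lemma mdeg_pred: "mdeg (a(i := a i - 1)) <= mdeg a" using mdeg_upd[of a i "a i - 1"] by simp

lemma hermv_upd: "hermv (a(i := n)) x = herm n (x $ i) * (\<Prod>j\<in>UNIV - {i}. herm (a j) (x $ j))"
proof -
 have "hermv (a(i := n)) x = herm n (x $ i) * (\<Prod>j\<in>UNIV - {i}. herm ((a(i := n)) j) (x $ j))"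
  unfolding hermv_def by (subst prod.remove[of _ i]) auto
 also have "(\<Prod>j\<in>UNIV - {i}. herm ((a(i := n)) j) (x $ j)) = (\<Prod>j\<in>UNIV - {i}. herm (a j) (x $ j))"
  by (rule prod.cong) auto
 finally show ?thesis .
qed

lemma hermv_remove: "hermv a x = herm (a i) (x $ i) * (\<Prod>j\<in>UNIV - {i}. herm (a j) (x $ j))"
 using hermv_upd[of a i "a i"] by simp

lemma mult_hermv:
 "x $ i * hermv a x = lad (Suc (a i)) * hermv (a(i := Suc (a i))) x + lad (a i) * hermv (a(i := a i - 1)) x"
proof -
 have "x $ i * hermv a x = (x $ i * herm (a i) (x $ i)) * (\<Prod>j\<in>UNIV - {i}. herm (a j) (x $ j))"
  using hermv_remove[of a x i] by simp
 then show ?thesis unfolding mult_herm hermv_upd by (simp add: algebra_simps)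
qed

lemma differentiable_hermc: "hermc a differentiable (at x)"
proof -
 have "((%x. herm (a i) (x $ i)) has_derivative (%h. h $ i * hderiv (a i) (x $ i))) (at x)" for i
 proof -
  have "(herm (a i) has_derivative (%h. h * hderiv (a i) (x $ i))) (at (x $ i))"
   by (rule has_derivative_eq_rhs[OF DERIV_herm[unfolded has_field_derivative_def]]) (rule ext, simp)
  from has_derivative_compose[OF bounded_linear.has_derivative[OF bounded_linear_vec_nth has_derivative_ident] this]
  show ?thesis .
 qed
 then have "((%x. hermv a x) has_derivative
   (%y. \<Sum>i\<in>UNIV. y $ i * hderiv (a i) (x $ i) * (\<Prod>j\<in>UNIV - {i}. herm (a j) (x $ j)))) (at x)"
  unfolding hermv_def by (intro has_derivative_prod)
 from bounded_linear.has_derivative[OF bounded_linear_of_real this]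
 show ?thesis unfolding differentiable_def by blast
qed

lemma line_component: "(x + t *\<^sub>R axis i 1) $ j = (if j = i then x $ i + t else x $ j)" for x :: "real^'n::finite"
 by (simp add: axis_def)

lemma partial_deriv_line_prod:
 fixes u :: "real => real"
 assumes "(u has_real_derivative u') (at (x $ i))"
 shows "partial_deriv i (%y. cplx (u (y $ i) * (\<Prod>j\<in>UNIV - {i}. herm (a j) (y $ j)))) x =
  cplx (u' * (\<Prod>j\<in>UNIV - {i}. herm (a j) (x $ j)))" unfolding partial_deriv_def
proof (rule vector_derivative_at)
 let ?P = "\<Prod>j\<in>UNIV - {i}. herm (a j) (x $ j)"
 have e: "cplx (u ((x + t *\<^sub>R axis i 1) $ i) * (\<Prod>j\<in>UNIV - {i}. herm (a j) ((x + t *\<^sub>R axis i 1) $ j))) =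
   cplx (u (t + x $ i) * ?P)" for t unfolding line_component by (simp add: add.commute)
 have "((%t. u (t + x $ i)) has_real_derivative u') (at 0)" using assms DERIV_shift[of u u' 0 "x $ i"] by simp
 then have "((%t. u (t + x $ i) * ?P) has_real_derivative u' * ?P) (at 0)" by (rule DERIV_cmult_right)
 then have "((%t. cplx (u (t + x $ i) * ?P)) has_vector_derivative cplx (u' * ?P)) (at 0)"
  unfolding has_real_derivative_iff_has_vector_derivative by (rule bounded_linear.has_vector_derivative[OF bounded_linear_of_real])
 then show "((%t. cplx (u ((x + t *\<^sub>R axis i 1) $ i) * (\<Prod>j\<in>UNIV - {i}. herm (a j) ((x + t *\<^sub>R axis i 1) $ j))))
   has_vector_derivative cplx (u' * ?P)) (at 0)" unfolding e .
qed

lemma partial_deriv_hermc: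
 "partial_deriv i (hermc a) = (%x. cplx (hderiv (a i) (x $ i) * (\<Prod>j\<in>UNIV - {i}. herm (a j) (x $ j))))"
 unfolding hermv_remove[of a _ i] by (rule ext, rule partial_deriv_line_prod) (rule DERIV_herm)

lemma partial_deriv_hermc_ladder:
 "partial_deriv i (hermc a) = (%x. cplx (lad (a i)) * hermc (a(i := a i - 1)) x
   + cplx (- lad (Suc (a i))) * hermc (a(i := Suc (a i))) x)"
 unfolding partial_deriv_hermc hermv_upd by (rule ext) (simp add: hderiv_def algebra_simps)

lemma partial_deriv2_hermc:
 "partial_deriv i (partial_deriv i (hermc a)) = (%x. cplx ((x $ i)^2 - (2 * real (a i) + 1)) * hermc a x)"
 unfolding partial_deriv_hermc by (rule ext, subst partial_deriv_line_prod[OF DERIV_hderiv], subst hermv_remove[of a _ i]) simp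

text \<open>The span is closed under partial derivatives by the ladder relations, so smoothness of
  Hermite functions reduces to plain differentiability of elements of the span.\<close>

definition hspan :: "(real^'n::finite => complex) set" where
 "hspan = {f. \<exists>A c. finite A & f = fcomb hermv A c}"

lemma fcomb_in_hspan: "finite A ==> fcomb hermv A c \<in> hspan" by (auto simp: hspan_def)

lemma hermc_in_hspan: "hermc a \<in> hspan"
proof -
 have "fcomb hermv {a} (%_. 1) = hermc a" by (rule ext) (simp add: fcomb_def)
 then show ?thesis using fcomb_in_hspan[of "{a}" "%_. 1"] by simp
qed

lemma hspan_cmult:
 assumes "f \<in> hspan" shows "(%x. c * f x) \<in> hspan"
proof -
 obtain A d where A: "finite A" "f = fcomb hermv A d" using assms by (auto simp: hspan_def)
 then have "(%x. c * f x) = fcomb hermv A (%a. c * d a)" by (simp add: fcomb_def fun_eq_iff sum_distrib_left mult.assoc)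
 with A(1) show ?thesis by (simp add: fcomb_in_hspan)
qed

lemma hspan_add:
 assumes "f \<in> hspan" "g \<in> hspan" shows "(%x. f x + g x) \<in> hspan"
proof -
 obtain A c where A: "finite A" "f = fcomb hermv A c" using assms by (auto simp: hspan_def)
 obtain B d where B: "finite B" "g = fcomb hermv B d" using assms by (auto simp: hspan_def)
 have f: "f = fcomb hermv (A \<union> B) (%e. if e \<in> A then c e else 0)"
  unfolding A(2) fcomb_def by (rule ext, rule sum.mono_neutral_cong_left) (use A(1) B(1) in auto)
 have g: "g = fcomb hermv (A \<union> B) (%e. if e \<in> B then d e else 0)"
  unfolding B(2) fcomb_def by (rule ext, rule sum.mono_neutral_cong_left) (use A(1) B(1) in auto)
 have comb: "(%x. fcomb hermv S a x + fcomb hermv S b x) = fcomb hermv S (%e. a e + b e)"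
  for S :: "('a => nat) set" and a b by (rule ext) (simp add: fcomb_def distrib_right sum.distrib)
 have "(%x. f x + g x) = fcomb hermv (A \<union> B) (%e. (if e \<in> A then c e else 0) + (if e \<in> B then d e else 0))"
  using f g comb by (simp only:)
 with A(1) B(1) show ?thesis by (simp add: fcomb_in_hspan)
qed

lemma hspan_differentiable:
 assumes "f \<in> hspan" shows "f differentiable (at x)"
proof -
 obtain A c where A: "finite A" "f = fcomb hermv A c" using assms by (auto simp: hspan_def)
 show ?thesis unfolding A(2) fcomb_def
  by (intro differentiable_sum ballI differentiable_mult differentiable_const differentiable_hermc A(1))
qed

lemma hspan_partial_deriv:
 assumes "f \<in> hspan" shows "partial_deriv i f \<in> hspan"
proof -
 have "partial_deriv i (fcomb hermv A c) \<in> hspan" if "finite A" for A :: "('a => nat) set" and c using that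
 proof (induction A)
  case empty
  have z: "fcomb hermv {} c = (%_. 0)" by (rule ext) (simp add: fcomb_def)
  have "partial_deriv i (fcomb hermv {} c) = fcomb hermv {} c" unfolding z by (rule ext) (rule partial_deriv_const)
  then show ?case by (simp add: fcomb_in_hspan)
 next
  case (insert a A)
  have e: "fcomb hermv (insert a A) c = (%x. c a * hermc a x + fcomb hermv A c x)"
   using insert by (simp add: fcomb_def fun_eq_iff)
  have "partial_deriv i (fcomb hermv (insert a A) c) =
    (%x. c a * partial_deriv i (hermc a) x + partial_deriv i (fcomb hermv A c) x)" unfolding e
   by (rule ext, subst partial_deriv_add)
     (auto simp: partial_deriv_cmult differentiable_hermc hspan_differentiable fcomb_in_hspan insert.hyps
      intro!: differentiable_mult)
  moreover have "partial_deriv i (hermc a) \<in> hspan"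
   unfolding partial_deriv_hermc_ladder by (intro hspan_add hspan_cmult hermc_in_hspan)
  ultimately show ?case using insert.IH by (simp add: hspan_add hspan_cmult)
 qed
 with assms show ?thesis by (auto simp: hspan_def)
qed

lemma hspan_smooth:
 assumes "f \<in> hspan" shows "smooth f"
proof -
 have "partials is f \<in> hspan" for "is" by (induction "is") (auto simp: partials_Cons assms hspan_partial_deriv)
 then show ?thesis unfolding smooth_def using hspan_differentiable by blast
qed

lemmas smooth_hermc = hspan_smooth[OF hermc_in_hspan]

lemma abs_hermv_le: "\<bar>hermv a x\<bar> <= 2 ^ CARD('n) * (1 + real (mdeg a)) ^ CARD('n)"
 for a :: "'n::finite => nat"
proof -
 have "\<bar>hermv a x\<bar> = (\<Prod>i\<in>UNIV. \<bar>herm (a i) (x $ i)\<bar>)" by (simp add: hermv_def abs_prod)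
 also have "... <= (\<Prod>i\<in>(UNIV::'n set). 2 * (1 + real (mdeg a)))"
 proof (rule prod_mono)
  fix i
  show "0 <= \<bar>herm (a i) (x $ i)\<bar> & \<bar>herm (a i) (x $ i)\<bar> <= 2 * (1 + real (mdeg a))"
   using abs_herm_le[of "a i" "x $ i"] le_mdeg[of a i] by simp
 qed
 finally show ?thesis unfolding prod_constant power_mult_distrib .
qed

lemma lad_le: "lad (Suc n) <= 1 + real n" unfolding lad_def by (rule real_le_lsqrt) (auto simp: power2_eq_square algebra_simps)

text \<open>One ladder step on a polynomial bound. Both neighbours of a multi-index of degree m have
  degree at most m + 1, whence 2 + m in the hypotheses; the ladder coefficients cost one more power
  of 1 + m.\<close>

lemma ladder_bound:
 fixes a b :: "'b::real_normed_vector"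
 assumes a: "norm a <= C * (2 + m) ^ M" and b: "norm b <= C * (2 + m) ^ M"
  and s: "\<bar>s\<bar> <= 1 + m" "\<bar>t\<bar> <= 1 + m" and C: "0 <= C" "0 <= m"
 shows "norm (s *\<^sub>R a + t *\<^sub>R b) <= (2 * C * 2 ^ M) * (1 + m) ^ Suc M"
proof -
 have "norm (s *\<^sub>R a + t *\<^sub>R b) <= \<bar>s\<bar> * norm a + \<bar>t\<bar> * norm b"
  by (rule order_trans[OF norm_triangle_ineq]) simp
 also have "... <= (1 + m) * (C * (2 + m) ^ M) + (1 + m) * (C * (2 + m) ^ M)" by (intro add_mono mult_mono a b s) (use C in auto)
 also have "... = 2 * (1 + m) * C * (2 + m) ^ M" by simp
 also have "... <= 2 * (1 + m) * C * (2 * (1 + m)) ^ M" by (intro mult_left_mono power_mono) (use C in auto)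
 also have "... = (2 * C * 2 ^ M) * (1 + m) ^ Suc M" by (simp only: power_mult_distrib power_Suc mult_ac)
 finally show ?thesis .
qed

lemma poly_bound_shift:
 assumes "0 <= C" "m' <= Suc m" "a <= C * (1 + real m') ^ M" shows "a <= C * (2 + real m) ^ M"
 by (rule order_trans[OF assms(3)]) (intro mult_left_mono power_mono assms, use assms(2) in auto)

lemma power_mult_hermv_bound:
 "\<exists>C M. 0 <= C & (\<forall>a x. \<bar>(x $ j) ^ N * hermv a x\<bar> <= C * (1 + real (mdeg (a::'n::finite => nat))) ^ M)"
proof (induction N)
 case 0
 show ?case by (rule exI[of _ "2 ^ CARD('n)"], rule exI[of _ "CARD('n)"]) (auto intro: abs_hermv_le)
next
 case (Suc N)
 then obtain C M where C: "0 <= C"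
  and CM: "!!a x. \<bar>(x $ j) ^ N * hermv a x\<bar> <= C * (1 + real (mdeg (a::'n => nat))) ^ M" by blast
 have "\<bar>(x $ j) ^ Suc N * hermv a x\<bar> <= (2 * C * 2 ^ M) * (1 + real (mdeg a)) ^ Suc M" for a :: "'n => nat" and x
 proof -
  have "(x $ j) ^ Suc N * hermv a x = (x $ j) ^ N * (x $ j * hermv a x)" by simp
  also have "... = lad (Suc (a j)) *\<^sub>R ((x $ j) ^ N * hermv (a(j := Suc (a j))) x)
    + lad (a j) *\<^sub>R ((x $ j) ^ N * hermv (a(j := a j - 1)) x)" unfolding mult_hermv by (simp add: algebra_simps)
  also have "norm ... <= (2 * C * 2 ^ M) * (1 + real (mdeg a)) ^ Suc M"
  proof (rule ladder_bound)
   show "norm ((x $ j) ^ N * hermv (a(j := Suc (a j))) x) <= C * (2 + real (mdeg a)) ^ M"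
    using poly_bound_shift[OF C _ CM[of x "a(j := Suc (a j))"], of "mdeg a"] by (simp add: mdeg_Suc)
   show "norm ((x $ j) ^ N * hermv (a(j := a j - 1)) x) <= C * (2 + real (mdeg a)) ^ M"
    using poly_bound_shift[OF C _ CM[of x "a(j := a j - 1)"], of "mdeg a"] mdeg_pred[of a j] by simp
   show "\<bar>lad (Suc (a j))\<bar> <= 1 + real (mdeg a)" "\<bar>lad (a j)\<bar> <= 1 + real (mdeg a)"
    using lad_le[of "a j"] le_mdeg[of a j] lad_mono[of "a j" "Suc (a j)"] by auto
  qed (use C in auto)
  finally show ?thesis by simp
 qed
 with C show ?case by (intro exI[of _ "2 * C * 2 ^ M"] exI[of _ "Suc M"]) auto
qed

lemma power_partials_hermc_bound:
 "\<exists>C M. 0 <= C & (\<forall>is e x. length is = k -->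
   \<bar>x $ j\<bar> ^ N * cmod (partials is (hermc e) x) <= C * (1 + real (mdeg (e::'n::finite => nat))) ^ M)"
proof (induction k)
 case 0
 obtain C M where "0 <= C" "!!e x. \<bar>(x $ j) ^ N * hermv e x\<bar> <= C * (1 + real (mdeg (e::'n => nat))) ^ M"
  using power_mult_hermv_bound by blast
 then show ?case by (intro exI[of _ C] exI[of _ M]) (auto simp: abs_mult power_abs)
next
 case (Suc k)
 then obtain C M where C: "0 <= C" and CM: "!!is e x. length is = k ==>
   \<bar>x $ j\<bar> ^ N * cmod (partials is (hermc e) x) <= C * (1 + real (mdeg (e::'n => nat))) ^ M" by blast
 have "\<bar>x $ j\<bar> ^ N * cmod (partials is (hermc e) x) <= (2 * C * 2 ^ M) * (1 + real (mdeg e)) ^ Suc M"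
  if len: "length is = Suc k" for "is" and e :: "'n => nat" and x
 proof -
  \<comment> \<open>The innermost derivative is the one that meets a Hermite function, and it
    becomes two neighbours; therefore the list is split at its end.\<close>
  obtain js i where js: "is = js @ [i]" "length js = k" using len by (metis length_Suc_conv_rev)
  let ?c = "\<bar>x $ j\<bar> ^ N"
  let ?a = "e(i := e i - 1)" and ?b = "e(i := Suc (e i))"
  have E: "partials is (hermc e) x = cplx (lad (e i)) * partials js (hermc ?a) x
    + cplx (- lad (Suc (e i))) * partials js (hermc ?b) x" unfolding js(1) partials_snoc partial_deriv_hermc_ladder
   by (simp add: partials_add partials_cmult smooth_cmult smooth_hermc del: of_real_minus)
  have "?c *\<^sub>R partials is (hermc e) x = lad (e i) *\<^sub>R (?c *\<^sub>R partials js (hermc ?a) x)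
    + (- lad (Suc (e i))) *\<^sub>R (?c *\<^sub>R partials js (hermc ?b) x)"
   unfolding E by (simp add: scaleR_conv_of_real algebra_simps)
  also have "norm ... <= (2 * C * 2 ^ M) * (1 + real (mdeg e)) ^ Suc M"
  proof (rule ladder_bound)
   show "norm (?c *\<^sub>R partials js (hermc ?a) x) <= C * (2 + real (mdeg e)) ^ M"
    using poly_bound_shift[OF C _ CM[OF js(2), of x ?a], of "mdeg e"] mdeg_pred[of e i] by simp
   show "norm (?c *\<^sub>R partials js (hermc ?b) x) <= C * (2 + real (mdeg e)) ^ M"
    using poly_bound_shift[OF C _ CM[OF js(2), of x ?b], of "mdeg e"] by (simp add: mdeg_Suc)
   show "\<bar>lad (e i)\<bar> <= 1 + real (mdeg e)" "\<bar>- lad (Suc (e i))\<bar> <= 1 + real (mdeg e)"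
    using lad_le[of "e i"] le_mdeg[of e i] lad_mono[of "e i" "Suc (e i)"] by auto
  qed (use C in auto)
  finally show ?thesis by simp
 qed
 with C show ?case by (intro exI[of _ "2 * C * 2 ^ M"] exI[of _ "Suc M"]) auto
qed

lemma power_1_plus_norm_le:
 fixes x :: "real^'n::finite" shows "(1 + norm x) ^ N <= (1 + real CARD('n)) ^ N * (1 + (\<Sum>j\<in>UNIV. \<bar>x $ j\<bar> ^ N))"
proof -
 have "Max (range (%i. \<bar>x $ i\<bar>)) \<in> range (%i. \<bar>x $ i\<bar>)" by (rule Max_in) auto
 then obtain j where j: "Max (range (%i. \<bar>x $ i\<bar>)) = \<bar>x $ j\<bar>" by (rule rangeE)
 have le: "\<bar>x $ i\<bar> <= \<bar>x $ j\<bar>" for i unfolding j[symmetric] by (rule Max_ge) auto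
 define m where "m = max 1 \<bar>x $ j\<bar>"
 have "norm x <= (\<Sum>i\<in>UNIV. \<bar>x $ i\<bar>)" by (rule norm_le_l1_cart)
 also have "... <= (\<Sum>i\<in>(UNIV::'n set). m)" by (rule sum_mono) (use le in \<open>auto simp: m_def intro: le_max_iff_disj[THEN iffD2]\<close>)
 finally have "1 + norm x <= m + real CARD('n) * m" by (simp add: m_def)
 then have "(1 + norm x) ^ N <= ((1 + real CARD('n)) * m) ^ N" by (intro power_mono) (auto simp: algebra_simps)
 also have "... = (1 + real CARD('n)) ^ N * m ^ N" by (rule power_mult_distrib)
 also have "m ^ N <= 1 + (\<Sum>j\<in>UNIV. \<bar>x $ j\<bar> ^ N)"
 proof -
  have "\<bar>x $ j\<bar> ^ N <= (\<Sum>j\<in>UNIV. \<bar>x $ j\<bar> ^ N)" by (rule member_le_sum) auto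
  then show ?thesis
  proof (cases "\<bar>x $ j\<bar> <= 1")
   case True
   then have "m = 1" by (simp add: m_def)
   then show ?thesis by (simp add: sum_nonneg)
  next
   case False
   then have "m = \<bar>x $ j\<bar>" by (simp add: m_def)
   with \<open>\<bar>x $ j\<bar> ^ N <= _\<close> show ?thesis by simp
  qed
 qed
 finally show ?thesis by (simp add: mult_left_mono)
qed

lemma hermc_schwartz_bound:
 "\<exists>C M. 0 <= C & (\<forall>is a x. length is <= k -->
   (1 + norm x) ^ N * cmod (partials is (hermc a) x) <= C * (1 + real (mdeg (a::'n::finite => nat))) ^ M)"
proof -
 define P where "P j n l C M \<longleftrightarrow> 0 <= C & (\<forall>is a x. length is = l -->
   \<bar>x $ j\<bar> ^ n * cmod (partials is (hermc a) x) <= C * (1 + real (mdeg (a::'n::finite => nat))) ^ M)" for j n l C M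
 have "\<exists>C M. P j n l C M" for j n l unfolding P_def by (rule power_partials_hermc_bound)
 then obtain C M where "!!j n l. P j n l (C j n l) (M j n l)" by metis
 then have C: "!!j n l. 0 <= C j n l" and CM: "!!j n l is a x. length is = l ==>
   \<bar>x $ j\<bar> ^ n * cmod (partials is (hermc a) x) <= C j n l * (1 + real (mdeg (a::'n::finite => nat))) ^ M j n l"
  unfolding P_def by blast+
 \<comment> \<open>The summand with \<open>undefined\<close> takes power 0 in an arbitrary
   coordinate: it bounds the derivative without any weight, for the 1 in
   \<open>power_1_plus_norm_le\<close>.\<close>
 define D where "D = (\<Sum>l\<le>k. C undefined 0 l + (\<Sum>j\<in>UNIV. C j N l))"
 define L where "L = (\<Sum>l\<le>k. M undefined 0 l + (\<Sum>j\<in>UNIV. M j N l))"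
 have D0: "0 <= D" unfolding D_def by (intro sum_nonneg add_nonneg_nonneg C)
 have "(1 + norm x) ^ N * cmod (partials is (hermc a) x) <= ((1 + real CARD('n)) ^ N * D) * (1 + real (mdeg a)) ^ L"
  if len: "length is <= k" for "is" and a :: "'n => nat" and x
 proof -
  let ?l = "length is" and ?p = "cmod (partials is (hermc a) x)" and ?m = "1 + real (mdeg a)"
  have Ml: "M undefined 0 ?l + (\<Sum>j\<in>UNIV. M j N ?l) <= L" unfolding L_def using len
   by (intro member_le_sum[of ?l "{..k}" "%l. M undefined 0 l + (\<Sum>j\<in>UNIV. M j N l)"]) auto
  have Mj: "M j N ?l <= L" for j using Ml member_le_sum[of j UNIV "%j. M j N ?l"] by simp
  have Dl: "C undefined 0 ?l + (\<Sum>j\<in>UNIV. C j N ?l) <= D" unfolding D_def using len C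
   by (intro member_le_sum[of ?l "{..k}" "%l. C undefined 0 l + (\<Sum>j\<in>UNIV. C j N l)"]) (auto intro!: add_nonneg_nonneg sum_nonneg)
  have "(1 + norm x) ^ N * ?p <= (1 + real CARD('n)) ^ N * (1 + (\<Sum>j\<in>UNIV. \<bar>x $ j\<bar> ^ N)) * ?p"
   by (intro mult_right_mono power_1_plus_norm_le) simp
  also have "... = (1 + real CARD('n)) ^ N * (?p + (\<Sum>j\<in>UNIV. \<bar>x $ j\<bar> ^ N * ?p))"
   by (simp add: distrib_left distrib_right sum_distrib_right mult.assoc)
  also have "... <= (1 + real CARD('n)) ^ N * (C undefined 0 ?l * ?m ^ L + (\<Sum>j\<in>UNIV. C j N ?l * ?m ^ L))"
  proof (intro mult_left_mono add_mono sum_mono)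
   have "?p <= C undefined 0 ?l * ?m ^ M undefined 0 ?l" using CM[of "is" ?l x undefined 0 a] by simp
   also have "... <= C undefined 0 ?l * ?m ^ L" using Ml by (intro mult_left_mono power_increasing C) auto
   finally show "?p <= C undefined 0 ?l * ?m ^ L" .
   fix j
   have "\<bar>x $ j\<bar> ^ N * ?p <= C j N ?l * ?m ^ M j N ?l" using CM[of "is" ?l x j N a] by simp
   also have "... <= C j N ?l * ?m ^ L" using Mj by (intro mult_left_mono power_increasing C) auto
   finally show "\<bar>x $ j\<bar> ^ N * ?p <= C j N ?l * ?m ^ L" .
  qed simp
  also have "... = (1 + real CARD('n)) ^ N * ((C undefined 0 ?l + (\<Sum>j\<in>UNIV. C j N ?l)) * ?m ^ L)"
   by (simp add: distrib_right sum_distrib_right)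
  also have "... <= (1 + real CARD('n)) ^ N * (D * ?m ^ L)" by (intro mult_left_mono mult_right_mono Dl) auto
  finally show ?thesis by (simp add: mult.assoc)
 qed
 then show ?thesis by (intro exI[of _ "(1 + real CARD('n)) ^ N * D"] exI[of _ L]) (use D0 in auto)
qed

lemma hermc_schwartz: "hermc a \<in> schwartz"
proof (rule schwartzI[OF smooth_hermc])
 fix "is" :: "'a list" and N
 show "\<exists>C. \<forall>x. (1 + norm x) ^ N * cmod (partials is (hermc a) x) <= C"
  using hermc_schwartz_bound[of "length is" N] by blast
qed

lemma fcomb_schwartz: "fcomb hermv A c \<in> schwartz" unfolding fcomb_def by (intro schwartz_sum schwartz_cmult hermc_schwartz)

subsection \<open>Rapidly decreasing Hermite series\<close>

text \<open>These are the coefficient families of Schwartz functions: \<open>rapid_fcoef\<close>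
  gives one direction and \<open>hser_schwartz\<close> the other.\<close>

definition rapid :: "(('n::finite => nat) => complex) => bool" where
 "rapid c \<longleftrightarrow> (\<forall>M. \<exists>K. \<forall>\<nu>. cmod (c \<nu>) * (1 + real (mdeg \<nu>)) ^ M <= K)"

definition hser :: "(('n::finite => nat) => complex) => real^'n => complex" where
 "hser c x = (\<Sum>n. fcomb hermv {\<nu>. mdeg \<nu> = n} c x)"

lemma card_level_le: "card {a::'n::finite => nat. mdeg a = n} <= (n + 1) ^ CARD('n)"
proof -
 have "{a::'n => nat. mdeg a = n} \<subseteq> UNIV \<rightarrow>\<^sub>E {..n}" using le_mdeg by (fastforce simp: PiE_def)
 then have "card {a::'n => nat. mdeg a = n} <= card ((UNIV::'n set) \<rightarrow>\<^sub>E {..n})"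
  by (intro card_mono finite_PiE) auto
 then show ?thesis by (simp add: card_PiE)
qed

text \<open>Passing from single coefficients to whole levels costs the number of multi-indices of
  degree n, at most (n + 1)^d; rapid decay is called with d further powers to pay for it.\<close>

lemma rapid_level_bound:
 fixes c :: "('n::finite => nat) => complex"
 assumes "rapid c" shows "\<exists>K\<ge>0. \<forall>n. (\<Sum>a | mdeg a = n. cmod (c a)) * (1 + real n) ^ M <= K"
proof -
 obtain K where K: "!!a. cmod (c a) * (1 + real (mdeg a)) ^ (M + CARD('n)) <= K" using assms unfolding rapid_def by blast
 have K0: "0 <= K" using order_trans[OF _ K[of undefined]] by simp
 have "(\<Sum>a | mdeg a = n. cmod (c a)) * (1 + real n) ^ M <= K" for n
 proof -
  have "(\<Sum>a::'n => nat | mdeg a = n. cmod (c a)) * (1 + real n) ^ M * (1 + real n) ^ CARD('n)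
    = (\<Sum>a::'n => nat | mdeg a = n. cmod (c a) * (1 + real (mdeg a)) ^ (M + CARD('n)))"
   unfolding sum_distrib_right by (intro sum.cong) (auto simp: power_add mult_ac)
  also have "... <= (\<Sum>a::'n => nat | mdeg a = n. K)" by (rule sum_mono) (rule K)
  also have "... <= real ((n + 1) ^ CARD('n)) * K"
   using card_level_le[where 'n='n, of n] K0 by (simp only: sum_constant of_nat_le_iff mult_right_mono)
  also have "... = K * (1 + real n) ^ CARD('n)" by (simp add: add.commute)
  finally show ?thesis by (rule mult_right_le_imp_le) (simp add: add_pos_nonneg)
 qed
 with K0 show ?thesis by blast
qed

lemma summable_inverse_sq: "summable (%n. K / (1 + real n)^2)"
proof -
 have "summable (%n. inverse (real (Suc n) ^ 2))" using inverse_power_summable[of 2, where 'a=real] by (subst summable_Suc_iff) simp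
 from summable_mult[OF this, of K] show ?thesis by (simp add: divide_inverse add.commute)
qed

lemma rapid_series_bound:
 fixes c :: "('n::finite => nat) => complex"
 assumes "rapid c" shows "\<exists>K\<ge>0. \<forall>is n x. length is <= k -->
  (1 + norm x) ^ N * cmod (partials is (fcomb hermv {a. mdeg a = n} c) x) <= K / (1 + real n)^2"
proof -
 obtain C M where C: "0 <= C" and CM: "!!is a x. length is <= k ==>
   (1 + norm x) ^ N * cmod (partials is (hermc a) x) <= C * (1 + real (mdeg (a::'n => nat))) ^ M"
  using hermc_schwartz_bound[of k N] by blast
 \<comment> \<open>The two powers beyond M leave the summable factor 1/(1 + n)^2.\<close>
 obtain K where K: "K >= 0" "!!n. (\<Sum>a | mdeg a = n. cmod (c a)) * (1 + real n) ^ (M + 2) <= K"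
  using rapid_level_bound[OF assms] by blast
 have "(1 + norm x) ^ N * cmod (partials is (fcomb hermv {a. mdeg a = n} c) x) <= (C * K) / (1 + real n)^2"
  if len: "length is <= k" for "is" n x
 proof -
  have "partials is (fcomb hermv {a. mdeg a = n} c) x = (\<Sum>a | mdeg a = n. c a * partials is (hermc a) x)"
   unfolding fcomb_def by (simp add: partials_sum smooth_cmult smooth_hermc partials_cmult)
  then have "(1 + norm x) ^ N * cmod (partials is (fcomb hermv {a. mdeg a = n} c) x) \<le>
    (1 + norm x) ^ N * (\<Sum>a | mdeg a = n. cmod (c a) * cmod (partials is (hermc a) x))"
   by (simp add: mult_left_mono sum_norm_le norm_mult)
  also have "... = (\<Sum>a | mdeg a = n. cmod (c a) * ((1 + norm x) ^ N * cmod (partials is (hermc a) x)))"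
   by (simp add: sum_distrib_left mult_ac)
  also have "... <= (\<Sum>a::'n => nat | mdeg a = n. cmod (c a) * (C * (1 + real n) ^ M))"
   using CM[OF len] by (intro sum_mono mult_left_mono) auto
  also have "... = C * ((\<Sum>a | mdeg a = n. cmod (c a)) * (1 + real n) ^ (M + 2)) / (1 + real n)^2"
  proof -
   have "(1 + real n)^2 ~= 0" by (simp add: add_eq_0_iff)
   then show ?thesis unfolding sum_distrib_right[symmetric] power_add by simp
  qed
  also have "... <= (C * K) / (1 + real n)^2" by (intro divide_right_mono mult_left_mono K C) simp
  finally show ?thesis .
 qed
 with C K show ?thesis by (intro exI[of _ "C * K"]) auto
qed

lemma smooth_fcomb: "smooth (fcomb hermv A c)" unfolding fcomb_def by (intro smooth_sum smooth_cmult smooth_hermc)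

lemma smooth_hser:
 fixes c :: "('n::finite => nat) => complex"
 assumes c: "rapid c" shows "smooth (hser c)"
  and partials_hser: "partials is (hser c) x = (\<Sum>n. partials is (fcomb hermv {a. mdeg a = n} c) x)"
proof -
 have "\<exists>K. \<forall>n x. cmod (partials is (fcomb hermv {a. mdeg a = n} c) x) <= K / (1 + real n)^2" for "is"
  using rapid_series_bound[OF c, of "length is" 0] by auto
 then obtain K where K: "!!is n x. cmod (partials is (fcomb hermv {a. mdeg a = n} c) x) <= K is / (1 + real n)^2" by metis
 have e: "hser c = (%x. \<Sum>n. fcomb hermv {a. mdeg a = n} c x)" by (simp add: hser_def fun_eq_iff)
 show "smooth (hser c)" "partials is (hser c) x = (\<Sum>n. partials is (fcomb hermv {a. mdeg a = n} c) x)" unfolding e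
  using smooth_series[OF smooth_fcomb K summable_inverse_sq] by auto
qed

lemma fcomb_levels: "fcomb hermv {a. mdeg a < L} c = (%x. \<Sum>n<L. fcomb hermv {a. mdeg a = n} c x)"
 by (simp add: fcomb_def fun_eq_iff hermv.sum_levels)

text \<open>The partial sums converge in every Schwartz seminorm, which is the form in which
  continuity of a tempered distribution can be used.\<close>

lemma hser_tail_bound:
 fixes c :: "('n::finite => nat) => complex"
 assumes c: "rapid c" shows "\<exists>t. t \<longlonglongrightarrow> 0 & (\<forall>L is x. length is <= N -->
  (1 + norm x) ^ N * cmod (partials is (%x. hser c x - fcomb hermv {a. mdeg a < L} c x) x) <= t L)"
proof -
 obtain K where K: "K >= 0" "!!is n x. length is <= N ==>
  (1 + norm x) ^ N * cmod (partials is (fcomb hermv {a. mdeg a = n} c) x) <= K / (1 + real n)^2"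
  using rapid_series_bound[OF c] by blast
 define t where "t L = (\<Sum>n. K / (1 + real (n + L))^2)" for L
 have t0: "t \<longlonglongrightarrow> 0" unfolding t_def by (rule suminf_exist_split2[OF summable_inverse_sq])
 have "(1 + norm x) ^ N * cmod (partials is (%x. hser c x - fcomb hermv {a. mdeg a < L} c x) x) <= t L"
  if len: "length is <= N" for L "is" x
 proof -
  let ?p = "%n. partials is (fcomb hermv {a. mdeg a = n} c) x"
  have pn: "cmod (?p n) <= K / (1 + real n)^2" for n
  proof -
   have "1 * cmod (?p n) <= (1 + norm x) ^ N * cmod (?p n)" by (intro mult_right_mono one_le_power) auto
   with K(2)[OF len, of x n] show ?thesis by simp
  qed
  have sp: "summable ?p" by (rule summable_comparison_test'[OF summable_inverse_sq]) (rule pn)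
  have "partials is (%x. hser c x + - 1 * fcomb hermv {a. mdeg a < L} c x) x =
    partials is (hser c) x + - 1 * partials is (fcomb hermv {a. mdeg a < L} c) x"
   by (subst partials_add) (simp_all only: smooth_hser(1)[OF c] smooth_cmult smooth_fcomb partials_cmult)
  also have "partials is (fcomb hermv {a. mdeg a < L} c) x = (\<Sum>n<L. ?p n)"
   unfolding fcomb_levels by (simp add: partials_sum smooth_fcomb)
  also have "partials is (hser c) x = (\<Sum>n. ?p n)" by (rule partials_hser[OF c])
  also have "(\<Sum>n. ?p n) + - 1 * (\<Sum>n<L. ?p n) = (\<Sum>n. ?p (n + L))" using suminf_split_initial_segment[OF sp, of L] by simp
  finally have e: "partials is (%x. hser c x - fcomb hermv {a. mdeg a < L} c x) x = (\<Sum>n. ?p (n + L))" by simp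
  have "(1 + norm x) ^ N * cmod (\<Sum>n. ?p (n + L)) = cmod (\<Sum>n. ((1 + norm x) ^ N) *\<^sub>R ?p (n + L))"
   using summable_ignore_initial_segment[OF sp, of L] by (subst suminf_scaleR_right[symmetric]) auto
  also have "... <= t L" unfolding t_def
  proof (rule norm_suminf_le)
   show "cmod ((1 + norm x) ^ N *\<^sub>R ?p (n + L)) <= K / (1 + real (n + L))^2" for n using K(2)[OF len, of x "n + L"] by simp
   show "summable (%n. K / (1 + real (n + L))^2)" by (rule summable_ignore_initial_segment[OF summable_inverse_sq])
  qed
  finally show ?thesis unfolding e .
 qed
 with t0 show ?thesis by blast
qed

lemma hser_schwartz:
 fixes c :: "('n::finite => nat) => complex"
 assumes c: "rapid c" shows "hser c \<in> schwartz"
proof (rule schwartzI[OF smooth_hser(1)[OF c]])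
 fix "is" :: "'n list" and N
 define N' where "N' = max N (length is)"
 obtain t where t: "!!L is x. length is <= N' ==>
  (1 + norm x) ^ N' * cmod (partials is (%x. hser c x - fcomb hermv {a. mdeg a < L} c x) x) <= t L"
  using hser_tail_bound[OF c] by blast
 have "(1 + norm x) ^ N * cmod (partials is (hser c) x) <= t 0" for x
 proof -
  have "(1 + norm x) ^ N * cmod (partials is (hser c) x) <= (1 + norm x) ^ N' * cmod (partials is (hser c) x)"
   by (intro mult_right_mono power_increasing) (auto simp: N'_def)
  also have "... <= t 0" using t[of "is" x 0] by (simp add: N'_def fcomb_def)
  finally show ?thesis .
 qed
 then show "\<exists>C. \<forall>x. (1 + norm x) ^ N * cmod (partials is (hser c) x) <= C" by blast
qed

text \<open>The seminorm with d powers of 1 + norm x is taken because the square of that factor is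
  exactly the reciprocal of \<open>weight\<close>.\<close>

lemma hser_nrm2_tendsto:
 fixes c :: "('n::finite => nat) => complex"
 assumes c: "rapid c" shows "(%L. nrm2 (%x. hser c x - fcomb hermv {a. mdeg a < L} c x)) \<longlonglongrightarrow> 0"
proof -
 obtain t where t: "t \<longlonglongrightarrow> 0" "!!L is x. length is <= CARD('n) ==>
  (1 + norm x) ^ CARD('n) * cmod (partials is (%x. hser c x - fcomb hermv {a. mdeg a < L} c x) x) <= t L"
  using hser_tail_bound[OF c] by blast
 let ?W = "\<integral>x. weight (x :: real^'n) \<partial>lborel"
 have "nrm2 (%x. hser c x - fcomb hermv {a. mdeg a < L} c x) <= (t L)^2 * ?W" for L
 proof -
  have le: "(cmod (hser c x - fcomb hermv {a. mdeg a < L} c x))^2 <= (t L)^2 * weight x" for x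
  proof -
   have "((1 + norm x) ^ CARD('n) * cmod (hser c x - fcomb hermv {a. mdeg a < L} c x))^2 <= (t L)^2"
    using t(2)[of "[]" x L] by (intro power_mono) auto
   then show ?thesis by (simp add: weight_def divide_simps add_pos_nonneg power_mult_distrib mult.commute flip: power_mult)
  qed
  have "nrm2 (%x. hser c x - fcomb hermv {a. mdeg a < L} c x) <= (LBINT x. (t L)^2 * weight (x :: real^'n))"
   unfolding nrm2_def by (intro integral_mono le L2_integrable L2_diff schwartz_L2 hser_schwartz fcomb_schwartz c
    integrable_mult_right integrable_weight)
  then show ?thesis by simp
 qed
 then have "\<forall>L. norm (nrm2 (%x. hser c x - fcomb hermv {a. mdeg a < L} c x)) <= (t L)^2 * ?W" by simp
 moreover have "(%L. (t L)^2 * ?W) \<longlonglongrightarrow> 0^2 * ?W" by (intro tendsto_intros t)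
 then have "(%L. (t L)^2 * ?W) \<longlonglongrightarrow> 0" by simp
 ultimately show ?thesis by (rule Lim_null_comparison[OF always_eventually])
qed

lemma fcoef_hser:
 fixes c :: "('n::finite => nat) => complex"
 assumes c: "rapid c" shows "fcoef hermv (hser c) a = c a"
proof (rule LIMSEQ_unique)
 show "(%L. fcoef hermv (fcomb hermv {a. mdeg a < L} c) a) \<longlonglongrightarrow> fcoef hermv (hser c) a"
  unfolding fcoef_def
  by (rule integral_mult_tendsto[OF hermv.fcomb_L2 schwartz_L2[OF hser_schwartz[OF c]] hermv.basis_L2 hser_nrm2_tendsto[OF c]])
 show "(%L. fcoef hermv (fcomb hermv {a. mdeg a < L} c) a) \<longlonglongrightarrow> c a"
  by (rule tendsto_eventually, rule eventually_mono[OF eventually_gt_at_top[of "mdeg a"]])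
    (simp add: hermv.fcoef_fcomb[OF hermv.fin_less])
qed

subsection \<open>Hermite coefficients of Schwartz functions\<close>

definition lam :: "('n::finite => nat) => real" where
 "lam \<nu> = real (2 * mdeg \<nu> + CARD('n))"

definition hosc :: "(real^'n::finite => complex) => real^'n => complex" where
 "hosc g x = - laplacian g x + cplx ((norm x)^2) * g x"

lemma norm_sq_sum: "(norm x)^2 = (\<Sum>i\<in>UNIV. (x $ i)^2)" for x :: "real^'n::finite"
 by (simp add: power2_norm_eq_inner inner_vec_def power2_eq_square[symmetric])

lemma laplacian_hermc: "laplacian (hermc a) x = cplx ((norm x)^2 - lam a) * hermc a x"
 unfolding laplacian_def partial_deriv2_hermc
 by (simp add: norm_sq_sum lam_def mdeg_def algebra_simps sum.distrib sum_subtractf sum_distrib_left sum_distrib_right)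

lemma laplacian_schwartz:
 assumes "g \<in> schwartz" shows "laplacian g \<in> schwartz"
proof -
 have "laplacian g = (%x. \<Sum>i\<in>UNIV. partial_deriv i (partial_deriv i g) x)" by (simp add: laplacian_def fun_eq_iff)
 then show ?thesis using assms by (auto intro!: schwartz_sum schwartz_partial_deriv)
qed

lemma norm_sq_mult_schwartz:
 assumes "g \<in> schwartz" shows "(%x. cplx ((norm x)^2) * g x) \<in> schwartz"
proof -
 have "(%x. cplx ((norm x)^2) * g x) = (%x. \<Sum>i\<in>UNIV. cplx (x $ i) * (cplx (x $ i) * g x))"
  by (rule ext, subst norm_sq_sum) (simp only: of_real_sum sum_distrib_right power2_eq_square of_real_mult mult.assoc)
 then show ?thesis using assms by (auto intro!: schwartz_sum schwartz_coord_mult)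
qed

lemma hosc_schwartz:
 assumes "g \<in> schwartz" shows "hosc g \<in> schwartz"
proof -
 have "hosc g = (%x. cplx ((norm x)^2) * g x - laplacian g x)" by (simp add: hosc_def fun_eq_iff)
 then show ?thesis by (simp only:) (intro schwartz_diff norm_sq_mult_schwartz laplacian_schwartz assms)
qed

lemma integral_laplacian_mult:
 assumes u: "u \<in> schwartz" and v: "v \<in> schwartz"
 shows "(LBINT x. laplacian u x * v x) = (LBINT x. u x * laplacian v x)"
proof -
 have "(LBINT x. laplacian u x * v x) = (\<Sum>i\<in>UNIV. \<integral>x. partial_deriv i (partial_deriv i u) x * v x \<partial>lborel)"
  unfolding laplacian_def sum_distrib_right
  by (rule Bochner_Integration.integral_sum) (intro integrable_mult_L2 schwartz_L2 schwartz_partial_deriv u v)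
 also have "... = (\<Sum>i\<in>UNIV. \<integral>x. u x * partial_deriv i (partial_deriv i v) x \<partial>lborel)"
  by (intro sum.cong refl) (simp add: integral_partial_deriv_mult schwartz_partial_deriv u v)
 also have "... = (LBINT x. u x * laplacian v x)" unfolding laplacian_def sum_distrib_left
  by (rule Bochner_Integration.integral_sum[symmetric]) (intro integrable_mult_L2 schwartz_L2 schwartz_partial_deriv u v)
 finally show ?thesis .
qed

lemma fcoef_hosc:
 assumes g: "g \<in> schwartz" shows "fcoef hermv (hosc g) a = cplx (lam a) * fcoef hermv g a"
proof -
 have i: "complex_integrable lborel (%x. laplacian g x * hermc a x)"
   "complex_integrable lborel (%x. cplx ((norm x)^2) * g x * hermc a x)"
   "complex_integrable lborel (%x. g x * laplacian (hermc a) x)"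
  by (intro integrable_mult_L2 schwartz_L2 laplacian_schwartz norm_sq_mult_schwartz g hermc_schwartz)+
 have "fcoef hermv (hosc g) a = (LBINT x. cplx ((norm x)^2) * g x * hermc a x) - (LBINT x. laplacian g x * hermc a x)"
  unfolding fcoef_def hosc_def using i by (simp add: algebra_simps del: of_real_power)
 also have "(LBINT x. laplacian g x * hermc a x) = (LBINT x. g x * laplacian (hermc a) x)"
  by (rule integral_laplacian_mult[OF g hermc_schwartz])
 also have "(LBINT x. cplx ((norm x)^2) * g x * hermc a x) - ... =
  (LBINT x. cplx ((norm x)^2) * g x * hermc a x - g x * laplacian (hermc a) x)" using i by simp
 also have "... = (LBINT x. cplx (lam a) * (g x * hermc a x))"
  unfolding laplacian_hermc by (simp add: algebra_simps)
 finally show ?thesis by (simp add: fcoef_def)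
qed

lemma lam_pos: "0 < lam a" and lam_ge_1: "1 <= lam a" and lam_ge: "1 + real (mdeg a) <= lam a"
proof -
 have "1 <= CARD('a)" using zero_less_card_finite[where 'a='a] by linarith
 then show "0 < lam a" "1 <= lam a" "1 + real (mdeg a) <= lam a" unfolding lam_def by linarith+
qed

text \<open>Applying H to g multiplies coefficients by \<open>lam\<close>. The coefficients of H^M g
  are bounded by its L^2 norm, and \<open>lam a\<close> is at least 1 +
  \<open>mdeg a\<close>.\<close>

lemma rapid_fcoef:
 assumes g: "g \<in> schwartz" shows "rapid (fcoef hermv g)" unfolding rapid_def
proof
 fix M
 define G where "G = (hosc ^^ M) g"
 have Gs: "(hosc ^^ k) g \<in> schwartz" for k by (induction k) (auto simp: g hosc_schwartz)
 have "fcoef hermv ((hosc ^^ k) g) a = cplx (lam a ^ k) * fcoef hermv g a" for a k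
  by (induction k) (auto simp: fcoef_hosc[OF Gs])
 then have e: "fcoef hermv G a = cplx (lam a ^ M) * fcoef hermv g a" for a by (simp add: G_def)
 have "cmod (fcoef hermv g a) * (1 + real (mdeg a)) ^ M <= sqrt (nrm2 G)" for a
 proof -
  have "cmod (fcoef hermv g a) * (1 + real (mdeg a)) ^ M <= cmod (fcoef hermv g a) * lam a ^ M"
   by (intro mult_left_mono power_mono lam_ge) auto
  also have "... = cmod (fcoef hermv G a)" using lam_pos[of a] by (simp add: e norm_mult norm_power)
  also have "... <= sqrt (nrm2 G)" using hermv.bessel[of "{a}" G] schwartz_L2[OF Gs] by (intro real_le_rsqrt) (auto simp: G_def)
  finally show ?thesis .
 qed
 then show "\<exists>K. \<forall>a. cmod (fcoef hermv g a) * (1 + real (mdeg a)) ^ M <= K" by blast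
qed

text \<open>A null open set is empty. This gives the pointwise uniqueness that the definite
  description in \<open>oscillator_calc_schwartz\<close> asks for.\<close>

lemma AE_eq_continuous_imp_eq:
 fixes f g :: "'a::euclidean_space => complex"
 assumes "continuous_on UNIV f" "continuous_on UNIV g" "AE x in lborel. f x = g x" shows "f = g"
proof -
 have "open {x. f x ~= g x}" by (rule open_Collect_neq[OF assms(1,2)])
 moreover have "negligible {x. f x ~= g x}"
 proof -
  obtain N where N: "N \<in> null_sets lborel" "{x \<in> space lborel. f x ~= g x} \<subseteq> N"
   using assms(3) by (auto elim: AE_E simp: null_sets_def)
  then have "N \<in> null_sets lebesgue" by (simp add: null_sets_completionI)
  then have "negligible N" by (simp add: negligible_iff_null_sets)
  then show ?thesis by (rule negligible_subset) (use N in simp)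
 qed
 ultimately have "{x. f x ~= g x} = {}" using open_not_negligible by blast
 then show ?thesis by auto
qed

section \<open>Tempered distributions on Hermite series\<close>

lemma tempered_add:
 "u \<in> tempered ==> f \<in> schwartz ==> g \<in> schwartz ==> u (%x. f x + g x) = u f + u g" by (simp add: tempered_def)

lemma tempered_cmult: "u \<in> tempered ==> f \<in> schwartz ==> u (%x. c * f x) = c * u f" by (simp add: tempered_def)

lemma tempered_sum:
 assumes u: "u \<in> tempered" and f: "!!i. i \<in> A ==> f i \<in> schwartz" and "finite A"
 shows "u (%x. \<Sum>i\<in>A. c i * f i x) = (\<Sum>i\<in>A. c i * u (f i))" using assms(3) f
proof (induction A)
 case empty
 show ?case using tempered_cmult[OF u schwartz_zero, of 0] by simp
next
 case (insert j A)
 have "u (%x. (c j * f j x) + (\<Sum>i\<in>A. c i * f i x)) = u (%x. c j * f j x) + u (%x. \<Sum>i\<in>A. c i * f i x)"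
  by (intro tempered_add u schwartz_sum schwartz_cmult insert.prems) auto
 moreover have "u (%x. c j * f j x) = c j * u (f j)" by (intro tempered_cmult u insert.prems) auto
 ultimately show ?case using insert by simp
qed

lemma tempered_fcomb:
 "u \<in> tempered ==> finite A ==> u (fcomb hermv A c) = (\<Sum>a\<in>A. c a * u (hermc a))"
 using tempered_sum[of u A hermc c] unfolding fcomb_def[abs_def] by (simp add: hermc_schwartz)

text \<open>The tail estimate is taken in the seminorm that controls u, so u may be applied term by
  term. Through this, m(H) u becomes an explicit series in the values of u on Hermite
  functions.\<close>

lemma tempered_hser:
 assumes u: "u \<in> tempered" and c: "rapid c" shows "(%n. \<Sum>a | mdeg a = n. c a * u (hermc a)) sums u (hser c)"
proof -
 obtain C N where CN: "!!f. f \<in> schwartz ==> cmod (u f) <= C * schwartz_norm N f" using u unfolding tempered_def by blast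
 obtain t where t: "t \<longlonglongrightarrow> 0" "!!L is x. length is <= N ==>
  (1 + norm x) ^ N * cmod (partials is (%x. hser c x - fcomb hermv {a. mdeg a < L} c x) x) <= t L"
  using hser_tail_bound[OF c] by blast
 have b: "cmod (u (fcomb hermv {a. mdeg a < L} c) - u (hser c)) <= \<bar>C\<bar> * t L" for L
 proof -
  let ?f = "%x. hser c x - fcomb hermv {a. mdeg a < L} c x"
  have fs: "?f \<in> schwartz" by (intro schwartz_diff hser_schwartz fcomb_schwartz c)
  have "u (%x. ?f x + fcomb hermv {a. mdeg a < L} c x) = u ?f + u (fcomb hermv {a. mdeg a < L} c)"
   by (rule tempered_add[OF u fs fcomb_schwartz])
  then have "u (hser c) - u (fcomb hermv {a. mdeg a < L} c) = u ?f" by simp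
  then have "cmod (u (fcomb hermv {a. mdeg a < L} c) - u (hser c)) = cmod (u ?f)" by (metis norm_minus_commute)
  also have "... <= C * schwartz_norm N ?f" by (rule CN[OF fs])
  also have "... <= \<bar>C\<bar> * schwartz_norm N ?f" by (intro mult_right_mono schwartz_norm_nonneg fs) simp
  also have "... <= \<bar>C\<bar> * t L" by (intro mult_left_mono schwartz_norm_le t(2)) auto
  finally show ?thesis .
 qed
 have "(%L. u (fcomb hermv {a. mdeg a < L} c)) \<longlonglongrightarrow> u (hser c)"
 proof (rule LIM_zero_cancel, rule Lim_null_comparison)
  show "eventually (%L. norm (u (fcomb hermv {a. mdeg a < L} c) - u (hser c)) <= \<bar>C\<bar> * t L) sequentially"
   using b by (intro always_eventually) auto
  show "(%L. \<bar>C\<bar> * t L) \<longlonglongrightarrow> 0" using tendsto_mult_right_zero[OF t(1)] .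
 qed
 then show ?thesis unfolding sums_def hermv.sum_levels by (simp add: tempered_fcomb[OF u hermv.fin_less])
qed

section \<open>The spectral resolution of the harmonic oscillator\<close>

subsection \<open>Diagonal projection measures\<close>

lemma L2_inner_add_left: "f \<in> L2 ==> g \<in> L2 ==> h \<in> L2 ==> L2_inner (%x. f x + g x) h = L2_inner f h + L2_inner g h"
 by (simp add: L2_inner_def distrib_right integrable_mult_L2 L2_cnj)

lemma L2_inner_scale_left: "L2_inner (%x. c * f x) h = c * L2_inner f h" by (simp add: L2_inner_def mult.assoc)

lemma L2_inner_add_right: "f \<in> L2 ==> g \<in> L2 ==> h \<in> L2 ==> L2_inner h (%x. f x + g x) = L2_inner h f + L2_inner h g"
 by (simp add: L2_inner_def distrib_left integrable_mult_L2 L2_cnj)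

lemma L2_inner_scale_right: "L2_inner h (%x. c * f x) = cnj c * L2_inner h f" by (simp add: L2_inner_def mult_ac)

lemma L2_inner_self: "L2_inner f f = cplx (nrm2 f)"
 by (simp add: L2_inner_def nrm2_def complex_norm_square[symmetric] flip: integral_complex_of_real)

lemma L2_inner_cong_AE:
 assumes "f \<in> L2" "f' \<in> L2" "g \<in> L2" "g' \<in> L2" "AE_eq f f'" "AE_eq g g'" shows "L2_inner f g = L2_inner f' g'"
proof -
 have [measurable]: "f \<in> bmeas" "f' \<in> bmeas"
  "(%x. cnj (g x)) \<in> bmeas" "(%x. cnj (g' x)) \<in> bmeas"
  using assms L2_cnj by (auto dest: L2_measurable)
 show ?thesis unfolding L2_inner_def by (rule integral_cong_AE) (use assms(5,6) in \<open>auto simp: AE_eq_def\<close>)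
qed

lemma L2_inner_commute: "L2_inner g f = cnj (L2_inner f g)"
proof -
 have "cnj (L2_inner f g) = (LBINT x. cnj (f x * cnj (g x)))"
  unfolding L2_inner_def by (rule Bochner_Integration.integral_cnj[symmetric])
 then show ?thesis by (simp add: L2_inner_def mult.commute)
qed

lemma L2_inner_hermc: "L2_inner f (hermc a) = fcoef hermv f a" by (simp add: L2_inner_def fcoef_def)

lemma L2_inner_sums:
 assumes "f \<in> L2" "g \<in> L2"
 shows "(%n. \<Sum>a | mdeg a = n. fcoef hermv f a * cnj (fcoef hermv g a)) sums L2_inner f g"
 using hermv.parseval_bilinear[OF assms(1) L2_cnj[OF assms(2)]] by (simp add: L2_inner_def hermv.fcoef_cnj)

definition evl :: "'n::finite itself => nat => real" where
 "evl _ n = real (2 * n + CARD('n))"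

lemma lam_evl: "lam (a :: 'n::finite => nat) = evl TYPE('n) (mdeg a)" by (simp add: lam_def evl_def)

definition mass :: "(real^'n::finite => complex) => nat => real" where
 "mass f n = (\<Sum>\<nu> | mdeg \<nu> = n. (cmod (fcoef hermv f \<nu>))^2)"

lemma mass_nonneg [simp]: "0 <= mass f n" by (simp add: mass_def sum_nonneg)

lemma summable_mass: "f \<in> L2 ==> summable (mass f)" unfolding mass_def[abs_def] by (rule hermv.summable_coef)

text \<open>The expected spectral measure of f: an atom of weight \<open>mass f n\<close> at each
  eigenvalue. As an image of a measure on \<open>nat\<close>, it turns spectral integrals into
  series.\<close>

definition smeas :: "(real^'n::finite => complex) => real measure" where
 "smeas f = distr (density (count_space UNIV) (%n. ennreal (mass f n))) borel (evl TYPE('n))"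

lemma sets_smeas [simp, measurable_cong]: "sets (smeas f) = sets borel" and space_smeas [simp]: "space (smeas f) = UNIV"
 by (simp_all add: smeas_def)

lemma emeasure_smeas:
 fixes f :: "real^'n::finite => complex"
 assumes "f \<in> L2" "A \<in> sets borel" shows "emeasure (smeas f) A = ennreal (\<Sum>n. of_bool (evl TYPE('n) n \<in> A) * mass f n)"
proof -
 have s: "summable (%n. of_bool (evl TYPE('n) n \<in> A) * mass f n)"
  by (rule summable_comparison_test'[OF summable_mass[OF assms(1)]]) (auto simp: of_bool_def)
 have "emeasure (smeas f) A = (\<integral>\<^sup>+n. ennreal (mass f n) * indicator (evl TYPE('n) -` A) n \<partial>count_space UNIV)"
  unfolding smeas_def using assms(2) by (simp add: emeasure_distr emeasure_density)
 also have "... = (\<Sum>n. ennreal (of_bool (evl TYPE('n) n \<in> A) * mass f n))"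
  unfolding nn_integral_count_space_nat by (intro suminf_cong) (auto simp: indicator_def)
 also have "... = ennreal (\<Sum>n. of_bool (evl TYPE('n) n \<in> A) * mass f n)" using s by (intro suminf_ennreal2) auto
 finally show ?thesis .
qed

lemma measure_smeas:
 fixes f :: "real^'n::finite => complex"
 assumes "f \<in> L2" "A \<in> sets borel" shows "measure (smeas f) A = (\<Sum>n. of_bool (evl TYPE('n) n \<in> A) * mass f n)"
proof -
 have "summable (%n. of_bool (evl TYPE('n) n \<in> A) * mass f n)"
  by (rule summable_comparison_test'[OF summable_mass[OF assms(1)]]) (auto simp: of_bool_def)
 then have "0 <= (\<Sum>n. of_bool (evl TYPE('n) n \<in> A) * mass f n)" by (rule suminf_nonneg) simp
 then show ?thesis by (simp add: measure_def emeasure_smeas[OF assms])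
qed

lemma finite_measure_smeas: "f \<in> L2 ==> finite_measure (smeas f)" by (rule finite_measureI) (simp add: emeasure_smeas)

lemma integral_smeas:
 fixes f :: "real^'n::finite => complex"
 assumes [measurable]: "m \<in> bmeas" and s: "summable (%n. \<bar>m (evl TYPE('n) n)\<bar> * mass f n)"
 shows "(%n. m (evl TYPE('n) n) * mass f n) sums (\<integral>l. m l \<partial>smeas f)"
proof -
 have [measurable]: "evl TYPE('n) \<in> measurable (count_space UNIV) borel" by simp
 have i: "integrable (count_space UNIV) (%n. m (evl TYPE('n) n) * mass f n)"
  unfolding integrable_count_space_nat_iff using s by (simp add: abs_mult)
 have "(\<integral>l. m l \<partial>smeas f) = (\<integral>n. m (evl TYPE('n) n) \<partial>density (count_space UNIV) (%n. ennreal (mass f n)))"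
  unfolding smeas_def by (rule integral_distr) auto
 also have "... = (\<integral>n. mass f n *\<^sub>R m (evl TYPE('n) n) \<partial>count_space UNIV)" by (rule integral_density) auto
 also have "... = (\<integral>n. m (evl TYPE('n) n) * mass f n \<partial>count_space UNIV)" by (simp add: mult.commute)
 also have "... = (\<Sum>n. m (evl TYPE('n) n) * mass f n)" by (rule integral_count_space_nat[OF i])
 finally show ?thesis using i unfolding integrable_count_space_nat_iff by (simp add: summable_sums summable_norm_cancel)
qed

lemma nn_integral_smeas:
 fixes f :: "real^'n::finite => complex"
 assumes [measurable]: "m \<in> bmeas"
 shows "(\<integral>\<^sup>+l. m l \<partial>smeas f) = (\<Sum>n. m (evl TYPE('n) n) * ennreal (mass f n))"
proof -
 have [measurable]: "evl TYPE('n) \<in> measurable (count_space UNIV) borel" by simp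
 have "(\<integral>\<^sup>+l. m l \<partial>smeas f) = (\<integral>\<^sup>+n. m (evl TYPE('n) n) \<partial>density (count_space UNIV) (%n. ennreal (mass f n)))"
  unfolding smeas_def by (rule nn_integral_distr) auto
 also have "... = (\<integral>\<^sup>+n. ennreal (mass f n) * m (evl TYPE('n) n) \<partial>count_space UNIV)"
  by (rule nn_integral_density) auto
 finally show ?thesis by (simp add: nn_integral_count_space_nat mult.commute)
qed

text \<open>E A is the projection onto the Hermite functions with eigenvalue in A. It is described
  by coefficients because its values are functions determined only up to null sets.\<close>

definition diag :: "(real^'n::finite) proj_measure => bool" where
 "diag E \<longleftrightarrow> (\<forall>A\<in>sets borel. \<forall>f\<in>L2. E A f \<in> L2 &
   (\<forall>\<nu>. fcoef hermv (E A f) \<nu> = (if lam \<nu> \<in> A then fcoef hermv f \<nu> else 0)))"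

lemma diag_L2: "diag E ==> A \<in> sets borel ==> f \<in> L2 ==> E A f \<in> L2" by (simp add: diag_def)

lemma diag_coef: "diag E ==> A \<in> sets borel ==> f \<in> L2 ==>
  fcoef hermv (E A f) a = (if lam a \<in> A then fcoef hermv f a else 0)" by (simp add: diag_def)

lemma multiplier_exists:
 fixes f :: "real^'n::finite => complex" and m :: "('n => nat) => real"
 assumes f: "f \<in> L2" and m: "!!a. \<bar>m a\<bar> <= K"
 shows "\<exists>g\<in>L2. \<forall>a. fcoef hermv g a = cplx (m a) * fcoef hermv f a"
proof -
 have "summable (%n. \<Sum>a | mdeg a = n. (cmod (cplx (m a) * fcoef hermv f a))^2)"
 proof (rule summable_comparison_test'[OF summable_mult[OF summable_mass[OF f], of "K^2"]])
  fix n :: nat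
  have "(m a)^2 <= K^2" for a using power_mono[OF m[of a], of 2] by simp
  then have "(\<Sum>a::'n => nat | mdeg a = n. (m a)^2 * (cmod (fcoef hermv f a))^2) <= (\<Sum>a | mdeg a = n. K^2 * (cmod (fcoef hermv f a))^2)"
   by (intro sum_mono mult_right_mono) auto
  then show "norm (\<Sum>a | mdeg a = n. (cmod (cplx (m a) * fcoef hermv f a))^2) <= K^2 * mass f n"
   by (simp add: mass_def norm_mult power_mult_distrib sum_distrib_left sum_nonneg)
 qed
 from hermv.expansion_exists[OF this] show ?thesis by blast
qed

lemma diag_exists: "\<exists>E :: (real^'n::finite) proj_measure. diag E"
proof -
 have "\<exists>g. f \<in> L2 --> g \<in> L2 & (\<forall>a. fcoef hermv g a = (if lam a \<in> A then fcoef hermv f a else 0))"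
  for f :: "real^'n => complex" and A
 proof (cases "f \<in> L2")
  case True
  then obtain g where "g \<in> L2" "!!a. fcoef hermv g a = cplx (of_bool (lam a \<in> A)) * fcoef hermv f a"
   using multiplier_exists[of f "%a. of_bool (lam a \<in> A)" 1] by auto
  then show ?thesis by (intro exI[of _ g]) auto
 qed simp
 note ex = this
 define E where "E A f = (SOME g. f \<in> L2 --> g \<in> L2 & (\<forall>a. fcoef hermv g a = (if lam a \<in> A then fcoef hermv f a else 0)))"
  for A and f :: "real^'n => complex"
 have "f \<in> L2 --> E A f \<in> L2 & (\<forall>a. fcoef hermv (E A f) a = (if lam a \<in> A then fcoef hermv f a else 0))" for A f
  unfolding E_def by (rule someI_ex[OF ex])
 then show ?thesis unfolding diag_def by blast
qed

lemma diag_inner_sums: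
 fixes f g :: "real^'n::finite => complex"
 assumes "diag E" "A \<in> sets borel" "f \<in> L2" "g \<in> L2"
 shows "(%n. of_bool (evl TYPE('n) n \<in> A) * (\<Sum>a | mdeg a = n. fcoef hermv f a * cnj (fcoef hermv g a))) sums L2_inner (E A f) g"
proof -
 have "(\<Sum>a | mdeg a = n. fcoef hermv (E A f) a * cnj (fcoef hermv g a)) =
   of_bool (evl TYPE('n) n \<in> A) * (\<Sum>a | mdeg a = n. fcoef hermv f a * cnj (fcoef hermv g a))" for n
  by (cases "evl TYPE('n) n \<in> A") (auto simp: diag_coef[OF assms(1-3)] lam_evl intro!: sum.cong sum.neutral)
 with L2_inner_sums[OF diag_L2[OF assms(1-3)] assms(4)] show ?thesis by simp
qed

lemma diag_inner_self:
 fixes f :: "real^'n::finite => complex"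
 assumes "diag E" "A \<in> sets borel" "f \<in> L2" shows "L2_inner (E A f) f = cplx (measure (smeas f) A)"
proof -
 have "cplx (mass f n) = (\<Sum>a | mdeg a = n. fcoef hermv f a * cnj (fcoef hermv f a))" for n
  unfolding mass_def of_real_sum complex_norm_square ..
 then have e: "of_bool (evl TYPE('n) n \<in> A) * (\<Sum>a | mdeg a = n. fcoef hermv f a * cnj (fcoef hermv f a))
   = cplx (of_bool (evl TYPE('n) n \<in> A) * mass f n)" for n by simp
 have s: "summable (%n. of_bool (evl TYPE('n) n \<in> A) * mass f n)"
  by (rule summable_comparison_test'[OF summable_mass[OF assms(3)]]) (auto simp: of_bool_def)
 have "(%n. cplx (of_bool (evl TYPE('n) n \<in> A) * mass f n)) sums L2_inner (E A f) f"
  using diag_inner_sums[OF assms assms(3)] unfolding e .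
 moreover have "(%n. cplx (of_bool (evl TYPE('n) n \<in> A) * mass f n)) sums cplx (\<Sum>n. of_bool (evl TYPE('n) n \<in> A) * mass f n)"
  by (rule sums_of_real[OF summable_sums[OF s]])
 ultimately show ?thesis unfolding measure_smeas[OF assms(3,2)] by (rule sums_unique2)
qed

lemma spectral_measure_diag:
 assumes "diag E" "f \<in> L2" shows "spectral_measure E f = smeas f"
proof -
 interpret finite_measure "smeas f" by (rule finite_measure_smeas[OF assms(2)])
 have "spectral_measure E f = measure_of UNIV (sets borel) (emeasure (smeas f))" unfolding spectral_measure_def
 proof (rule measure_of_eq)
  fix A :: "real set" assume "A \<in> sigma_sets UNIV (sets borel)"
  then have A: "A \<in> sets borel" using sets.sigma_sets_eq[of "borel :: real measure"] by simp
  show "ennreal (Re (L2_inner (E A f) f)) = emeasure (smeas f) A"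
   by (simp add: diag_inner_self[OF assms(1) A assms(2)] emeasure_eq_measure)
 qed simp
 also have "... = smeas f" using measure_of_of_measure[of "smeas f"] by simp
 finally show ?thesis .
qed

lemma cnj_of_bool: "cnj (of_bool P) = of_bool P" by (simp add: of_bool_def)

lemma diag_is_proj_measure:
 fixes E :: "(real^'n::finite) proj_measure"
 assumes E: "diag E" shows "is_proj_measure E" unfolding is_proj_measure_def
proof (intro conjI ballI allI impI)
 fix A :: "real set" and f g :: "real^'n => complex"
 assume A: "A \<in> sets borel" and f: "f \<in> L2" 
 show "E A f \<in> L2" by (rule diag_L2[OF E A f])
 assume g: "g \<in> L2"
 have "(%n. cnj (of_bool (evl TYPE('n) n \<in> A) * (\<Sum>a | mdeg a = n. fcoef hermv g a * cnj (fcoef hermv f a)))) sums cnj (L2_inner (E A g) f)"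
  using diag_inner_sums[OF E A g f] by (simp only: sums_cnj)
 then have "(%n. of_bool (evl TYPE('n) n \<in> A) * (\<Sum>a | mdeg a = n. fcoef hermv f a * cnj (fcoef hermv g a))) sums L2_inner f (E A g)"
  unfolding L2_inner_commute[of "E A g" f] by (simp add: mult.commute cnj_of_bool)
 with diag_inner_sums[OF E A f g] show "L2_inner (E A f) g = L2_inner f (E A g)" using sums_unique2 by blast
next
 fix A B :: "real set" and f :: "real^'n => complex"
 assume A: "A \<in> sets borel" and B: "B \<in> sets borel" and f: "f \<in> L2"
 then show "AE_eq (E (A \<inter> B) f) (E A (E B f))"
  unfolding AE_eq_def by (intro hermv.coef_eq_AE) (auto simp: diag_L2[OF E] diag_coef[OF E])
next
 fix f :: "real^'n => complex"
 assume "f \<in> L2"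
 then show "AE_eq (E UNIV f) f" unfolding AE_eq_def by (intro hermv.coef_eq_AE) (auto simp: diag_L2[OF E] diag_coef[OF E])
next
 fix A :: "nat => real set" and f :: "real^'n => complex"
 assume A: "range A \<subseteq> sets borel" and dis: "disjoint_family A" and f: "f \<in> L2"
 have Ai: "A i \<in> sets borel" for i using A by auto
 interpret finite_measure "smeas f" by (rule finite_measure_smeas[OF f])
 have "(%i. measure (smeas f) (A i)) sums measure (smeas f) (\<Union>i. A i)" by (rule finite_measure_UNION) (use A dis in auto)
 then show "(%i. L2_inner (E (A i) f) f) sums L2_inner (E (\<Union>i. A i) f) f"
  using Ai by (simp add: diag_inner_self[OF E _ f] sums_of_real_iff)
qed

text \<open>The sums of i^k and of i^(2k) over k < 4 vanish, so of the four terms of the square only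
  a times the conjugate of b survives.\<close>

lemma sum_polarization:
 "(\<Sum>k<4. \<i> ^ k * cplx ((cmod (a + \<i> ^ k * b))^2)) = 4 * (a * cnj b)"
proof -
 have s: "{..<4} = {0, 1, 2, 3 :: nat}" by auto
 have i3: "\<i> ^ 3 = - \<i>" by (simp add: power3_eq_cube)
 show ?thesis unfolding s complex_norm_square by (simp add: i3 algebra_simps)
qed

lemma mass_add_le:
 assumes "f \<in> L2" "g \<in> L2" "cmod c = 1" shows "mass (%x. f x + c * g x) n <= 2 * mass f n + 2 * mass g n"
proof -
 have "mass (%x. f x + c * g x) n <= (\<Sum>a | mdeg a = n. 2 * (cmod (fcoef hermv f a))^2 + 2 * (cmod (fcoef hermv g a))^2)"
  unfolding mass_def
 proof (rule sum_mono)
  fix a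
  show "(cmod (fcoef hermv (%x. f x + c * g x) a))^2 <= 2 * (cmod (fcoef hermv f a))^2 + 2 * (cmod (fcoef hermv g a))^2"
   using norm_add_sq_le[of "fcoef hermv f a" "c * fcoef hermv g a"] assms
   by (simp add: hermv.fcoef_add L2_scale hermv.fcoef_scale norm_mult)
 qed
 then show ?thesis by (simp add: mass_def sum.distrib sum_distrib_left)
qed

lemma spectral_integral_diag:
 fixes f g :: "real^'n::finite => complex"
 assumes E: "diag E" and m: "m \<in> bmeas" and f: "f \<in> L2" and g: "g \<in> L2"
  and sf: "summable (%n. \<bar>m (evl TYPE('n) n)\<bar> * mass f n)" and sg: "summable (%n. \<bar>m (evl TYPE('n) n)\<bar> * mass g n)"
 shows "(%n. m (evl TYPE('n) n) * (\<Sum>a | mdeg a = n. fcoef hermv f a * cnj (fcoef hermv g a)))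
  sums spectral_integral E m f g"
proof -
 let ?h = "%k x. f x + \<i> ^ k * g x"
 have hL2: "?h k \<in> L2" for k by (intro L2_add L2_scale f g)
 have "summable (%n. \<bar>m (evl TYPE('n) n)\<bar> * mass (?h k) n)" for k
 proof (rule summable_comparison_test'[OF summable_add[OF summable_mult[OF sf, of 2] summable_mult[OF sg, of 2]]])
  fix n :: nat
  have "\<bar>m (evl TYPE('n) n)\<bar> * mass (?h k) n <= \<bar>m (evl TYPE('n) n)\<bar> * (2 * mass f n + 2 * mass g n)"
   by (intro mult_left_mono mass_add_le f g) (simp_all add: norm_power)
  then show "norm (\<bar>m (evl TYPE('n) n)\<bar> * mass (?h k) n) <= 2 * (\<bar>m (evl TYPE('n) n)\<bar> * mass f n) + 2 * (\<bar>m (evl TYPE('n) n)\<bar> * mass g n)"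
   by (simp add: abs_mult algebra_simps)
 qed
 from integral_smeas[OF m this]
 have "(%n. (\<Sum>k<4. \<i> ^ k * cplx (m (evl TYPE('n) n) * mass (?h k) n)) / 4) sums
   ((\<Sum>k<4. \<i> ^ k * cplx (\<integral>l. m l \<partial>smeas (?h k))) / 4)"
  by (intro sums_divide sums_sum sums_mult sums_of_real)
 moreover have "(\<Sum>k<4. \<i> ^ k * cplx (m (evl TYPE('n) n) * mass (?h k) n)) / 4 =
   m (evl TYPE('n) n) * (\<Sum>a | mdeg a = n. fcoef hermv f a * cnj (fcoef hermv g a))" for n
 proof -
  have c: "fcoef hermv (?h k) a = fcoef hermv f a + \<i> ^ k * fcoef hermv g a" for k a
   by (simp add: hermv.fcoef_add f L2_scale g hermv.fcoef_scale)
  have "(\<Sum>k<4. \<i> ^ k * cplx (m (evl TYPE('n) n) * mass (?h k) n)) =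
   (\<Sum>k<4. m (evl TYPE('n) n) * (\<Sum>a | mdeg a = n. \<i> ^ k * cplx ((cmod (fcoef hermv f a + \<i> ^ k * fcoef hermv g a))^2)))"
   unfolding mass_def c by (intro sum.cong refl) (simp add: sum_distrib_left mult_ac del: of_real_power)
  also have "... = m (evl TYPE('n) n) * (\<Sum>k<4. \<Sum>a | mdeg a = n. \<i> ^ k * cplx ((cmod (fcoef hermv f a + \<i> ^ k * fcoef hermv g a))^2))"
   by (rule sum_distrib_left[symmetric])
  also have "... = m (evl TYPE('n) n) * (\<Sum>a | mdeg a = n. 4 * (fcoef hermv f a * cnj (fcoef hermv g a)))"
   unfolding sum_polarization[symmetric] by (subst sum.swap) (rule refl)
  finally show ?thesis by (simp add: sum_distrib_left[symmetric])
 qed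
 ultimately show ?thesis unfolding spectral_integral_def spectral_measure_diag[OF E hL2] by simp
qed

subsection \<open>The domain of the oscillator\<close>

text \<open>The weak Laplacian may be tested on \<open>hermc a\<close>, which is a Schwartz function
  and an eigenfunction; the terms with the squared norm of x cancel.\<close>

lemma oscillator_fcoef:
 assumes "(f, h) \<in> oscillator" shows "fcoef hermv h a = cplx (lam a) * fcoef hermv f a"
proof -
 obtain u where f: "f \<in> L2" and xf: "(%x. (norm x)^2 *\<^sub>R f x) \<in> L2" and h: "h \<in> L2"
  and u: "u \<in> L2" and wl: "weak_laplacian f u" and ae: "AE_eq h (%x. - u x + (norm x)^2 *\<^sub>R f x)"
  using assms by (auto simp: oscillator_def)
 have rhs: "(%x. - u x + (norm x)^2 *\<^sub>R f x) \<in> L2" by (intro L2_add L2_uminus u xf)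
 have i: "complex_integrable lborel (%x. u x * hermc a x)"
  "complex_integrable lborel (%x. (norm x)^2 *\<^sub>R f x * hermc a x)"
  "complex_integrable lborel (%x. f x * laplacian (hermc a) x)"
  by (intro integrable_mult_L2 u xf f hermv.basis_L2 schwartz_L2 laplacian_schwartz hermc_schwartz)+
 have "fcoef hermv h a = fcoef hermv (%x. - u x + (norm x)^2 *\<^sub>R f x) a"
  using L2_inner_cong_AE[OF h rhs hermv.basis_L2 hermv.basis_L2 ae, of a a] by (simp add: AE_eq_def L2_inner_hermc)
 also have "... = (LBINT x. (norm x)^2 *\<^sub>R f x * hermc a x - u x * hermc a x)"
  unfolding fcoef_def by (simp add: left_diff_distrib)
 also have "... = (LBINT x. (norm x)^2 *\<^sub>R f x * hermc a x) - (LBINT x. u x * hermc a x)"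
  by (rule Bochner_Integration.integral_diff[OF i(2,1)])
 also have "(LBINT x. u x * hermc a x) = (LBINT x. f x * laplacian (hermc a) x)"
  by (rule bspec[OF wl[unfolded weak_laplacian_def] hermc_schwartz, symmetric])
 also have "(LBINT x. (norm x)^2 *\<^sub>R f x * hermc a x) - ... =
   (LBINT x. (norm x)^2 *\<^sub>R f x * hermc a x - f x * laplacian (hermc a) x)" using i by simp
 also have "... = (LBINT x. cplx (lam a) * (f x * hermc a x))"
  unfolding laplacian_hermc by (simp add: scaleR_conv_of_real algebra_simps)
 finally show ?thesis by (simp add: fcoef_def)
qed

text \<open>Each ladder step maps the Hermite basis injectively into itself, so that multiplication by
  \<open>x\<^sub>i\<close> costs one factor \<open>lad\<close> in the coefficients.\<close>

lemma nrm2_shifted: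
 assumes "finite A" "inj_on \<sigma> A"
 shows "nrm2 (%x. \<Sum>a\<in>A. c a * hermc (\<sigma> a) x) = (\<Sum>a\<in>A. (cmod (c a))^2)"
proof -
 have "(%x. \<Sum>a\<in>A. c a * hermc (\<sigma> a) x) = fcomb hermv (\<sigma> ` A) (%b. c (the_inv_into A \<sigma> b))"
  unfolding fcomb_def using assms(2) by (subst sum.reindex[OF assms(2)]) (auto simp: fun_eq_iff the_inv_into_f_f intro!: sum.cong)
 then have "nrm2 (%x. \<Sum>a\<in>A. c a * hermc (\<sigma> a) x) = (\<Sum>b\<in>\<sigma> ` A. (cmod (c (the_inv_into A \<sigma> b)))^2)"
  using assms(1) by (simp add: hermv.nrm2_fcomb)
 also have "... = (\<Sum>a\<in>A. (cmod (c a))^2)"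
  using assms(2) by (subst sum.reindex[OF assms(2)]) (auto simp: the_inv_into_f_f intro!: sum.cong)
 finally show ?thesis .
qed

text \<open>Raising and lowering are kept apart because each is injective by itself, the latter once
  the indices with \<open>v i = 0\<close>, whose ladder coefficient is zero, are dropped. The moment
  bounds are stated for all k so that the lemma can be iterated; 2^k pays for the change of
  degree.\<close>

lemma mult_fcomb:
 fixes c :: "('n::finite => nat) => complex"
 assumes "finite A" shows "\<exists>A1 c1 A2 c2. finite A1 & finite A2 &
  (%x. cplx (x $ i) * fcomb hermv A c x) = (%x. fcomb hermv A1 c1 x + fcomb hermv A2 c2 x) &
  (\<forall>k. (\<Sum>b\<in>A1. (cmod (c1 b))^2 * (1 + real (mdeg b)) ^ k) <= 2 ^ k * (\<Sum>v\<in>A. (cmod (c v))^2 * (1 + real (mdeg v)) ^ Suc k)) &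
  (\<forall>k. (\<Sum>b\<in>A2. (cmod (c2 b))^2 * (1 + real (mdeg b)) ^ k) <= 2 ^ k * (\<Sum>v\<in>A. (cmod (c v))^2 * (1 + real (mdeg v)) ^ Suc k))"
proof -
 define p where "p v = v(i := Suc (v i))" for v :: "'n => nat"
 define q where "q v = v(i := v i - 1)" for v :: "'n => nat"
 define B where "B = {v\<in>A. 0 < v i}"
 have fB: "finite B" "B \<subseteq> A" using assms by (auto simp: B_def)
 have qp: "q (p v) = v" for v by (simp add: p_def q_def)
 have pq: "p (q v) = v" if "v \<in> B" for v using that by (simp add: p_def q_def B_def)
 have injp: "inj_on p A" by (rule inj_on_inverseI[of _ q]) (rule qp)
 have injq: "inj_on q B" by (rule inj_on_inverseI[of _ p]) (rule pq)
 define c1 where "c1 b = c (q b) * cplx (lad (Suc (q b i)))" for b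
 define c2 where "c2 b = c (p b) * cplx (lad (p b i))" for b
 have e: "cplx (x $ i) * fcomb hermv A c x = fcomb hermv (p ` A) c1 x + fcomb hermv (q ` B) c2 x" for x
 proof -
  have "cplx (x $ i) * fcomb hermv A c x = (\<Sum>v\<in>A. c v * cplx (x $ i * hermv v x))"
   by (simp add: fcomb_def sum_distrib_left mult_ac)
  also have "... = (\<Sum>v\<in>A. c v * cplx (lad (Suc (v i))) * hermc (p v) x) + (\<Sum>v\<in>A. c v * cplx (lad (v i)) * hermc (q v) x)"
   unfolding mult_hermv p_def q_def by (simp add: algebra_simps sum.distrib)
  also have "(\<Sum>v\<in>A. c v * cplx (lad (v i)) * hermc (q v) x) = (\<Sum>v\<in>B. c v * cplx (lad (v i)) * hermc (q v) x)"
   by (rule sum.mono_neutral_right) (use assms in \<open>auto simp: B_def\<close>)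
  also have "... = fcomb hermv (q ` B) c2 x" unfolding fcomb_def by (subst sum.reindex[OF injq]) (auto simp: c2_def pq intro!: sum.cong)
  also have "(\<Sum>v\<in>A. c v * cplx (lad (Suc (v i))) * hermc (p v) x) = fcomb hermv (p ` A) c1 x"
   unfolding fcomb_def by (subst sum.reindex[OF injp]) (auto simp: c1_def qp intro!: sum.cong)
  finally show ?thesis .
 qed
 have l: "(lad (Suc (v i)))^2 <= 1 + real (mdeg v)" "(lad (v i))^2 <= 1 + real (mdeg v)" for v :: "'n => nat"
  using le_mdeg[of v i] by (auto simp: lad_def)
 have tbound: "(cmod (a * cplx r))^2 * (1 + real m') ^ k <= 2 ^ k * ((cmod a)^2 * (1 + real m) ^ Suc k)"
  if "r^2 <= 1 + real m" "m' <= Suc m" for a r and m m' k :: nat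
 proof -
  have "(1 + real m') ^ k <= (2 * (1 + real m)) ^ k" using that(2) by (intro power_mono) auto
  then have "(1 + real m') ^ k <= 2 ^ k * (1 + real m) ^ k" unfolding power_mult_distrib .
  then have "r^2 * (1 + real m') ^ k <= (1 + real m) * (2 ^ k * (1 + real m) ^ k)" by (intro mult_mono that(1)) auto
  then have "(cmod a)^2 * (r^2 * (1 + real m') ^ k) <= (cmod a)^2 * ((1 + real m) * (2 ^ k * (1 + real m) ^ k))"
   by (rule mult_left_mono) simp
  then show ?thesis by (simp add: norm_mult power_mult_distrib mult_ac)
 qed
 have b1: "(\<Sum>b\<in>p ` A. (cmod (c1 b))^2 * (1 + real (mdeg b)) ^ k) <= 2 ^ k * (\<Sum>v\<in>A. (cmod (c v))^2 * (1 + real (mdeg v)) ^ Suc k)" for k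
 proof -
  have "(\<Sum>b\<in>p ` A. (cmod (c1 b))^2 * (1 + real (mdeg b)) ^ k) = (\<Sum>v\<in>A. (cmod (c v * cplx (lad (Suc (v i)))))^2 * (1 + real (mdeg (p v))) ^ k)"
   by (subst sum.reindex[OF injp]) (auto simp: c1_def qp intro!: sum.cong)
  also have "... <= (\<Sum>v\<in>A. 2 ^ k * ((cmod (c v))^2 * (1 + real (mdeg v)) ^ Suc k))"
   by (intro sum_mono tbound l) (simp add: p_def mdeg_Suc)
  finally show ?thesis by (simp add: sum_distrib_left)
 qed
 have b2: "(\<Sum>b\<in>q ` B. (cmod (c2 b))^2 * (1 + real (mdeg b)) ^ k) <= 2 ^ k * (\<Sum>v\<in>A. (cmod (c v))^2 * (1 + real (mdeg v)) ^ Suc k)" for k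
 proof -
  have "(\<Sum>b\<in>q ` B. (cmod (c2 b))^2 * (1 + real (mdeg b)) ^ k) = (\<Sum>v\<in>B. (cmod (c v * cplx (lad (v i))))^2 * (1 + real (mdeg (q v))) ^ k)"
   by (subst sum.reindex[OF injq]) (auto simp: c2_def pq intro!: sum.cong)
  also have "... <= (\<Sum>v\<in>B. 2 ^ k * ((cmod (c v))^2 * (1 + real (mdeg v)) ^ Suc k))"
   by (intro sum_mono tbound l) (use mdeg_pred[of _ i] in \<open>simp add: q_def le_SucI\<close>)
  also have "... <= (\<Sum>v\<in>A. 2 ^ k * ((cmod (c v))^2 * (1 + real (mdeg v)) ^ Suc k))"
   by (rule sum_mono2) (use assms fB in auto)
  finally show ?thesis by (simp add: sum_distrib_left)
 qed
 show ?thesis by (rule exI[of _ "p ` A"], rule exI[of _ c1], rule exI[of _ "q ` B"], rule exI[of _ c2])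
    (use e b1 b2 assms fB in \<open>auto simp: fun_eq_iff\<close>)
qed

lemma nrm2_mult_fcomb_le:
 fixes c :: "('n::finite => nat) => complex"
 assumes "finite A"
 shows "nrm2 (%x. cplx (x $ i) * fcomb hermv A c x) <= 4 * (\<Sum>a\<in>A. (cmod (c a))^2 * (1 + real (mdeg a)))"
proof -
 obtain A1 c1 A2 c2 where *: "finite A1" "finite A2"
  "(%x. cplx (x $ i) * fcomb hermv A c x) = (%x. fcomb hermv A1 c1 x + fcomb hermv A2 c2 x)"
  "!!k. (\<Sum>b\<in>A1. (cmod (c1 b))^2 * (1 + real (mdeg b)) ^ k) <= 2 ^ k * (\<Sum>a\<in>A. (cmod (c a))^2 * (1 + real (mdeg a)) ^ Suc k)"
  "!!k. (\<Sum>b\<in>A2. (cmod (c2 b))^2 * (1 + real (mdeg b)) ^ k) <= 2 ^ k * (\<Sum>a\<in>A. (cmod (c a))^2 * (1 + real (mdeg a)) ^ Suc k)"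
  using mult_fcomb[OF assms, of i c] by blast
 have "nrm2 (%x. fcomb hermv A1 c1 x + fcomb hermv A2 c2 x) <= 2 * nrm2 (fcomb hermv A1 c1) + 2 * nrm2 (fcomb hermv A2 c2)"
  by (intro nrm2_add_le hermv.fcomb_L2)
 also have "... <= 4 * (\<Sum>a\<in>A. (cmod (c a))^2 * (1 + real (mdeg a)))"
  using *(4)[of 0] *(5)[of 0] by (simp add: hermv.nrm2_fcomb *(1,2))
 finally show ?thesis unfolding *(3) .
qed

lemma nrm2_mult2_fcomb_le:
 fixes c :: "('n::finite => nat) => complex"
 assumes "finite A"
 shows "nrm2 (%x. cplx (x $ i) * (cplx (x $ i) * fcomb hermv A c x)) <= 32 * (\<Sum>a\<in>A. (cmod (c a))^2 * (1 + real (mdeg a))^2)"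
proof -
 obtain A1 c1 A2 c2 where *: "finite A1" "finite A2"
  "(%x. cplx (x $ i) * fcomb hermv A c x) = (%x. fcomb hermv A1 c1 x + fcomb hermv A2 c2 x)"
  "!!k. (\<Sum>b\<in>A1. (cmod (c1 b))^2 * (1 + real (mdeg b)) ^ k) <= 2 ^ k * (\<Sum>a\<in>A. (cmod (c a))^2 * (1 + real (mdeg a)) ^ Suc k)"
  "!!k. (\<Sum>b\<in>A2. (cmod (c2 b))^2 * (1 + real (mdeg b)) ^ k) <= 2 ^ k * (\<Sum>a\<in>A. (cmod (c a))^2 * (1 + real (mdeg a)) ^ Suc k)"
  using mult_fcomb[OF assms, of i c] by blast
 have "(%x. cplx (x $ i) * (cplx (x $ i) * fcomb hermv A c x)) =
   (%x. cplx (x $ i) * fcomb hermv A1 c1 x + cplx (x $ i) * fcomb hermv A2 c2 x)"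
  using fun_cong[OF *(3)] by (simp add: distrib_left)
 then have "nrm2 (%x. cplx (x $ i) * (cplx (x $ i) * fcomb hermv A c x)) \<le>
   2 * nrm2 (%x. cplx (x $ i) * fcomb hermv A1 c1 x) + 2 * nrm2 (%x. cplx (x $ i) * fcomb hermv A2 c2 x)"
  by (simp only:) (intro nrm2_add_le schwartz_L2 schwartz_coord_mult fcomb_schwartz)
 also have "... <= 32 * (\<Sum>a\<in>A. (cmod (c a))^2 * (1 + real (mdeg a))^2)"
  using nrm2_mult_fcomb_le[OF *(1), of i c1] nrm2_mult_fcomb_le[OF *(2), of i c2] *(4)[of 1] *(5)[of 1] by (simp add: power2_eq_square)
 finally show ?thesis .
qed

text \<open>The substantial half of the description of the domain: a finite second spectral moment
  forces the product of f with x_i^2 into L^2. The bound is uniform over the partial sums, and Fatou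
  passes it to f along a subsequence converging almost everywhere.\<close>

lemma coord_sq_mult_L2:
 fixes f :: "real^'n::finite => complex"
 assumes f: "f \<in> L2" and s: "summable (%n. (evl TYPE('n) n)^2 * mass f n)"
 shows "(%x. cplx (x $ i) * (cplx (x $ i) * f x)) \<in> L2"
proof -
 let ?S = "%N. fcomb hermv {a. mdeg a < N} (fcoef hermv f)"
 let ?x = "%f x. cplx (x $ i) * (cplx (x $ i) * f x)"
 define K where "K = 32 * (\<Sum>n. (evl TYPE('n) n)^2 * mass f n)"
 have fm [measurable]: "f \<in> bmeas" by (rule L2_measurable[OF f])
 have Sm [measurable]: "?S N \<in> bmeas" for N by (rule L2_measurable[OF hermv.fcomb_L2])
 have b: "nrm2 (?x (?S N)) <= K" for N
 proof -
  have "(\<Sum>a::'n => nat | mdeg a < N. (cmod (fcoef hermv f a))^2 * (1 + real (mdeg a))^2)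
    <= (\<Sum>a::'n => nat | mdeg a < N. (cmod (fcoef hermv f a))^2 * (lam a)^2)"
   using lam_ge by (intro sum_mono mult_left_mono power_mono) auto
  also have "... = (\<Sum>n<N. (evl TYPE('n) n)^2 * mass f n)"
   unfolding hermv.sum_levels[symmetric] by (simp add: mass_def lam_evl sum_distrib_left mult.commute)
  also have "... <= (\<Sum>n. (evl TYPE('n) n)^2 * mass f n)" by (rule sum_le_suminf[OF s]) auto
  finally show ?thesis using nrm2_mult2_fcomb_le[OF hermv.fin_less, of i N "fcoef hermv f"] by (simp add: K_def)
 qed
 have "\<exists>r::nat=>nat. strict_mono r & (AE x in lborel. (%n. (cmod (f x - ?S (r n) x))^2) \<longlonglongrightarrow> 0)"
 proof (rule tendsto_L1_AE_subseq)
  show "integrable lborel (%x. (cmod (f x - ?S n x))^2)" for n by (intro L2_integrable L2_diff f hermv.fcomb_L2)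
  show "(%n. \<integral>x. norm ((cmod (f x - ?S n x))^2) \<partial>lborel) \<longlonglongrightarrow> 0"
   using hermv.expansion_tendsto[OF f] by (simp add: nrm2_def)
 qed
 then obtain r where r: "AE x in lborel. (%n. (cmod (f x - ?S (r n) x))^2) \<longlonglongrightarrow> 0" by blast
 have AE: "AE x in lborel. (%n. ?S (r n) x) \<longlonglongrightarrow> f x" using r
 proof eventually_elim
  case (elim x)
  have "(%n. sqrt ((cmod (f x - ?S (r n) x))^2)) \<longlonglongrightarrow> sqrt 0" by (rule tendsto_real_sqrt[OF elim])
  then have "(%n. cmod (f x - ?S (r n) x)) \<longlonglongrightarrow> 0" by simp
  then have "(%n. ?S (r n) x - f x) \<longlonglongrightarrow> 0"
   by (subst tendsto_norm_zero_iff[symmetric]) (simp add: norm_minus_commute)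
  then show ?case by (simp add: LIM_zero_iff)
 qed
 have "(\<integral>\<^sup>+x. ennreal ((cmod (?x f x))^2) \<partial>lborel) = (\<integral>\<^sup>+x. liminf (%n. ennreal ((cmod (?x (?S (r n)) x))^2)) \<partial>lborel)"
 proof (rule nn_integral_cong_AE)
  show "AE x in lborel. ennreal ((cmod (?x f x))^2) = liminf (%n. ennreal ((cmod (?x (?S (r n)) x))^2))" using AE
  proof eventually_elim
   case (elim x)
   have "(%n. ennreal ((cmod (?x (?S (r n)) x))^2)) \<longlonglongrightarrow> ennreal ((cmod (?x f x))^2)"
    by (intro tendsto_ennrealI tendsto_intros elim)
   from lim_imp_Liminf[OF _ this] show ?case by simp
  qed
 qed
 also have "... <= liminf (%n. \<integral>\<^sup>+x. ennreal ((cmod (?x (?S (r n)) x))^2) \<partial>lborel)"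
  by (rule nn_integral_liminf) measurable
 also have "... <= ennreal K"
 proof (rule Liminf_le)
  have "(\<integral>\<^sup>+x. ennreal ((cmod (?x (?S (r n)) x))^2) \<partial>lborel) = ennreal (nrm2 (?x (?S (r n))))" for n
   unfolding nrm2_def by (rule nn_integral_eq_integral) (auto intro!: L2_integrable schwartz_L2 schwartz_coord_mult fcomb_schwartz)
  then show "eventually (%n. (\<integral>\<^sup>+x. ennreal ((cmod (?x (?S (r n)) x))^2) \<partial>lborel) <= ennreal K) sequentially"
   using b by (intro always_eventually) (simp add: ennreal_leI)
 qed simp
 finally have fin: "(\<integral>\<^sup>+x. ennreal ((cmod (?x f x))^2) \<partial>lborel) <= ennreal K" .
 show ?thesis
 proof (rule L2I)
  show "?x f \<in> bmeas" by measurable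
  show "integrable lborel (%x. (cmod (?x f x))^2)"
  proof (rule integrableI_bounded)
   show "(\<integral>\<^sup>+x. ennreal (norm ((cmod (?x f x))^2)) \<partial>lborel) < \<infinity>"
    using fin by (simp add: order_le_less_trans)
  qed measurable
 qed
qed

text \<open>The equation for the coefficients dictates the candidate u = (norm x)^2 f - k for the
  Laplacian. That it is the weak Laplacian follows from Parseval, with H moved onto the test
  function.\<close>

lemma oscillator_memI:
 fixes f k :: "real^'n::finite => complex"
 assumes f: "f \<in> L2" and k: "k \<in> L2" and c: "!!a. fcoef hermv k a = cplx (lam a) * fcoef hermv f a"
 shows "(f, k) \<in> oscillator"
proof -
 have "mass k = (%n. (evl TYPE('n) n)^2 * mass f n)"
  by (rule ext) (simp add: mass_def c norm_mult power_mult_distrib lam_evl sum_distrib_left)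
 then have s: "summable (%n. (evl TYPE('n) n)^2 * mass f n)" using summable_mass[OF k] by simp
 have "(%x. (norm x)^2 *\<^sub>R f x) = (%x. \<Sum>i\<in>UNIV. cplx (x $ i) * (cplx (x $ i) * f x))"
  unfolding norm_sq_sum by (rule ext) (simp add: scaleR_sum_left scaleR_conv_of_real power2_eq_square mult.assoc sum_distrib_right)
 then have xf: "(%x. (norm x)^2 *\<^sub>R f x) \<in> L2" by (simp only:) (intro L2_sum coord_sq_mult_L2 f s)
 define u where "u x = (norm x)^2 *\<^sub>R f x - k x" for x
 have u: "u \<in> L2" unfolding u_def by (intro L2_diff xf k)
 have "weak_laplacian f u" unfolding weak_laplacian_def
 proof
  fix \<phi> :: "real^'n => complex" assume p: "\<phi> \<in> schwartz"
  have "(%n. \<Sum>a | mdeg a = n. fcoef hermv f a * fcoef hermv (hosc \<phi>) a) sums (LBINT x. f x * hosc \<phi> x)"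
   by (rule hermv.parseval_bilinear[OF f schwartz_L2[OF hosc_schwartz[OF p]]])
  moreover have "(%n. \<Sum>a | mdeg a = n. fcoef hermv k a * fcoef hermv \<phi> a) sums (LBINT x. k x * \<phi> x)"
   by (rule hermv.parseval_bilinear[OF k schwartz_L2[OF p]])
  ultimately have e: "(LBINT x. f x * hosc \<phi> x) = (LBINT x. k x * \<phi> x)"
   by (simp add: fcoef_hosc[OF p] c mult_ac sums_unique2)
  have i: "complex_integrable lborel (%x. f x * laplacian \<phi> x)" "complex_integrable lborel (%x. (norm x)^2 *\<^sub>R f x * \<phi> x)"
   "complex_integrable lborel (%x. k x * \<phi> x)" "complex_integrable lborel (%x. f x * hosc \<phi> x)"
   by (intro integrable_mult_L2 f k xf schwartz_L2 laplacian_schwartz hosc_schwartz p)+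
  have "(LBINT x. f x * hosc \<phi> x) = (LBINT x. (norm x)^2 *\<^sub>R f x * \<phi> x - f x * laplacian \<phi> x)"
   by (simp add: hosc_def scaleR_conv_of_real algebra_simps)
  also have "... = (LBINT x. (norm x)^2 *\<^sub>R f x * \<phi> x) - (LBINT x. f x * laplacian \<phi> x)"
   by (rule Bochner_Integration.integral_diff[OF i(2,1)])
  finally have "(LBINT x. f x * laplacian \<phi> x) = (LBINT x. (norm x)^2 *\<^sub>R f x * \<phi> x) - (LBINT x. k x * \<phi> x)"
   using e by (simp add: algebra_simps)
  also have "... = (LBINT x. (norm x)^2 *\<^sub>R f x * \<phi> x - k x * \<phi> x)"
   by (rule Bochner_Integration.integral_diff[OF i(2,3), symmetric])
  also have "... = (LBINT x. u x * \<phi> x)" by (simp add: u_def left_diff_distrib)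
  finally show "(LBINT x. f x * laplacian \<phi> x) = (LBINT x. u x * \<phi> x)" .
 qed
 moreover have "AE_eq k (%x. - u x + (norm x)^2 *\<^sub>R f x)" by (simp add: AE_eq_def u_def)
 ultimately show ?thesis using f k xf u unfolding oscillator_def by auto
qed

lemma Domain_oscillator:
 "Domain (oscillator :: ((real^'n::finite => complex) \<times> _) set) =
  {f \<in> L2. summable (%n. (evl TYPE('n) n)^2 * mass f n)}"
proof (intro set_eqI iffI)
 fix f :: "real^'n => complex"
 assume "f \<in> Domain oscillator"
 then obtain h where h: "(f, h) \<in> oscillator" by blast
 then have "f \<in> L2" "h \<in> L2" by (auto simp: oscillator_def)
 moreover have "mass h = (%n. (evl TYPE('n) n)^2 * mass f n)"
  by (rule ext) (simp add: mass_def oscillator_fcoef[OF h] norm_mult power_mult_distrib lam_evl sum_distrib_left)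
 ultimately show "f \<in> {f \<in> L2. summable (%n. (evl TYPE('n) n)^2 * mass f n)}" using summable_mass[of h] by simp
next
 fix f :: "real^'n => complex"
 assume "f \<in> {f \<in> L2. summable (%n. (evl TYPE('n) n)^2 * mass f n)}"
 then have f: "f \<in> L2" and s: "summable (%n. (evl TYPE('n) n)^2 * mass f n)" by auto
 have "(\<Sum>a | mdeg a = n. (cmod (cplx (lam a) * fcoef hermv f a))^2) = (evl TYPE('n) n)^2 * mass f n" for n
  by (simp add: mass_def norm_mult power_mult_distrib lam_evl sum_distrib_left)
 with s have "summable (%n. \<Sum>a | mdeg a = n. (cmod (cplx (lam a) * fcoef hermv f a))^2)" by simp
 from hermv.expansion_exists[OF this]
 obtain k where "k \<in> L2" "!!a. fcoef hermv k a = cplx (lam a) * fcoef hermv f a" by blast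
 then show "f \<in> Domain oscillator" using oscillator_memI[OF f] by blast
qed

lemma diag_is_spectral_resolution:
 fixes E :: "(real^'n::finite) proj_measure"
 assumes E: "diag E" shows "is_spectral_resolution oscillator E" unfolding is_spectral_resolution_def
proof (intro conjI)
 show "is_proj_measure E" by (rule diag_is_proj_measure[OF E])
 have "(\<integral>\<^sup>+ l. ennreal (l^2) \<partial>spectral_measure E f) < top \<longleftrightarrow> summable (%n. (evl TYPE('n) n)^2 * mass f n)"
  if f: "f \<in> L2" for f
 proof -
  have "(\<integral>\<^sup>+ l. ennreal (l^2) \<partial>spectral_measure E f) = (\<Sum>n. ennreal ((evl TYPE('n) n)^2 * mass f n))"
   unfolding spectral_measure_diag[OF E f] by (subst nn_integral_smeas) (auto simp: ennreal_mult')
  moreover have "(\<Sum>n. ennreal ((evl TYPE('n) n)^2 * mass f n)) < top \<longleftrightarrow> summable (%n. (evl TYPE('n) n)^2 * mass f n)"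
  proof
   assume "(\<Sum>n. ennreal ((evl TYPE('n) n)^2 * mass f n)) < top"
   then show "summable (%n. (evl TYPE('n) n)^2 * mass f n)" by (intro summable_suminf_not_top) auto
  next
   assume "summable (%n. (evl TYPE('n) n)^2 * mass f n)"
   then show "(\<Sum>n. ennreal ((evl TYPE('n) n)^2 * mass f n)) < top" by (subst suminf_ennreal2) auto
  qed
  ultimately show ?thesis by simp
 qed
 then show "Domain oscillator = {f \<in> L2. (\<integral>\<^sup>+ l. ennreal (l^2) \<partial>spectral_measure E f) < top}"
  unfolding Domain_oscillator by auto
 show "\<forall>(f, h)\<in>oscillator. \<forall>g\<in>Domain oscillator. L2_inner h g = spectral_integral E (%l. l) f g"
 proof clarify
  fix f h g k :: "real^'n => complex"
  assume fh: "(f, h) \<in> oscillator" and gk: "(g, k) \<in> oscillator"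
  have dom: "f \<in> Domain oscillator" "g \<in> Domain oscillator" using fh gk by auto
  then have L: "f \<in> L2" "g \<in> L2" unfolding Domain_oscillator by auto
  have h: "h \<in> L2" using fh by (auto simp: oscillator_def)
  have s: "summable (%n. \<bar>evl TYPE('n) n\<bar> * mass f n)" if "f \<in> Domain oscillator" for f :: "real^'n => complex"
  proof (rule summable_comparison_test')
   show "summable (%n. (evl TYPE('n) n)^2 * mass f n)" using that unfolding Domain_oscillator by auto
   fix n
   \<comment> \<open>All eigenvalues are at least 1, so the second moment of the domain condition
     controls the first one.\<close>
   have "1 <= 2 * n + CARD('n)" using zero_less_card_finite[where 'a='n] by linarith
   then have "1 <= evl TYPE('n) n" using of_nat_mono[of 1 "2 * n + CARD('n)", where 'a=real] by (simp add: evl_def)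
   then have "\<bar>evl TYPE('n) n\<bar> <= (evl TYPE('n) n)^2" by (simp add: power2_eq_square)
   then show "norm (\<bar>evl TYPE('n) n\<bar> * mass f n) <= (evl TYPE('n) n)^2 * mass f n" by (simp add: abs_mult mult_right_mono)
  qed
  have "(%n. evl TYPE('n) n * (\<Sum>a | mdeg a = n. fcoef hermv f a * cnj (fcoef hermv g a))) sums spectral_integral E (%l. l) f g"
   using spectral_integral_diag[OF E _ L s[OF dom(1)] s[OF dom(2)]] by simp
  moreover have "(%n. evl TYPE('n) n * (\<Sum>a | mdeg a = n. fcoef hermv f a * cnj (fcoef hermv g a))) sums L2_inner h g"
   using L2_inner_sums[OF h L(2)] by (simp add: oscillator_fcoef[OF fh] lam_evl sum_distrib_left mult.assoc)
  ultimately show "L2_inner h g = spectral_integral E (%l. l) f g" using sums_unique2 by blast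
 qed
qed

subsection \<open>Every spectral resolution is diagonal\<close>

locale proj_measure =
 fixes E :: "(real^'n::finite) proj_measure"
 assumes pm: "is_proj_measure E"
begin

lemma pm_L2: "A \<in> sets borel ==> f \<in> L2 ==> E A f \<in> L2" using pm by (simp add: is_proj_measure_def)

lemma pm_sym: "A \<in> sets borel ==> f \<in> L2 ==> g \<in> L2 ==> L2_inner (E A f) g = L2_inner f (E A g)"
 using pm by (simp add: is_proj_measure_def)

lemma pm_Int:
 assumes "A \<in> sets borel" "B \<in> sets borel" "f \<in> L2" shows "AE_eq (E A (E B f)) (E (A \<inter> B) f)"
proof -
 have "AE_eq (E (A \<inter> B) f) (E A (E B f))" using pm assms by (simp add: is_proj_measure_def)
 then show ?thesis by (simp add: AE_eq_def eq_commute)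
qed

lemma AE_eq_refl: "AE_eq f f" by (simp add: AE_eq_def)

lemma inner_Int_left: "A \<in> sets borel ==> B \<in> sets borel ==> f \<in> L2 ==> g \<in> L2 ==>
  L2_inner (E A (E B f)) g = L2_inner (E (A \<inter> B) f) g" by (rule L2_inner_cong_AE) (auto intro!: pm_L2 pm_Int AE_eq_refl)

definition wt :: "(real^'n => complex) => real set => real" where
 "wt f A = nrm2 (E A f)"

lemma wt_nonneg [simp]: "0 <= wt f A" by (simp add: wt_def)

lemma inner_wt:
 assumes "A \<in> sets borel" "f \<in> L2" shows "L2_inner (E A f) f = cplx (wt f A)"
proof -
 have "cplx (wt f A) = L2_inner (E A f) (E A f)" by (simp add: wt_def L2_inner_self)
 also have "... = L2_inner (E A (E A f)) f" using assms by (simp add: pm_sym pm_L2)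
 also have "... = L2_inner (E A f) f" using inner_Int_left[OF assms(1,1,2,2)] by simp
 finally show ?thesis by simp
qed

lemma wt_sums:
 fixes A :: "nat => real set"
 assumes "range A \<subseteq> sets borel" "disjoint_family A" "f \<in> L2" shows "(%i. wt f (A i)) sums wt f (\<Union>i. A i)"
proof -
 have Ai: "A i \<in> sets borel" for i using assms by auto
 then have UA: "(\<Union>i. A i) \<in> sets borel" by blast
 have "(%i. L2_inner (E (A i) f) f) sums L2_inner (E (\<Union>i. A i) f) f" using pm assms unfolding is_proj_measure_def by blast
 then show ?thesis by (simp add: inner_wt[OF Ai assms(3)] inner_wt[OF UA assms(3)] sums_of_real_iff)
qed

lemma wt_empty: "f \<in> L2 ==> wt f {} = 0"
 using wt_sums[of "%_. {}" f] by (simp add: disjoint_family_on_def sums_iff summable_const_iff)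

lemma sets_spectral [simp, measurable_cong]: "sets (spectral_measure E f) = sets borel"
 and space_spectral [simp]: "space (spectral_measure E f) = UNIV" using sets.sigma_sets_eq[of "borel :: real measure"]
 by (simp_all add: spectral_measure_def sets_measure_of_conv space_measure_of_conv)

lemma emeasure_spectral:
 assumes "f \<in> L2" "A \<in> sets borel" shows "emeasure (spectral_measure E f) A = ennreal (wt f A)"
proof -
 have e: "ennreal (Re (L2_inner (E A f) f)) = ennreal (wt f A)" if "A \<in> sets borel" for A by (simp add: inner_wt[OF that assms(1)])
 have "emeasure (spectral_measure E f) A = ennreal (Re (L2_inner (E A f) f))"
 proof (rule emeasure_measure_of[OF spectral_measure_def])
  show "positive (sets (spectral_measure E f)) (%A. ennreal (Re (L2_inner (E A f) f)))" by (simp add: positive_def e wt_empty assms(1))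
  show "countably_additive (sets (spectral_measure E f)) (%A. ennreal (Re (L2_inner (E A f) f)))" unfolding countably_additive_def
  proof (intro allI impI)
   fix A :: "nat => real set"
   assume A: "range A \<subseteq> sets (spectral_measure E f)" and dis: "disjoint_family A" and U: "(\<Union>i. A i) \<in> sets (spectral_measure E f)"
   have "(%i. wt f (A i)) sums wt f (\<Union>i. A i)" using wt_sums[of A f] A dis assms(1) by simp
   then have "(\<Sum>i. ennreal (wt f (A i))) = ennreal (wt f (\<Union>i. A i))" by (intro suminf_ennreal_eq) auto
   moreover have "A i \<in> sets borel" for i using A by auto
   moreover have "(\<Union>i. A i) \<in> sets borel" using U by (simp only: sets_spectral)
   ultimately show "(\<Sum>i. ennreal (Re (L2_inner (E (A i) f) f))) = ennreal (Re (L2_inner (E (\<Union>i. A i) f) f))"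
    by (simp only: e)
  qed
 qed (use assms in auto)
 then show ?thesis by (simp add: e assms(2))
qed

lemma finite_measure_spectral: "f \<in> L2 ==> finite_measure (spectral_measure E f)"
 by (rule finite_measureI) (simp add: emeasure_spectral)

lemma measure_spectral: "f \<in> L2 ==> A \<in> sets borel ==> measure (spectral_measure E f) A = wt f A"
 by (simp add: measure_def emeasure_spectral)

text \<open>\<open>spectral_integral\<close> polarizes, so for g = E(B) f it involves the measures
  of f + c E(B) f with c a power of i. On B such a vector is (1 + c) times f, and the squared
  modulus of 1 + c is 2 + 2 Re c.\<close>

lemma wt_perturb:
 assumes A: "A \<in> sets borel" and B: "B \<in> sets borel" and f: "f \<in> L2" and c: "cmod c = 1"
 shows "wt (%x. f x + c * E B f x) A = wt f A + (1 + 2 * Re c) * wt f (A \<inter> B)"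
proof -
 define g where "g = E B f"
 define h where "h x = f x + c * g x" for x
 have g: "g \<in> L2" unfolding g_def by (rule pm_L2[OF B f])
 have cg: "(%x. c * g x) \<in> L2" by (rule L2_scale[OF g])
 have h: "h \<in> L2" unfolding h_def by (intro L2_add L2_scale f g)
 have AB: "A \<inter> B \<in> sets borel" "B \<inter> (A \<inter> B) \<in> sets borel" using A B by auto
 note L = pm_L2[OF A]
 have left: "L2_inner h u = L2_inner f u + c * L2_inner g u" if "u \<in> L2" for u
  unfolding h_def by (subst L2_inner_add_left[OF f cg that]) (simp add: L2_inner_scale_left)
 have right: "L2_inner u h = L2_inner u f + cnj c * L2_inner u g" if "u \<in> L2" for u
  unfolding h_def by (subst L2_inner_add_right[OF f cg that]) (simp add: L2_inner_scale_right)
 have gf: "L2_inner (E A g) f = cplx (wt f (A \<inter> B))"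
  unfolding g_def inner_Int_left[OF A B f f] by (rule inner_wt[OF AB(1) f])
 have fg: "L2_inner (E A f) g = cplx (wt f (A \<inter> B))"
  using gf L2_inner_commute[of "E A f" g] pm_sym[OF A g f] pm_sym[OF A f g] L2_inner_commute[of "E A g" f] by simp
 have gg: "L2_inner (E A g) g = cplx (wt f (A \<inter> B))"
 proof -
  have "L2_inner (E A g) g = L2_inner (E (A \<inter> B) f) (E B f)" unfolding g_def by (rule inner_Int_left[OF A B f pm_L2[OF B f]])
  also have "... = L2_inner (E B (E (A \<inter> B) f)) f" by (rule pm_sym[OF B pm_L2[OF AB(1) f] f, symmetric])
  also have "... = L2_inner (E (B \<inter> (A \<inter> B)) f) f" by (rule inner_Int_left[OF B AB(1) f f])
  also have "B \<inter> (A \<inter> B) = A \<inter> B" by auto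
  finally show ?thesis by (simp add: inner_wt[OF AB(1) f])
 qed
 have "cplx (wt h A) = L2_inner (E A h) h" by (rule inner_wt[OF A h, symmetric])
 also have "... = L2_inner (E A h) f + cnj c * L2_inner (E A h) g" by (rule right[OF L[OF h]])
 also have "L2_inner (E A h) f = L2_inner f (E A f) + c * L2_inner g (E A f)" unfolding pm_sym[OF A h f] by (rule left[OF L[OF f]])
 also have "L2_inner (E A h) g = L2_inner f (E A g) + c * L2_inner g (E A g)" unfolding pm_sym[OF A h g] by (rule left[OF L[OF g]])
 also have "L2_inner f (E A f) + c * L2_inner g (E A f) + cnj c * (L2_inner f (E A g) + c * L2_inner g (E A g)) =
   cplx (wt f A) + (c + cnj c + c * cnj c) * cplx (wt f (A \<inter> B))"
  unfolding pm_sym[OF A f f, symmetric] pm_sym[OF A g f, symmetric] pm_sym[OF A f g, symmetric] pm_sym[OF A g g, symmetric]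
   inner_wt[OF A f] gf fg gg by (simp add: algebra_simps)
 also have "c + cnj c + c * cnj c = cplx (1 + 2 * Re c)" using c by (simp add: complex_add_cnj complex_norm_square[symmetric])
 finally have "cplx (wt h A) = cplx (wt f A + (1 + 2 * Re c) * wt f (A \<inter> B))" by simp
 then show ?thesis unfolding h_def g_def by (simp only: of_real_eq_iff)
qed

lemma spectral_measure_perturb:
 assumes B: "B \<in> sets borel" and f: "f \<in> L2" and c: "cmod c = 1" "- 1 <= Re c"
 shows "spectral_measure E (%x. f x + c * E B f x) =
  density (spectral_measure E f) (%l. ennreal (1 + (1 + 2 * Re c) * indicator B l))"
proof (rule measure_eqI)
 interpret finite_measure "spectral_measure E f" by (rule finite_measure_spectral[OF f])
 fix A assume "A \<in> sets (spectral_measure E (%x. f x + c * E B f x))"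
 then have A: "A \<in> sets borel" by simp
 have [measurable]: "A \<in> sets borel" "B \<in> sets borel" by fact+
 have d: "0 <= 2 + 2 * Re c" using c(2) by simp
 have "emeasure (density (spectral_measure E f) (%l. ennreal (1 + (1 + 2 * Re c) * indicator B l))) A =
  (\<integral>\<^sup>+l. ennreal (1 + (1 + 2 * Re c) * indicator B l) * indicator A l \<partial>spectral_measure E f)"
  by (rule emeasure_density) auto
 also have "... = (\<integral>\<^sup>+l. indicator (A - B) l + ennreal (2 + 2 * Re c) * indicator (A \<inter> B) l \<partial>spectral_measure E f)"
  by (rule nn_integral_cong) (auto simp: indicator_def)
 also have "... = ennreal (wt f (A - B)) + ennreal (2 + 2 * Re c) * ennreal (wt f (A \<inter> B))"
  by (subst nn_integral_add) (auto simp: nn_integral_cmult emeasure_spectral[OF f])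
 also have "... = ennreal (wt f (A - B) + (2 + 2 * Re c) * wt f (A \<inter> B))"
  using d by (subst ennreal_plus) (auto simp: ennreal_mult')
 also have "wt f (A - B) + (2 + 2 * Re c) * wt f (A \<inter> B) = wt f A + (1 + 2 * Re c) * wt f (A \<inter> B)"
 proof -
  have "wt f A = wt f (A - B) + wt f (A \<inter> B)"
  proof -
   have e: "(A - B) \<union> (A \<inter> B) = A" "(A - B) \<inter> (A \<inter> B) = {}" by auto
   show ?thesis using finite_measure_Union[OF _ _ e(2)] unfolding e(1) by (simp add: measure_spectral[OF f])
  qed
  then show ?thesis by (simp add: algebra_simps)
 qed
 also have "ennreal ... = emeasure (spectral_measure E (%x. f x + c * E B f x)) A"
  by (subst emeasure_spectral[OF L2_add[OF f L2_scale[OF pm_L2[OF B f]]] A])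
    (simp add: wt_perturb[OF A B f c(1)])
 finally show "emeasure (spectral_measure E (%x. f x + c * E B f x)) A =
  emeasure (density (spectral_measure E f) (%l. ennreal (1 + (1 + 2 * Re c) * indicator B l))) A" by simp
qed simp

text \<open>In the polarization sum the common term ?I drops out because the powers of i add up to
  zero; of ?J only k = 0 and k = 2 contribute, each with weight 2, against the denominator
  4.\<close>

lemma spectral_integral_restrict:
 assumes B: "B \<in> sets borel" and f: "f \<in> L2" and int: "integrable (spectral_measure E f) (%l. l)"
 shows "spectral_integral E (%l. l) f (E B f) = cplx (\<integral>l. indicator B l * l \<partial>spectral_measure E f)"
proof -
 have [measurable]: "B \<in> sets borel" by fact
 let ?I = "\<integral>l. l \<partial>spectral_measure E f" and ?J = "\<integral>l. indicator B l * l \<partial>spectral_measure E f"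
 have intB: "integrable (spectral_measure E f) (%l. indicator B l * l)"
  by (rule Bochner_Integration.integrable_bound[OF int]) (auto simp: indicator_def)
 have i: "(\<integral>l. l \<partial>spectral_measure E (%x. f x + c * E B f x)) = ?I + (1 + 2 * Re c) * ?J"
  if c: "cmod c = 1" "- 1 <= Re c" for c
 proof -
  have "(\<integral>l. l \<partial>spectral_measure E (%x. f x + c * E B f x)) =
   (\<integral>l. (1 + (1 + 2 * Re c) * indicator B l) *\<^sub>R l \<partial>spectral_measure E f)"
   unfolding spectral_measure_perturb[OF B f c] by (rule integral_density) (use c(2) in \<open>auto simp: indicator_def\<close>)
  also have "... = (\<integral>l. l + (1 + 2 * Re c) * (indicator B l * l) \<partial>spectral_measure E f)" by (simp add: algebra_simps)
  also have "... = ?I + (1 + 2 * Re c) * ?J" using int intB by simp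
  finally show ?thesis .
 qed
 have i3: "\<i> ^ 3 = - \<i>" by (simp add: power3_eq_cube)
 have s: "{..<4} = {0, 1, 2, 3 :: nat}" by auto
 have k: "(\<integral>l. l \<partial>spectral_measure E (%x. f x + \<i> ^ k * E B f x)) = ?I + (1 + 2 * Re (\<i> ^ k)) * ?J" if "k < 4" for k
 proof (rule i)
  show "cmod (\<i> ^ k) = 1" by (simp add: norm_power)
  show "- 1 <= Re (\<i> ^ k)" using abs_Re_le_cmod[of "\<i> ^ k"] by (simp add: norm_power)
 qed
 have "spectral_integral E (%l. l) f (E B f) = (\<Sum>k<4. \<i> ^ k * cplx (?I + (1 + 2 * Re (\<i> ^ k)) * ?J)) / 4"
  unfolding spectral_integral_def using k by (intro arg_cong[where f="%z. z / 4"] sum.cong) auto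
 also have "... = cplx ?J" unfolding s by (simp add: i3 algebra_simps)
 finally show ?thesis .
qed

end

text \<open>Testing the defining identity of the resolution with E(B) f, for f =
  \<open>hermc a\<close>, shows that l - \<open>lam a\<close> integrates to zero over every Borel
  set B against the spectral measure of f. That measure therefore sits at the single point
  \<open>lam a\<close>.\<close>

lemma resolution_eigen:
 fixes E :: "(real^'n::finite) proj_measure"
 assumes R: "is_spectral_resolution oscillator E" and A: "A \<in> sets borel"
 shows "AE_eq (E A (hermc a)) (%x. of_bool (lam a \<in> A) * hermc a x)"
proof -
 interpret proj_measure E by standard (use R in \<open>simp add: is_spectral_resolution_def\<close>)
 define f where "f = hermc a"
 have f: "f \<in> L2" unfolding f_def by (rule hermv.basis_L2)
 interpret mu: finite_measure "spectral_measure E f" by (rule finite_measure_spectral[OF f])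
 have memf: "(f, %x. cplx (lam a) * f x) \<in> oscillator" by (rule oscillator_memI[OF f L2_scale[OF f]])
    (auto simp: f_def hermv.fcoef_scale hermv.fcoef_basis)
 have dom: "g \<in> Domain oscillator \<longleftrightarrow> g \<in> L2 & (\<integral>\<^sup>+ l. ennreal (l^2) \<partial>spectral_measure E g) < top" for g
  using R by (auto simp: is_spectral_resolution_def)
 have "f \<in> Domain oscillator" using memf by blast
 then have fin: "(\<integral>\<^sup>+ l. ennreal (l^2) \<partial>spectral_measure E f) < top" using dom by blast
 then have int2: "integrable (spectral_measure E f) (%l. l^2)" by (intro integrableI_bounded) auto
 have int: "integrable (spectral_measure E f) (%l. l)"
 proof (rule Bochner_Integration.integrable_bound)
  show "integrable (spectral_measure E f) (%l. 1 + l^2)" using int2 by simp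
  have "\<bar>l\<bar> <= 1 + l^2" for l :: real using sum_squares_bound[of "\<bar>l\<bar>" 1] by simp
  then show "AE l in spectral_measure E f. norm l <= norm (1 + l^2)" by simp
 qed simp
 \<comment> \<open>The identity is only available for test vectors in the domain. The spectral
   measure of E(B) f is the restriction of that of f to B, so its second moment is finite
   too.\<close>
 have domB: "E B f \<in> Domain oscillator" if B: "B \<in> sets borel" for B unfolding dom
 proof
  show "E B f \<in> L2" by (rule pm_L2[OF B f])
  have [measurable]: "B \<in> sets borel" by fact
  have "spectral_measure E (E B f) = density (spectral_measure E f) (indicator B)"
  proof (rule measure_eqI)
   fix A assume "A \<in> sets (spectral_measure E (E B f))"
   then have A: "A \<in> sets borel" by simp
   have "cplx (wt (E B f) A) = L2_inner (E A (E B f)) (E B f)" by (rule inner_wt[OF A pm_L2[OF B f], symmetric])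
   also have "... = L2_inner (E (A \<inter> B) f) (E B f)" by (rule inner_Int_left[OF A B f pm_L2[OF B f]])
   also have "... = L2_inner (E B (E (A \<inter> B) f)) f" using A B by (intro pm_sym[OF B pm_L2[OF _ f] f, symmetric]) auto
   also have "... = L2_inner (E (B \<inter> (A \<inter> B)) f) f" using A B by (intro inner_Int_left f) auto
   also have "B \<inter> (A \<inter> B) = A \<inter> B" by auto
   also have "L2_inner (E (A \<inter> B) f) f = cplx (wt f (A \<inter> B))" using A B by (intro inner_wt f) auto
   finally have "wt (E B f) A = wt f (A \<inter> B)" by (simp only: of_real_eq_iff)
   then show "emeasure (spectral_measure E (E B f)) A = emeasure (density (spectral_measure E f) (indicator B)) A"
    using A B by (simp add: emeasure_spectral pm_L2 f emeasure_density indicator_inter_arith[symmetric] Int_commute)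
  qed simp
  then have "(\<integral>\<^sup>+ l. ennreal (l^2) \<partial>spectral_measure E (E B f)) = (\<integral>\<^sup>+ l. indicator B l * ennreal (l^2) \<partial>spectral_measure E f)"
   by (simp add: nn_integral_density)
  also have "... <= (\<integral>\<^sup>+ l. ennreal (l^2) \<partial>spectral_measure E f)"
   by (rule nn_integral_mono) (auto simp: indicator_def)
  finally show "(\<integral>\<^sup>+ l. ennreal (l^2) \<partial>spectral_measure E (E B f)) < top" using fin by simp
 qed
 have key: "(\<integral>l. indicator B l * (l - lam a) \<partial>spectral_measure E f) = 0" if B: "B \<in> sets borel" for B
 proof -
  have [measurable]: "B \<in> sets borel" by fact
  have "L2_inner (%x. cplx (lam a) * f x) (E B f) = spectral_integral E (%l. l) f (E B f)"
   using R memf domB[OF B] unfolding is_spectral_resolution_def by blast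
  also have "... = cplx (\<integral>l. indicator B l * l \<partial>spectral_measure E f)"
   by (rule spectral_integral_restrict[OF B f int])
  also have "L2_inner (%x. cplx (lam a) * f x) (E B f) = cplx (lam a * wt f B)"
   using inner_wt[OF B f] pm_sym[OF B f f] by (simp add: L2_inner_scale_left)
  finally have "lam a * wt f B = (\<integral>l. indicator B l * l \<partial>spectral_measure E f)" by (simp only: of_real_eq_iff)
  moreover have "wt f B = (\<integral>l. indicator B l \<partial>spectral_measure E f)" using B by (simp add: measure_spectral[OF f])
  moreover have "integrable (spectral_measure E f) (%l. indicator B l * l)"
   by (rule Bochner_Integration.integrable_bound[OF int]) (auto simp: indicator_def)
  ultimately show ?thesis by (simp add: right_diff_distrib B mu.emeasure_eq_measure mult.commute)
 qed
 \<comment> \<open>The sign s selects a side of \<open>lam a\<close>; there the integrand has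
   constant sign and zero integral, so B is a null set.\<close>
 have null: "wt f B = 0" if B: "B \<in> sets borel" and side: "!!l. l \<in> B ==> 0 < s * (l - lam a)" for B s
 proof -
  have [measurable]: "B \<in> sets borel" by fact
  have nn: "0 <= s * (indicator B l * (l - lam a))" for l using side[of l] by (auto simp: indicator_def)
  have i: "integrable (spectral_measure E f) (%l. s * (indicator B l * (l - lam a)))"
   by (intro integrable_mult_right Bochner_Integration.integrable_bound[OF Bochner_Integration.integrable_diff[OF int mu.integrable_const[of "lam a"]]])
     (auto simp: indicator_def)
  have "(\<integral>l. s * (indicator B l * (l - lam a)) \<partial>spectral_measure E f) = 0" using key[OF B] by simp
  then have "AE l in spectral_measure E f. s * (indicator B l * (l - lam a)) = 0" using integral_nonneg_eq_0_iff_AE[OF i] nn by auto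
  then have "AE l in spectral_measure E f. l \<notin> B"
   by eventually_elim (use side side[of "lam a"] in \<open>auto simp: indicator_def\<close>)
  then have "B \<in> null_sets (spectral_measure E f)" using AE_iff_null_sets[of B "spectral_measure E f"] B by simp
  then have "measure (spectral_measure E f) B = 0" by (rule measure_eq_0_null_sets)
  then show ?thesis by (simp add: measure_spectral[OF f B])
 qed
 have off: "wt f B = 0" if B: "B \<in> sets borel" and "lam a \<notin> B" for B
 proof -
  have [measurable]: "B \<in> sets borel" by fact
  have BB: "B \<inter> {..<lam a} \<in> sets borel" "B \<inter> {lam a<..} \<in> sets borel" by auto
  have "wt f B = measure (spectral_measure E f) ((B \<inter> {..<lam a}) \<union> (B \<inter> {lam a<..}))"
   unfolding measure_spectral[OF f B, symmetric]
   by (rule arg_cong[where f="measure _"]) (use that(2) in \<open>auto simp: not_less_iff_gr_or_eq\<close>)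
  also have "... <= wt f (B \<inter> {..<lam a}) + wt f (B \<inter> {lam a<..})"
   unfolding measure_spectral[OF f BB(1), symmetric] measure_spectral[OF f BB(2), symmetric]
   by (rule measure_subadditive) (use BB in auto)
  also have "... = 0" using null[OF BB(1), of "-1"] null[OF BB(2), of 1] by simp
  finally show ?thesis using wt_nonneg[of f B] by linarith
 qed
 have [measurable]: "A \<in> sets borel" by fact
 show ?thesis
 proof (cases "lam a \<in> A")
  case False
  then have "nrm2 (E A f) = 0" using off[OF A] by (simp add: wt_def)
  from nrm2_zero_AE[OF pm_L2[OF A f] this] show ?thesis using False by (simp add: AE_eq_def f_def)
 next
  case True
  have U: "wt f UNIV = nrm2 f"
  proof -
   have "AE_eq (E UNIV f) f" using pm f by (simp add: is_proj_measure_def)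
   then have "L2_inner (E UNIV f) f = L2_inner f f" by (intro L2_inner_cong_AE pm_L2 f AE_eq_refl) auto
   then show ?thesis by (simp add: inner_wt f L2_inner_self)
  qed
  have "wt f UNIV = wt f A + wt f (- A)" using mu.finite_measure_Union[of A "- A"] by (simp add: measure_spectral[OF f])
  moreover have "wt f (- A) = 0" using True by (intro off) auto
  ultimately have wA: "wt f A = nrm2 f" using U by simp
  have L: "E A f \<in> L2" "(%x. - 1 * f x) \<in> L2" by (intro pm_L2 A f L2_scale)+
  let ?d = "%x. E A f x + - 1 * f x"
  have d: "?d \<in> L2" by (rule L2_add[OF L])
  \<comment> \<open>Once all the mass lies in A, expanding the square gives norm zero for E(A) f -
    f.\<close>
  have "L2_inner f (E A f) = cplx (nrm2 f)" using inner_wt[OF A f] pm_sym[OF A f f] wA by simp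
  then have "L2_inner ?d ?d = L2_inner (E A f) (E A f) - cplx (nrm2 f)"
   by (simp only: L2_inner_add_left[OF L d] L2_inner_add_right[OF L L(1)] L2_inner_add_right[OF L L(2)]
     L2_inner_scale_left L2_inner_scale_right inner_wt[OF A f] wA L2_inner_self) simp
  also have "L2_inner (E A f) (E A f) = cplx (nrm2 f)" using wA by (simp add: L2_inner_self wt_def)
  finally have "nrm2 ?d = 0" by (simp add: L2_inner_self)
  from nrm2_zero_AE[OF d this] show ?thesis using True by (simp add: AE_eq_def f_def)
 qed
qed

text \<open>By symmetry E(A) moves from f onto the Hermite function, where its action is already
  known.\<close>

lemma resolution_diag:
 fixes E :: "(real^'n::finite) proj_measure"
 assumes R: "is_spectral_resolution oscillator E" shows "diag E" unfolding diag_def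
proof (intro ballI conjI allI)
 interpret proj_measure E by standard (use R in \<open>simp add: is_spectral_resolution_def\<close>)
 fix A :: "real set" and f :: "real^'n => complex" and a
 assume A: "A \<in> sets borel" and f: "f \<in> L2"
 show "E A f \<in> L2" by (rule pm_L2[OF A f])
 have "fcoef hermv (E A f) a = L2_inner f (E A (hermc a))" using pm_sym[OF A f hermv.basis_L2] by (simp add: L2_inner_hermc)
 also have "... = L2_inner f (%x. of_bool (lam a \<in> A) * hermc a x)"
  by (intro L2_inner_cong_AE f pm_L2 A hermv.basis_L2 L2_scale AE_eq_refl resolution_eigen R)
 finally show "fcoef hermv (E A f) a = (if lam a \<in> A then fcoef hermv f a else 0)"
  by (simp add: L2_inner_scale_right L2_inner_hermc)
qed

lemma diag_spectral_resolution: "diag (spectral_resolution (oscillator :: ((real^'n::finite => complex) \<times> _) set))"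
proof -
 obtain E :: "(real^'n) proj_measure" where "diag E" using diag_exists by blast
 then have "is_spectral_resolution oscillator E" by (rule diag_is_spectral_resolution)
 then have "is_spectral_resolution oscillator (spectral_resolution (oscillator :: ((real^'n::finite => complex) \<times> _) set))"
  unfolding spectral_resolution_def by (rule someI[of "is_spectral_resolution oscillator"])
 then show ?thesis by (rule resolution_diag)
qed

subsection \<open>Functional calculus\<close>

text \<open>The chosen representative is pinned down by testing with Hermite functions: any
  admissible choice has the same coefficients as the coefficientwise multiplier, whose existence
  also justifies the choice.\<close>

lemma fun_calc_oscillator:
 fixes f :: "real^'n::finite => complex"
 assumes m: "m \<in> bmeas" and b: "!!a :: 'n => nat. \<bar>m (lam a)\<bar> <= K" and f: "f \<in> L2"
 shows "fun_calc oscillator m f \<in> L2"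
  and "fcoef hermv (fun_calc oscillator m f) a = cplx (m (lam a)) * fcoef hermv f a"
proof -
 let ?E = "spectral_resolution (oscillator :: ((real^'n => complex) \<times> _) set)"
 have bn: "\<bar>m (evl TYPE('n) n)\<bar> <= K" for n
 proof -
  \<comment> \<open>A multi-index of degree n, concentrated in one arbitrary coordinate: every level
    carries an eigenfunction, so a bound over multi-indices is a bound over levels.\<close>
  have "mdeg ((%_. 0)(undefined := n) :: 'n => nat) = n" using mdeg_upd[of "%_. 0" undefined n] by (simp add: mdeg_def)
  then show ?thesis using b[of "(%_. 0)(undefined := n)"] by (simp add: lam_evl)
 qed
 have s: "summable (%n. \<bar>m (evl TYPE('n) n)\<bar> * mass g n)" if "g \<in> L2" for g :: "real^'n => complex"
  by (rule summable_comparison_test'[OF summable_mult[OF summable_mass[OF that], of K]])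
    (use bn in \<open>auto simp: abs_mult intro!: mult_right_mono\<close>)
 have si: "(%n. \<Sum>a | mdeg a = n. cplx (m (lam a)) * fcoef hermv f a * cnj (fcoef hermv g a)) sums spectral_integral ?E m f g"
  if g: "g \<in> L2" for g using spectral_integral_diag[OF diag_spectral_resolution m f g s[OF f] s[OF g]]
  by (simp add: lam_evl sum_distrib_left mult.assoc)
 obtain v where v: "v \<in> L2" "!!a. fcoef hermv v a = cplx (m (lam a)) * fcoef hermv f a"
  using multiplier_exists[OF f, of "%a. m (lam a)" K] b by blast
 have "\<exists>u. u \<in> L2 & (\<forall>g\<in>L2. L2_inner u g = spectral_integral ?E m f g)"
  using v L2_inner_sums[OF v(1)] si by (intro exI[of _ v]) (auto intro: sums_unique2)
 from someI_ex[OF this] have u: "fun_calc oscillator m f \<in> L2"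
  "!!g. g \<in> L2 ==> L2_inner (fun_calc oscillator m f) g = spectral_integral ?E m f g" unfolding fun_calc_def by blast+
 show "fun_calc oscillator m f \<in> L2" by (rule u(1))
 have "L2_inner v g = spectral_integral ?E m f g" if "g \<in> L2" for g
  using L2_inner_sums[OF v(1) that] si[OF that] by (auto simp: v(2) intro: sums_unique2)
 from this[OF hermv.basis_L2[of a]]
 have "L2_inner (fun_calc oscillator m f) (hermc a) = L2_inner v (hermc a)" using u(2)[OF hermv.basis_L2[of a]] by simp
 then show "fcoef hermv (fun_calc oscillator m f) a = cplx (m (lam a)) * fcoef hermv f a"
  by (simp add: L2_inner_hermc v(2))
qed

lemma rapid_mult:
 assumes "rapid c" and b: "!!a. \<bar>m a\<bar> <= (K::real)" shows "rapid (%a. cplx (m a) * c a)"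
 unfolding rapid_def
proof
 fix M
 obtain L where L: "!!a. cmod (c a) * (1 + real (mdeg a)) ^ M <= L" using assms(1) unfolding rapid_def by blast
 have K: "0 <= K" using b[of undefined] by linarith
 have "cmod (cplx (m a) * c a) * (1 + real (mdeg a)) ^ M <= K * L" for a
 proof -
  have "cmod (cplx (m a) * c a) * (1 + real (mdeg a)) ^ M = \<bar>m a\<bar> * (cmod (c a) * (1 + real (mdeg a)) ^ M)"
   by (simp add: norm_mult)
  also have "... <= K * L" by (intro mult_mono b L) (use K in auto)
  finally show ?thesis .
 qed
 then show "\<exists>K. \<forall>a. cmod (cplx (m a) * c a) * (1 + real (mdeg a)) ^ M <= K" by blast
qed

lemma oscillator_calc_schwartz_eq:
 fixes g :: "real^'n::finite => complex"
 assumes m: "m \<in> bmeas" and b: "!!a :: 'n => nat. \<bar>m (lam a)\<bar> <= K" and g: "g \<in> schwartz"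
 shows "oscillator_calc_schwartz m g = hser (%a. cplx (m (lam a)) * fcoef hermv g a)"
 unfolding oscillator_calc_schwartz_def
proof (rule the_equality)
 let ?v = "hser (%a. cplx (m (lam a)) * fcoef hermv g a)"
 have r: "rapid (%a. cplx (m (lam a)) * fcoef hermv g a)" by (rule rapid_mult[OF rapid_fcoef[OF g] b])
 note fc = fun_calc_oscillator[OF m b schwartz_L2[OF g]]
 have ae: "AE_eq ?v (fun_calc oscillator m g)" unfolding AE_eq_def
  by (rule hermv.coef_eq_AE) (auto simp: schwartz_L2 hser_schwartz r fcoef_hser fc)
 then show "?v \<in> schwartz & AE_eq ?v (fun_calc oscillator m g)" by (simp add: hser_schwartz r)
 fix v assume "v \<in> schwartz & AE_eq v (fun_calc oscillator m g)"
 then have v: "v \<in> schwartz" "AE x in lborel. v x = fun_calc oscillator m g x" by (auto simp: AE_eq_def)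
 from ae have "AE x in lborel. ?v x = fun_calc oscillator m g x" by (simp add: AE_eq_def)
 with v(2) have "AE x in lborel. v x = ?v x" by eventually_elim simp
 then show "v = ?v" by (intro AE_eq_continuous_imp_eq continuous_schwartz v hser_schwartz r)
qed

lemma oscillator_calc_schwartz_schwartz:
 fixes g :: "real^'n::finite => complex"
 assumes "m \<in> bmeas" "!!a :: 'n => nat. \<bar>m (lam a)\<bar> <= K" "g \<in> schwartz"
 shows "oscillator_calc_schwartz m g \<in> schwartz" unfolding oscillator_calc_schwartz_eq[OF assms]
 by (rule hser_schwartz[OF rapid_mult[OF rapid_fcoef[OF assms(3)], of "%a. m (lam a)" K, OF assms(2)]])

lemma oscillator_calc_sums:
 fixes g :: "real^'n::finite => complex"
 assumes m: "m \<in> bmeas" and b: "!!a :: 'n => nat. \<bar>m (lam a)\<bar> <= K" and g: "g \<in> schwartz"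
  and u: "u \<in> tempered"
 shows "(%n. cplx (m (evl TYPE('n) n)) * (\<Sum>a | mdeg a = n. fcoef hermv g a * u (hermc a))) sums calc m u g"
 using tempered_hser[OF u rapid_mult[OF rapid_fcoef[OF g], of "%a. m (lam a)" K, OF b]]
 by (simp add: oscillator_calc_def oscillator_calc_schwartz_eq[OF m b g] lam_evl sum_distrib_left mult.assoc)

lemma oscillator_calc_compose:
 fixes g :: "real^'n::finite => complex"
 assumes m: "m \<in> bmeas" and b: "!!a :: 'n => nat. \<bar>m (lam a)\<bar> <= K"
  and m': "m' \<in> bmeas" and b': "!!a :: 'n => nat. \<bar>m' (lam a)\<bar> <= K'" and g: "g \<in> schwartz"
 shows "calc m (calc m' u) g = calc (%l. m l * m' l) u g"
proof -
 have [measurable]: "m \<in> bmeas" "m' \<in> bmeas" by fact+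
 have K: "0 <= K" using b[of undefined] by linarith
 have mm: "(%l. m l * m' l) \<in> bmeas" by measurable
 have bb: "\<bar>m (lam a) * m' (lam a)\<bar> <= K * K'" for a :: "'n => nat"
  unfolding abs_mult by (intro mult_mono b b' K) simp
 note sm = oscillator_calc_schwartz_schwartz[OF m b g]
 have r: "rapid (%a. cplx (m (lam a)) * fcoef hermv g a)" by (rule rapid_mult[OF rapid_fcoef[OF g] b])
 show ?thesis unfolding oscillator_calc_def oscillator_calc_schwartz_eq[OF m' b' sm] oscillator_calc_schwartz_eq[OF mm bb g]
  unfolding oscillator_calc_schwartz_eq[OF m b g] fcoef_hser[OF r] by (simp add: mult_ac)
qed

section \<open>The kernel of a finite spectral multiplier\<close>

definition ndiff :: "(nat => real) => nat => real" where
 "ndiff m n = m n - m (Suc n)"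

text \<open>The Christoffel-Darboux numerator: by \<open>diff_mult_herm\<close>, (a - b) h_n(a)
  h_n(b) is the increment of \<open>wker\<close> from n - 1 to n, ready for summation by
  parts.\<close>

definition wker :: "nat => real => real => real" where
 "wker n a b = lad (Suc n) * (herm (Suc n) a * herm n b - herm n a * herm (Suc n) b)"

lemma diff_mult_herm:
 "(a - b) * (herm n a * herm n b) = wker n a b - (if n = 0 then 0 else wker (n - 1) a b)"
proof -
 have "(a - b) * (herm n a * herm n b) = (a * herm n a) * herm n b - herm n a * (b * herm n b)" by (simp add: algebra_simps)
 then show ?thesis unfolding mult_herm by (cases n) (simp_all add: wker_def algebra_simps)
qed

definition kprod :: "'n::finite set => ('n => nat) => real^'n => real^'n => real" where
 "kprod S \<nu> x y = (\<Prod>i\<in>UNIV. if i \<in> S then wker (\<nu> i) (x $ i) (y $ i) else herm (\<nu> i) (x $ i) * herm (\<nu> i) (y $ i))"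

text \<open>The kernel after multiplication by x_i - y_i for every i in S: each such factor costs
  one difference of m and turns the Hermite product of that coordinate into \<open>wker\<close>. For
  empty S it is the kernel of m(H).\<close>

definition kerS :: "nat => (nat => real) => 'n::finite set => real^'n => real^'n => real" where
 "kerS R m S x y = (\<Sum>\<nu> | mdeg \<nu> <= R. (ndiff ^^ card S) m (mdeg \<nu>) * kprod S \<nu> x y)"

lemma ndiff_pow_zero:
 assumes "!!n. n > R ==> m n = 0" "n > R" shows "(ndiff ^^ k) m n = 0" using assms(2)
proof (induction k arbitrary: n)
 case 0
 then show ?case using assms(1) by simp
next
 case (Suc k)
 have "(ndiff ^^ k) m n = 0" "(ndiff ^^ k) m (Suc n) = 0" using Suc by auto
 then show ?case by (simp add: ndiff_def[of "(ndiff ^^ k) m"])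
qed

lemma kprod_remove:
 "kprod S a x y = (if i \<in> S then wker (a i) (x $ i) (y $ i) else herm (a i) (x $ i) * herm (a i) (y $ i)) *
  (\<Prod>j\<in>UNIV - {i}. if j \<in> S then wker (a j) (x $ j) (y $ j) else herm (a j) (x $ j) * herm (a j) (y $ j))"
 unfolding kprod_def by (rule prod.remove) auto

text \<open>Summation by parts in the \<open>i\<close>-th index.\<close>

lemma diff_mult_kerS:
 fixes m :: "nat => real" and S :: "'n::finite set"
 assumes m: "!!n. n > R ==> m n = 0" and i: "i \<notin> S" shows "(x $ i - y $ i) * kerS R m S x y = kerS R m (insert i S) x y"
proof -
 define M where "M = (ndiff ^^ card S) m"
 define G where "G e = kprod (insert i S) e x y" for e
 define q where "q e = e(i := e i - 1)" for e :: "'n => nat"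
 define p where "p e = e(i := Suc (e i))" for e :: "'n => nat"
 let ?A = "{e::'n => nat. mdeg e <= R}"
 have fA: "finite ?A" by (rule finite_mdeg_le)
 have step: "(x $ i - y $ i) * kprod S e x y = G e - (if e i = 0 then 0 else G (q e))" for e
 proof -
  define P where "P b = (\<Prod>j\<in>UNIV - {i}. if j \<in> S then wker (b j) (x $ j) (y $ j) else herm (b j) (x $ j) * herm (b j) (y $ j))"
   for b :: "'n => nat"
  have G: "G b = wker (b i) (x $ i) (y $ i) * P b" for b
   unfolding G_def kprod_remove[of "insert i S" b x y i] P_def by (auto intro!: prod.cong)
  have Pq: "P (q e) = P e" unfolding P_def q_def by (rule prod.cong) auto
  have "(x $ i - y $ i) * kprod S e x y = ((x $ i - y $ i) * (herm (e i) (x $ i) * herm (e i) (y $ i))) * P e"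
   unfolding kprod_remove[of S e x y i] P_def using i by simp
  also have "... = G e - (if e i = 0 then 0 else G (q e))"
   unfolding diff_mult_herm G Pq by (simp add: q_def left_diff_distrib)
  finally show ?thesis .
 qed
 have MR: "M n = 0" if "n > R" for n unfolding M_def using ndiff_pow_zero[OF m that] .
 have "(\<Sum>e\<in>?A. M (mdeg e) * (if e i = 0 then 0 else G (q e))) = (\<Sum>e\<in>{e\<in>?A. e i ~= 0}. M (mdeg e) * G (q e))"
  by (rule sum.mono_neutral_cong_right) (use fA in auto)
 also have "... = (\<Sum>b\<in>{b. mdeg b < R}. M (Suc (mdeg b)) * G b)"
 proof (rule sum.reindex_bij_witness[of _ p q])
  fix e assume a: "e \<in> {e\<in>?A. e i ~= 0}"
  then show pq: "p (q e) = e" by (simp add: p_def q_def)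
  have md: "Suc (mdeg (q e)) = mdeg e" using mdeg_Suc[of "q e" i] pq by (simp add: p_def)
  then show "q e \<in> {b. mdeg b < R}" using a by auto
  show "M (Suc (mdeg (q e))) * G (q e) = M (mdeg e) * G (q e)" by (simp add: md)
 next
  fix b :: "'n => nat" assume "b \<in> {b. mdeg b < R}"
  then show "q (p b) = b" "p b \<in> {e\<in>?A. e i ~= 0}" by (auto simp: p_def q_def mdeg_Suc)
 qed
 \<comment> \<open>The added terms have degree exactly R and carry the factor M (R + 1) = 0.\<close>
 also have "... = (\<Sum>b\<in>?A. M (Suc (mdeg b)) * G b)" by (rule sum.mono_neutral_left) (use fA MR in auto)
 finally have shift: "(\<Sum>e\<in>?A. M (mdeg e) * (if e i = 0 then 0 else G (q e))) = (\<Sum>b\<in>?A. M (Suc (mdeg b)) * G b)" .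
 have "(x $ i - y $ i) * kerS R m S x y = (\<Sum>e\<in>?A. M (mdeg e) * ((x $ i - y $ i) * kprod S e x y))"
  by (simp add: kerS_def M_def sum_distrib_left mult_ac)
 also have "... = (\<Sum>e\<in>?A. M (mdeg e) * G e) - (\<Sum>e\<in>?A. M (mdeg e) * (if e i = 0 then 0 else G (q e)))"
  unfolding step by (simp add: right_diff_distrib sum_subtractf)
 also have "... = (\<Sum>e\<in>?A. ndiff M (mdeg e) * G e)"
  unfolding shift by (simp add: ndiff_def left_diff_distrib sum_subtractf)
 also have "... = kerS R m (insert i S) x y" using i by (simp add: kerS_def G_def M_def)
 finally show ?thesis .
qed

lemma prod_diff_mult_kerS:
 fixes S :: "'n::finite set"
 assumes m: "!!n. n > R ==> m n = 0" shows "(\<Prod>i\<in>S. x $ i - y $ i) * kerS R m {} x y = kerS R m S x y"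
proof -
 have "finite S" by simp
 then show ?thesis
 proof (induction S)
  case (insert i S)
  have "(\<Prod>i\<in>insert i S. x $ i - y $ i) * kerS R m {} x y = (x $ i - y $ i) * ((\<Prod>i\<in>S. x $ i - y $ i) * kerS R m {} x y)"
   using insert by simp
  also have "... = kerS R m (insert i S) x y" unfolding insert.IH by (rule diff_mult_kerS[OF m insert.hyps(2)])
  finally show ?case .
 qed simp
qed

definition shiftS :: "'n set => ('n => nat) => 'n => nat" where
 "shiftS U \<nu> = (%i. if i \<in> U then Suc (\<nu> i) else \<nu> i)"

lemma inj_shiftS: "inj (shiftS U)" by (rule injI) (auto simp: shiftS_def fun_eq_iff split: if_splits)

text \<open>Each \<open>wker\<close> is a difference of two products; U records the coordinates in
  which the factor in x is the raised one. For fixed x, this exhibits the kernel as a combination of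
  shifted Hermite functions of y.\<close>

lemma kprod_expand:
 fixes S :: "'n::finite set"
 shows "kprod S e x y = (\<Sum>U\<in>Pow S. (- 1) ^ card (S - U) * (\<Prod>i\<in>S. lad (Suc (e i))) * hermv (shiftS U e) x * hermv (shiftS (S - U) e) y)"
proof -
 define a where "a i = lad (Suc (e i)) * (herm (Suc (e i)) (x $ i) * herm (e i) (y $ i))" for i
 define b where "b i = (- 1) * (lad (Suc (e i)) * (herm (e i) (x $ i) * herm (Suc (e i)) (y $ i)))" for i
 define c where "c i = herm (e i) (x $ i) * herm (e i) (y $ i)" for i
 have "kprod S e x y = (\<Prod>i\<in>S. wker (e i) (x $ i) (y $ i)) * (\<Prod>i\<in>UNIV - S. c i)" unfolding kprod_def c_def
  by (subst prod.subset_diff[of S UNIV]) (auto simp: mult.commute intro!: arg_cong2[where f="(*)"] prod.cong)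
 also have "(\<Prod>i\<in>S. wker (e i) (x $ i) (y $ i)) = (\<Prod>i\<in>S. a i + b i)"
  by (rule prod.cong) (auto simp: wker_def a_def b_def algebra_simps)
 also have "... = (\<Sum>U\<in>Pow S. (\<Prod>i\<in>U. a i) * (\<Prod>i\<in>S - U. b i))" by (rule prod_add) simp
 also have "... * (\<Prod>i\<in>UNIV - S. c i) = (\<Sum>U\<in>Pow S. (\<Prod>i\<in>U. a i) * (\<Prod>i\<in>S - U. b i) * (\<Prod>i\<in>UNIV - S. c i))"
  by (rule sum_distrib_right)
 also have "... = (\<Sum>U\<in>Pow S. (- 1) ^ card (S - U) * (\<Prod>i\<in>S. lad (Suc (e i))) * hermv (shiftS U e) x * hermv (shiftS (S - U) e) y)"
 proof (rule sum.cong[OF refl])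
  fix U assume "U \<in> Pow S"
  then have U: "U \<subseteq> S" by simp
  have split: "(\<Prod>i\<in>UNIV. g i) = (\<Prod>i\<in>U. g i) * (\<Prod>i\<in>S - U. g i) * (\<Prod>i\<in>UNIV - S. g i)" for g :: "'n => real"
  proof -
   have "(\<Prod>i\<in>UNIV. g i) = (\<Prod>i\<in>UNIV - S. g i) * (\<Prod>i\<in>S. g i)" by (rule prod.subset_diff) auto
   also have "(\<Prod>i\<in>S. g i) = (\<Prod>i\<in>S - U. g i) * (\<Prod>i\<in>U. g i)" using U by (intro prod.subset_diff) auto
   finally show ?thesis by simp
  qed
  have splitS: "(\<Prod>i\<in>S. g i) = (\<Prod>i\<in>U. g i) * (\<Prod>i\<in>S - U. g i)" for g :: "'n => real"
   using prod.subset_diff[OF U, of g] by (simp add: mult.commute)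
  have hx: "hermv (shiftS U e) x = (\<Prod>i\<in>U. herm (Suc (e i)) (x $ i)) * (\<Prod>i\<in>S - U. herm (e i) (x $ i)) * (\<Prod>i\<in>UNIV - S. herm (e i) (x $ i))"
   unfolding hermv_def split by (intro arg_cong2[where f="(*)"] prod.cong) (use U in \<open>auto simp: shiftS_def\<close>)
  have hy: "hermv (shiftS (S - U) e) y = (\<Prod>i\<in>U. herm (e i) (y $ i)) * (\<Prod>i\<in>S - U. herm (Suc (e i)) (y $ i)) * (\<Prod>i\<in>UNIV - S. herm (e i) (y $ i))"
   unfolding hermv_def split by (intro arg_cong2[where f="(*)"] prod.cong) (use U in \<open>auto simp: shiftS_def\<close>)
  show "(\<Prod>i\<in>U. a i) * (\<Prod>i\<in>S - U. b i) * (\<Prod>i\<in>UNIV - S. c i) =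
    (- 1) ^ card (S - U) * (\<Prod>i\<in>S. lad (Suc (e i))) * hermv (shiftS U e) x * hermv (shiftS (S - U) e) y"
   unfolding hx hy splitS a_def b_def c_def prod.distrib prod_constant by (simp only: mult_ac)
 qed
 finally show ?thesis .
qed

lemma nrm2_sum_le:
 assumes "!!i. i \<in> I ==> f i \<in> L2" "finite I"
 shows "nrm2 (%x. \<Sum>i\<in>I. f i x) <= real (card I) * (\<Sum>i\<in>I. nrm2 (f i))"
proof -
 have le: "(cmod (\<Sum>i\<in>I. f i x))^2 <= real (card I) * (\<Sum>i\<in>I. (cmod (f i x))^2)" for x
 proof -
  have "(cmod (\<Sum>i\<in>I. f i x))^2 <= (\<Sum>i\<in>I. cmod (f i x))^2" by (intro power_mono norm_sum) simp
  also have "... <= (\<Sum>i\<in>I. (cmod (f i x))^2) * real (card I)" by (rule sum_squared_le_sum_of_squares)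
  finally show ?thesis by (simp add: mult.commute)
 qed
 have i: "integrable lborel (%x. real (card I) * (\<Sum>i\<in>I. (cmod (f i x))^2))"
  using assms(1) by (intro integrable_mult_right Bochner_Integration.integrable_sum L2_integrable)
 have "nrm2 (%x. \<Sum>i\<in>I. f i x) <= (LBINT x. real (card I) * (\<Sum>i\<in>I. (cmod (f i x))^2))"
  unfolding nrm2_def by (rule integral_mono[OF _ i le]) (intro L2_integrable L2_sum assms(1))
 also have "... = real (card I) * (\<Sum>i\<in>I. nrm2 (f i))"
  unfolding nrm2_def using assms(1) by (subst integral_mult_right_zero, subst Bochner_Integration.integral_sum) auto
 finally show ?thesis .
qed

text \<open>The simplex of multi-indices is enlarged to a cube of side R + 2, where the sum
  factorises into one-dimensional Christoffel sums. The 48 comes from 16 (R + 2) \<le> 48 R for R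
  \<ge> 1.\<close>

lemma sum_hermv_sq_le:
 fixes x :: "real^'n::finite"
 assumes "R >= 1" shows "(\<Sum>e | mdeg e <= R. (hermv (shiftS U e) x)^2) <= sqrt (48 * real R) ^ CARD('n)"
proof -
 have f: "finite ((UNIV::'n set) \<rightarrow>\<^sub>E {..<R + 2})" by (intro finite_PiE) auto
 have "(\<Sum>e::'n => nat | mdeg e <= R. (hermv (shiftS U e) x)^2) = (\<Sum>b\<in>shiftS U ` {e. mdeg e <= R}. (hermv b x)^2)"
  by (subst sum.reindex) (auto intro: inj_on_subset[OF inj_shiftS])
 also have "... <= (\<Sum>b\<in>UNIV \<rightarrow>\<^sub>E {..<R + 2}. (hermv b x)^2)"
 proof (rule sum_mono2[OF f])
  show "shiftS U ` {e. mdeg e <= R} \<subseteq> UNIV \<rightarrow>\<^sub>E {..<R + 2}"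
  proof clarify
   fix e :: "'n => nat" assume a: "mdeg e <= R"
   have "shiftS U e i < R + 2" for i using le_mdeg[of e i] a by (simp add: shiftS_def)
   then show "shiftS U e \<in> UNIV \<rightarrow>\<^sub>E {..<R + 2}" by auto
  qed
 qed auto
 also have "... = (\<Sum>b\<in>UNIV \<rightarrow>\<^sub>E {..<R + 2}. \<Prod>i\<in>UNIV. (herm (b i) (x $ i))^2)"
  by (simp add: hermv_def prod_power_distrib)
 also have "... = (\<Prod>i\<in>UNIV. \<Sum>n<R + 2. (herm n (x $ i))^2)" by (rule prod_sum_PiE[symmetric]) auto
 also have "... <= (\<Prod>i\<in>(UNIV::'n set). sqrt (48 * real R))"
 proof (intro prod_mono conjI sum_nonneg)
  fix i
  have "(\<Sum>n<R + 2. (herm n (x $ i))^2) <= 4 * sqrt (real (R + 2))" by (rule sum_herm_sq_le)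
  also have "... = sqrt (16 * real (R + 2))" by (simp only: real_sqrt_mult) simp
  also have "... <= sqrt (48 * real R)" using assms by (intro real_sqrt_le_mono) auto
  finally show "(\<Sum>n<R + 2. (herm n (x $ i))^2) <= sqrt (48 * real R)" .
 qed auto
 finally show ?thesis by simp
qed

lemma kerS_fcomb:
 fixes S :: "'n::finite set" shows "cplx (kerS R m S x y) = (\<Sum>U\<in>Pow S. \<Sum>a | mdeg a <= R.
   cplx ((ndiff ^^ card S) m (mdeg a) * ((- 1) ^ card (S - U) * (\<Prod>i\<in>S. lad (Suc (a i))) * hermv (shiftS U a) x)) * hermc (shiftS (S - U) a) y)"
 unfolding kerS_def kprod_expand sum_distrib_left by (subst sum.swap) (simp add: mult_ac)

text \<open>With k = \<open>card S\<close>, the differences contribute A^2/R^(2k) and the ladder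
  coefficients at most R^k, which leaves R^(-k) times a Christoffel sum. Of the factor 4^k, one 2^k
  counts the subsets U and the other comes from Cauchy-Schwarz over them.\<close>

lemma nrm2_kerS_le:
 fixes S :: "'n::finite set"
 assumes R: "R >= 1" and A: "A >= 0" and d: "!!n. \<bar>(ndiff ^^ card S) m n\<bar> <= A / real R ^ card S"
 shows "(%y. cplx (kerS R m S x y)) \<in> L2"
  and "real R ^ card S * nrm2 (%y. cplx (kerS R m S x y)) <= 4 ^ card S * (A^2 * sqrt (48 * real R) ^ CARD('n))"
proof -
 let ?k = "card S" and ?A = "{v::'n => nat. mdeg v <= R}" and ?Q = "sqrt (48 * real R) ^ CARD('n)"
 define c where "c U v = cplx ((ndiff ^^ card S) m (mdeg v) * ((- 1) ^ card (S - U) * (\<Prod>i\<in>S. lad (Suc (v i))) * hermv (shiftS U v) x))"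
  for U and v :: "'n => nat"
 define T where "T U y = (\<Sum>v\<in>?A. c U v * hermc (shiftS (S - U) v) y)" for U y
 have e: "(%y. cplx (kerS R m S x y)) = (%y. \<Sum>U\<in>Pow S. T U y)" unfolding T_def c_def by (rule ext) (rule kerS_fcomb)
 have TL2: "T U \<in> L2" for U unfolding T_def by (intro L2_sum L2_scale hermv.basis_L2)
 show "(%y. cplx (kerS R m S x y)) \<in> L2" unfolding e by (intro L2_sum TL2)
 have Rk: "real R ^ ?k > 0" using R by simp
 have T: "real R ^ ?k * nrm2 (T U) <= A^2 * ?Q" for U
 proof -
  have "nrm2 (T U) = (\<Sum>v\<in>?A. (cmod (c U v))^2)"
   unfolding T_def by (rule nrm2_shifted[OF finite_mdeg_le]) (rule inj_on_subset[OF inj_shiftS], simp)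
  also have "... <= (\<Sum>v\<in>?A. (A^2 / real R ^ ?k) * (hermv (shiftS U v) x)^2)"
  proof (rule sum_mono)
   fix v assume a: "v \<in> ?A"
   have "(lad (Suc (v i)))^2 <= real R" for i
   proof -
    have "v i <= R" using a le_mdeg[of v i] by simp
    then show ?thesis using R by (simp add: lad_def)
   qed
   then have "(\<Prod>i\<in>S. (lad (Suc (v i)))^2) <= (\<Prod>i\<in>S. real R)" by (intro prod_mono) auto
   then have l: "(\<Prod>i\<in>S. lad (Suc (v i)))^2 <= real R ^ ?k" by (simp add: prod_power_distrib)
   have "((ndiff ^^ ?k) m (mdeg v))^2 <= (A / real R ^ ?k)^2" using power_mono[OF d[of "mdeg v"] abs_ge_zero, of 2] by simp
   then have "((ndiff ^^ ?k) m (mdeg v))^2 * (\<Prod>i\<in>S. lad (Suc (v i)))^2 <= (A / real R ^ ?k)^2 * real R ^ ?k"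
    by (intro mult_mono l) auto
   also have "... = A^2 / real R ^ ?k" using Rk by (simp add: power_divide power2_eq_square)
   finally have "(((ndiff ^^ ?k) m (mdeg v))^2 * (\<Prod>i\<in>S. lad (Suc (v i)))^2) * (hermv (shiftS U v) x)^2
     <= (A^2 / real R ^ ?k) * (hermv (shiftS U v) x)^2" by (rule mult_right_mono) simp
   moreover have "(cmod (c U v))^2 = (((ndiff ^^ ?k) m (mdeg v))^2 * (\<Prod>i\<in>S. lad (Suc (v i)))^2) * (hermv (shiftS U v) x)^2"
    unfolding c_def norm_of_real power2_abs by (simp add: power_mult_distrib flip: power_mult)
   ultimately show "(cmod (c U v))^2 <= (A^2 / real R ^ ?k) * (hermv (shiftS U v) x)^2" by simp
  qed
  also have "... = (A^2 / real R ^ ?k) * (\<Sum>v\<in>?A. (hermv (shiftS U v) x)^2)" by (rule sum_distrib_left[symmetric])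
  also have "... <= (A^2 / real R ^ ?k) * ?Q" by (intro mult_left_mono sum_hermv_sq_le R) simp
  finally have "real R ^ ?k * nrm2 (T U) <= real R ^ ?k * ((A^2 / real R ^ ?k) * ?Q)" using Rk by (intro mult_left_mono) auto
  then show ?thesis using R by simp
 qed
 have "nrm2 (%y. cplx (kerS R m S x y)) <= real (card (Pow S)) * (\<Sum>U\<in>Pow S. nrm2 (T U))"
  unfolding e by (intro nrm2_sum_le TL2) simp
 then have "real R ^ ?k * nrm2 (%y. cplx (kerS R m S x y)) <= real R ^ ?k * (real (card (Pow S)) * (\<Sum>U\<in>Pow S. nrm2 (T U)))"
  using Rk by (intro mult_left_mono) auto
 also have "... = real (card (Pow S)) * (\<Sum>U\<in>Pow S. real R ^ ?k * nrm2 (T U))" by (simp add: sum_distrib_left mult_ac)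
 also have "... <= real (card (Pow S)) * (\<Sum>U\<in>Pow S. A^2 * ?Q)" by (intro mult_left_mono sum_mono T) simp
 also have "... = 4 ^ ?k * (A^2 * ?Q)"
 proof -
  have "(2::real) ^ ?k * 2 ^ ?k = 4 ^ ?k" by (simp flip: power_mult_distrib)
  then show ?thesis by (simp add: card_Pow flip: mult.assoc)
 qed
 finally show "real R ^ ?k * nrm2 (%y. cplx (kerS R m S x y)) <= 4 ^ ?k * (A^2 * ?Q)" .
qed

section \<open>Integrability of the kernel in one variable\<close>

definition cauchy_mass :: real where
 "cauchy_mass = (\<integral>t. inverse (1 + t^2) \<partial>(lborel :: real measure))"

lemma cauchy_mass_nonneg: "0 <= cauchy_mass"
 unfolding cauchy_mass_def by (intro integral_nonneg_AE) (auto intro!: AE_I2 add_nonneg_nonneg)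

lemma cauchy_scaled:
 assumes "R > 0" shows "integrable lborel (%t::real. inverse (1 + R * (a - t)^2))"
  and "(\<integral>t. inverse (1 + R * (a - t)^2) \<partial>(lborel :: real measure)) = cauchy_mass / sqrt R"
proof -
 have e: "(- sqrt R * a + sqrt R * t)^2 = R * (a - t)^2" for t
 proof -
  have "(- sqrt R * a + sqrt R * t)^2 = (sqrt R)^2 * (a - t)^2" by (simp add: power2_eq_square algebra_simps)
  then show ?thesis using assms by simp
 qed
 have s: "sqrt R ~= 0" using assms by simp
 show "integrable lborel (%t::real. inverse (1 + R * (a - t)^2))"
  using lborel_integrable_real_affine[OF integrable_inverse_1_plus_sq s, of "- sqrt R * a"] unfolding e .
 have "cauchy_mass = \<bar>sqrt R\<bar> *\<^sub>R (LBINT t. inverse (1 + (- sqrt R * a + sqrt R * t)^2))"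
  unfolding cauchy_mass_def by (rule lborel_integral_real_affine[OF s])
 then show "(\<integral>t. inverse (1 + R * (a - t)^2) \<partial>(lborel :: real measure)) = cauchy_mass / sqrt R"
  unfolding e using assms by (simp add: field_simps)
qed

definition mker :: "nat => (nat => real) => real^'n::finite => real^'n => real" where
 "mker R m x y = (\<Sum>\<nu> | mdeg \<nu> <= R. m (mdeg \<nu>) * (hermv \<nu> x * hermv \<nu> y))"

lemma kerS_empty: "kerS R m {} = mker R m" by (simp add: kerS_def mker_def fun_eq_iff kprod_def hermv_def prod.distrib)

lemma mker_commute: "mker R m x y = mker R m y x" by (simp add: mker_def mult.commute)

lemma mker_schwartz: "(%y. cplx (mker R m x y)) \<in> schwartz"
proof -
 have "(%y. cplx (mker R m x y)) = (%y. \<Sum>a | mdeg a <= R. cplx (m (mdeg a) * hermv a x) * hermc a y)"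
  by (simp add: mker_def mult.assoc)
 then show ?thesis by (simp only:) (intro schwartz_sum schwartz_cmult hermc_schwartz)
qed

text \<open>The first summand bounds the weighted square of the kernel, with 8 = 2 * 4 per
  coordinate from the number of sets S and the factor 4^\<open>card S\<close>; the second bounds the
  reciprocal weight.\<close>

definition kconst :: "'n::finite itself => real" where
 "kconst _ = (8 * sqrt 48) ^ CARD('n) + cauchy_mass ^ CARD('n)"

text \<open>The weight \<open>W = \<Prod>(1 + R (x\<^sub>i - y\<^sub>i)\<^sup>2)\<close> expands into a sum over subsets \<open>S\<close>, so that
  \<open>\<integral> W K\<^sup>2\<close> is controlled by the \<open>L\<^sup>2\<close> norms of the iterated commutators \<open>kerS\<close>; then
  \<open>2 \<bar>K\<bar> \<le> \<epsilon> W K\<^sup>2 + 1 / (\<epsilon> W)\<close>.\<close>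

theorem kernel_integral_le:
 fixes x :: "real^'n::finite"
 assumes R: "R >= 1" and A: "A > 0" and m0: "!!n. n > R ==> m n = 0"
  and d: "!!k n. k <= CARD('n) ==> \<bar>(ndiff ^^ k) m n\<bar> <= A / real R ^ k"
 shows "(LBINT y. \<bar>mker R m x y\<bar>) <= kconst TYPE('n) * A"
proof -
 let ?K = "mker R m x" and ?d = "CARD('n)" and ?r = "sqrt (real R)"
 have R0: "real R > 0" using R by simp
 define W where "W y = (\<Prod>i\<in>UNIV. 1 + real R * (x $ i - y $ i)^2)" for y
 have W0: "W y > 0" for y unfolding W_def using R0 by (intro prod_pos) (simp add: add_pos_nonneg)
 have cardS: "card S <= ?d" for S :: "'n set" by (rule card_mono) auto
 have WK: "W y * (?K y)^2 = (\<Sum>S\<in>Pow UNIV. real R ^ card S * (kerS R m S x y)^2)" for y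
 proof -
  have "W y = (\<Prod>i\<in>UNIV. real R * (x $ i - y $ i)^2 + 1)" by (simp add: W_def add.commute)
  also have "... = (\<Sum>S\<in>Pow UNIV. (\<Prod>i\<in>S. real R * (x $ i - y $ i)^2) * (\<Prod>i\<in>UNIV - S. 1))" by (rule prod_add) simp
  also have "... = (\<Sum>S\<in>Pow UNIV. real R ^ card S * (\<Prod>i\<in>S. x $ i - y $ i)^2)"
   by (simp add: prod.distrib prod_power_distrib)
  finally have "W y * (?K y)^2 = (\<Sum>S\<in>Pow UNIV. real R ^ card S * ((\<Prod>i\<in>S. x $ i - y $ i) * ?K y)^2)"
   by (simp add: sum_distrib_right power_mult_distrib mult.assoc)
  then show ?thesis using prod_diff_mult_kerS[OF m0, where x=x and y=y] by (simp add: kerS_empty)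
 qed
 note L = nrm2_kerS_le[OF R less_imp_le[OF A] d[OF cardS]]
 have iS: "integrable lborel (%y. (kerS R m S x y)^2)" for S using L2_integrable[OF L(1)[of S x]] by simp
 have iWK: "integrable lborel (%y. W y * (?K y)^2)" unfolding WK by (intro Bochner_Integration.integrable_sum integrable_mult_right iS)
 have WKle: "(LBINT y. W y * (?K y)^2) <= A^2 * (8 * sqrt 48) ^ ?d * ?r ^ ?d"
 proof -
  have "(LBINT y. W y * (?K y)^2) = (\<Sum>S\<in>Pow UNIV. real R ^ card S * nrm2 (%y. cplx (kerS R m S x y)))"
   unfolding WK nrm2_def by (subst Bochner_Integration.integral_sum) (auto intro: iS)
  also have "... <= (\<Sum>S\<in>Pow (UNIV::'n set). 4 ^ ?d * (A^2 * sqrt (48 * real R) ^ ?d))"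
  proof (rule sum_mono)
   fix S :: "'n set"
   have "real R ^ card S * nrm2 (%y. cplx (kerS R m S x y)) <= 4 ^ card S * (A^2 * sqrt (48 * real R) ^ ?d)" by (rule L(2))
   also have "... <= 4 ^ ?d * (A^2 * sqrt (48 * real R) ^ ?d)" using cardS[of S] by (intro mult_right_mono power_increasing) auto
   finally show "real R ^ card S * nrm2 (%y. cplx (kerS R m S x y)) <= 4 ^ ?d * (A^2 * sqrt (48 * real R) ^ ?d)" .
  qed
  also have "... = 2 ^ ?d * (4 ^ ?d * (A^2 * sqrt (48 * real R) ^ ?d))" by (simp add: card_Pow)
  also have "... = A^2 * (8 * sqrt 48) ^ ?d * ?r ^ ?d"
  proof -
   have "(8::real) ^ ?d = 2 ^ ?d * 4 ^ ?d" by (simp flip: power_mult_distrib)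
   then show ?thesis unfolding real_sqrt_mult power_mult_distrib by simp
  qed
  finally show ?thesis .
 qed
 have Wi: "inverse (W y) = (\<Prod>i\<in>UNIV. inverse (1 + real R * (x $ i - y $ i)^2))" for y
  unfolding W_def by (rule prod_inversef[symmetric, unfolded o_def])
 have iWi: "integrable lborel (%y. inverse (W y))"
  unfolding Wi using integrable_vec_prod[of "%i t. inverse (1 + real R * (x $ i - t)^2)"] cauchy_scaled(1)[OF R0] by auto
 have WiI: "(LBINT y. inverse (W y)) = (cauchy_mass / ?r) ^ ?d"
  unfolding Wi using integral_vec_prod[of "%i t. inverse (1 + real R * (x $ i - t)^2)"] cauchy_scaled[OF R0] by auto
 \<comment> \<open>The integral of W K^2 is of order A^2 R^(d/2) and that of 1/W of order R^(-d/2);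
   this choice makes both contributions multiples of A.\<close>
 define \<epsilon> where "\<epsilon> = 1 / (A * ?r ^ ?d)"
 have r0: "?r ^ ?d > 0" using R0 by simp
 have e0: "\<epsilon> > 0" unfolding \<epsilon>_def using A r0 by simp
 have pw: "\<bar>?K y\<bar> <= \<epsilon> * (W y * (?K y)^2) + inverse \<epsilon> * inverse (W y)" for y
 proof -
  have "2 * (sqrt (\<epsilon> * W y) * \<bar>?K y\<bar>) * sqrt (inverse (\<epsilon> * W y)) <= (sqrt (\<epsilon> * W y) * \<bar>?K y\<bar>)^2 + (sqrt (inverse (\<epsilon> * W y)))^2"
   by (rule sum_squares_bound)
  also have "sqrt (inverse (\<epsilon> * W y)) = inverse (sqrt (\<epsilon> * W y))" by (rule real_sqrt_inverse)
  also have "2 * (sqrt (\<epsilon> * W y) * \<bar>?K y\<bar>) * inverse (sqrt (\<epsilon> * W y)) = 2 * \<bar>?K y\<bar>"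
   using e0 W0[of y] by simp
  finally have "2 * \<bar>?K y\<bar> <= \<epsilon> * W y * (?K y)^2 + inverse (\<epsilon> * W y)"
   using e0 W0[of y] by (simp add: power_mult_distrib power_inverse)
  then show ?thesis using abs_ge_zero[of "?K y"] by (simp add: mult.assoc del: abs_ge_zero)
 qed
 have iK: "integrable lborel (%y. \<bar>?K y\<bar>)" using integrable_norm[OF integrable_schwartz[OF mker_schwartz[of R m x]]] by simp
 have "(LBINT y. \<bar>?K y\<bar>) <= (LBINT y. \<epsilon> * (W y * (?K y)^2) + inverse \<epsilon> * inverse (W y))"
  by (rule integral_mono[OF iK _ pw]) (intro Bochner_Integration.integrable_add integrable_mult_right iWK iWi)
 also have "... = \<epsilon> * (LBINT y. W y * (?K y)^2) + inverse \<epsilon> * (cauchy_mass / ?r) ^ ?d"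
  using iWK iWi by (simp add: WiI)
 also have "... <= \<epsilon> * (A^2 * (8 * sqrt 48) ^ ?d * ?r ^ ?d) + inverse \<epsilon> * (cauchy_mass / ?r) ^ ?d"
  using e0 WKle by (intro add_right_mono mult_left_mono) auto
 also have "\<epsilon> * (A^2 * (8 * sqrt 48) ^ ?d * ?r ^ ?d) = A * (8 * sqrt 48) ^ ?d"
  unfolding \<epsilon>_def using A r0 R0 by (simp add: field_simps power2_eq_square)
 also have "inverse \<epsilon> * (cauchy_mass / ?r) ^ ?d = A * cauchy_mass ^ ?d"
  unfolding \<epsilon>_def using A r0 R0 by (simp add: power_divide)
 finally show ?thesis by (simp add: kconst_def algebra_simps)
qed

section \<open>Estimates for \<open>L\<^sup>p\<close> norms\<close>

lemma epowr_ennreal: "0 <= a ==> epowr (ennreal a) r = ennreal (a powr r)" by (simp add: epowr_def)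

lemma epowr_top [simp]: "epowr top r = top" by (simp add: epowr_def)

lemma epowr_mono: "x <= y ==> 0 <= r ==> epowr x r <= epowr y r"
 by (cases x; cases y) (auto simp: epowr_ennreal top_unique intro!: ennreal_leI powr_mono2)

lemma borel_measurable_epowr [measurable]: "(%x. epowr x r) \<in> bmeas" unfolding epowr_def[abs_def] by measurable

lemma epowr_le_iff:
 assumes "0 < r" "0 <= B" shows "epowr x (1 / r) <= ennreal B \<longleftrightarrow> x <= ennreal (B powr r)"
proof (cases x)
 case (real a)
 have "a powr (1 / r) <= B \<longleftrightarrow> a <= B powr r"
 proof
  assume "a powr (1 / r) <= B"
  then have "(a powr (1 / r)) powr r <= B powr r" using assms by (intro powr_mono2) auto
  then show "a <= B powr r" using assms real by (simp add: powr_powr)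
 next
  assume "a <= B powr r"
  then have "a powr (1 / r) <= (B powr r) powr (1 / r)" using assms real by (intro powr_mono2) auto
  then show "a powr (1 / r) <= B" using assms by (simp add: powr_powr)
 qed
 then show ?thesis using real assms by (simp add: epowr_ennreal ennreal_le_iff)
qed (simp add: top_unique)

lemma enn2real_ge_1:
 assumes "1 <= p" "p ~= top" shows "1 <= enn2real p" using assms by (cases p) (auto simp: ennreal_1[symmetric] simp del: ennreal_1)

lemma eLp_norm_le_iff:
 assumes p: "1 <= p" "p ~= top" and B: "0 <= B"
 shows "eLp_norm p M a <= ennreal B \<longleftrightarrow> (\<integral>\<^sup>+x. epowr (a x) (enn2real p) \<partial>M) <= ennreal (B powr enn2real p)"
 using epowr_le_iff[OF _ B, of "enn2real p"] enn2real_ge_1[OF p] p(2) by (simp add: eLp_norm_def)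

lemma eLp_norm_top_le_iff:
 assumes "a \<in> borel_measurable M" shows "eLp_norm top M a <= c \<longleftrightarrow> (AE x in M. a x <= c)"
proof
 assume "eLp_norm top M a <= c"
 then have "esssup M a <= c" by (simp add: eLp_norm_def)
 with esssup_AE[of a M] show "AE x in M. a x <= c" by (auto elim!: eventually_mono intro: order_trans)
next
 assume "AE x in M. a x <= c"
 then show "eLp_norm top M a <= c" using assms by (auto simp: eLp_norm_def esssup_eq_AE intro!: Inf_lower)
qed

lemma le_powr_div_add:
 fixes t P :: real
 assumes "1 <= P" "0 <= t" shows "t <= t powr P / P + (1 - 1 / P)"
proof (cases "P = 1")
 case False
 then have P: "P > 1" using assms(1) False by (simp add: less_le)
 define q where "q = P / (P - 1)"
 have "q > 1" "1 / P + 1 / q = 1" using P by (auto simp: q_def field_simps)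
 from Youngs_inequality[OF P this(1) this(2) assms(2), of 1]
 have "t <= t powr P / P + 1 / q" by simp
 also have "1 / q = 1 - 1 / P" using \<open>1 / P + 1 / q = 1\<close> by simp
 finally show ?thesis .
qed (use assms in simp)

text \<open>Jensen's inequality for the density \<kappa>, whose mass is only bounded by C. Instead
  of normalising, the tangent line to the power function is integrated; it comes from Young's
  inequality with second factor 1.\<close>

lemma jensen_epowr:
 fixes \<kappa> b :: "'a => real"
 assumes P: "1 <= P" and C: "0 < C" and k [measurable]: "\<kappa> \<in> borel_measurable N" and k0: "!!y. 0 <= \<kappa> y"
  and b [measurable]: "b \<in> borel_measurable N" and b0: "!!y. 0 <= b y"
  and kC: "(\<integral>\<^sup>+y. ennreal (\<kappa> y) \<partial>N) <= ennreal C"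
 shows "epowr (\<integral>\<^sup>+y. ennreal (\<kappa> y * b y) \<partial>N) P <= ennreal (C powr (P - 1)) * (\<integral>\<^sup>+y. ennreal (\<kappa> y * b y powr P) \<partial>N)"
proof (cases "\<integral>\<^sup>+y. ennreal (\<kappa> y * b y powr P) \<partial>N")
 case top
 then show ?thesis using C by (simp add: ennreal_mult_top)
next
 case (real j)
 show ?thesis
 proof (cases "j = 0")
  case True
  have "AE y in N. ennreal (\<kappa> y * b y powr P) = 0" using real True by (subst nn_integral_0_iff_AE[symmetric]) auto
  then have "AE y in N. ennreal (\<kappa> y * b y) = 0"
   by eventually_elim (use k0 in \<open>auto simp: ennreal_eq_0_iff mult_le_0_iff less_le_not_le\<close>)
  then have "(\<integral>\<^sup>+y. ennreal (\<kappa> y * b y) \<partial>N) = 0" by (subst nn_integral_0_iff_AE) auto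
  then show ?thesis using epowr_ennreal[of 0 P] by simp
 next
  case False
  with real have j: "j > 0" by simp
  \<comment> \<open>The point of tangency is chosen with s^P = j/C, which makes the two terms of the
    linear bound add up to s C.\<close>
  define s where "s = (j / C) powr (1 / P)"
  have s: "s > 0" using j C by (simp add: s_def)
  have sP: "s powr P = j / C" using j C P by (simp add: s_def powr_powr)
  define c1 c2 where "c1 = s powr (1 - P) / P" and "c2 = s * (1 - 1 / P)"
  have pw: "\<kappa> y * b y <= c1 * (\<kappa> y * b y powr P) + c2 * \<kappa> y" for y
  proof -
   have "b y / s <= (b y / s) powr P / P + (1 - 1 / P)" using P s b0[of y] by (intro le_powr_div_add) auto
   also have "(b y / s) powr P = b y powr P / s powr P" using s b0 by (simp add: powr_divide)
   finally have "b y <= s * (b y powr P / s powr P / P + (1 - 1 / P))" using s by (simp add: pos_divide_le_eq mult.commute)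
   also have "... = c1 * b y powr P + c2" using s by (simp add: c1_def c2_def powr_diff distrib_left)
   finally have "\<kappa> y * b y <= \<kappa> y * (c1 * b y powr P + c2)" by (intro mult_left_mono k0)
   then show ?thesis by (simp add: algebra_simps)
  qed
  have nn: "0 <= c1" "0 <= c2" using s P by (auto simp: c1_def c2_def)
  have "(\<integral>\<^sup>+y. ennreal (\<kappa> y * b y) \<partial>N) <= (\<integral>\<^sup>+y. ennreal c1 * ennreal (\<kappa> y * b y powr P) + ennreal c2 * ennreal (\<kappa> y) \<partial>N)"
  proof (rule nn_integral_mono)
   fix y
   have "ennreal (\<kappa> y * b y) <= ennreal (c1 * (\<kappa> y * b y powr P) + c2 * \<kappa> y)" by (rule ennreal_leI[OF pw])
   also have "... = ennreal c1 * ennreal (\<kappa> y * b y powr P) + ennreal c2 * ennreal (\<kappa> y)"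
    using nn k0[of y] by (subst ennreal_plus) (simp_all add: ennreal_mult')
   finally show "ennreal (\<kappa> y * b y) <= ennreal c1 * ennreal (\<kappa> y * b y powr P) + ennreal c2 * ennreal (\<kappa> y)" .
  qed
  also have "... = ennreal c1 * ennreal j + ennreal c2 * (\<integral>\<^sup>+y. ennreal (\<kappa> y) \<partial>N)"
   by (subst nn_integral_add) (auto simp: nn_integral_cmult real)
  also have "... <= ennreal c1 * ennreal j + ennreal c2 * ennreal C" by (intro add_left_mono mult_left_mono kC) simp
  also have "... = ennreal (c1 * j + c2 * C)" using nn C j by (subst ennreal_plus) (simp_all add: ennreal_mult')
  also have "c1 * j + c2 * C = s * C"
  proof -
   have "s powr (1 - P) * j = s * C" using s sP C j by (simp add: powr_diff)
   then have "c1 * j = s * C / P" by (simp add: c1_def)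
   then show ?thesis using P by (simp add: c2_def field_simps)
  qed
  finally have "epowr (\<integral>\<^sup>+y. ennreal (\<kappa> y * b y) \<partial>N) P <= epowr (ennreal (s * C)) P"
   using P by (intro epowr_mono) auto
  also have "... = ennreal ((s * C) powr P)" using s C by (intro epowr_ennreal) auto
  also have "(s * C) powr P = C powr (P - 1) * j" using s C by (simp add: powr_mult sP powr_diff)
  finally show ?thesis using real by (simp add: ennreal_mult')
 qed
qed

text \<open>Jensen in y for each x, then exchange of the integrals: C^(P-1) from the first step and
  C from the second give C^P. The same statement serves for kernels on the space and for both
  passages between scales and time.\<close>

theorem schur_test:
 fixes \<kappa> :: "'a => 'b => real" and b :: "'b => real"
 assumes M: "sigma_finite_measure M" and N: "sigma_finite_measure N" and p: "1 <= p" and C: "0 < C" and B: "0 <= B"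
  and k [measurable]: "(%(x, y). \<kappa> x y) \<in> borel_measurable (M \<Otimes>\<^sub>M N)" and k0: "!!x y. 0 <= \<kappa> x y"
  and kN: "!!x. x \<in> space M ==> (\<integral>\<^sup>+y. ennreal (\<kappa> x y) \<partial>N) <= ennreal C"
  and kM: "!!y. y \<in> space N ==> (\<integral>\<^sup>+x. ennreal (\<kappa> x y) \<partial>M) <= ennreal C"
  and b [measurable]: "b \<in> borel_measurable N" and b0: "!!y. 0 <= b y" and bB: "eLp_norm p N (%y. ennreal (b y)) <= ennreal B"
  and a [measurable]: "a \<in> borel_measurable M"
  and ab: "!!x. x \<in> space M ==> a x <= (\<integral>\<^sup>+y. ennreal (\<kappa> x y * b y) \<partial>N)"
 shows "eLp_norm p M a <= ennreal (C * B)"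
proof -
 interpret M: sigma_finite_measure M by fact
 interpret N: sigma_finite_measure N by fact
 interpret pair_sigma_finite M N by standard
 have kx [measurable]: "\<kappa> x \<in> borel_measurable N" if "x \<in> space M" for x using measurable_Pair2[OF k that] by simp
 show ?thesis
 proof (cases "p = top")
  case True
  have "AE y in N. ennreal (b y) <= ennreal B" using bB True by (subst (asm) True, subst (asm) eLp_norm_top_le_iff) auto
  then have AEb: "AE y in N. b y <= B" by eventually_elim (simp add: B)
  have "a x <= ennreal (C * B)" if x: "x \<in> space M" for x
  proof -
   have "a x <= (\<integral>\<^sup>+y. ennreal (\<kappa> x y * b y) \<partial>N)" by (rule ab[OF x])
   also have "... <= (\<integral>\<^sup>+y. ennreal (\<kappa> x y) * ennreal B \<partial>N)"
    by (rule nn_integral_mono_AE, use AEb in eventually_elim)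
      (auto simp: ennreal_mult'[symmetric] B k0 intro!: ennreal_leI mult_left_mono)
   also have "... = (\<integral>\<^sup>+y. ennreal (\<kappa> x y) \<partial>N) * ennreal B"
    using kx[OF x] by (simp add: nn_integral_multc)
   also have "... <= ennreal C * ennreal B" by (intro mult_right_mono kN[OF x]) simp
   finally show ?thesis using B C by (simp add: ennreal_mult')
  qed
  then show ?thesis unfolding True by (subst eLp_norm_top_le_iff) auto
 next
  case False
  define P where "P = enn2real p"
  have P: "1 <= P" unfolding P_def by (rule enn2real_ge_1[OF p False])
  have bI: "(\<integral>\<^sup>+y. ennreal (b y powr P) \<partial>N) <= ennreal (B powr P)"
   using bB unfolding eLp_norm_le_iff[OF p False B] P_def[symmetric] by (simp add: epowr_ennreal b0)
  have "(\<integral>\<^sup>+x. epowr (a x) P \<partial>M) <= (\<integral>\<^sup>+x. ennreal (C powr (P - 1)) * (\<integral>\<^sup>+y. ennreal (\<kappa> x y * b y powr P) \<partial>N) \<partial>M)"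
  proof (rule nn_integral_mono)
   fix x assume x: "x \<in> space M"
   have "epowr (a x) P <= epowr (\<integral>\<^sup>+y. ennreal (\<kappa> x y * b y) \<partial>N) P" using P by (intro epowr_mono ab x) auto
   also have "... <= ennreal (C powr (P - 1)) * (\<integral>\<^sup>+y. ennreal (\<kappa> x y * b y powr P) \<partial>N)"
    by (rule jensen_epowr[OF P C kx[OF x] k0 b b0 kN[OF x]])
   finally show "epowr (a x) P <= ennreal (C powr (P - 1)) * (\<integral>\<^sup>+y. ennreal (\<kappa> x y * b y powr P) \<partial>N)" .
  qed
  also have "... = ennreal (C powr (P - 1)) * (\<integral>\<^sup>+x. \<integral>\<^sup>+y. ennreal (\<kappa> x y * b y powr P) \<partial>N \<partial>M)"
   by (rule nn_integral_cmult) measurable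
  also have "(\<integral>\<^sup>+x. \<integral>\<^sup>+y. ennreal (\<kappa> x y * b y powr P) \<partial>N \<partial>M) = (\<integral>\<^sup>+y. \<integral>\<^sup>+x. ennreal (\<kappa> x y * b y powr P) \<partial>M \<partial>N)"
   by (rule Fubini'[symmetric]) measurable
  also have "... <= (\<integral>\<^sup>+y. ennreal C * ennreal (b y powr P) \<partial>N)"
  proof (rule nn_integral_mono)
   fix y assume y: "y \<in> space N"
   have [measurable]: "(%x. \<kappa> x y) \<in> borel_measurable M" using measurable_Pair1[OF k y] by simp
   have "(\<integral>\<^sup>+x. ennreal (\<kappa> x y * b y powr P) \<partial>M) = (\<integral>\<^sup>+x. ennreal (\<kappa> x y) \<partial>M) * ennreal (b y powr P)"
    by (subst nn_integral_multc[symmetric]) (auto simp: ennreal_mult k0)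
   also have "... <= ennreal C * ennreal (b y powr P)" by (intro mult_right_mono kM[OF y]) simp
   finally show "(\<integral>\<^sup>+x. ennreal (\<kappa> x y * b y powr P) \<partial>M) <= ennreal C * ennreal (b y powr P)" .
  qed
  also have "... = ennreal C * (\<integral>\<^sup>+y. ennreal (b y powr P) \<partial>N)" by (rule nn_integral_cmult) measurable
  also have "ennreal (C powr (P - 1)) * ... <= ennreal (C powr (P - 1)) * (ennreal C * ennreal (B powr P))"
   by (intro mult_left_mono bI) auto
  also have "... = ennreal ((C * B) powr P)" using C B by (simp add: powr_mult powr_diff ennreal_mult'[symmetric])
  finally have "(\<integral>\<^sup>+x. epowr (a x) P \<partial>M) <= ennreal ((C * B) powr P)" by (simp add: mult_left_mono)
  then show ?thesis using C B by (subst eLp_norm_le_iff[OF p False]) (auto simp: P_def)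
 qed
qed

text \<open>Again Jensen, now for the weights w on \<open>nat\<close>: each g k is written as w k
  times the quotient g k / w k. Only upper bounds for the individual norms enter, so no duality
  argument is required.\<close>

theorem minkowski_suminf:
 fixes g :: "nat => 'a => real"
 assumes p: "1 <= p" and g [measurable]: "!!k. g k \<in> borel_measurable M" and g0: "!!k x. 0 <= g k x"
  and w: "!!k. 0 < w k" "summable w" and gw: "!!k. eLp_norm p M (%x. ennreal (g k x)) <= ennreal (w k)"
  and a [measurable]: "a \<in> borel_measurable M" and ag: "!!x. x \<in> space M ==> a x <= (\<Sum>k. ennreal (g k x))"
 shows "eLp_norm p M a <= ennreal (suminf w)"
proof -
 define W where "W = suminf w"
 have W: "W > 0" unfolding W_def by (rule suminf_pos[OF w(2,1)])
 have sw: "(\<Sum>k. ennreal (w k)) = ennreal W" unfolding W_def by (rule suminf_ennreal2) (use w less_imp_le in auto)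
 show ?thesis
 proof (cases "p = top")
  case True
  have "AE x in M. ennreal (g k x) <= ennreal (w k)" for k using gw[of k] unfolding True by (subst (asm) eLp_norm_top_le_iff) auto
  then have "AE x in M. \<forall>k. ennreal (g k x) <= ennreal (w k)" by (simp add: AE_all_countable)
  then have "AE x in M. a x <= ennreal W"
  proof (rule AE_mp, intro AE_I2 impI)
   fix x assume x: "x \<in> space M" and le: "\<forall>k. ennreal (g k x) <= ennreal (w k)"
   have "a x <= (\<Sum>k. ennreal (g k x))" by (rule ag[OF x])
   also have "... <= (\<Sum>k. ennreal (w k))" using le by (intro suminf_le) auto
   finally show "a x <= ennreal W" by (simp add: sw)
  qed
  then show ?thesis unfolding True W_def[symmetric] by (subst eLp_norm_top_le_iff) auto
 next
  case False
  define P where "P = enn2real p"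
  have P: "1 <= P" unfolding P_def by (rule enn2real_ge_1[OF p False])
  have gI: "(\<integral>\<^sup>+x. ennreal (g k x powr P) \<partial>M) <= ennreal (w k powr P)" for k
   using gw[of k] unfolding eLp_norm_le_iff[OF p False less_imp_le[OF w(1)]] P_def[symmetric] by (simp add: epowr_ennreal g0)
  have "(\<integral>\<^sup>+x. epowr (a x) P \<partial>M) <= (\<integral>\<^sup>+x. ennreal (W powr (P - 1)) * (\<Sum>k. ennreal (w k powr (1 - P)) * ennreal (g k x powr P)) \<partial>M)"
  proof (rule nn_integral_mono)
   fix x assume x: "x \<in> space M"
   have e: "w k * (g k x / w k) = g k x" for k using w(1)[of k] by simp
   have e': "w k * (g k x / w k) powr P = w k powr (1 - P) * g k x powr P" for k
    using w(1)[of k] g0[of k x] by (simp add: powr_divide powr_diff)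
   have "epowr (a x) P <= epowr (\<Sum>k. ennreal (g k x)) P" using P by (intro epowr_mono ag x) auto
   also have "... = epowr (\<integral>\<^sup>+k. ennreal (w k * (g k x / w k)) \<partial>count_space UNIV) P"
    by (simp only: e nn_integral_count_space_nat)
   also have "... <= ennreal (W powr (P - 1)) * (\<integral>\<^sup>+k. ennreal (w k * (g k x / w k) powr P) \<partial>count_space UNIV)"
    using w(1) g0 by (intro jensen_epowr P W) (auto simp: nn_integral_count_space_nat sw less_imp_le)
   also have "... = ennreal (W powr (P - 1)) * (\<Sum>k. ennreal (w k powr (1 - P)) * ennreal (g k x powr P))"
    unfolding e' nn_integral_count_space_nat by (simp add: ennreal_mult)
   finally show "epowr (a x) P <= ennreal (W powr (P - 1)) * (\<Sum>k. ennreal (w k powr (1 - P)) * ennreal (g k x powr P))" .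
  qed
  also have "... = ennreal (W powr (P - 1)) * (\<Sum>k. ennreal (w k powr (1 - P)) * (\<integral>\<^sup>+x. ennreal (g k x powr P) \<partial>M))"
   by (subst nn_integral_cmult, measurable, subst nn_integral_suminf, measurable, subst nn_integral_cmult) auto
  also have "... <= ennreal (W powr (P - 1)) * (\<Sum>k. ennreal (w k powr (1 - P)) * ennreal (w k powr P))"
   by (intro mult_left_mono suminf_le gI) auto
  also have "(\<Sum>k. ennreal (w k powr (1 - P)) * ennreal (w k powr P)) = ennreal W"
  proof -
   have "ennreal (w k powr (1 - P)) * ennreal (w k powr P) = ennreal (w k)" for k
    using w(1)[of k] by (simp add: ennreal_mult'[symmetric] powr_add[symmetric])
   then show ?thesis by (simp add: sw)
  qed
  also have "ennreal (W powr (P - 1)) * ennreal W = ennreal (W powr P)" using W by (simp add: ennreal_mult'[symmetric] powr_diff)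
  finally have "(\<integral>\<^sup>+x. epowr (a x) P \<partial>M) <= ennreal (W powr P)" .
  then show ?thesis unfolding W_def[symmetric] using W by (subst eLp_norm_le_iff[OF p False]) (auto simp: P_def)
 qed
qed

subsection \<open>Distributions in \<open>L\<^sup>p\<close>\<close>

text \<open>\<open>dist_Lp_norm\<close> is an infimum; estimates are carried out for an actual
  representative with norm at most A and transferred back by
  \<open>dist_Lp_norm_transfer\<close>.\<close>

definition Lp_bound :: "ennreal => 'n::finite dist => real => bool" where
 "Lp_bound p u A \<longleftrightarrow> (\<exists>g\<in>bmeas. eLp_norm p lborel (%x. ennreal (cmod (g x))) <= ennreal A & represents g u)"

lemma dist_Lp_norm_le: "Lp_bound p u A ==> dnorm p u <= ennreal A" unfolding Lp_bound_def dist_Lp_norm_def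
 by (auto intro!: INF_lower2 simp: order_le_less_trans[of _ "ennreal A"])

lemma Lp_bound_if_less:
 assumes "dnorm p u < ennreal A" shows "Lp_bound p u A"
 using assms unfolding dist_Lp_norm_def INF_less_iff Lp_bound_def by (auto intro: less_imp_le)

text \<open>Attainment of the infimum is avoided: a representative within e/K of it exists, which
  costs e on the other side.\<close>

lemma dist_Lp_norm_transfer:
 assumes K: "0 < K" and f: "!!A. 0 < A ==> Lp_bound p u A ==> Lp_bound q v (K * A)"
 shows "dnorm q v <= ennreal K * dnorm p u"
proof (cases "dnorm p u")
 case (real a)
 show ?thesis
 proof (rule ennreal_le_epsilon)
  fix e :: real assume e: "0 < e"
  have "dnorm p u < ennreal (a + e / K)" using real e K by (simp add: ennreal_less_iff)
  then have "Lp_bound q v (K * (a + e / K))" using real e K by (intro f Lp_bound_if_less) (auto simp: add_nonneg_pos)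
  from dist_Lp_norm_le[OF this]
  show "dnorm q v <= ennreal K * dnorm p u + ennreal e"
   using real e K by (simp add: distrib_left ennreal_plus ennreal_mult')
 qed
next
 case top
 then show ?thesis using K by (simp add: ennreal_mult_top)
qed

lemma dist_Lp_norm_cong:
 assumes "!!f. f \<in> schwartz ==> u f = v f" shows "dnorm p u = dnorm p v"
proof -
 have "represents g u = represents g v" for g using assms by (auto simp: represents_def)
 then show ?thesis by (simp add: dist_Lp_norm_def)
qed

text \<open>In place of Hoelder's inequality, the modulus of g is bounded by 1 plus its P-th power,
  and h is both integrable and bounded.\<close>

lemma integrable_Lp_schwartz:
 assumes p: "1 <= p" and g [measurable]: "g \<in> bmeas"
  and gA: "eLp_norm p lborel (%x. ennreal (cmod (g x))) <= ennreal A" and h: "h \<in> schwartz"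
 shows "complex_integrable lborel (%x. g x * h x)"
proof -
 have hm [measurable]: "h \<in> bmeas" by (rule borel_measurable_schwartz[OF h])
 have hi: "(\<integral>\<^sup>+x. ennreal (cmod (h x)) \<partial>lborel) < \<infinity>"
  using integrable_schwartz[OF h] by (simp add: integrable_iff_bounded)
 obtain D where D: "D >= 0" "!!x. cmod (h x) <= D" using schwartz_bounded[OF h] by blast
 have A: "eLp_norm p lborel (%x. ennreal (cmod (g x))) <= ennreal \<bar>A\<bar>" using gA by (rule order_trans) (simp add: ennreal_leI)
 have "(\<integral>\<^sup>+x. ennreal (cmod (g x * h x)) \<partial>lborel) < \<infinity>"
 proof (cases "p = top")
  case True
  have "AE x in lborel. ennreal (cmod (g x)) <= ennreal \<bar>A\<bar>" using A unfolding True by (subst (asm) eLp_norm_top_le_iff) auto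
  then have "(\<integral>\<^sup>+x. ennreal (cmod (g x * h x)) \<partial>lborel) <= (\<integral>\<^sup>+x. ennreal \<bar>A\<bar> * ennreal (cmod (h x)) \<partial>lborel)"
   by (intro nn_integral_mono_AE, eventually_elim) (auto simp: norm_mult ennreal_mult'[symmetric] intro!: ennreal_leI mult_right_mono)
  also have "... = ennreal \<bar>A\<bar> * (\<integral>\<^sup>+x. ennreal (cmod (h x)) \<partial>lborel)" by (rule nn_integral_cmult) measurable
  also have "... < \<infinity>" using hi by (simp add: ennreal_mult_less_top)
  finally show ?thesis .
 next
  case False
  define P where "P = enn2real p"
  have P: "1 <= P" unfolding P_def by (rule enn2real_ge_1[OF p False])
  have gI: "(\<integral>\<^sup>+x. ennreal (cmod (g x) powr P) \<partial>lborel) <= ennreal (\<bar>A\<bar> powr P)"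
   using A unfolding eLp_norm_le_iff[OF p False abs_ge_zero] P_def[symmetric] by (simp add: epowr_ennreal)
  have "(\<integral>\<^sup>+x. ennreal (cmod (g x * h x)) \<partial>lborel) <= (\<integral>\<^sup>+x. ennreal (cmod (h x)) + ennreal D * ennreal (cmod (g x) powr P) \<partial>lborel)"
  proof (rule nn_integral_mono)
   fix x
   have t: "cmod (g x) <= 1 + cmod (g x) powr P"
   proof (cases "cmod (g x) <= 1")
    case False
    then have "cmod (g x) powr 1 <= cmod (g x) powr P" using P by (intro powr_mono) auto
    then show ?thesis using False by simp
   qed (simp add: add_increasing2)
   have "cmod (g x * h x) <= (1 + cmod (g x) powr P) * cmod (h x)" unfolding norm_mult by (intro mult_right_mono t) simp
   also have "... <= cmod (h x) + D * cmod (g x) powr P"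
    using mult_right_mono[OF D(2)[of x], of "cmod (g x) powr P"] by (simp add: algebra_simps)
   finally show "ennreal (cmod (g x * h x)) <= ennreal (cmod (h x)) + ennreal D * ennreal (cmod (g x) powr P)"
    using D(1) by (simp add: ennreal_leI ennreal_mult'[symmetric] flip: ennreal_plus)
  qed
  also have "... = (\<integral>\<^sup>+x. ennreal (cmod (h x)) \<partial>lborel) + ennreal D * (\<integral>\<^sup>+x. ennreal (cmod (g x) powr P) \<partial>lborel)"
   by (subst nn_integral_add) (auto simp: nn_integral_cmult)
  also have "... < \<infinity>" using hi order_le_less_trans[OF gI ennreal_less_top] by (simp add: ennreal_mult_less_top)
  finally show ?thesis .
 qed
 then show ?thesis by (simp add: integrable_iff_bounded)
qed

text \<open>The representative of the limit is the pointwise sum of the representatives. Minkowski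
  makes the sum of their moduli finite almost everywhere and, against a Schwartz function, an
  integrable majorant for the partial sums.\<close>

lemma Lp_bound_suminf:
 fixes u :: "nat => 'n::finite dist"
 assumes p: "1 <= p" and w: "!!k. 0 < w k" "summable w" and u: "!!k. Lp_bound p (u k) (w k)"
  and s: "!!f. f \<in> schwartz ==> (%k. u k f) sums v f" shows "Lp_bound p v (suminf w)"
proof -
 have "\<forall>k. \<exists>g. g \<in> bmeas & eLp_norm p lborel (%x. ennreal (cmod (g x))) <= ennreal (w k) & represents g (u k)"
  using u unfolding Lp_bound_def by blast
 then obtain g where g [measurable]: "!!k. g k \<in> bmeas"
  and gw: "!!k. eLp_norm p lborel (%x. ennreal (cmod (g k x))) <= ennreal (w k)" and gr: "!!k. represents (g k) (u k)" by metis
 define G where "G x = (\<Sum>k. ennreal (cmod (g k x)))" for x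
 have Gm [measurable]: "G \<in> bmeas" unfolding G_def by measurable
 have Gn: "eLp_norm p lborel G <= ennreal (suminf w)"
 proof (rule minkowski_suminf[OF p _ _ w gw])
  show "(%x. cmod (g k x)) \<in> borel_measurable lborel" for k by measurable
  show "G \<in> borel_measurable lborel" by measurable
  show "G x <= (\<Sum>k. ennreal (cmod (g k x)))" for x by (simp add: G_def)
 qed simp_all
 have Gfin: "AE x in lborel. G x ~= top"
 proof (cases "p = top")
  case True
  have "AE x in lborel. G x <= ennreal (suminf w)" using Gn unfolding True by (subst (asm) eLp_norm_top_le_iff) auto
  then show ?thesis by eventually_elim (auto simp: top_unique)
 next
  case False
  have "(\<integral>\<^sup>+x. epowr (G x) (enn2real p) \<partial>lborel) <= ennreal (suminf w powr enn2real p)"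
   using Gn w by (subst (asm) eLp_norm_le_iff[OF p False]) (auto intro!: suminf_nonneg suminf_pos less_imp_le)
  then have "(\<integral>\<^sup>+x. epowr (G x) (enn2real p) \<partial>lborel) ~= \<infinity>" by (auto simp: top_unique)
  then have "AE x in lborel. epowr (G x) (enn2real p) ~= \<infinity>" by (intro nn_integral_PInf_AE) auto
  then show ?thesis by eventually_elim auto
 qed
 \<comment> \<open>A finite-valued copy of G, with value 0 where G is infinite; it serves as the
   majorant.\<close>
 define G' where "G' x = cplx (enn2real (G x))" for x
 have G'm [measurable]: "G' \<in> bmeas" unfolding G'_def by measurable
 have G'n: "eLp_norm p lborel (%x. ennreal (cmod (G' x))) <= ennreal (suminf w)"
 proof -
  have le: "ennreal (cmod (G' x)) <= G x" for x unfolding G'_def by (cases "G x") auto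
  show ?thesis
  proof (rule minkowski_suminf[OF p _ _ w gw])
   show "(%x. cmod (g k x)) \<in> borel_measurable lborel" for k by measurable
   show "(%x. ennreal (cmod (G' x))) \<in> borel_measurable lborel" by measurable
  qed (simp_all only: le[unfolded G_def] norm_ge_zero)
 qed
 have summ: "AE x in lborel. summable (%k. cmod (g k x)) & (\<Sum>k. cmod (g k x)) = enn2real (G x)" using Gfin
 proof eventually_elim
  case (elim x)
  have "summable (%k. cmod (g k x))" by (rule summable_suminf_not_top) (use elim in \<open>auto simp: G_def\<close>)
  moreover from this have "G x = ennreal (\<Sum>k. cmod (g k x))" unfolding G_def by (intro suminf_ennreal2) auto
  ultimately show ?case by (simp add: suminf_nonneg)
 qed
 define h where "h x = (\<Sum>k. g k x)" for x
 have hm [measurable]: "h \<in> bmeas" unfolding h_def by measurable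
 have hn: "eLp_norm p lborel (%x. ennreal (cmod (h x))) <= ennreal (suminf w)"
 proof -
  have le: "ennreal (cmod (h x)) <= G x" for x
  proof (cases "G x = top")
   case False
   then have s: "summable (%k. cmod (g k x))" by (intro summable_suminf_not_top) (auto simp: G_def)
   then have "cmod (h x) <= (\<Sum>k. cmod (g k x))" unfolding h_def by (rule summable_norm)
   also have "ennreal ... = G x" unfolding G_def using s by (intro suminf_ennreal2[symmetric]) auto
   finally show ?thesis by (simp add: ennreal_leI)
  qed simp
  show ?thesis
  proof (rule minkowski_suminf[OF p _ _ w gw])
   show "(%x. cmod (g k x)) \<in> borel_measurable lborel" for k by measurable
   show "(%x. ennreal (cmod (h x))) \<in> borel_measurable lborel" by measurable
  qed (simp_all only: le[unfolded G_def] norm_ge_zero)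
 qed
 have "represents h v" unfolding represents_def
 proof
  fix f :: "real^'n => complex" assume f: "f \<in> schwartz"
  have [measurable]: "f \<in> bmeas" by (rule borel_measurable_schwartz[OF f])
  have "(%n. \<integral>x. (\<Sum>k<n. g k x * f x) \<partial>lborel) \<longlonglongrightarrow> (LBINT x. h x * f x)"
  proof (rule integral_dominated_convergence[where w="%x. cmod (G' x * f x)"])
   show "integrable lborel (%x. cmod (G' x * f x))" by (intro integrable_norm integrable_Lp_schwartz[OF p _ G'n f]) measurable
   show "AE x in lborel. (%n. \<Sum>k<n. g k x * f x) \<longlonglongrightarrow> h x * f x" using summ
   proof eventually_elim
    case (elim x)
    then have "(%k. g k x) sums h x" unfolding h_def by (metis summable_sums summable_norm_cancel)
    then have "(%k. g k x * f x) sums (h x * f x)" by (rule sums_mult2)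
     then show ?case by (simp add: sums_def)
   qed
   show "AE x in lborel. norm (\<Sum>k<n. g k x * f x) <= cmod (G' x * f x)" for n using summ
   proof eventually_elim
    case (elim x)
    have "norm (\<Sum>k<n. g k x * f x) <= (\<Sum>k<n. cmod (g k x)) * cmod (f x)"
     unfolding sum_distrib_right[symmetric] norm_mult by (intro mult_right_mono norm_sum) simp
    also have "... <= (\<Sum>k. cmod (g k x)) * cmod (f x)" using elim by (intro mult_right_mono sum_le_suminf) auto
    finally show ?case using elim by (simp add: G'_def norm_mult)
   qed
  qed measurable
  moreover have "(LBINT x. (\<Sum>k<n. g k x * f x)) = (\<Sum>k<n. u k f)" for n
  proof -
   have "(LBINT x. (\<Sum>k<n. g k x * f x)) = (\<Sum>k<n. \<integral>x. g k x * f x \<partial>lborel)"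
    by (intro Bochner_Integration.integral_sum integrable_Lp_schwartz[OF p g gw f])
   then show ?thesis using gr f by (simp add: represents_def)
  qed
  ultimately have "(%k. u k f) sums (LBINT x. h x * f x)" by (simp add: sums_def)
  with s[OF f] show "v f = (LBINT x. h x * f x)" by (rule sums_unique2)
 qed
 with hn show ?thesis unfolding Lp_bound_def by (intro bexI[of _ h] conjI hm) assumption+
qed

lemma hser_finite:
 assumes "!!a. mdeg a > R ==> c a = 0" shows "hser c = fcomb hermv {a. mdeg a <= R} c"
proof
 fix x
 have "hser c x = (\<Sum>n<Suc R. fcomb hermv {a. mdeg a = n} c x)"
  unfolding hser_def by (rule suminf_finite) (auto simp: fcomb_def assms)
 also have "... = fcomb hermv {a. mdeg a <= R} c x" unfolding fcomb_def hermv.sum_levels by (simp add: less_Suc_eq_le)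
 finally show "hser c x = fcomb hermv {a. mdeg a <= R} c x" .
qed

text \<open>The cut-off at R makes m(H) u a finite Hermite combination, so its representation by the
  kernel is a matter of finite sums. The kernel is symmetric, so one bound serves both marginals in
  the Schur test.\<close>

theorem Lp_bound_multiplier:
 fixes u :: "'n::finite dist"
 assumes p: "1 <= p" and u: "Lp_bound p u B" and B: "0 <= B"
  and m: "m \<in> bmeas" and R: "R >= 1" and A: "A > 0" and m0: "!!n. n > R ==> m (evl TYPE('n) n) = 0"
  and d: "!!k n. k <= CARD('n) ==> \<bar>(ndiff ^^ k) (%n. m (evl TYPE('n) n)) n\<bar> <= A / real R ^ k"
 shows "Lp_bound p (calc m u) ((kconst TYPE('n) * A) * B)"
proof -
 let ?\<mu> = "%n. m (evl TYPE('n) n)" and ?A = "{a::'n => nat. mdeg a <= R}"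
 obtain g where g [measurable]: "g \<in> bmeas"
  and gB: "eLp_norm p lborel (%x. ennreal (cmod (g x))) <= ennreal B" and gr: "represents g u" using u unfolding Lp_bound_def by blast
 have gi: "complex_integrable lborel (%x. g x * h x)" if "h \<in> schwartz" for h by (rule integrable_Lp_schwartz[OF p g gB that])
 have mb: "\<bar>m (lam a)\<bar> <= A" for a :: "'n => nat" using d[of 0 "mdeg a"] by (simp add: lam_evl)
 define F where "F x = (LBINT y. g y * cplx (mker R ?\<mu> x y))" for x
 have Fe: "F x = (\<Sum>a\<in>?A. (cplx (?\<mu> (mdeg a)) * (LBINT y. g y * hermc a y)) * hermc a x)" for x
 proof -
  have "g y * cplx (mker R ?\<mu> x y) = (\<Sum>a\<in>?A. (cplx (?\<mu> (mdeg a)) * hermc a x) * (g y * hermc a y))" for y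
   by (simp add: mker_def sum_distrib_left mult_ac)
  then have "F x = (\<Sum>a\<in>?A. \<integral>y. (cplx (?\<mu> (mdeg a)) * hermc a x) * (g y * hermc a y) \<partial>lborel)"
   unfolding F_def by (simp only:) (intro Bochner_Integration.integral_sum integrable_mult_right gi hermc_schwartz)
  then show ?thesis unfolding integral_mult_right_zero by (simp only: mult_ac)
 qed
 have Fs: "F \<in> schwartz"
 proof -
  have "F = fcomb hermv ?A (%a. cplx (?\<mu> (mdeg a)) * (LBINT y. g y * hermc a y))"
   by (rule ext) (simp add: Fe fcomb_def)
  then show ?thesis by (simp add: fcomb_schwartz)
 qed
 have [measurable]: "F \<in> bmeas" by (rule borel_measurable_schwartz[OF Fs])
 have "represents F (calc m u)" unfolding represents_def
 proof
  fix f :: "real^'n => complex" assume f: "f \<in> schwartz"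
  let ?c = "%a. cplx (m (lam a)) * fcoef hermv f a"
  have cs: "oscillator_calc_schwartz m f = fcomb hermv ?A ?c"
   unfolding oscillator_calc_schwartz_eq[OF m mb f] by (rule hser_finite) (simp add: lam_evl m0)
  have "calc m u f = (LBINT x. g x * fcomb hermv ?A ?c x)"
   unfolding oscillator_calc_def cs by (rule bspec[OF gr[unfolded represents_def] fcomb_schwartz])
  also have "... = (LBINT x. (\<Sum>a\<in>?A. ?c a * (g x * hermc a x)))"
   by (simp add: fcomb_def sum_distrib_left mult_ac)
  also have "... = (\<Sum>a\<in>?A. ?c a * (LBINT x. g x * hermc a x))"
   by (subst Bochner_Integration.integral_sum) (auto intro!: integrable_mult_right gi hermc_schwartz)
  also have "... = (\<Sum>a\<in>?A. (cplx (?\<mu> (mdeg a)) * (LBINT y. g y * hermc a y)) * fcoef hermv f a)"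
   by (simp add: lam_evl mult_ac)
  also have "... = (\<integral>x. fcomb hermv ?A (%a. cplx (?\<mu> (mdeg a)) * (LBINT y. g y * hermc a y)) x * f x \<partial>lborel)"
   by (rule hermv.integral_fcomb_mult[OF schwartz_L2[OF f], symmetric])
  also have "... = (LBINT x. F x * f x)" by (simp add: Fe fcomb_def)
  finally show "calc m u f = (LBINT x. F x * f x)" .
 qed
 moreover have "eLp_norm p lborel (%x. ennreal (cmod (F x))) <= ennreal ((kconst TYPE('n) * A) * B)"
 proof (rule schur_test[where \<kappa>="%(x::real^'n) y::real^'n. \<bar>mker R ?\<mu> x y\<bar>" and b="%y. cmod (g y)"])
  have K: "0 < (8 * sqrt 48) ^ CARD('n)" by simp
  show "0 < kconst TYPE('n) * A" unfolding kconst_def using A cauchy_mass_nonneg by (intro mult_pos_pos add_pos_nonneg K) auto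
  have [measurable]: "hermv a \<in> bmeas" for a :: "'n => nat" by (rule hermv.meas)
  have hm: "(%z::(real^'n) \<times> (real^'n). hermv a (fst z)) \<in> borel_measurable (lborel \<Otimes>\<^sub>M lborel)"
    "(%z::(real^'n) \<times> (real^'n). hermv a (snd z)) \<in> borel_measurable (lborel \<Otimes>\<^sub>M lborel)" for a :: "'n => nat"
   by (rule measurable_compose[of _ _ lborel], simp_all)+
  show "(%(x::real^'n, y::real^'n). \<bar>mker R ?\<mu> x y\<bar>) \<in> borel_measurable (lborel \<Otimes>\<^sub>M lborel)"
   unfolding mker_def split_beta by (intro borel_measurable_abs borel_measurable_sum borel_measurable_times borel_measurable_const hm)
  have ik: "(\<integral>\<^sup>+y. ennreal \<bar>mker R ?\<mu> x y\<bar> \<partial>lborel) <= ennreal (kconst TYPE('n) * A)" for x :: "real^'n"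
  proof -
   have "integrable lborel (%y. \<bar>mker R ?\<mu> x y\<bar>)"
    using integrable_norm[OF integrable_schwartz[OF mker_schwartz[of R ?\<mu> x]]] by simp
   then have "(\<integral>\<^sup>+y. ennreal \<bar>mker R ?\<mu> x y\<bar> \<partial>lborel) = ennreal (LBINT y. \<bar>mker R ?\<mu> x y\<bar>)"
    by (rule nn_integral_eq_integral) simp
   also have "... <= ennreal (kconst TYPE('n) * A)" by (intro ennreal_leI kernel_integral_le R A m0 d)
   finally show ?thesis .
  qed
  then show "(\<integral>\<^sup>+y. ennreal \<bar>mker R ?\<mu> x y\<bar> \<partial>lborel) <= ennreal (kconst TYPE('n) * A)" for x :: "real^'n" .
  show "(\<integral>\<^sup>+x. ennreal \<bar>mker R ?\<mu> x y\<bar> \<partial>lborel) <= ennreal (kconst TYPE('n) * A)" for y :: "real^'n"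
   using ik[of y] by (simp add: mker_commute[of R _ y])
  show "ennreal (cmod (F x)) <= (\<integral>\<^sup>+y. ennreal (\<bar>mker R ?\<mu> x y\<bar> * cmod (g y)) \<partial>lborel)" for x
  proof -
   have "ennreal (cmod (F x)) <= (\<integral>\<^sup>+y. ennreal (norm (g y * cplx (mker R ?\<mu> x y))) \<partial>lborel)"
    unfolding F_def by (rule integral_norm_bound_ennreal) (intro gi mker_schwartz)
   then show ?thesis by (simp add: norm_mult mult.commute)
  qed
 qed (use p B gB in \<open>auto intro: sigma_finite_lborel\<close>)
 ultimately show ?thesis unfolding Lp_bound_def by (intro bexI[of _ F]) auto
qed

section \<open>Smooth multipliers at a dyadic scale\<close>

text \<open>Only the k-th derivative is bounded; the lower ones merely exist. Derivatives are given
  existentially, so that no iterated \<open>deriv\<close> has to be computed.\<close>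

primrec deriv_bound :: "nat => real => (real => real) => bool" where
 "deriv_bound 0 B F \<longleftrightarrow> (\<forall>x>0. \<bar>F x\<bar> <= B)"
| "deriv_bound (Suc k) B F \<longleftrightarrow>
   (\<exists>F'. (\<forall>x>0. (F has_real_derivative F' x) (at x)) & deriv_bound k B F')"

lemma deriv_bound_diff:
 assumes "deriv_bound (Suc k) B F" "0 < h" shows "deriv_bound k (h * B) (%x. F x - F (x + h))" using assms(1)
proof (induction k arbitrary: F)
 case 0
 then obtain F' where F': "!!x. x > 0 ==> (F has_real_derivative F' x) (at x)" "!!x. x > 0 ==> \<bar>F' x\<bar> <= B" by auto
 have "\<bar>F x - F (x + h)\<bar> <= h * B" if "x > 0" for x
 proof -
  have "\<exists>z>x. z < x + h & F (x + h) - F x = (x + h - x) * F' z"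
   by (rule MVT2) (use that assms(2) in \<open>auto intro!: F'(1)\<close>)
  then obtain z where z: "x < z" "z < x + h" "F (x + h) - F x = (x + h - x) * F' z" by blast
  have "\<bar>F x - F (x + h)\<bar> = h * \<bar>F' z\<bar>" using z(3) assms(2) by (subst abs_minus_commute) (simp add: abs_mult)
  also have "... <= h * B" using F'(2)[of z] z that assms(2) by (intro mult_left_mono) auto
  finally show ?thesis .
 qed
 then show ?case by simp
next
 case (Suc k)
 from Suc.prems obtain F' where F': "!!x. x > 0 ==> (F has_real_derivative F' x) (at x)" "deriv_bound (Suc k) B F'"
  unfolding deriv_bound.simps(2)[of "Suc k"] by blast
 have D: "((%x. F x - F (x + h)) has_real_derivative F' x - F' (x + h)) (at x)" if "x > 0" for x
  using F'(1)[of "x + h"] that assms(2) by (intro DERIV_diff F'(1)) (auto simp: DERIV_shift)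
 show ?case unfolding deriv_bound.simps(2)[of k] by (intro exI[of _ "%x. F' x - F' (x + h)"] conjI allI impI D Suc.IH[OF F'(2)])
qed

text \<open>Consecutive eigenvalues differ by 2, so one difference in n is a step 2r for F, and each
  step trades one derivative for a factor 2r.\<close>

lemma ndiff_pow_le:
 assumes "deriv_bound k B F" "0 < r"
 shows "\<bar>(ndiff ^^ k) (%n. F (r * evl TYPE('n::finite) n)) n\<bar> <= (2 * r) ^ k * B" using assms(1)
proof (induction k arbitrary: F B)
 case 0
 have "r * evl TYPE('n) n > 0" using assms(2) by (simp add: evl_def add_nonneg_pos)
 with 0 show ?case by simp
next
 case (Suc k)
 have "(ndiff ^^ Suc k) (%n. F (r * evl TYPE('n) n)) = (ndiff ^^ k) (ndiff (%n. F (r * evl TYPE('n) n)))"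
  by (simp add: funpow_swap1)
 also have "ndiff (%n. F (r * evl TYPE('n) n)) = (%n. F (r * evl TYPE('n) n) - F (r * evl TYPE('n) n + 2 * r))"
  by (simp add: ndiff_def fun_eq_iff evl_def algebra_simps)
 finally show ?case using Suc.IH[OF deriv_bound_diff[OF Suc.prems, of "2 * r"]] assms(2) by (simp add: mult_ac)
qed

text \<open>The interval \<open>[1/16, 16]\<close> contains \<open>\<lambda>\<^sup>2\<close> for each \<open>\<lambda>\<close> in the support of
  \<open>\<phi>\<^sub>-\<^sub>1 + \<phi>\<^sub>0 + \<phi>\<^sub>1\<close>.\<close>

primrec bounded_family :: "'p set => nat => ('p => real) => ('p => real => real) => bool" where
 "bounded_family P 0 W F \<longleftrightarrow> (\<exists>A. \<forall>p\<in>P. \<forall>x\<in>{1/16..16}. \<bar>F p x\<bar> <= A * W p)"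
| "bounded_family P (Suc k) W F \<longleftrightarrow> (\<exists>A. \<forall>p\<in>P. \<forall>x\<in>{1/16..16}. \<bar>F p x\<bar> <= A * W p) &
   (\<exists>F'. (\<forall>p\<in>P. \<forall>x>0. (F p has_real_derivative F' p x) (at x)) & bounded_family P k W F')"

lemma bounded_family_0: "bounded_family P k W F ==> bounded_family P 0 W F" by (cases k) auto

lemma bounded_family_0E:
 assumes "bounded_family P 0 W F"
 obtains A where "!!p x. p \<in> P ==> x \<in> {1/16..16} ==> \<bar>F p x\<bar> <= A * W p"
 using assms unfolding bounded_family.simps by blast

lemma bounded_family_0I:
 "(!!p x. p \<in> P ==> x \<in> {1/16..16} ==> \<bar>F p x\<bar> <= A * W p) ==> bounded_family P 0 W F"
 unfolding bounded_family.simps by blast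

lemma bounded_family_SucI:
 assumes "bounded_family P 0 W F" "!!p x. p \<in> P ==> 0 < x ==> (F p has_real_derivative F' p x) (at x)"
  "bounded_family P k W F'" shows "bounded_family P (Suc k) W F" using assms unfolding bounded_family.simps by blast

lemma bounded_family_SucE:
 assumes "bounded_family P (Suc k) W F"
 obtains F' where "!!p x. p \<in> P ==> 0 < x ==> (F p has_real_derivative F' p x) (at x)" "bounded_family P k W F'"
 using assms unfolding bounded_family.simps by blast

lemma bounded_family_Suc_D: "bounded_family P (Suc k) W F ==> bounded_family P k W F"
proof (induction k arbitrary: F)
 case (Suc k)
 from Suc.prems obtain F' where F': "!!p x. p \<in> P ==> 0 < x ==> (F p has_real_derivative F' p x) (at x)" "bounded_family P (Suc k) W F'"
  by (rule bounded_family_SucE) blast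
 show ?case by (rule bounded_family_SucI[OF bounded_family_0[OF Suc.prems] F'(1) Suc.IH[OF F'(2)]])
qed (rule bounded_family_0)

lemma bounded_family_le: "k <= k' ==> bounded_family P k' W F ==> bounded_family P k W F"
 by (induction rule: inc_induct) (auto dest: bounded_family_Suc_D simp del: bounded_family.simps)

lemma bounded_family_add:
 assumes "bounded_family P k W F" "bounded_family P k W G" shows "bounded_family P k W (%p x. F p x + G p x)" using assms
proof (induction k arbitrary: F G)
 case (0 F G)
 from 0(1) obtain A where A: "!!p x. p \<in> P ==> x \<in> {1/16..16} ==> \<bar>F p x\<bar> <= A * W p" by (rule bounded_family_0E) blast
 from 0(2) obtain B where B: "!!p x. p \<in> P ==> x \<in> {1/16..16} ==> \<bar>G p x\<bar> <= B * W p" by (rule bounded_family_0E) blast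
 have "\<bar>F p x + G p x\<bar> <= (A + B) * W p" if "p \<in> P" "x \<in> {1/16..16}" for p x
  using A[OF that] B[OF that] by (auto simp: distrib_right)
 then show ?case by (rule bounded_family_0I)
next
 case (Suc k F G)
 from Suc.prems(1) obtain F' where F': "!!p x. p \<in> P ==> 0 < x ==> (F p has_real_derivative F' p x) (at x)" "bounded_family P k W F'"
  by (rule bounded_family_SucE) blast
 from Suc.prems(2) obtain G' where G': "!!p x. p \<in> P ==> 0 < x ==> (G p has_real_derivative G' p x) (at x)" "bounded_family P k W G'"
  by (rule bounded_family_SucE) blast
 note k = Suc.prems[THEN bounded_family_Suc_D]
 show ?case by (rule bounded_family_SucI[OF bounded_family_0[OF Suc.IH[OF k]] DERIV_add Suc.IH[OF F'(2) G'(2)]]) (fact F' G')+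
qed

lemma bounded_family_mult:
 assumes "bounded_family P k W F" "bounded_family P k V G" shows "bounded_family P k (%p. W p * V p) (%p x. F p x * G p x)" using assms
proof (induction k arbitrary: F G)
 case (0 F G)
 from 0(1) obtain A where A: "!!p x. p \<in> P ==> x \<in> {1/16..16} ==> \<bar>F p x\<bar> <= A * W p" by (rule bounded_family_0E) blast
 from 0(2) obtain B where B: "!!p x. p \<in> P ==> x \<in> {1/16..16} ==> \<bar>G p x\<bar> <= B * V p" by (rule bounded_family_0E) blast
 have "\<bar>F p x * G p x\<bar> <= (A * B) * (W p * V p)" if "p \<in> P" "x \<in> {1/16..16}" for p x
 proof -
  have "\<bar>F p x\<bar> * \<bar>G p x\<bar> <= (A * W p) * (B * V p)" using A[OF that] B[OF that] by (intro mult_mono) auto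
  then show ?thesis by (simp add: abs_mult mult_ac)
 qed
 then show ?case by (rule bounded_family_0I)
next
 case (Suc k F G)
 from Suc.prems(1) obtain F' where F': "!!p x. p \<in> P ==> 0 < x ==> (F p has_real_derivative F' p x) (at x)" "bounded_family P k W F'"
  by (rule bounded_family_SucE) blast
 from Suc.prems(2) obtain G' where G': "!!p x. p \<in> P ==> 0 < x ==> (G p has_real_derivative G' p x) (at x)" "bounded_family P k V G'"
  by (rule bounded_family_SucE) blast
 note k = Suc.prems[THEN bounded_family_Suc_D]
 show ?case
 proof (rule bounded_family_SucI[OF bounded_family_0[OF Suc.IH[OF k]]])
  show "((%x. F p x * G p x) has_real_derivative F' p x * G p x + F p x * G' p x) (at x)" if "p \<in> P" "x > 0" for p x
   using DERIV_mult[OF F'(1)[OF that] G'(1)[OF that]] by (simp add: mult.commute)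
  show "bounded_family P k (%p. W p * V p) (%p x. F' p x * G p x + F p x * G' p x)" by (intro bounded_family_add Suc.IH F' G' k)
 qed
qed

lemma bounded_family_const: "bounded_family P k (%_. 1) (%_ _. c)"
proof (induction k arbitrary: c)
 case (Suc k)
 have "bounded_family P 0 (%_. 1) (%_ _. c)" by (rule bounded_family_0I[where A="\<bar>c\<bar>"]) simp
 then show ?case by (rule bounded_family_SucI[OF _ _ Suc[of 0]]) simp
qed auto

lemma bounded_family_cmult: "bounded_family P k W F ==> bounded_family P k W (%p x. c * F p x)"
 using bounded_family_mult[OF bounded_family_const] by simp

lemma bounded_family_continuous:
 fixes g :: "real => real"
 assumes "!!x. 0 < x ==> isCont g x" shows "bounded_family P 0 (%_. 1) (%_. g)"
proof -
 have "compact (g ` {1/16..16})" by (intro compact_continuous_image continuous_at_imp_continuous_on ballI assms) auto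
 from compact_imp_bounded[OF this] obtain A where "!!x. x \<in> {1/16..16} ==> \<bar>g x\<bar> <= A" unfolding bounded_iff by force
 then show ?thesis by (intro bounded_family_0I[where A=A]) simp
qed

lemma bounded_family_powr: "bounded_family P k (%_. 1) (%_ x. x powr b)"
proof (induction k arbitrary: b)
 case 0
 show ?case by (rule bounded_family_continuous) (auto intro!: continuous_intros)
next
 case (Suc k)
 have "bounded_family P 0 (%_. 1) (%_ x. x powr b)" by (rule bounded_family_continuous) (auto intro!: continuous_intros)
 then show ?case by (rule bounded_family_SucI[OF _ has_real_derivative_powr bounded_family_cmult[OF Suc]])
qed

lemma bounded_family_sqrt:
 fixes g :: "real => real"
 assumes g: "!!n x. (deriv ^^ n) g differentiable (at x)" shows "bounded_family P k (%_. 1) (%_ x. (deriv ^^ n) g (b * sqrt x))"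
proof (induction k arbitrary: n)
 have d: "((deriv ^^ n) g has_real_derivative (deriv ^^ Suc n) g x) (at x)" for n x
  using g[of n x] by (simp add: DERIV_deriv_iff_real_differentiable)
 have c: "isCont (%x. (deriv ^^ n) g (b * sqrt x)) x" for n x by (intro isCont_o2[OF _ DERIV_isCont[OF d]] continuous_intros)
 {
  case 0
  show ?case by (rule bounded_family_continuous) (rule c)
 next
  case (Suc k)
  have "bounded_family P 0 (%_. 1) (%_ x. (deriv ^^ n) g (b * sqrt x))" by (rule bounded_family_continuous) (rule c)
  then show ?case
  proof (rule bounded_family_SucI)
   fix x :: real assume x: "x > 0"
   have "((%x. b * sqrt x) has_real_derivative b * (inverse (sqrt x) / 2)) (at x)" by (intro DERIV_cmult DERIV_real_sqrt x)
   from DERIV_chain2[OF d this]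
   show "((%x. (deriv ^^ n) g (b * sqrt x)) has_real_derivative
    (b / 2) * ((deriv ^^ Suc n) g (b * sqrt x) * x powr (- (1/2)))) (at x)" using x by (simp add: powr_minus powr_half_sqrt mult_ac)
  next
   show "bounded_family P k (%_. 1) (%_ x. (b / 2) * ((deriv ^^ Suc n) g (b * sqrt x) * x powr (- (1/2))))"
    using bounded_family_cmult[OF bounded_family_mult[OF Suc[of "Suc n"] bounded_family_powr[where b="- (1/2)"]], of "b/2"] by simp
  qed
 }
qed

text \<open>With G_m the function for exponent a + m, its derivative is 1/x times (a + m) G_m + c
  G_(m+1). The scale is closed under differentiation, so bounds on the values for all m imply bounds
  on all derivatives. It is used with c = -1 for the semigroup and c = 1 for its inverse.\<close>

lemma bounded_family_power_exp:
 assumes P: "!!r. r \<in> P ==> 0 < r"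
  and b: "!!m. bounded_family P 0 W (%r x. (r * x) powr (a + real m) * exp (c * (r * x)))"
 shows "bounded_family P k W (%r x. (r * x) powr (a + real m) * exp (c * (r * x)))"
proof (induction k arbitrary: m)
 case (Suc k)
 let ?G = "%m r x. (r * x) powr (a + real m) * exp (c * (r * x))"
 show ?case
 proof (rule bounded_family_SucI[OF b])
  fix r x :: real assume t: "r \<in> P" and x: "x > 0"
  have tx: "r * x > 0" using P[OF t] x by simp
  have p1: "(r * x) powr (a + real m - 1) * r = x powr (- 1) * (r * x) powr (a + real m)"
   using P[OF t] x by (simp add: powr_minus powr_diff field_simps)
  have p2: "(r * x) powr (a + real (Suc m)) = (r * x) powr (a + real m) * (r * x)"
   using tx by (simp add: powr_add powr_realpow[symmetric] add.assoc[symmetric] add.commute[of 1])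
  have p3: "x powr (- 1) * x = 1" using x by (simp add: powr_minus)
  have D1: "((%x. (r * x) powr (a + real m)) has_real_derivative (a + real m) * (r * x) powr (a + real m - 1) * r) (at x)"
   using DERIV_chain2[OF has_real_derivative_powr[OF tx] DERIV_cmult_Id[of r]] by simp
  have D2: "((%x. exp (c * (r * x))) has_real_derivative exp (c * (r * x)) * (c * r)) (at x)"
   by (auto intro!: derivative_eq_intros)
  have "(a + real m) * (r * x) powr (a + real m - 1) * r * exp (c * (r * x)) + exp (c * (r * x)) * (c * r) * (r * x) powr (a + real m)
   = (a + real m) * ((r * x) powr (a + real m - 1) * r) * exp (c * (r * x)) + (x powr (- 1) * x) * exp (c * (r * x)) * (c * r) * (r * x) powr (a + real m)"
   unfolding p3 by (simp only: mult_ac mult_1_left mult_1_right)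
  also have "... = x powr (- 1) * ((a + real m) * ?G m r x + c * ?G (Suc m) r x)"
   unfolding p1 p2 by (simp only: distrib_left distrib_right mult_ac)
  finally show "(?G m r has_real_derivative x powr (- 1) * ((a + real m) * ?G m r x + c * ?G (Suc m) r x)) (at x)"
   using DERIV_mult[OF D1 D2] by simp
 next
  have "bounded_family P k (%r. 1 * W r) (%r x. x powr (- 1) * ((a + real m) * ?G m r x + c * ?G (Suc m) r x))"
   by (intro bounded_family_mult bounded_family_powr bounded_family_add bounded_family_cmult Suc)
  then show "bounded_family P k W (%r x. x powr (- 1) * ((a + real m) * ?G m r x + c * ?G (Suc m) r x))" by simp
 qed
qed (rule b)

text \<open>Off the closed interval F vanishes on an open set, hence its derivatives vanish there
  too, and bounds on the interval extend to all x > 0.\<close>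

lemma bounded_family_deriv_bound:
 assumes "bounded_family P k W F" and "!!p x. p \<in> P ==> 0 < x ==> x \<notin> {1/16..16} ==> F p x = 0"
  and W: "!!p. p \<in> P ==> 0 <= W p" shows "\<exists>A\<ge>0. \<forall>p\<in>P. deriv_bound k (A * W p) (F p)" using assms(1,2)
proof (induction k arbitrary: F)
 case 0
 from 0(1) obtain A where A: "!!p x. p \<in> P ==> x \<in> {1/16..16} ==> \<bar>F p x\<bar> <= A * W p" by (rule bounded_family_0E) blast
 have "\<bar>F p x\<bar> <= \<bar>A\<bar> * W p" if "p \<in> P" "x > 0" for p x
 proof (cases "x \<in> {1/16..16}")
  case True
  have "\<bar>F p x\<bar> <= A * W p" by (rule A[OF that(1) True])
  also have "... <= \<bar>A\<bar> * W p" by (intro mult_right_mono W that) simp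
  finally show ?thesis .
 qed (use 0(2)[OF that] W[OF that(1)] in simp)
 then show ?case by (intro exI[of _ "\<bar>A\<bar>"]) auto
next
 case (Suc k)
 from Suc.prems(1) obtain F' where F': "!!p x. p \<in> P ==> x > 0 ==> (F p has_real_derivative F' p x) (at x)" "bounded_family P k W F'"
  by (rule bounded_family_SucE) blast
 have "F' p x = 0" if p: "p \<in> P" and x: "x > 0" "x \<notin> {1/16..16}" for p x
 proof -
  have "open ({0<..} - {1/16..16::real})" by (intro open_Diff) auto
  moreover have "x \<in> {0<..} - {1/16..16}" using x by auto
  ultimately have "(F p has_real_derivative 0) (at x)"
   by (rule has_field_derivative_transform_within_open[of "%_. 0", rotated]) (use Suc.prems(2)[OF p] in auto)
  then show ?thesis using DERIV_unique F'(1)[OF p x(1)] by blast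
 qed
 from Suc.IH[OF F'(2) this] F'(1) show ?case by (metis deriv_bound.simps(2))
qed

text \<open>The dilated multiplier lives on levels up to about 8/r, while its k-th difference is of
  order r^k. These scales match, which is exactly the hypothesis of
  \<open>Lp_bound_multiplier\<close>, uniformly in r.\<close>

lemma Lp_bound_bounded_family:
 fixes F :: "'p => real => real"
 assumes F: "bounded_family P CARD('n::finite) W F" and Fm: "!!p. p \<in> P ==> F p \<in> bmeas"
  and F0: "!!p x. p \<in> P ==> 0 < x ==> x \<notin> {1/16..16} ==> F p x = 0" and W: "!!p. p \<in> P ==> 0 < W p"
 shows "\<exists>K>0. \<forall>p\<in>P. \<forall>r\<in>{0<..4}. \<forall>q\<ge>1. \<forall>u :: 'n dist.
  dnorm q (calc (%l. F p (r * l)) u) <= ennreal (K * W p) * dnorm q u"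
proof -
 let ?d = "CARD('n)"
 have "\<exists>A\<ge>0. \<forall>p\<in>P. deriv_bound k (A * W p) (F p)" if "k <= ?d" for k
  by (rule bounded_family_deriv_bound[OF bounded_family_le[OF that F] F0 less_imp_le[OF W]])
 then obtain A where A: "!!k. k <= ?d ==> 0 <= A k" "!!k p. k <= ?d ==> p \<in> P ==> deriv_bound k (A k * W p) (F p)" by metis
 define B where "B = (\<Sum>k\<le>?d. 24 ^ k * A k) + 1"
 have B: "B > 0" "!!k. k <= ?d ==> 24 ^ k * A k <= B"
 proof -
  have "0 <= (\<Sum>k\<le>?d. 24 ^ k * A k)" by (intro sum_nonneg mult_nonneg_nonneg A) auto
  then show "B > 0" by (simp add: B_def)
  show "24 ^ k * A k <= B" if "k <= ?d" for k using member_le_sum[of k "{..?d}" "%k. 24 ^ k * A k"] that A(1) by (simp add: B_def)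
 qed
 have kc: "kconst TYPE('n) > 0" unfolding kconst_def using cauchy_mass_nonneg by (intro add_pos_nonneg) auto
 have "dnorm q (calc (%l. F p (r * l)) u) <= ennreal ((kconst TYPE('n) * B) * W p) * dnorm q u"
  if p: "p \<in> P" and t: "0 < r" "r <= 4" and q: "1 <= q" for p r q and u :: "'n dist"
 proof -
  \<comment> \<open>Beyond R the argument r times the eigenvalue exceeds 16, where F vanishes.
    Rounding up is harmless since r \<le> 4: it keeps 2 r R \<le> 16 + 2 r \<le> 24, the source of
    the powers of 24.\<close>
  define R where "R = nat \<lceil>8 / r\<rceil>"
  have Rr: "8 / r <= real R" "real R <= 8 / r + 1" unfolding R_def using t by (auto simp: of_nat_nat ceiling_mono intro: order_trans[of 0])
  have R1: "real R > 0" using t by (intro less_le_trans[OF _ Rr(1)]) simp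
  have t2: "2 * r * real R <= 24"
  proof -
   have "2 * r * real R <= 2 * r * (8 / r + 1)" using t by (intro mult_left_mono Rr) auto
   also have "... = 16 + 2 * r" using t by (simp add: distrib_left)
   finally show ?thesis using t by simp
  qed
  have BW: "B * W p > 0" using B W[OF p] by simp
  have "Lp_bound q (calc (%l. F p (r * l)) u) ((kconst TYPE('n) * (B * W p)) * C)" if C: "0 < C" "Lp_bound q u C" for C
  proof (rule Lp_bound_multiplier[OF q C(2) less_imp_le[OF C(1)] _ _ BW])
   have [measurable]: "F p \<in> bmeas" by (rule Fm[OF p])
   show "(%l. F p (r * l)) \<in> bmeas" by measurable
   show "1 <= R" using R1 by simp
   show "F p (r * evl TYPE('n) n) = 0" if "R < n" for n
   proof -
    have "8 / r < real n" using Rr(1) that by linarith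
    then have "16 < r * (2 * real n)" using t by (simp add: field_simps)
    also have "... <= r * evl TYPE('n) n" using t by (intro mult_left_mono) (auto simp: evl_def)
    finally show ?thesis using F0[OF p, of "r * evl TYPE('n) n"] by auto
   qed
   show "\<bar>(ndiff ^^ k) (%n. F p (r * evl TYPE('n) n)) n\<bar> <= B * W p / real R ^ k" if k: "k <= ?d" for k n
   proof -
    have "\<bar>(ndiff ^^ k) (%n. F p (r * evl TYPE('n) n)) n\<bar> * real R ^ k <= ((2 * r) ^ k * (A k * W p)) * real R ^ k"
     by (intro mult_right_mono ndiff_pow_le A k p t) simp
    also have "... = (2 * r * real R) ^ k * (A k * W p)" by (simp add: power_mult_distrib mult_ac)
    also have "... <= 24 ^ k * (A k * W p)" using t t2 A(1)[OF k] W[OF p] by (intro mult_right_mono power_mono) auto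
    also have "... <= B * W p" using mult_right_mono[OF B(2)[OF k], of "W p"] W[OF p] by (simp add: mult_ac)
    finally show ?thesis using R1 by (simp add: pos_le_divide_eq)
   qed
  qed
  then show ?thesis using kc B(1) W[OF p] by (intro dist_Lp_norm_transfer) (auto simp: mult_ac)
 qed
 then show ?thesis using kc B by (intro exI[of _ "kconst TYPE('n) * B"]) auto
qed

section \<open>Dyadic pieces of the heat semigroup\<close>

definition spec_bounded :: "'n::finite itself => (real => real) => bool" where
 "spec_bounded _ m \<longleftrightarrow> m \<in> bmeas & (\<exists>K. \<forall>\<nu> :: 'n => nat. \<bar>m (lam \<nu>)\<bar> <= K)"

lemma spec_boundedI:
 assumes "m \<in> bmeas" "!!l. 1 <= l ==> \<bar>m l\<bar> <= K" shows "spec_bounded TYPE('n::finite) m"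
 using assms lam_ge_1 unfolding spec_bounded_def by blast

lemma spec_bounded_mult:
 assumes "spec_bounded TYPE('n::finite) m" "spec_bounded TYPE('n) m'" shows "spec_bounded TYPE('n) (%l. m l * m' l)"
proof -
 obtain K K' where K: "!!a :: 'n => nat. \<bar>m (lam a)\<bar> <= K" "!!a :: 'n => nat. \<bar>m' (lam a)\<bar> <= K'"
  and [measurable]: "m \<in> bmeas" "m' \<in> bmeas" using assms unfolding spec_bounded_def by blast
 have "\<bar>m (lam a) * m' (lam a)\<bar> <= K * K'" for a :: "'n => nat"
  unfolding abs_mult using K(1)[of a] K(2)[of a] by (intro mult_mono) auto
 then show ?thesis unfolding spec_bounded_def by auto
qed

lemma oscillator_calc_cong:
 fixes u :: "'n::finite dist"
 assumes m: "spec_bounded TYPE('n) m" and m': "spec_bounded TYPE('n) m'"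
  and e: "!!a :: 'n => nat. m (lam a) = m' (lam a)" and g: "g \<in> schwartz"
 shows "calc m u g = calc m' u g"
proof -
 obtain K K' where K: "!!a :: 'n => nat. \<bar>m (lam a)\<bar> <= K" "!!a :: 'n => nat. \<bar>m' (lam a)\<bar> <= K'"
  and b: "m \<in> bmeas" "m' \<in> bmeas" using m m' unfolding spec_bounded_def by blast
 show ?thesis unfolding oscillator_calc_def oscillator_calc_schwartz_eq[OF b(1) K(1) g] oscillator_calc_schwartz_eq[OF b(2) K(2) g] e ..
qed

text \<open>The product is compared with m'' on the spectrum only, so that cut-offs and inverses
  valid only there may be inserted.\<close>

lemma oscillator_calc_calc:
 fixes u :: "'n::finite dist"
 assumes m: "spec_bounded TYPE('n) m" and m': "spec_bounded TYPE('n) m'" and m'': "spec_bounded TYPE('n) m''"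
  and e: "!!a :: 'n => nat. m (lam a) * m' (lam a) = m'' (lam a)" and g: "g \<in> schwartz"
 shows "calc m (calc m' u) g = calc m'' u g"
proof -
 obtain K K' where K: "!!a :: 'n => nat. \<bar>m (lam a)\<bar> <= K" "!!a :: 'n => nat. \<bar>m' (lam a)\<bar> <= K'"
  and b [measurable]: "m \<in> bmeas" "m' \<in> bmeas" using m m' unfolding spec_bounded_def by blast
 have "spec_bounded TYPE('n) (%l. m l * m' l)" using m'' b unfolding spec_bounded_def e by auto
 then show ?thesis unfolding oscillator_calc_compose[OF b(1) K(1) b(2) K(2) g] using m'' e g by (rule oscillator_calc_cong)
qed

lemma oscillator_calc_diff:
 fixes u :: "'n::finite dist"
 assumes m: "spec_bounded TYPE('n) m" and m': "spec_bounded TYPE('n) m'" and u: "u \<in> tempered" and g: "g \<in> schwartz"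
 shows "calc (%l. m l - m' l) u g = calc m u g - calc m' u g"
proof -
 obtain K K' where K: "!!a :: 'n => nat. \<bar>m (lam a)\<bar> <= K" "!!a :: 'n => nat. \<bar>m' (lam a)\<bar> <= K'"
  and b [measurable]: "m \<in> bmeas" "m' \<in> bmeas" using m m' unfolding spec_bounded_def by blast
 have "\<bar>m (lam a) - m' (lam a)\<bar> <= K + K'" for a :: "'n => nat" using K(1)[of a] K(2)[of a] by linarith
 then have "(%n. cplx (m (evl TYPE('n) n) - m' (evl TYPE('n) n)) * (\<Sum>a | mdeg a = n. fcoef hermv g a * u (hermc a)))
   sums calc (%l. m l - m' l) u g" using oscillator_calc_sums[of "%l. m l - m' l" "K + K'" g u] g u by simp
 from sums_unique2[OF this] sums_diff[OF oscillator_calc_sums[OF b(1) K(1) g u] oscillator_calc_sums[OF b(2) K(2) g u]]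
 show ?thesis by (simp add: left_diff_distrib)
qed

lemma powr_le_add:
 assumes "0 < a" "a <= x" "x <= (b::real)" shows "x powr c <= a powr c + b powr c"
proof (cases "0 <= c")
 case True
 then have "x powr c <= b powr c" using assms by (intro powr_mono2) auto
 then show ?thesis by (simp add: add_increasing)
next
 case False
 then have "x powr c <= a powr c" using assms by (intro powr_mono2') auto
 then show ?thesis by (simp add: add_increasing2)
qed

text \<open>The exponential handles large x for any exponent. Near zero a negative power has to be
  kept away by \<delta>, while for a \<ge> 0 nothing can go wrong; hence the alternative in the
  hypothesis.\<close>

lemma powr_exp_bounded:
 assumes c: "0 < c" and \<delta>: "0 < \<delta> | 0 <= a"
 shows "\<exists>K>0. \<forall>x>0. \<delta> <= x --> x powr a * exp (- (c * x)) <= (K::real)"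
proof -
 have "((%x. x powr a * exp (- (c * x))) \<longlongrightarrow> 0) at_top" using c by real_asymp
 then have "\<forall>\<^sub>F x in at_top. x powr a * exp (- (c * x)) < 1" by (rule order_tendstoD) simp
 then obtain M where M: "!!x. x >= M ==> x powr a * exp (- (c * x)) < 1" by (auto simp: eventually_at_top_linorder)
 let ?K = "1 + \<bar>\<delta>\<bar> powr a + \<bar>M\<bar> powr a"
 have "x powr a * exp (- (c * x)) <= ?K" if x: "0 < x" "\<delta> <= x" for x
 proof (cases "x >= M")
  case True
  then show ?thesis using M[OF True] powr_ge_zero[of "\<bar>\<delta>\<bar>" a] powr_ge_zero[of "\<bar>M\<bar>" a] by linarith
 next
  case False
  have "x powr a <= ?K"
  proof (cases "a >= 0")
   case True
   have "x powr a <= \<bar>M\<bar> powr a" using True x False by (intro powr_mono2) auto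
   then show ?thesis using powr_ge_zero[of "\<bar>\<delta>\<bar>" a] by linarith
  next
   case a: False
   with \<delta> have "x powr a <= \<bar>\<delta>\<bar> powr a" using x by (intro powr_mono2') auto
   then show ?thesis using powr_ge_zero[of "\<bar>M\<bar>" a] by linarith
  qed
  moreover have "x powr a * exp (- (c * x)) <= x powr a * 1" using c x by (intro mult_left_mono) auto
  ultimately show ?thesis by simp
 qed
 moreover have "?K > 0" using powr_ge_zero[of "\<bar>\<delta>\<bar>" a] powr_ge_zero[of "\<bar>M\<bar>" a] by linarith
 ultimately show ?thesis by blast
qed

lemma heat_mult_measurable [measurable]: "heat_mult a t \<in> bmeas" unfolding heat_mult_def by measurable

lemma spec_bounded_powr_heat:
 assumes "0 < t" shows "spec_bounded TYPE('n::finite) (%l. l powr b * heat_mult a t l)"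
proof -
 obtain K where K: "K > 0" "!!x. 0 < x ==> t <= x ==> x powr (b + a) * exp (- (1 * x)) <= K"
  using powr_exp_bounded[of 1 t "b + a"] assms by auto
 show ?thesis
 proof (rule spec_boundedI)
  fix l :: real assume l: "1 <= l"
  have tl: "0 < t * l" "t <= t * l" using l assms by auto
  have "l powr b * heat_mult a t l = inverse (t powr b) * ((t * l) powr (b + a) * exp (- (1 * (t * l))))"
   using l assms by (simp add: heat_mult_def powr_mult powr_add field_simps)
  also have "... <= inverse (t powr b) * K" by (intro mult_left_mono K tl) simp
  finally show "\<bar>l powr b * heat_mult a t l\<bar> <= inverse (t powr b) * K" using l assms by (simp add: heat_mult_def)
 qed measurable
qed

lemma spec_bounded_heat:
 assumes "0 < t" shows "spec_bounded TYPE('n::finite) (heat_mult a t)"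
proof -
 have e: "lam m powr 0 * heat_mult a t (lam m) = heat_mult a t (lam m)" for m :: "'n => nat"
  using lam_pos[of m] by simp
 from spec_bounded_powr_heat[OF assms, of 0 a, where 'n='n] show ?thesis unfolding spec_bounded_def e using heat_mult_measurable by blast
qed

section \<open>Cut-offs attached to the dyadic partition\<close>

locale dyadic =
 fixes \<phi>0 :: "real => real"
 assumes dp: "dyadic_partition \<phi>0"
begin

abbreviation piece :: "int => 'n::finite dist => 'n dist" where
 "piece j == oscillator_calc (dyadic_mult \<phi>0 j)"

lemma phi_deriv: "(deriv ^^ n) \<phi>0 differentiable (at x)" and phi_nonneg: "0 <= \<phi>0 x"
 using dp unfolding dyadic_partition_def by auto

lemma phi_cont: "continuous_on A \<phi>0"
 using phi_deriv[of 0] by (auto intro!: continuous_at_imp_continuous_on differentiable_imp_continuous_within)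

lemma phi_measurable [measurable]: "\<phi>0 \<in> bmeas" by (rule borel_measurable_continuous_onI[OF phi_cont])

text \<open>The set where \<phi>0 is nonzero is open, hence inside the interior of its closed bound.
  The strict inequalities are what confine overlapping indices to the three values -1, 0, 1.\<close>

lemma phi_supp: assumes "\<phi>0 x ~= 0" shows "1/2 < x" "x < 2"
proof -
 have "open {x. \<phi>0 x ~= 0}" by (rule open_Collect_neq[OF phi_cont continuous_on_const])
 moreover have c: "closure {x. \<phi>0 x ~= 0} \<subseteq> {1/2..2}" using dp unfolding dyadic_partition_def by (elim conjE)
 have "{x. \<phi>0 x ~= 0} \<subseteq> {1/2..2}" by (rule subset_trans[OF closure_subset c])
 ultimately have "{x. \<phi>0 x ~= 0} \<subseteq> interior {1/2..2}" by (rule interior_maximal[rotated])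
 with assms have "x \<in> interior {1/2..2}" by blast
 then show "1/2 < x" "x < 2" unfolding interior_atLeastAtMost_real by auto
qed

lemma phi_sum:
 assumes J: "finite J" and l: "0 < l" and z: "!!j. \<phi>0 (2 powr (- real_of_int j) * l) ~= 0 ==> j \<in> J"
 shows "(\<Sum>j\<in>J. \<phi>0 (2 powr (- real_of_int j) * l)) = 1"
proof -
 have "((%j::int. \<phi>0 (2 powr (- real_of_int j) * l)) has_sum 1) UNIV" using dp l unfolding dyadic_partition_def by auto
 then have "((%j::int. \<phi>0 (2 powr (- real_of_int j) * l)) has_sum 1) J"
  by (rule has_sum_cong_neutral[THEN iffD1, rotated -1]) (use z in auto)
 with has_sum_finite[OF J, of "%j. \<phi>0 (2 powr (- real_of_int j) * l)"] show ?thesis using has_sum_unique by blast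
qed

lemma phi_shift_range:
 assumes "\<phi>0 x ~= 0" "\<phi>0 (2 powr (- real_of_int j) * x) ~= 0" shows "j \<in> {-1, 0, 1}"
proof -
 let ?p = "2 powr (- real_of_int j) :: real"
 have x: "1/2 < x" "x < 2" by (rule phi_supp[OF assms(1)])+
 have p: "1/2 < ?p * x" "?p * x < 2" by (rule phi_supp[OF assms(2)])+
 have "?p * (1/2) < ?p * x" using x by (intro mult_strict_left_mono) auto
 then have "?p < 4" using p by linarith
 then have "?p < 2 powr 2" by simp
 moreover have "?p * x < ?p * 2" using x by (intro mult_strict_left_mono) auto
 then have "1/4 < ?p" using p by linarith
 then have "2 powr (-2) < ?p" by (simp add: powr_minus)
 ultimately have "- real_of_int j < 2" "-2 < - real_of_int j" by (simp_all only: powr_less_cancel_iff[of 2])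
 then show ?thesis by auto
qed

lemma phi_le_1: "\<phi>0 x <= 1"
proof (cases "\<phi>0 x = 0")
 case False
 have "(\<Sum>j\<in>{-1, 0, 1}. \<phi>0 (2 powr (- real_of_int j) * x)) = 1"
  by (rule phi_sum) (use phi_supp(1)[OF False] phi_shift_range[OF False] in auto)
 then show ?thesis using phi_nonneg[of "2 * x"] phi_nonneg[of "x / 2"] by (simp add: powr_minus)
qed simp

text \<open>A fattened cut-off in the variable of H: it equals 1 wherever \<phi>0 (sqrt x) is
  nonzero, by \<open>phi_Phi\<close>, and vanishes off [1/16, 16] for positive x, by
  \<open>Phi_zero\<close>.\<close>

definition \<Phi> :: "real => real" where
 "\<Phi> x = \<phi>0 (2 powr 1 * sqrt x) + \<phi>0 (2 powr 0 * sqrt x) + \<phi>0 (2 powr (-1) * sqrt x)"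

lemma Phi_measurable [measurable]: "\<Phi> \<in> bmeas" unfolding \<Phi>_def by measurable

lemma phi_Phi: "\<Phi> x * \<phi>0 (sqrt x) = \<phi>0 (sqrt x)"
proof (cases "\<phi>0 (sqrt x) = 0")
 case False
 have "0 < sqrt x" using phi_supp(1)[OF False] by linarith
 then have "(\<Sum>j\<in>{-1, 0, 1}. \<phi>0 (2 powr (- real_of_int j) * sqrt x)) = 1" by (intro phi_sum phi_shift_range[OF False]) auto
 then show ?thesis by (simp add: \<Phi>_def)
qed simp

lemma Phi_zero: assumes "0 < x" "x \<notin> {1/16..16}" shows "\<Phi> x = 0"
proof -
 have "\<phi>0 (2 powr b * sqrt x) = 0" if b: "-1 <= b" "b <= 1" for b
 proof (rule ccontr)
  assume "\<phi>0 (2 powr b * sqrt x) ~= 0"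
  then have p: "1/2 < 2 powr b * sqrt x" "2 powr b * sqrt x < 2" by (rule phi_supp)+
  have "2 powr (-1) <= (2 powr b :: real)" "(2 powr b :: real) <= 2 powr 1" using b by (intro powr_mono; simp)+
  then have q: "1/2 <= (2 powr b :: real)" "(2 powr b :: real) <= 2" by (simp_all add: powr_minus)
  have s: "0 < sqrt x" using assms by simp
  have "2 powr b * sqrt x <= 2 * sqrt x" "1/2 * sqrt x <= 2 powr b * sqrt x" using q s by (intro mult_right_mono; simp)+
  with p have a: "1/4 < sqrt x" "sqrt x < 4" by auto
  have "sqrt x ^ 2 < 4 ^ 2" using a s by (intro power_strict_mono) auto
  moreover have "(1/4) ^ 2 < sqrt x ^ 2" using a by (intro power_strict_mono) auto
  ultimately show False using assms by (simp add: power2_eq_square)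
 qed
 from this[of 1] this[of 0] this[of "-1"] show ?thesis by (simp add: \<Phi>_def)
qed

lemma dyadic_mult_eq: "dyadic_mult \<phi>0 j l = \<phi>0 (sqrt (4 powr (- real_of_int j) * l))"
proof -
 have "sqrt (4 powr (- real_of_int j)) = 2 powr (- real_of_int j)"
  by (rule real_sqrt_unique) (simp_all add: power2_eq_square flip: powr_mult)
 then show ?thesis by (simp add: dyadic_mult_def real_sqrt_mult)
qed

lemma dyadic_mult_measurable [measurable]: "dyadic_mult \<phi>0 j \<in> bmeas" unfolding dyadic_mult_def by measurable

lemma spec_bounded_dyadic: "spec_bounded TYPE('n::finite) (dyadic_mult \<phi>0 j)"
 by (rule spec_boundedI[of _ 1]) (simp_all add: dyadic_mult_def phi_le_1 phi_nonneg)

lemma bounded_family_Phi: "bounded_family P k (%_. 1) (%_. \<Phi>)"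
proof -
 have "bounded_family P k (%_. 1) (%_ x. \<phi>0 (b * sqrt x))" for b using bounded_family_sqrt[of \<phi>0 P k 0 b, OF phi_deriv] by simp
 then show ?thesis unfolding \<Phi>_def by (intro bounded_family_add)
qed

lemma four_powr_range: "-1 <= j ==> 4 powr (- real_of_int j) \<in> {0<..4}" using powr_mono[of "- real_of_int j" 1 4] by simp

text \<open>Uniform boundedness of the dyadic projections; it lets the L^p norm dominate each piece,
  as the lower estimate requires for X = L^p.\<close>

lemma dyadic_piece_le:
 "\<exists>K>0. \<forall>j\<ge>-1. \<forall>q\<ge>1. \<forall>u :: 'n::finite dist.
   dnorm q (piece j u) <= ennreal K * dnorm q u"
proof -
 have "bounded_family {()} CARD('n) (%_. 1) (%_ x. \<phi>0 (1 * sqrt x))"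
  using bounded_family_sqrt[of \<phi>0 "{()}" _ 0 1, OF phi_deriv] by simp
 then have "\<exists>K>0. \<forall>p\<in>{()}. \<forall>r\<in>{0<..4}. \<forall>q\<ge>1. \<forall>u :: 'n dist.
  dnorm q (calc (%l. \<phi>0 (1 * sqrt (r * l))) u) <= ennreal (K * 1) * dnorm q u"
 proof (rule Lp_bound_bounded_family)
  fix x :: real assume x: "0 < x" "x \<notin> {1/16..16}"
  from phi_Phi[of x] show "\<phi>0 (1 * sqrt x) = 0" unfolding Phi_zero[OF x] by simp
 qed auto
 then show ?thesis unfolding dyadic_mult_eq using four_powr_range by fastforce
qed

text \<open>Two scales are independent here: h stands for 4^(-j) and dilates the spectrum, r stands
  for t 4^j and parametrises the family of profiles.\<close>

lemma localized_bound:
 fixes W :: "real => real"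
 assumes G: "bounded_family P CARD('n::finite) W G" and Gm: "!!r. r \<in> P ==> G r \<in> bmeas"
  and W: "!!r. r \<in> P ==> 0 < W r"
 shows "\<exists>K>0. \<forall>r\<in>P. \<forall>h\<in>{0<..4}. spec_bounded TYPE('n) (%l. \<Phi> (h * l) * G r (h * l)) &
   (\<forall>q\<ge>1. \<forall>u :: 'n dist. dnorm q (calc (%l. \<Phi> (h * l) * G r (h * l)) u) <= ennreal (K * W r) * dnorm q u)"
proof -
 have F: "bounded_family P CARD('n) W (%r x. \<Phi> x * G r x)" using bounded_family_mult[OF bounded_family_Phi G] by simp
 have Fm: "(%x. \<Phi> x * G r x) \<in> bmeas" if "r \<in> P" for r using Gm[OF that] by measurable
 have F0: "\<Phi> x * G r x = 0" if "0 < x" "x \<notin> {1/16..16}" for r x using Phi_zero[OF that] by simp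
 obtain A where A: "!!r x. r \<in> P ==> x \<in> {1/16..16} ==> \<bar>\<Phi> x * G r x\<bar> <= A * W r"
  using bounded_family_0[OF F] by (rule bounded_family_0E) blast
 have "spec_bounded TYPE('n) (%l. \<Phi> (h * l) * G r (h * l))" if t: "r \<in> P" "0 < h" for r h
 proof (rule spec_boundedI)
  show "(%l. \<Phi> (h * l) * G r (h * l)) \<in> bmeas"
   by (rule measurable_compose[OF _ Fm[OF t(1)]]) measurable
  fix l :: real assume "1 <= l"
  then have "0 < h * l" using t by simp
  then show "\<bar>\<Phi> (h * l) * G r (h * l)\<bar> <= \<bar>A * W r\<bar>"
   using A[OF t(1), of "h * l"] F0[of "h * l" r] by (cases "h * l \<in> {1/16..16}") auto
 qed
 moreover obtain K where "K > 0" "\<forall>r\<in>P. \<forall>h\<in>{0<..4}. \<forall>q\<ge>1. \<forall>u :: 'n dist.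
   dnorm q (calc (%l. \<Phi> (h * l) * G r (h * l)) u) <= ennreal (K * W r) * dnorm q u"
  using Lp_bound_bounded_family[OF F Fm F0 W] by blast
 ultimately show ?thesis by (intro exI[of _ K]) auto
qed

lemma dyadic_heat_le:
 "\<exists>K>0. \<forall>j\<ge>-1. \<forall>q\<ge>1. \<forall>t>0. \<forall>u :: 'n::finite dist.
   dnorm q (piece j (heat a t u))
    <= ennreal (K * ((t * 4 powr j) powr a * exp (- (t * 4 powr j / 32)))) * dnorm q (piece j u)"
proof -
 let ?W = "%r::real. r powr a * exp (- (r / 32))"
 let ?G = "%r x::real. (r * x) powr (a + real 0) * exp (- 1 * (r * x))"
 have "bounded_family {0<..} CARD('n) ?W ?G"
 proof (rule bounded_family_power_exp)
  fix m :: nat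
  obtain K where K: "K > 0" "!!x. 0 < x ==> x powr real m * exp (- (1/32 * x)) <= K"
   using powr_exp_bounded[of "1/32" 0 "real m"] by (auto simp: less_imp_le)
  show "bounded_family {0<..} 0 ?W (%r x. (r * x) powr (a + real m) * exp (- 1 * (r * x)))"
  proof (rule bounded_family_0I)
   fix r x :: real assume "r \<in> {0<..}" and x: "x \<in> {1/16..16}"
   then have t: "0 < r" and x0: "0 < x" by auto
   let ?B = "(1/16) powr (a + real m) + 16 powr (a + real m)"
   have b: "x powr (a + real m) <= ?B" using x by (intro powr_le_add) auto
   \<comment> \<open>On the interval x \<ge> 1/16, so exp(-rx) is at most the product of two copies
     of exp(-r/32). One copy absorbs r^m, the other is kept as decay.\<close>
   have e: "exp (- 1 * (r * x)) <= exp (- (1/32 * r)) * exp (- (r / 32))"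
    unfolding mult_exp_exp using x t mult_left_mono[of "1/16" x r] by simp
   have "\<bar>(r * x) powr (a + real m) * exp (- 1 * (r * x))\<bar> = r powr a * r powr real m * x powr (a + real m) * exp (- 1 * (r * x))"
    using t x0 by (simp add: powr_mult powr_add)
   also have "... <= r powr a * r powr real m * ?B * (exp (- (1/32 * r)) * exp (- (r / 32)))"
    by (intro mult_mono e b mult_nonneg_nonneg) auto
   also have "... = ?B * (r powr real m * exp (- (1/32 * r))) * ?W r" by (simp add: mult_ac)
   also have "... <= ?B * K * ?W r" by (intro mult_left_mono mult_right_mono K t) auto
   finally show "\<bar>(r * x) powr (a + real m) * exp (- 1 * (r * x))\<bar> <= ?B * K * ?W r" .
  qed
 qed auto
 from localized_bound[OF this] obtain K where K: "K > 0"
  "!!r h. 0 < r ==> h \<in> {0<..4} ==> spec_bounded TYPE('n) (%l. \<Phi> (h * l) * ?G r (h * l))"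
  "!!r h q u. 0 < r ==> h \<in> {0<..4} ==> 1 <= q ==>
   dnorm q (calc (%l. \<Phi> (h * l) * ?G r (h * l)) (u :: 'n dist)) <= ennreal (K * ?W r) * dnorm q u"
  by auto
 have "dnorm q (piece j (heat a t u))
    <= ennreal (K * ?W (t * 4 powr j)) * dnorm q (piece j u)"
  if j: "-1 <= j" and q: "1 <= q" and t: "0 < t" for j q t and u :: "'n dist"
 proof -
  let ?h = "4 powr (- real_of_int j)" and ?r = "t * 4 powr j"
  have tt: "?r * (?h * l) = t * l" for l by (simp add: powr_minus)
  have h: "?h \<in> {0<..4}" by (rule four_powr_range[OF j])
  have r: "0 < ?r" using t by simp
  have sb: "spec_bounded TYPE('n) (%l. dyadic_mult \<phi>0 j l * heat_mult a t l)"
   using spec_bounded_mult[OF spec_bounded_dyadic spec_bounded_heat[OF t]] .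
  have "dnorm q (piece j (heat a t u))
   = dnorm q (calc (%l. \<Phi> (?h * l) * ?G ?r (?h * l)) (piece j u))"
  proof (rule dist_Lp_norm_cong)
   fix g :: "real^'n => complex" assume g: "g \<in> schwartz"
   have "piece j (heat a t u) g = calc (%l. dyadic_mult \<phi>0 j l * heat_mult a t l) u g"
    by (rule oscillator_calc_calc[OF spec_bounded_dyadic spec_bounded_heat[OF t] sb refl g])
   \<comment> \<open>Inserting \<Phi> changes nothing, as it is 1 where the dyadic multiplier lives,
     but it makes the second factor compactly supported.\<close>
   also have "... = calc (%l. \<Phi> (?h * l) * ?G ?r (?h * l)) (piece j u) g"
   proof (rule oscillator_calc_calc[OF K(2)[OF r h] spec_bounded_dyadic sb _ g, symmetric])
    fix v :: "'n => nat"
    show "\<Phi> (?h * lam v) * ?G ?r (?h * lam v) * dyadic_mult \<phi>0 j (lam v) = dyadic_mult \<phi>0 j (lam v) * heat_mult a t (lam v)"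
     unfolding tt dyadic_mult_eq heat_mult_def using phi_Phi[of "?h * lam v"] by (simp add: mult_ac)
   qed
   finally show "piece j (heat a t u) g
    = calc (%l. \<Phi> (?h * l) * ?G ?r (?h * l)) (piece j u) g" .
  qed
  with K(3)[OF r h q] show ?thesis by simp
 qed
 with K(1) show ?thesis by blast
qed

text \<open>The inverse multiplier (rx)^(-a) exp(rx) is unbounded in general, but harmless once
  \<Phi> confines x and the time t is comparable to 4^(-j).\<close>

lemma dyadic_heat_ge:
 "\<exists>K>0. \<forall>j\<ge>-1. \<forall>q\<ge>1. \<forall>t. t * 4 powr j \<in> {1/4..1} --> (\<forall>u :: 'n::finite dist.
   dnorm q (piece j u)
    <= ennreal K * dnorm q (piece j (heat a t u)))"
proof -
 let ?G = "%r x::real. (r * x) powr (- a + real 0) * exp (1 * (r * x))"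
 have "bounded_family {1/4..1} CARD('n) (%_. 1) ?G"
 proof (rule bounded_family_power_exp)
  fix m :: nat
  let ?c = "- a + real m"
  show "bounded_family {1/4..1} 0 (%_. 1) (%r x. (r * x) powr ?c * exp (1 * (r * x)))"
  proof (rule bounded_family_0I)
   fix r x :: real assume t: "r \<in> {1/4..1}" and x: "x \<in> {1/16..16}"
   have y: "1/64 <= r * x" "r * x <= 16" using t x mult_mono[of "1/4" r "1/16" x] mult_mono[of r 1 x 16] by auto
   have "(r * x) powr ?c <= (1/64) powr ?c + 16 powr ?c" using y by (intro powr_le_add) auto
   then have "(r * x) powr ?c * exp (1 * (r * x)) <= ((1/64) powr ?c + 16 powr ?c) * exp 16"
    using y by (intro mult_mono) auto
   then show "\<bar>(r * x) powr ?c * exp (1 * (r * x))\<bar> <= ((1/64) powr ?c + 16 powr ?c) * exp 16 * 1" by simp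
  qed
 qed auto
 from localized_bound[OF this] obtain K where K: "K > 0"
  "!!r h. r \<in> {1/4..1} ==> h \<in> {0<..4} ==> spec_bounded TYPE('n) (%l. \<Phi> (h * l) * ?G r (h * l))"
  "!!r h q u. r \<in> {1/4..1} ==> h \<in> {0<..4} ==> 1 <= q ==>
   dnorm q (calc (%l. \<Phi> (h * l) * ?G r (h * l)) (u :: 'n dist)) <= ennreal K * dnorm q u"
  by auto
 have "dnorm q (piece j u)
    <= ennreal K * dnorm q (piece j (heat a t u))"
  if j: "-1 <= j" and q: "1 <= q" and r: "t * 4 powr j \<in> {1/4..1}" for j q t and u :: "'n dist"
 proof -
  let ?h = "4 powr (- real_of_int j)" and ?r = "t * 4 powr j"
  have tt: "?r * (?h * l) = t * l" for l by (simp add: powr_minus)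
  have h: "?h \<in> {0<..4}" by (rule four_powr_range[OF j])
  have t: "0 < t" using r by (auto intro: zero_less_mult_pos2[of _ "4 powr j"])
  have sb: "spec_bounded TYPE('n) (%l. dyadic_mult \<phi>0 j l * heat_mult a t l)"
   using spec_bounded_mult[OF spec_bounded_dyadic spec_bounded_heat[OF t]] .
  have "dnorm q (piece j u)
   = dnorm q (calc (%l. \<Phi> (?h * l) * ?G ?r (?h * l)) (calc (%l. dyadic_mult \<phi>0 j l * heat_mult a t l) u))"
  proof (rule dist_Lp_norm_cong, rule oscillator_calc_calc[OF K(2)[OF r h] sb spec_bounded_dyadic, symmetric])
   fix e :: "'n => nat"
   have l: "0 < t * lam e" using t lam_pos[of e] by simp
   then have "(t * lam e) powr (- a) * exp (t * lam e) * heat_mult a t (lam e) = 1"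
    by (auto simp: heat_mult_def powr_minus exp_minus field_simps)
   then show "\<Phi> (?h * lam e) * ?G ?r (?h * lam e) * (dyadic_mult \<phi>0 j (lam e) * heat_mult a t (lam e)) = dyadic_mult \<phi>0 j (lam e)"
    unfolding tt dyadic_mult_eq using phi_Phi[of "?h * lam e"] by (simp add: mult_ac) (metis mult.assoc mult.commute mult_1)
  qed
  also have "... <= ennreal K * dnorm q (calc (%l. dyadic_mult \<phi>0 j l * heat_mult a t l) u)"
   by (rule K(3)[OF r h q])
  also have "dnorm q (calc (%l. dyadic_mult \<phi>0 j l * heat_mult a t l) u)
    = dnorm q (piece j (heat a t u))"
   by (rule dist_Lp_norm_cong, rule oscillator_calc_calc[OF spec_bounded_dyadic spec_bounded_heat[OF t] sb refl, symmetric])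
  finally show ?thesis .
 qed
 with K(1) show ?thesis by blast
qed

end

section \<open>Triangle inequalities for norms of distributions\<close>

lemma dist_Lp_norm_suminf:
 fixes u :: "nat => 'n::finite dist"
 assumes p: "1 <= p" and s: "!!g. g \<in> schwartz ==> (%k. u k g) sums v g" shows "dnorm p v <= (\<Sum>k. dnorm p (u k))"
proof (cases "(\<Sum>k. dnorm p (u k)) = top")
 case False
 then have f: "dnorm p (u k) ~= top" for k using ennreal_suminf_lessD[of "%k. dnorm p (u k)" top k] by (auto simp: less_top)
 define a where "a k = enn2real (dnorm p (u k))" for k
 have a: "dnorm p (u k) = ennreal (a k)" "0 <= a k" for k using f[of k] by (simp_all add: a_def less_top)
 have sa: "summable a" by (rule summable_suminf_not_top) (use False in \<open>simp_all add: a\<close>)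
 show ?thesis
 proof (rule ennreal_le_epsilon)
  fix e :: real assume e: "0 < e"
  \<comment> \<open>Each infimum is given its share e 2^(-k-1) of room; this also makes the weights
    strictly positive, as \<open>Lp_bound_suminf\<close> demands.\<close>
  define w where "w k = a k + e * (1/2) ^ Suc k" for k
  have he: "(%k. e * (1/2) ^ Suc k) sums (e * 1)" by (intro sums_mult power_half_series)
  have "Lp_bound p (u k) (w k)" for k using e a[of k] by (intro Lp_bound_if_less) (simp add: w_def ennreal_less_iff)
  moreover have "0 < w k" for k using e a(2)[of k] by (simp add: w_def add_nonneg_pos)
  moreover have "summable w" unfolding w_def using sa he by (intro summable_add) (auto dest: sums_summable)
  ultimately have "dnorm p v <= ennreal (suminf w)" using s by (intro dist_Lp_norm_le Lp_bound_suminf[OF p]) auto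
  also have "suminf w = suminf a + e" unfolding w_def using suminf_add[OF sa sums_summable[OF he]] sums_unique[OF he] by simp
  also have "ennreal ... = (\<Sum>k. dnorm p (u k)) + ennreal e" using sa a e by (simp add: suminf_ennreal2 suminf_nonneg)
  finally show "dnorm p v <= (\<Sum>k. dnorm p (u k)) + ennreal e" .
 qed
qed simp

lemma dist_Lp_norm_zero: "1 <= p ==> dnorm p (%_. 0) = 0"
proof -
 assume p: "1 <= p"
 have "eLp_norm p lborel (%x. ennreal (cmod 0)) <= ennreal 0"
  using eLp_norm_top_le_iff[of "%_. 0" lborel 0] by (cases "p = top") (simp_all add: eLp_norm_def[of p] epowr_def)
 then have "Lp_bound p (%_. 0) 0" unfolding Lp_bound_def by (intro bexI[of _ "%_. 0"]) (auto simp: represents_def)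
 then show ?thesis using dist_Lp_norm_le by fastforce
qed

lemma dist_Lp_norm_add:
 fixes u u' v :: "'n::finite dist"
 assumes p: "1 <= p" and s: "!!g. g \<in> schwartz ==> v g = u g + u' g" shows "dnorm p v <= dnorm p u + dnorm p u'"
proof -
 let ?w = "%k::nat. if k = 0 then u else if k = 1 then u' else (%_. 0)"
 have "dnorm p v <= (\<Sum>k. dnorm p (?w k))"
 proof (rule dist_Lp_norm_suminf[OF p])
  fix g :: "real^'n => complex" assume "g \<in> schwartz"
  with s sums_finite[of "{0, 1}" "%k. ?w k g"] show "(%k. ?w k g) sums v g" by (auto simp: numeral_2_eq_2)
 qed
 also have "... = (\<Sum>k\<in>{0, 1}. dnorm p (?w k))" by (rule suminf_finite) (auto simp: dist_Lp_norm_zero[OF p])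
 finally show ?thesis by simp
qed

lemma dist_Lp_norm_uminus:
 fixes u v :: "'n::finite dist"
 assumes s: "!!g. g \<in> schwartz ==> v g = - u g" shows "dnorm p v <= dnorm p u"
proof -
 have "Lp_bound p v (1 * A)" if u: "Lp_bound p u A" for A
 proof -
  obtain g where [measurable]: "g \<in> bmeas" and
   g: "eLp_norm p lborel (%x. ennreal (cmod (g x))) <= ennreal A" "represents g u" using u unfolding Lp_bound_def by blast
  then have "represents (%x. - g x) v" using s by (auto simp: represents_def)
  with g(1) show ?thesis unfolding Lp_bound_def by (intro bexI[of _ "%x. - g x"]) auto
 qed
 then show ?thesis using dist_Lp_norm_transfer[of 1 p u p v] by simp
qed

lemma dist_Lp_norm_diff:
 fixes u u' w :: "'n::finite dist"
 assumes p: "1 <= p" and s: "!!g. g \<in> schwartz ==> w g = u g - u' g" shows "dnorm p w <= dnorm p u + dnorm p u'"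
proof -
 have "dnorm p w <= dnorm p u + dnorm p (%g. - u' g)" by (rule dist_Lp_norm_add[OF p]) (simp add: s)
 also have "... <= dnorm p u + dnorm p u'" by (intro add_left_mono dist_Lp_norm_uminus) simp
 finally show ?thesis .
qed

text \<open>The reverse triangle inequality, through which continuity in t reduces to the smallness
  of differences.\<close>

lemma dist_Lp_norm_diff_abs:
 fixes u u' w :: "'n::finite dist"
 assumes p: "1 <= p" and s: "!!g. g \<in> schwartz ==> w g = u g - u' g" and f: "dnorm p u < top" "dnorm p u' < top"
 shows "\<bar>enn2real (dnorm p u) - enn2real (dnorm p u')\<bar> <= enn2real (dnorm p w)"
proof -
 have "dnorm p w <= dnorm p u + dnorm p u'" by (rule dist_Lp_norm_diff[OF p]) (rule s)
 also have "... < top" using f by (simp add: ennreal_add_less_top)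
 finally have w: "dnorm p w < top" .
 have "dnorm p u <= dnorm p u' + dnorm p w" by (rule dist_Lp_norm_add[OF p]) (simp add: s)
 then have "enn2real (dnorm p u) <= enn2real (dnorm p u') + enn2real (dnorm p w)"
  using f w by (metis enn2real_mono enn2real_plus ennreal_add_less_top)
 moreover have "dnorm p u' <= dnorm p u + dnorm p w" by (rule dist_Lp_norm_diff[OF p]) (simp add: s)
 then have "enn2real (dnorm p u') <= enn2real (dnorm p u) + enn2real (dnorm p w)"
  using f w by (metis enn2real_mono enn2real_plus ennreal_add_less_top)
 ultimately show ?thesis by linarith
qed

text \<open>With R fixed, a k-th difference is at most 2^k times the supremum, so smallness on
  finitely many levels already gives a small operator norm. The constant depends badly on R; the
  purpose is continuity in t at one scale.\<close>

lemma truncated_multiplier_le: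
 assumes R: "1 <= R"
 shows "\<exists>C>0. \<forall>q\<ge>1. \<forall>m e. \<forall>u :: 'n::finite dist. m \<in> bmeas --> 0 < e -->
   (\<forall>n>R. m (evl TYPE('n) n) = 0) --> (\<forall>n\<le>R. \<bar>m (evl TYPE('n) n)\<bar> <= e) -->
   dnorm q (calc m u) <= ennreal (C * e) * dnorm q u"
proof -
 let ?C = "kconst TYPE('n) * (2 * real R) ^ CARD('n)"
 have kc: "kconst TYPE('n) > 0" unfolding kconst_def using cauchy_mass_nonneg by (intro add_pos_nonneg) auto
 have "dnorm q (calc m u) <= ennreal (?C * e) * dnorm q u"
  if q: "1 <= q" and m: "m \<in> bmeas" and e: "0 < e" and m0: "!!n. n > R ==> m (evl TYPE('n) n) = 0"
   and mb: "!!n. n <= R ==> \<bar>m (evl TYPE('n) n)\<bar> <= e" for q m e and u :: "'n dist"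
 proof -
  have mb': "\<bar>m (evl TYPE('n) n)\<bar> <= e" for n using m0[of n] mb[of n] e by (cases "n <= R") auto
  have d: "\<bar>(ndiff ^^ k) (%n. m (evl TYPE('n) n)) n\<bar> <= 2 ^ k * e" for k n
  proof (induction k arbitrary: n)
   case (Suc k)
   show ?case using Suc[of n] Suc[of "Suc n"] by (simp add: ndiff_def)
  qed (use mb' in simp)
  have "\<bar>(ndiff ^^ k) (%n. m (evl TYPE('n) n)) n\<bar> <= ((2 * real R) ^ CARD('n) * e) / real R ^ k" if k: "k <= CARD('n)" for k n
  proof -
   have "\<bar>(ndiff ^^ k) (%n. m (evl TYPE('n) n)) n\<bar> * real R ^ k <= (2 ^ k * e) * real R ^ k"
    by (intro mult_right_mono d) simp
   also have "... = (2 * real R) ^ k * e" by (simp add: power_mult_distrib)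
   also have "... <= (2 * real R) ^ CARD('n) * e" using R e k by (intro mult_right_mono power_increasing) auto
   finally show ?thesis using R by (simp add: pos_le_divide_eq)
  qed
  then have "Lp_bound q (calc m u) ((kconst TYPE('n) * ((2 * real R) ^ CARD('n) * e)) * B)" if "0 < B" "Lp_bound q u B" for B
   using that R e by (intro Lp_bound_multiplier[OF q that(2) _ m R _ m0]) auto
  then show ?thesis using kc R e by (intro dist_Lp_norm_transfer) (auto simp: mult_ac)
 qed
 then show ?thesis using kc R by (intro exI[of _ ?C]) auto
qed

lemma nn_integral_shift_int:
 "(\<integral>\<^sup>+j. f j \<partial>scales) = (\<Sum>k. f (int k - 1))"
proof -
 have "bij_betw (%k. int k - 1) UNIV {-1..}" by (rule bij_betw_byWitness[where f'="%j. nat (j + 1)"]) auto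
 then show ?thesis by (simp add: nn_integral_bij_count_space[of _ UNIV "{-1..}" f, symmetric] nn_integral_count_space_nat)
qed

text \<open>Together with \<open>eLp_norm_count_space_le\<close> this places each sequence norm
  between supremum and sum. The norm estimates for X = B^0_{p,r} use r through these two embeddings,
  hence uniformly.\<close>

lemma eLp_norm_count_space_ge:
 fixes b :: "'a => ennreal"
 assumes r: "1 <= r" and j: "j \<in> A" shows "b j <= eLp_norm r (count_space A) b"
proof (cases "eLp_norm r (count_space A) b")
 case (real B)
 show ?thesis
 proof (cases "r = top")
  case True
  with real have "eLp_norm top (count_space A) b <= ennreal B" by simp
  then show ?thesis using j real by (simp add: eLp_norm_top_le_iff AE_count_space)
 next
  case False
  have "epowr (b j) (enn2real r) = (\<integral>\<^sup>+x. epowr (b x) (enn2real r) * indicator {j} x \<partial>count_space A)"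
   using j by (subst nn_integral_indicator_singleton) auto
  also have "... <= (\<integral>\<^sup>+x. epowr (b x) (enn2real r) \<partial>count_space A)"
   by (intro nn_integral_mono) (auto simp: indicator_def)
  also have "... <= ennreal (B powr enn2real r)" using real by (subst eLp_norm_le_iff[OF r False, symmetric]) auto
  finally have le: "epowr (b j) (enn2real r) <= ennreal (B powr enn2real r)" .
  have r1: "1 <= enn2real r" by (rule enn2real_ge_1[OF r False])
  show ?thesis
  proof (cases "b j")
   case (real c)
   have "c <= B"
   proof (rule ccontr)
    assume "~ c <= B"
    then have "B powr enn2real r < c powr enn2real r" using r1 \<open>0 <= B\<close> by (intro powr_less_mono2) auto
    then show False using le real \<open>0 <= B\<close> by (simp add: epowr_ennreal)
   qed
   then show ?thesis using real \<open>eLp_norm r (count_space A) b = ennreal B\<close> by (simp add: ennreal_leI)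
  qed (use le in \<open>simp add: top_unique\<close>)
 qed
qed simp

lemma eLp_norm_count_space_le:
 fixes b :: "'a => ennreal"
 assumes r: "1 <= r" shows "eLp_norm r (count_space A) b <= (\<integral>\<^sup>+j. b j \<partial>count_space A)"
proof (cases "\<integral>\<^sup>+j. b j \<partial>count_space A")
 case (real S)
 have le: "b j <= ennreal S" if j: "j \<in> A" for j
 proof -
  have "b j = (\<integral>\<^sup>+x. b x * indicator {j} x \<partial>count_space A)"
   using j by (subst nn_integral_indicator_singleton) auto
  also have "... <= ennreal S" unfolding real(2)[symmetric] by (intro nn_integral_mono) (auto simp: indicator_def)
  finally show ?thesis .
 qed
 show ?thesis
 proof (cases "r = top")
  case True
  then show ?thesis using le real by (simp add: eLp_norm_top_le_iff AE_count_space)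
 next
  case False
  let ?r = "enn2real r"
  have r1: "1 <= ?r" by (rule enn2real_ge_1[OF r False])
  have "(\<integral>\<^sup>+x. epowr (b x) ?r \<partial>count_space A) <= (\<integral>\<^sup>+x. ennreal (S powr (?r - 1)) * b x \<partial>count_space A)"
  proof (intro nn_integral_mono)
   fix x assume "x \<in> space (count_space A)"
   then have "b x <= ennreal S" using le by simp
   then obtain c where c: "b x = ennreal c" "0 <= c" "c <= S" using real(1) by (cases "b x") (auto simp: top_unique)
   have "c powr ?r = c powr (?r - 1) * c" using c(2) by (cases "c = 0") (simp_all add: powr_diff)
   also have "... <= S powr (?r - 1) * c" using c r1 by (intro mult_right_mono powr_mono2) auto
   finally show "epowr (b x) ?r <= ennreal (S powr (?r - 1)) * b x"
    using c by (simp add: epowr_ennreal ennreal_leI flip: ennreal_mult)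
  qed
  also have "... = ennreal (S powr (?r - 1) * S)" using real by (subst nn_integral_cmult) (auto simp: ennreal_mult)
  also have "S powr (?r - 1) * S = S powr ?r" using real(1) by (cases "S = 0") (simp_all add: powr_diff)
  finally show ?thesis using real by (simp add: eLp_norm_le_iff[OF r False])
 qed
qed simp

section \<open>Reconstruction from the dyadic pieces\<close>

context dyadic
begin

lemma dyadic_partial_sum:
 assumes l: "1 <= l"
 obtains M where "!!K. M <= K ==> (\<Sum>k<K. dyadic_mult \<phi>0 (int k - 1) l) = 1"
proof -
 obtain J where J: "2 * sqrt l < 2 ^ J" using real_arch_pow[of 2 "2 * sqrt l"] by auto
 have "(\<Sum>k<K. dyadic_mult \<phi>0 (int k - 1) l) = 1" if K: "Suc J <= K" for K
 proof -
  have "(\<Sum>k<K. dyadic_mult \<phi>0 (int k - 1) l) = (\<Sum>j\<in>(%k. int k - 1) ` {..<K}. \<phi>0 (2 powr (- real_of_int j) * sqrt l))"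
   by (subst sum.reindex) (auto simp: inj_on_def dyadic_mult_def)
  also have "... = 1"
  proof (rule phi_sum)
   show "0 < sqrt l" using l by simp
   fix j assume "\<phi>0 (2 powr (- real_of_int j) * sqrt l) ~= 0"
   then have p: "1/2 < 2 powr (- real_of_int j) * sqrt l" "2 powr (- real_of_int j) * sqrt l < 2" by (rule phi_supp)+
   have "2 powr (- real_of_int j) * 1 <= 2 powr (- real_of_int j) * sqrt l" using l by (intro mult_left_mono) auto
   then have "2 powr (- real_of_int j) < 2" using p by linarith
   then have "2 powr (- real_of_int j) < 2 powr 1" by simp
   then have j0: "0 <= j" by (simp only: powr_less_cancel_iff)
   have "j < int J"
   proof (rule ccontr)
    assume "~ j < int J"
    then have "2 powr (- real_of_int j) * sqrt l <= 2 powr (- real J) * sqrt l" using l by (intro mult_right_mono powr_mono) auto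
    also have "... = sqrt l / 2 ^ J" by (simp add: powr_minus powr_realpow divide_inverse)
    also have "... <= 1/2" using J by (simp add: field_simps)
    finally show False using p by simp
   qed
   then have "j = int (nat (j + 1)) - 1" "nat (j + 1) < K" using j0 K by auto
   then show "j \<in> (%k. int k - 1) ` {..<K}" by blast
  qed simp
  finally show ?thesis .
 qed
 then show ?thesis by (rule that)
qed

lemma dyadic_partial_sum_le:
 assumes l: "1 <= l" shows "\<bar>\<Sum>k<K. dyadic_mult \<phi>0 (int k - 1) l\<bar> <= 1"
proof -
 obtain M where M: "!!K. M <= K ==> (\<Sum>k<K. dyadic_mult \<phi>0 (int k - 1) l) = 1" by (rule dyadic_partial_sum[OF l]) blast
 have "(\<Sum>k<K. dyadic_mult \<phi>0 (int k - 1) l) <= (\<Sum>k<max K M. dyadic_mult \<phi>0 (int k - 1) l)"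
  by (intro sum_mono2) (auto simp: dyadic_mult_def phi_nonneg)
 then show ?thesis using M[of "max K M"] by (simp add: sum_nonneg dyadic_mult_def phi_nonneg)
qed

text \<open>Tannery's theorem interchanges the limit over scales with the Hermite series. The
  majorant comes from \<open>m2\<close>: the terms of the convergent series for l^2 m(l) are
  bounded, so those for m are O(1/n^2), and the partial sums of the partition lie in [0, 1].\<close>

lemma dyadic_sums:
 fixes u :: "'n::finite dist"
 assumes m: "spec_bounded TYPE('n) m" and m2: "spec_bounded TYPE('n) (%l. l powr 2 * m l)" and u: "u \<in> tempered" and g: "g \<in> schwartz"
 shows "(%k. piece (int k - 1) (calc m u) g) sums calc m u g"
proof -
 define c where "c n = (\<Sum>a | mdeg a = n. fcoef hermv g a * u (hermc a))" for n
 have cs: "(%n. cplx (m' (evl TYPE('n) n)) * c n) sums calc m' u g" if "spec_bounded TYPE('n) m'" for m'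
  using that oscillator_calc_sums[OF _ _ g u] unfolding spec_bounded_def c_def by blast
 have e1: "1 <= evl TYPE('n) n" "real (Suc n) <= evl TYPE('n) n" for n
  using zero_less_card_finite[where 'a='n] unfolding evl_def by linarith+
 obtain D where D: "!!n. cmod (cplx (evl TYPE('n) n powr 2 * m (evl TYPE('n) n)) * c n) <= D"
  using summable_imp_bounded[OF sums_summable[OF cs[OF m2]]] unfolding bounded_iff by auto
 have D': "cmod (cplx (m (evl TYPE('n) n)) * c n) <= D / real (Suc n) ^ 2" for n
 proof -
  have "cmod (cplx (m (evl TYPE('n) n)) * c n) * real (Suc n) ^ 2 <= cmod (cplx (m (evl TYPE('n) n)) * c n) * evl TYPE('n) n ^ 2"
   using e1[of n] by (intro mult_left_mono power_mono) auto
  also have "... <= D" using D[of n] e1[of n] by (simp add: norm_mult norm_power abs_mult powr_numeral mult_ac)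
  finally show ?thesis by (simp add: pos_le_divide_eq)
 qed
 have sb: "spec_bounded TYPE('n) (%l. dyadic_mult \<phi>0 j l * m l)" for j by (rule spec_bounded_mult[OF spec_bounded_dyadic m])
 define P where "P n K = (\<Sum>k<K. dyadic_mult \<phi>0 (int k - 1) (evl TYPE('n) n))" for n K
 have PP: "\<bar>P n K\<bar> <= 1" for n K unfolding P_def by (rule dyadic_partial_sum_le[OF e1(1)])
 have "(%K. \<Sum>n. cplx (P n K) * (cplx (m (evl TYPE('n) n)) * c n))
   \<longlonglongrightarrow> (\<Sum>n. cplx (m (evl TYPE('n) n)) * c n)"
 proof (rule tannerys_theorem[THEN conjunct2, THEN conjunct2])
  fix n
  obtain M where M: "!!K. M <= K ==> P n K = 1" using dyadic_partial_sum[OF e1(1)] unfolding P_def by blast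
  show "(%K. cplx (P n K) * (cplx (m (evl TYPE('n) n)) * c n)) \<longlonglongrightarrow> cplx (m (evl TYPE('n) n)) * c n"
   by (rule tendsto_eventually) (auto simp: eventually_sequentially M intro!: exI[of _ M])
 next
  have "cmod (cplx (P n K) * (cplx (m (evl TYPE('n) n)) * c n)) <= D / real (Suc n) ^ 2" for n K
  proof -
   have "cmod (cplx (P n K) * (cplx (m (evl TYPE('n) n)) * c n)) <= 1 * (D / real (Suc n) ^ 2)"
    unfolding norm_mult[of "cplx (P n K)"] using PP D' by (intro mult_mono) auto
   then show ?thesis by simp
  qed
  then show "\<forall>\<^sub>F (n, K) in sequentially \<times>\<^sub>F sequentially. cmod (cplx (P n K) * (cplx (m (evl TYPE('n) n)) * c n)) <= D / real (Suc n) ^ 2"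
   by (intro always_eventually) auto
 next
  have "summable (%n. inverse (real (Suc n) ^ 2))"
   using inverse_power_summable[of 2, where 'a=real] by (subst summable_Suc_iff[of "%n. inverse (real n ^ 2)"]) auto
  then show "summable (%n. D / real (Suc n) ^ 2)" unfolding divide_inverse by (rule summable_mult)
 qed simp
 moreover have "(\<Sum>n. cplx (P n K) * (cplx (m (evl TYPE('n) n)) * c n))
   = (\<Sum>k<K. piece (int k - 1) (calc m u) g)" for K
 proof -
  have "(%n. \<Sum>k<K. cplx (dyadic_mult \<phi>0 (int k - 1) (evl TYPE('n) n) * m (evl TYPE('n) n)) * c n)
    sums (\<Sum>k<K. calc (%l. dyadic_mult \<phi>0 (int k - 1) l * m l) u g)" by (intro sums_sum cs sb)
  moreover have "(%n. \<Sum>k<K. cplx (dyadic_mult \<phi>0 (int k - 1) (evl TYPE('n) n) * m (evl TYPE('n) n)) * c n)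
    = (%n. cplx (P n K) * (cplx (m (evl TYPE('n) n)) * c n))" by (simp add: P_def sum_distrib_right mult.assoc)
  ultimately show ?thesis using oscillator_calc_calc[OF spec_bounded_dyadic m sb refl g] by (simp add: sums_unique[symmetric])
 qed
 ultimately show ?thesis using sums_unique[OF cs[OF m]] by (simp add: sums_def)
qed

lemma dist_Lp_norm_dyadic_le:
 fixes u :: "'n::finite dist"
 assumes p: "1 <= p" and m: "spec_bounded TYPE('n) m" "spec_bounded TYPE('n) (%l. l powr 2 * m l)" and u: "u \<in> tempered"
 shows "dnorm p (calc m u) <= (\<integral>\<^sup>+j. dnorm p (piece j (calc m u)) \<partial>scales)"
 unfolding nn_integral_shift_int by (rule dist_Lp_norm_suminf[OF p]) (rule dyadic_sums[OF m u])

end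

section \<open>Continuity of the heat norms in time\<close>

lemma spec_bounded_diff:
 assumes "spec_bounded TYPE('n::finite) m" "spec_bounded TYPE('n) m'" shows "spec_bounded TYPE('n) (%l. m l - m' l)"
proof -
 obtain K K' where K: "!!a :: 'n => nat. \<bar>m (lam a)\<bar> <= K" "!!a :: 'n => nat. \<bar>m' (lam a)\<bar> <= K'"
  and [measurable]: "m \<in> bmeas" "m' \<in> bmeas" using assms unfolding spec_bounded_def by blast
 have "\<bar>m (lam a) - m' (lam a)\<bar> <= K + K'" for a :: "'n => nat" using K(1)[of a] K(2)[of a] by linarith
 then show ?thesis unfolding spec_bounded_def by auto
qed

lemma tendsto_heat_mult: "0 < t ==> 0 < l ==> ((%t. heat_mult a t l) \<longlongrightarrow> heat_mult a t l) (at t)"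
 unfolding heat_mult_def by (auto intro!: tendsto_eq_intros)

lemma isCont_of_diff_le:
 fixes N :: "real => real"
 assumes "0 < s" "!!t. 0 < t ==> \<bar>N t - N s\<bar> <= g t" "(g \<longlongrightarrow> 0) (at s)" shows "isCont N s"
proof -
 have "\<forall>\<^sub>F t in at s. 0 < t" using assms(1) by (intro order_tendstoD(1)[OF tendsto_ident_at])
 then have "\<forall>\<^sub>F t in at s. norm (N t - N s) <= g t" by eventually_elim (use assms(2) in auto)
 from Lim_null_comparison[OF this assms(3)] show ?thesis unfolding isCont_def by (rule LIM_zero_cancel)
qed

context dyadic
begin

lemma besov_piece_le:
 assumes f: "f \<in> besov_space \<phi>0 s p q" and q: "1 <= q"
 obtains B where "0 <= B"
  "!!j. -1 <= j ==> dnorm p (piece j f) <= ennreal (B * 2 powr (- s * real_of_int j))"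
proof -
 let ?a = "%j. dnorm p (piece j f)"
 have "besov_norm \<phi>0 s p q f < top" using f by (simp add: besov_space_def)
 then obtain B where B: "0 <= B" "besov_norm \<phi>0 s p q f = ennreal B" by (cases "besov_norm \<phi>0 s p q f") auto
 have "?a j <= ennreal (B * 2 powr (- s * real_of_int j))" if "-1 <= j" for j
 proof -
  have "ennreal (2 powr (s * real_of_int j)) * ?a j <= ennreal B" unfolding B(2)[symmetric] besov_norm_def using that
   by (intro eLp_norm_count_space_ge[OF q, of j "{-1..}" "%j. ennreal (2 powr (s * real_of_int j)) * ?a j"]) auto
  then have "ennreal (2 powr (- s * real_of_int j)) * (ennreal (2 powr (s * real_of_int j)) * ?a j) <= ennreal (2 powr (- s * real_of_int j)) * ennreal B"
   by (rule mult_left_mono) simp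
  moreover have "ennreal (2 powr (- s * real_of_int j)) * (ennreal (2 powr (s * real_of_int j)) * ?a j) = ?a j"
   by (simp add: mult.assoc[symmetric] ennreal_mult[symmetric] powr_add[symmetric])
  ultimately show ?thesis using B(1) by (simp add: ennreal_mult mult.commute)
 qed
 with B(1) show ?thesis by (rule that)
qed

text \<open>Membership in the Besov space only bounds piece j by a multiple of 2^(-sj), which may
  grow; the exponential wins as long as t stays away from zero. In the exponent a - s/2 + 1, the
  part -s/2 compensates that growth and the 1 buys the decay 4^(-k). Here k = j + 1.\<close>

lemma heat_piece_decay:
 fixes f :: "'n::finite dist"
 assumes f: "f \<in> besov_space \<phi>0 s p q" and p: "1 <= p" and q: "1 <= q" and \<delta>: "0 < \<delta>"
 obtains C where "0 <= C"
  "!!t k. \<delta> <= t ==> t <= D ==> dnorm p (piece (int k - 1) (heat a t f)) <= ennreal (C * (1/4) ^ k)"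
proof -
 obtain B where B: "0 <= B" "!!j. -1 <= j ==> dnorm p (piece j f) <= ennreal (B * 2 powr (- s * real_of_int j))"
  by (rule besov_piece_le[OF f q]) blast
 obtain K where K: "K > 0" "!!j t u. -1 <= j ==> 0 < t ==>
   dnorm p (piece j (heat a t (u :: 'n dist)))
    <= ennreal (K * ((t * 4 powr j) powr a * exp (- (t * 4 powr j / 32)))) * dnorm p (piece j u)"
  using dyadic_heat_le[of a, where 'n='n] p by blast
 obtain L where L: "L > 0" "!!x. 0 < x ==> \<delta> / 4 <= x ==> x powr (a - s/2 + 1) * exp (- (1/32 * x)) <= L"
  using powr_exp_bounded[of "1/32" "\<delta>/4" "a - s/2 + 1"] \<delta> by auto
 define T where "T = \<delta> powr (s/2 - 1) + D powr (s/2 - 1)"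
 have "dnorm p (piece (int k - 1) (heat a t f)) <= ennreal ((4 * K * B * L * T) * (1/4) ^ k)"
  if t: "\<delta> <= t" "t <= D" for t k
 proof -
  let ?j = "int k - 1" and ?x = "t * 4 powr (real k - 1)"
  have t0: "0 < t" using t \<delta> by simp
  have x0: "0 < ?x" using t0 by simp
  have "4 powr (-1) <= 4 powr (real k - 1)" by (intro powr_mono) auto
  then have "\<delta> * (1/4) <= ?x" using t t0 \<delta> by (intro mult_mono) (auto simp: powr_minus)
  then have x: "\<delta> / 4 <= ?x" by simp
  have tT: "t powr (s/2 - 1) <= T" unfolding T_def using t \<delta> by (intro powr_le_add) auto
  have "(4::real) = 2 powr 2" by simp
  then have "(4 powr (real k - 1)) powr (- s/2) = 2 powr (2 * (real k - 1) * (- s/2))" by (simp only: powr_powr)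
  also have "2 * (real k - 1) * (- s/2) = - s * (real k - 1)" by simp
  finally have "2 powr (- s * (real k - 1)) = (4 powr (real k - 1)) powr (- s/2)" by simp
  also have "... = ?x powr (- s/2) * t powr (s/2)" using t0 by (simp add: powr_mult powr_minus)
  finally have e1: "2 powr (- s * (real k - 1)) = ?x powr (- s/2) * t powr (s/2)" .
  have e2: "?x powr a * ?x powr (- s/2) = ?x powr (a - s/2 + 1) * inverse ?x"
  proof -
   have "a - s/2 + 1 = a + (- s/2) + 1" by simp
   then have "?x powr (a - s/2 + 1) = ?x powr a * ?x powr (- s/2) * ?x" using x0 by (simp only: powr_add powr_one less_imp_le)
   moreover have "?x * inverse ?x = 1" using t0 by (intro right_inverse) simp
   ultimately show ?thesis by (simp only: mult.assoc mult_1_right)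
  qed
  have e3: "inverse ?x * t powr (s/2) = t powr (s/2 - 1) * (4 * (1/4) ^ k)"
  proof -
   have A: "t powr (s/2) = t powr (s/2 - 1) * t" using t0 powr_add[of t "s/2 - 1" 1] by simp
   have B: "(4::real) powr (real k - 1) = 4 ^ k / 4" by (simp add: powr_diff powr_realpow)
   show ?thesis unfolding A B using t0 by (simp add: power_one_over)
  qed
  have "dnorm p (calc (dyadic_mult \<phi>0 ?j) (heat a t f))
   <= ennreal (K * (?x powr a * exp (- (?x / 32)))) * ennreal (B * 2 powr (- s * (real k - 1)))"
   using order_trans[OF K(2)[of ?j t f] mult_left_mono[OF B(2)[of ?j]]] t0 by simp
  also have "... = ennreal (K * B * (?x powr a * ?x powr (- s/2) * exp (- (?x / 32)) * t powr (s/2)))"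
   unfolding e1 using K(1) B(1) by (simp add: mult_ac flip: ennreal_mult)
  also have "?x powr a * ?x powr (- s/2) * exp (- (?x / 32)) * t powr (s/2) = (?x powr (a - s/2 + 1) * exp (- (1/32 * ?x))) * (inverse ?x * t powr (s/2))"
   unfolding e2 by (simp add: mult_ac)
  also have "... = (?x powr (a - s/2 + 1) * exp (- (1/32 * ?x))) * (t powr (s/2 - 1) * (4 * (1/4) ^ k))" unfolding e3 ..
  also have "ennreal (K * B * ...) <= ennreal (K * B * (L * (T * (4 * (1/4) ^ k))))"
   using K(1) B(1) L(1) by (intro ennreal_leI mult_left_mono mult_mono L(2)[OF x0 x] tT mult_right_mono) auto
  finally show ?thesis by (simp add: mult_ac)
 qed
 moreover have "0 <= 4 * K * B * L * T" using K(1) B(1) L(1) by (auto simp: T_def)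
 ultimately show ?thesis using that by blast
qed

text \<open>Piece j sees only the finitely many eigenvalues below 4^(j+1), on which the heat
  multipliers converge uniformly as t tends to s.\<close>

lemma heat_diff_piece_tendsto:
 fixes f :: "'n::finite dist"
 assumes p: "1 <= p" and a: "dnorm p (piece j f) < top" and s: "0 < s"
 shows "((%t. enn2real (dnorm p (piece j (calc (%l. heat_mult b t l - heat_mult b s l) f)))) \<longlongrightarrow> 0) (at s)"
proof -
 let ?N = "%t. dnorm p (piece j (calc (%l. heat_mult b t l - heat_mult b s l) f))"
 obtain A where A: "0 <= A" "dnorm p (piece j f) = ennreal A"
  using a by (cases "dnorm p (piece j f)") auto
 define R where "R = nat \<lceil>4 powr (real_of_int j + 1)\<rceil> + 1"
 have R: "1 <= R" "4 powr (real_of_int j + 1) <= real R" unfolding R_def by (auto simp: of_nat_nat) linarith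
 have z: "dyadic_mult \<phi>0 j (evl TYPE('n) n) = 0" if "R < n" for n
 proof (rule ccontr)
  assume "dyadic_mult \<phi>0 j (evl TYPE('n) n) ~= 0"
  then have "sqrt (4 powr (- real_of_int j) * evl TYPE('n) n) < 2" unfolding dyadic_mult_eq by (rule phi_supp)
  then have "sqrt (4 powr (- real_of_int j) * evl TYPE('n) n) < sqrt 4" by simp
  then have "4 powr (- real_of_int j) * evl TYPE('n) n < 4" by (simp only: real_sqrt_less_iff)
  then have "evl TYPE('n) n < 4 powr (real_of_int j + 1)" by (simp add: powr_minus powr_add field_simps)
  moreover have "real n <= evl TYPE('n) n" by (simp add: evl_def)
  ultimately show False using R(2) that by linarith
 qed
 obtain C where C: "C > 0" "!!m \<epsilon> (u :: 'n dist). m \<in> bmeas ==> 0 < \<epsilon> ==>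
   (!!n. n > R ==> m (evl TYPE('n) n) = 0) ==> (!!n. n <= R ==> \<bar>m (evl TYPE('n) n)\<bar> <= \<epsilon>) ==>
   dnorm p (calc m u) <= ennreal (C * \<epsilon>) * dnorm p u"
  using truncated_multiplier_le[OF R(1), where 'n='n] p by blast
 show ?thesis
 proof (rule tendstoI)
  fix e :: real assume e: "0 < e"
  define \<epsilon> where "\<epsilon> = e / (C * (A + 1))"
  have \<epsilon>: "0 < \<epsilon>" "C * \<epsilon> * A < e"
  proof -
   show "0 < \<epsilon>" unfolding \<epsilon>_def using e C(1) A(1) by (intro divide_pos_pos mult_pos_pos) auto
   have "C * \<epsilon> * A = e * A / (A + 1)" using C(1) by (simp add: \<epsilon>_def)
   also have "... < e" using e A(1) by (simp add: pos_divide_less_eq distrib_left)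
   finally show "C * \<epsilon> * A < e" .
  qed
  have "\<forall>\<^sub>F t in at s. \<forall>n\<in>{..R}. \<bar>heat_mult b t (evl TYPE('n) n) - heat_mult b s (evl TYPE('n) n)\<bar> < \<epsilon>"
  proof (intro eventually_ball_finite ballI)
   fix n
   have "0 < evl TYPE('n) n" by (simp add: evl_def add_nonneg_pos)
   from tendstoD[OF tendsto_heat_mult[OF s this] \<epsilon>(1)]
   show "\<forall>\<^sub>F t in at s. \<bar>heat_mult b t (evl TYPE('n) n) - heat_mult b s (evl TYPE('n) n)\<bar> < \<epsilon>" by (simp add: dist_real_def)
  qed simp
  moreover have "\<forall>\<^sub>F t in at s. 0 < t" by (rule order_tendstoD(1)[OF tendsto_ident_at s])
  ultimately show "\<forall>\<^sub>F t in at s. dist (enn2real (?N t)) 0 < e"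
  proof eventually_elim
   case (elim t)
   let ?d = "%l. heat_mult b t l - heat_mult b s l"
   \<comment> \<open>Cutting the difference off above level R does not affect piece j and brings it
     into the form of \<open>truncated_multiplier_le\<close>.\<close>
   let ?m = "%l. if l <= evl TYPE('n) R then ?d l else 0"
   have sd: "spec_bounded TYPE('n) ?d" by (intro spec_bounded_diff spec_bounded_heat elim s)
   have sm: "spec_bounded TYPE('n) ?m"
   proof -
    have "?m \<in> bmeas" by measurable
    moreover obtain K where "!!v :: 'n => nat. \<bar>?d (lam v)\<bar> <= K" using sd unfolding spec_bounded_def by blast
    then have "\<bar>?m (lam v)\<bar> <= max K 0" for v :: "'n => nat" by (simp add: le_max_iff_disj)
    ultimately show ?thesis unfolding spec_bounded_def by blast
   qed
   have "?N t = dnorm p (calc ?m (piece j f))"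
   proof (rule dist_Lp_norm_cong)
    fix g :: "real^'n => complex" assume g: "g \<in> schwartz"
    have sb: "spec_bounded TYPE('n) (%l. dyadic_mult \<phi>0 j l * ?d l)" by (rule spec_bounded_mult[OF spec_bounded_dyadic sd])
    have e: "?m (lam v) * dyadic_mult \<phi>0 j (lam v) = dyadic_mult \<phi>0 j (lam v) * ?d (lam v)" for v :: "'n => nat"
     unfolding lam_evl using z[of "mdeg v"] by (cases "R < mdeg v") (auto simp: evl_def)
    show "piece j (calc ?d f) g = calc ?m (piece j f) g"
     unfolding oscillator_calc_calc[OF spec_bounded_dyadic sd sb refl g] oscillator_calc_calc[OF sm spec_bounded_dyadic sb e g] ..
   qed
   also have "... <= ennreal (C * \<epsilon>) * dnorm p (piece j f)"
   proof (rule C(2)[OF _ \<epsilon>(1)])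
    show "?m \<in> bmeas" by measurable
    show "?m (evl TYPE('n) n) = 0" if "R < n" for n using that by (simp add: evl_def)
    show "\<bar>?m (evl TYPE('n) n)\<bar> <= \<epsilon>" if "n <= R" for n using that elim(1) \<epsilon>(1) by (auto intro: less_imp_le)
   qed
   also have "... = ennreal (C * \<epsilon> * A)" using A C(1) \<epsilon>(1) by (simp add: ennreal_mult)
   finally have "enn2real (?N t) <= C * \<epsilon> * A" using A(1) C(1) \<epsilon>(1) by (intro enn2real_leI) auto
   then show ?case using \<epsilon>(2) by (simp add: dist_real_def)
  qed
 qed
qed

lemma heat_piece_finite:
 fixes f :: "'n::finite dist"
 assumes f: "f \<in> besov_space \<phi>0 s p q" and p: "1 <= p" and q: "1 <= q" and t: "0 < t" and j: "-1 <= j"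
 shows "dnorm p (piece j (heat a t f)) < top"
proof -
 obtain C where "!!k. dnorm p (piece (int k - 1) (heat a t f)) <= ennreal (C * (1/4) ^ k)"
  by (rule heat_piece_decay[OF f p q t, where D=t and a=a]) blast
 from this[of "nat (j + 1)"] j show ?thesis by (simp add: order_le_less_trans)
qed

lemma piece_heat_diff:
 fixes f :: "'n::finite dist"
 assumes t: "0 < t" "0 < t'" and f: "f \<in> tempered" and g: "g \<in> schwartz"
 shows "piece j (calc (%l. heat_mult a t l - heat_mult a t' l) f) g =
  piece j (heat a t f) g - piece j (calc (heat_mult a t') f) g"
proof -
 have h: "spec_bounded TYPE('n) (heat_mult a t)" "spec_bounded TYPE('n) (heat_mult a t')" by (intro spec_bounded_heat t)+
 note d = spec_bounded_diff[OF h] and m = spec_bounded_mult[OF spec_bounded_dyadic]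
 show ?thesis
  unfolding oscillator_calc_calc[OF spec_bounded_dyadic d m[OF d] refl g] oscillator_calc_calc[OF spec_bounded_dyadic h(1) m[OF h(1)] refl g]
   oscillator_calc_calc[OF spec_bounded_dyadic h(2) m[OF h(2)] refl g] right_diff_distrib
  by (rule oscillator_calc_diff[OF m[OF h(1)] m[OF h(2)] f g])
qed

lemma heat_piece_continuous:
 fixes f :: "'n::finite dist"
 assumes f: "f \<in> besov_space \<phi>0 s p q" and p: "1 <= p" and q: "1 <= q" and j: "-1 <= j"
 shows "continuous_on {0<..} (%t. enn2real (dnorm p (piece j (heat a t f))))"
proof (intro continuous_at_imp_continuous_on ballI)
 fix t0 :: real assume "t0 \<in> {0<..}"
 then have t0: "0 < t0" by simp
 have ft: "f \<in> tempered" using f by (simp add: besov_space_def)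
 obtain B where Bf: "!!j. -1 <= j ==> dnorm p (piece j f) <= ennreal (B * 2 powr (- s * real_of_int j))"
  by (rule besov_piece_le[OF f q]) blast
 have fin: "dnorm p (piece j f) < top" by (rule order_le_less_trans[OF Bf[OF j] ennreal_less_top])
 show "isCont (%t. enn2real (dnorm p (piece j (heat a t f)))) t0"
 proof (rule isCont_of_diff_le[OF t0 _ heat_diff_piece_tendsto[OF p fin t0]], rule dist_Lp_norm_diff_abs[OF p])
  fix t :: real assume "0 < t"
  then show "g \<in> schwartz ==> piece j (calc (%l. heat_mult a t l - heat_mult a t0 l) f) g =
   piece j (heat a t f) g - piece j (heat a t0 f) g" for g
   using t0 ft by (rule piece_heat_diff)
 qed (rule heat_piece_finite[OF f p q _ j], use t0 in simp)+
qed

lemma heat_finite: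
 fixes f :: "'n::finite dist"
 assumes f: "f \<in> besov_space \<phi>0 s p q" and p: "1 <= p" and q: "1 <= q" and t: "0 < t"
 shows "dnorm p (heat a t f)
   <= (\<integral>\<^sup>+j. dnorm p (piece j (heat a t f)) \<partial>scales)"
  and "(\<integral>\<^sup>+j. dnorm p (piece j (heat a t f)) \<partial>scales) < top"
proof -
 have ft: "f \<in> tempered" using f by (simp add: besov_space_def)
 show "dnorm p (heat a t f)
   <= (\<integral>\<^sup>+j. dnorm p (piece j (heat a t f)) \<partial>scales)"
  by (intro dist_Lp_norm_dyadic_le p spec_bounded_heat spec_bounded_powr_heat t ft)
 obtain C where C: "0 <= C" "!!k. dnorm p (piece (int k - 1) (heat a t f)) <= ennreal (C * (1/4) ^ k)"
  by (rule heat_piece_decay[OF f p q t, where D=t and a=a]) blast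
 have "(\<Sum>k. dnorm p (piece (int k - 1) (heat a t f))) <= (\<Sum>k. ennreal (C * (1/4) ^ k))"
  by (intro suminf_le C) auto
 also have "... = ennreal (\<Sum>k. C * (1/4) ^ k)" using C(1) by (intro suminf_ennreal2 summable_mult summable_geometric) auto
 finally show "(\<integral>\<^sup>+j. dnorm p (piece j (heat a t f)) \<partial>scales) < top"
  unfolding nn_integral_shift_int by (rule order_le_less_trans) simp
qed

text \<open>The difference of two times is summed over its dyadic pieces. Each piece tends to zero,
  and \<open>heat_piece_decay\<close> on [t0/2, 2 t0] supplies a geometric majorant, so Tannery's
  theorem applies.\<close>

lemma heat_continuous:
 fixes f :: "'n::finite dist"
 assumes f: "f \<in> besov_space \<phi>0 s p q" and p: "1 <= p" and q: "1 <= q"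
 shows "continuous_on {0<..} (%t. enn2real (dnorm p (heat a t f)))"
proof (intro continuous_at_imp_continuous_on ballI)
 fix t0 :: real assume "t0 \<in> {0<..}"
 then have t0: "0 < t0" by simp
 have ft: "f \<in> tempered" using f by (simp add: besov_space_def)
 obtain B where Bf: "!!j. -1 <= j ==> dnorm p (piece j f) <= ennreal (B * 2 powr (- s * real_of_int j))"
  by (rule besov_piece_le[OF f q]) blast
 have fin: "dnorm p (piece (int k - 1) f) < top" for k
  by (rule order_le_less_trans[OF Bf ennreal_less_top]) simp
 obtain C where C: "0 <= C"
  "!!t k. t0 / 2 <= t ==> t <= 2 * t0 ==> dnorm p (piece (int k - 1) (heat a t f)) <= ennreal (C * (1/4) ^ k)"
  by (rule heat_piece_decay[OF f p q, where \<delta>="t0/2" and D="2 * t0" and a=a]) (use t0 in auto)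
 let ?d = "%t l. heat_mult a t l - heat_mult a t0 l"
 define D where "D k t = dnorm p (piece (int k - 1) (calc (?d t) f))" for k t
 have h: "spec_bounded TYPE('n) (heat_mult a t)" if "0 < t" for t by (rule spec_bounded_heat[OF that])
 have d: "spec_bounded TYPE('n) (?d t)" if "0 < t" for t by (intro spec_bounded_diff h that t0)
 have DC: "D k t <= ennreal (2 * C * (1/4) ^ k)" if t: "t0 / 2 <= t" "t <= 2 * t0" for k t
 proof -
  have t': "0 < t" using t t0 by simp
  let ?j = "int k - 1"
  have "D k t <= dnorm p (calc (dyadic_mult \<phi>0 ?j) (heat a t f))
    + dnorm p (calc (dyadic_mult \<phi>0 ?j) (heat a t0 f))"
   unfolding D_def by (rule dist_Lp_norm_diff[OF p piece_heat_diff[OF t' t0 ft]])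
  also have "... <= ennreal (C * (1/4) ^ k) + ennreal (C * (1/4) ^ k)" using t t0 by (intro add_mono C) auto
  also have "... = ennreal (2 * C * (1/4) ^ k)" using C(1) by (simp flip: ennreal_plus)
  finally show ?thesis .
 qed
 have near: "\<forall>\<^sub>F t in at t0. t0 / 2 <= t & t <= 2 * t0"
 proof -
  have "\<forall>\<^sub>F t in at t0. t0 / 2 < t" by (rule order_tendstoD(1)[OF tendsto_ident_at]) (use t0 in simp)
  moreover have "\<forall>\<^sub>F t in at t0. t < 2 * t0" by (rule order_tendstoD(2)[OF tendsto_ident_at]) (use t0 in simp)
  ultimately show ?thesis by eventually_elim simp
 qed
 have geo: "summable (%k. 2 * C * (1/4) ^ k :: real)" by (intro summable_mult summable_geometric) simp
 have "((%t. \<Sum>k. enn2real (D k t)) \<longlongrightarrow> (\<Sum>k::nat. 0)) (at t0)"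
 proof (rule tannerys_theorem[THEN conjunct2, THEN conjunct2, OF _ _ geo])
  show "((%t. enn2real (D k t)) \<longlongrightarrow> 0) (at t0)" for k unfolding D_def by (rule heat_diff_piece_tendsto[OF p fin t0])
  have "\<forall>\<^sub>F t in at t0. \<forall>k. enn2real (D k t) <= 2 * C * (1/4) ^ k"
   using near by eventually_elim (use DC C(1) in \<open>auto intro!: enn2real_leI\<close>)
  then have "\<forall>\<^sub>F (k, t) in sequentially \<times>\<^sub>F at t0. \<forall>k. enn2real (D k t) <= 2 * C * (1/4) ^ k"
   by (subst eventually_prod2) auto
  then show "\<forall>\<^sub>F (k, t) in sequentially \<times>\<^sub>F at t0. norm (enn2real (D k t)) <= 2 * C * (1/4) ^ k"
   by eventually_elim auto
 qed simp
 then have D0: "((%t. \<Sum>k. enn2real (D k t)) \<longlongrightarrow> 0) (at t0)" by simp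
 have "\<forall>\<^sub>F t in at t0. norm (enn2real (dnorm p (heat a t f)) - enn2real (dnorm p (heat a t0 f)))
   <= (\<Sum>k. enn2real (D k t))" using near
 proof eventually_elim
  case (elim t)
  then have t: "0 < t" using t0 by simp
  have "dnorm p (calc (?d t) f) <= (\<Sum>k. D k t)"
   unfolding D_def nn_integral_shift_int[symmetric, of "%j. dnorm p (piece j (calc (?d t) f))"]
  proof (rule dist_Lp_norm_dyadic_le[OF p d[OF t] _ ft])
   show "spec_bounded TYPE('n) (%l. l powr 2 * ?d t l)"
    unfolding right_diff_distrib by (intro spec_bounded_diff spec_bounded_powr_heat t t0)
  qed
  also have "... = (\<Sum>k. ennreal (enn2real (D k t)))" using order_le_less_trans[OF DC[of t] ennreal_less_top] elim by simp
  also have "... = ennreal (\<Sum>k. enn2real (D k t))"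
  proof (intro suminf_ennreal2 summable_comparison_test[OF _ geo] exI allI impI)
   show "norm (enn2real (D k t)) <= 2 * C * (1/4) ^ k" for k using DC[of t k] elim C(1) by (auto intro!: enn2real_leI)
  qed simp
  finally have "enn2real (dnorm p (calc (?d t) f)) <= (\<Sum>k. enn2real (D k t))"
   by (intro enn2real_leI suminf_nonneg summable_comparison_test[OF _ geo] exI allI impI)
    (use DC[of t] elim C(1) in \<open>auto intro!: enn2real_leI\<close>)
  moreover have "\<bar>enn2real (dnorm p (heat a t f)) - enn2real (dnorm p (heat a t0 f))\<bar>
   <= enn2real (dnorm p (calc (?d t) f))"
   by (rule dist_Lp_norm_diff_abs[OF p oscillator_calc_diff[OF h[OF t] h[OF t0] ft]])
    (use order_le_less_trans[OF heat_finite[OF f p q]] t t0 in auto)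
  ultimately show ?case by simp
 qed
 from Lim_null_comparison[OF this D0]
 show "isCont (%t. enn2real (dnorm p (heat a t f))) t0" unfolding isCont_def by (rule LIM_zero_cancel)
qed

end

section \<open>The time variable\<close>

text \<open>The endpoint 4 is 2^(-2 j0) for j0 = -1.\<close>

lemma space_time_measure: "space (tmeas) = {0<..<4}" by (simp add: time_measure_def space_restrict_space)

lemma sets_time_measure: "sets (tmeas) = sets (restrict_space borel {0<..<4})"
 unfolding time_measure_def by (simp add: sets_restrict_space)

lemma borel_measurable_time_measure:
 "f \<in> bmeas ==> f \<in> borel_measurable (tmeas)"
 unfolding measurable_cong_sets[OF sets_time_measure refl] by (rule measurable_restrict_space1)

lemma sigma_finite_time_measure: "sigma_finite_measure (tmeas)"
proof -
 let ?R = "restrict_space lborel {0<..<2 powr (- 2 * real_of_int (-1))}"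
 interpret R: sigma_finite_measure ?R by (rule sigma_finite_measure_restrict_space[OF sigma_finite_lborel]) simp
 have "(%t. ennreal (1 / t)) \<in> borel_measurable ?R" by (rule measurable_restrict_space1) measurable
 then show ?thesis unfolding time_measure_def by (subst R.sigma_finite_iff_density_finite') auto
qed

lemma nn_integral_time_measure:
 assumes f: "f \<in> bmeas"
 shows "(\<integral>\<^sup>+t. f t \<partial>tmeas) = (\<integral>\<^sup>+t. ennreal (1 / t) * f t * indicator {0<..<4} t \<partial>lborel)"
proof -
 let ?R = "restrict_space lborel {0<..<2 powr (- 2 * real_of_int (-1))}"
 have "(%t. ennreal (1 / t)) \<in> borel_measurable ?R" by (rule measurable_restrict_space1) measurable
 moreover have "f \<in> borel_measurable ?R" by (rule measurable_restrict_space1) (use f in simp)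
 ultimately show ?thesis unfolding time_measure_def by (subst nn_integral_density) (auto simp: nn_integral_restrict_space)
qed

lemma geometric_nn_integral_int:
 assumes r: "0 <= r" "r < (1::real)"
 shows "(\<integral>\<^sup>+k. ennreal (r ^ nat (k0 - k)) \<partial>count_space {..k0}) = ennreal (1 / (1 - r))"
  and "(\<integral>\<^sup>+k. ennreal (r ^ nat (k - k0 - 1)) \<partial>count_space {k0<..}) = ennreal (1 / (1 - r))"
proof -
 have g: "(\<Sum>n. ennreal (r ^ n)) = ennreal (1 / (1 - r))" using r by (subst suminf_ennreal2) (auto simp: suminf_geometric)
 have "bij_betw (%n. k0 - int n) UNIV {..k0}" by (rule bij_betw_byWitness[where f'="%k. nat (k0 - k)"]) auto
 from nn_integral_bij_count_space[OF this, of "%k. ennreal (r ^ nat (k0 - k))"] g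
 show "(\<integral>\<^sup>+k. ennreal (r ^ nat (k0 - k)) \<partial>count_space {..k0}) = ennreal (1 / (1 - r))"
  by (simp add: nn_integral_count_space_nat)
 have "bij_betw (%n. k0 + 1 + int n) UNIV {k0<..}" by (rule bij_betw_byWitness[where f'="%k. nat (k - k0 - 1)"]) auto
 from nn_integral_bij_count_space[OF this, of "%k. ennreal (r ^ nat (k - k0 - 1))"] g
 show "(\<integral>\<^sup>+k. ennreal (r ^ nat (k - k0 - 1)) \<partial>count_space {k0<..}) = ennreal (1 / (1 - r))"
  by (simp add: nn_integral_count_space_nat)
qed

section \<open>Schur kernels between time and scales\<close>

definition heat_kernel :: "real => real => int => real" where
 "heat_kernel b t k = (t * 4 powr real_of_int k) powr b * exp (- (t * 4 powr real_of_int k / 32))"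

lemma heat_kernel_nonneg: "0 <= heat_kernel b t k" by (simp add: heat_kernel_def)

text \<open>The sum is split where u = t 4^k passes 1. Below, u^b decays geometrically with ratio
  4^(-b), which is where b > 0 is used; above, the exponential makes the kernel at most a multiple
  of 1/u, with ratio 1/4.\<close>

lemma heat_kernel_sum_le:
 assumes b: "0 < b"
 shows "\<exists>C>0. \<forall>t>0. (\<integral>\<^sup>+k. ennreal (heat_kernel b t k) \<partial>scales) <= ennreal C"
proof -
 obtain L where L: "L > 0" "!!x. 0 < x ==> x powr (b + 1) * exp (- (1/32 * x)) <= L"
  using powr_exp_bounded[of "1/32" 0 "b + 1"] b by (auto simp: less_imp_le)
 let ?r = "(4::real) powr (- b)"
 have r: "0 <= ?r" "?r < 1" using b by (simp_all add: powr_less_one)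
 have "(\<integral>\<^sup>+k. ennreal (heat_kernel b t k) \<partial>scales) <= ennreal (1 / (1 - ?r) + L * (4/3))" if t: "0 < t" for t
 proof -
  define k0 where "k0 = \<lfloor>log 4 (1 / t)\<rfloor>"
  have k0: "real_of_int k0 <= log 4 (1 / t)" "log 4 (1 / t) < real_of_int k0 + 1" unfolding k0_def by linarith+
  have t4: "t = 4 powr (- log 4 (1 / t))" using t by (simp add: log_divide powr_minus)
  have x: "t * 4 powr real_of_int k = 4 powr (real_of_int k - log 4 (1 / t))" for k by (subst t4) (simp add: powr_add[symmetric])
  have A: "ennreal (heat_kernel b t k) <= ennreal (?r ^ nat (k0 - k))" if "k <= k0" for k
  proof -
   have "heat_kernel b t k <= (t * 4 powr real_of_int k) powr b * 1" unfolding heat_kernel_def using t by (intro mult_left_mono) auto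
   also have "... = 4 powr (b * (real_of_int k - log 4 (1 / t)))" unfolding x by (simp add: powr_powr mult.commute)
   also have "... <= 4 powr (b * (real_of_int k - real_of_int k0))" using k0 b by (intro powr_mono mult_left_mono) auto
   also have "... = ?r powr real (nat (k0 - k))" using that by (simp add: powr_powr of_nat_nat algebra_simps)
   also have "... = ?r ^ nat (k0 - k)" by (rule powr_realpow) simp
   finally show ?thesis by (rule ennreal_leI)
  qed
  have B: "ennreal (heat_kernel b t k) <= ennreal L * ennreal ((1/4) ^ nat (k - k0 - 1))" if "k0 < k" for k
  proof -
   let ?x = "t * 4 powr real_of_int k"
   have x0: "0 < ?x" using t by simp
   have "heat_kernel b t k = (?x powr (b + 1) * exp (- (1/32 * ?x))) * inverse ?x"
   proof -
    have "?x * inverse ?x = 1" by (intro right_inverse) (use t in simp)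
    moreover have "?x powr (b + 1) = ?x powr b * ?x" using x0 by (simp only: powr_add powr_one less_imp_le)
    then have "(?x powr (b + 1) * exp (- (1/32 * ?x))) * inverse ?x = ?x powr b * exp (- (1/32 * ?x)) * (?x * inverse ?x)"
     by (simp only: mult_ac)
    ultimately show ?thesis by (simp add: heat_kernel_def)
   qed
   also have "... <= L * inverse ?x" 
    by (rule mult_right_mono[OF L(2)[OF x0]]) (use less_imp_le[OF x0] in \<open>simp only: inverse_nonnegative_iff_nonnegative\<close>)
   also have "inverse ?x = 4 powr (log 4 (1 / t) - real_of_int k)" unfolding x by (simp add: powr_minus[symmetric])
   also have "... <= 4 powr (- real (nat (k - k0 - 1)))" using k0 that by (intro powr_mono) (auto simp: of_nat_nat)
   also have "... = (1/4) ^ nat (k - k0 - 1)" by (simp add: powr_minus powr_realpow power_one_over inverse_eq_divide)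
   finally show ?thesis using L(1) by (simp add: ennreal_leI flip: ennreal_mult)
  qed
  have "(\<integral>\<^sup>+k. ennreal (heat_kernel b t k) \<partial>scales) = (\<integral>\<^sup>+k. ennreal (heat_kernel b t k) * indicator {-1..} k \<partial>count_space UNIV)"
   by (simp add: nn_integral_count_space_indicator)
  also have "... <= (\<integral>\<^sup>+k. ennreal (?r ^ nat (k0 - k)) * indicator {..k0} k + ennreal L * ennreal ((1/4) ^ nat (k - k0 - 1)) * indicator {k0<..} k \<partial>count_space UNIV)"
  proof (intro nn_integral_mono)
   fix k :: int
   show "ennreal (heat_kernel b t k) * indicator {-1..} k <= ennreal (?r ^ nat (k0 - k)) * indicator {..k0} k + ennreal L * ennreal ((1/4) ^ nat (k - k0 - 1)) * indicator {k0<..} k"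
    using A[of k] B[of k] by (cases "k <= k0") (auto simp: indicator_def simp del: ennreal_power)
  qed
  also have "... = (\<integral>\<^sup>+k. ennreal (?r ^ nat (k0 - k)) \<partial>count_space {..k0}) + (\<integral>\<^sup>+k. ennreal L * ennreal ((1/4) ^ nat (k - k0 - 1)) \<partial>count_space {k0<..})"
   by (subst nn_integral_add) (auto simp: nn_integral_count_space_indicator)
  also have "... = ennreal (1 / (1 - ?r)) + ennreal L * ennreal (1 / (1 - 1/4))"
   using r by (simp only: nn_integral_cmult measurable_count_space geometric_nn_integral_int) (subst nn_integral_cmult, simp_all add: geometric_nn_integral_int del: ennreal_power)
  also have "... = ennreal (1 / (1 - ?r) + L * (4/3))" using r L(1) ennreal_plus[of "1 / (1 - ?r)" "L * (4/3)"] ennreal_mult[of L "4/3"] by simp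
  finally show ?thesis .
 qed
 moreover have "0 < 1 / (1 - ?r) + L * (4/3)" using r L(1) by (intro add_pos_pos) auto
 ultimately show ?thesis by blast
qed

text \<open>By invariance of dt/t under dilations, the substitution y = 4^k t / 32 removes k and
  leaves 32^b times the Gamma integral.\<close>

lemma heat_kernel_integral_le:
 assumes b: "0 < b"
 shows "(\<integral>\<^sup>+t. ennreal (heat_kernel b t k) \<partial>tmeas) <= ennreal (32 powr b * Gamma b)"
proof -
 let ?c = "4 powr real_of_int k / 32"
 let ?g = "%t. ennreal (indicator {0..} t * t powr (b - 1) / exp t)"
 have c: "0 < ?c" by simp
 have m: "(%t. ennreal (heat_kernel b t k)) \<in> bmeas" unfolding heat_kernel_def by measurable
 have "(\<integral>\<^sup>+t. ennreal (heat_kernel b t k) \<partial>tmeas) <= (\<integral>\<^sup>+t. ennreal (32 powr b) * (ennreal ?c * ?g (0 + ?c * t)) \<partial>lborel)"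
  unfolding nn_integral_time_measure[OF m]
 proof (intro nn_integral_mono)
  fix t :: real
  show "ennreal (1 / t) * ennreal (heat_kernel b t k) * indicator {0<..<4} t <= ennreal (32 powr b) * (ennreal ?c * ?g (0 + ?c * t))"
  proof (cases "0 < t")
   case True
   let ?y = "?c * t"
   have y: "0 < ?y" using True by simp
   have yb: "?y powr b = ?y powr (b - 1) * ?y" using y powr_add[of ?y "b - 1" 1] by simp
   have "t * 4 powr real_of_int k = 32 * ?y" by simp
   then have "heat_kernel b t k = 32 powr b * ?y powr b * exp (- ?y)" unfolding heat_kernel_def using y by (simp only: powr_mult) simp
   then have hk: "heat_kernel b t k = 32 powr b * (?y powr (b - 1) * ?y) * exp (- ?y)" unfolding yb .
   have "1 / t * (u * (v * (c * t)) * w) = u * (c * (v * w))" for u v c w using True by simp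
   then have "1 / t * heat_kernel b t k = 32 powr b * (?c * (?y powr (b - 1) * exp (- ?y)))" unfolding hk .
   then have k: "1 / t * heat_kernel b t k = 32 powr b * (?c * (?y powr (b - 1) / exp ?y))" by (simp only: exp_minus divide_inverse)
   have "ennreal (1 / t) * ennreal (heat_kernel b t k) = ennreal (1 / t * heat_kernel b t k)"
    by (rule ennreal_mult[symmetric]) (use True heat_kernel_nonneg in auto)
   also have "... = ennreal (32 powr b) * (ennreal ?c * ennreal (?y powr (b - 1) / exp ?y))"
   proof -
    have n: "0 <= ?c" "0 <= ?y powr (b - 1) / exp ?y" by (simp_all only: divide_nonneg_nonneg powr_ge_zero exp_ge_zero zero_le_numeral)
    show ?thesis unfolding k by (simp only: ennreal_mult[OF powr_ge_zero mult_nonneg_nonneg[OF n]] ennreal_mult[OF n])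
   qed
   also have "ennreal (?y powr (b - 1) / exp ?y) = ?g (0 + ?c * t)" using True by simp
   finally have "ennreal (1 / t) * ennreal (heat_kernel b t k) = ennreal (32 powr b) * (ennreal ?c * ?g (0 + ?c * t))" .
   then show ?thesis by (simp add: indicator_def)
  qed simp
 qed
 also have "... = ennreal (32 powr b) * (ennreal ?c * (\<integral>\<^sup>+t. ?g (0 + ?c * t) \<partial>lborel))"
  by (simp add: nn_integral_cmult)
 also have "ennreal ?c * (\<integral>\<^sup>+t. ?g (0 + ?c * t) \<partial>lborel) = (\<integral>\<^sup>+t. ?g t \<partial>lborel)"
  by (subst nn_integral_real_affine[of ?g ?c 0]) simp_all
 also have "(\<integral>\<^sup>+t. ?g t \<partial>lborel) = ennreal (Gamma b)" by (rule Gamma_conv_nn_integral_real[OF b, symmetric])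
 finally show ?thesis using b by (simp add: ennreal_mult Gamma_real_nonneg)
qed

text \<open>The times with t 4^j in (1/4, 1), the range of \<open>dyadic_heat_ge\<close>. Intervals
  of different j are disjoint, and for j \<ge> -1 they lie in (0, 4).\<close>

definition dyadic_interval :: "int => real set" where
 "dyadic_interval j = {4 powr (- real_of_int j - 1)<..<4 powr (- real_of_int j)}"

text \<open>The mass for dt/t is log 4. The bounds 3/4 and 3 result from replacing 1/t by its
  endpoint values on an interval whose length is 3/4 of its right end.\<close>

lemma time_measure_dyadic_interval:
 assumes j: "-1 <= j" shows "(\<integral>\<^sup>+t. indicator (dyadic_interval j) t \<partial>tmeas) <= 3"
  and "ennreal (3/4) <= (\<integral>\<^sup>+t. indicator (dyadic_interval j) t \<partial>tmeas)"
proof -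
 let ?q = "4 powr (- real_of_int j) :: real"
 have I: "dyadic_interval j = {?q / 4<..<?q}" by (simp add: dyadic_interval_def powr_diff)
 have q: "0 < ?q" "?q <= 4" using powr_mono[of "- real_of_int j" 1 4] j by auto
 have m: "indicator (dyadic_interval j) \<in> bmeas" by (simp add: dyadic_interval_def)
 have mI: "dyadic_interval j \<in> sets lborel" by (simp add: dyadic_interval_def)
 have e: "emeasure lborel (dyadic_interval j) = ennreal (3/4 * ?q)" unfolding I using q by (simp add: field_simps)
 have "(\<integral>\<^sup>+t. ennreal (1 / t) * indicator (dyadic_interval j) t * indicator {0<..<4} t \<partial>lborel)
   <= (\<integral>\<^sup>+t. ennreal (4 / ?q) * indicator (dyadic_interval j) t \<partial>lborel)"
  using q by (intro nn_integral_mono) (auto simp: I indicator_def field_simps intro!: ennreal_leI)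
 also have "... = ennreal (4 / ?q * (3/4 * ?q))"
  by (subst nn_integral_cmult_indicator[OF mI]) (use q in \<open>simp add: e flip: ennreal_mult\<close>)
 also have "... = 3" using q by simp
 finally show "(\<integral>\<^sup>+t. indicator (dyadic_interval j) t \<partial>tmeas) <= 3" unfolding nn_integral_time_measure[OF m] .
 have "ennreal (3/4) = ennreal (1 / ?q * (3/4 * ?q))" using q by simp
 also have "... = (\<integral>\<^sup>+t. ennreal (1 / ?q) * indicator (dyadic_interval j) t \<partial>lborel)"
  by (subst nn_integral_cmult_indicator[OF mI]) (use q in \<open>simp add: e flip: ennreal_mult\<close>)
 also have "... <= (\<integral>\<^sup>+t. ennreal (1 / t) * indicator (dyadic_interval j) t * indicator {0<..<4} t \<partial>lborel)"
  using q by (intro nn_integral_mono) (auto simp: I indicator_def field_simps intro!: ennreal_leI)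
 finally show "ennreal (3/4) <= (\<integral>\<^sup>+t. indicator (dyadic_interval j) t \<partial>tmeas)" unfolding nn_integral_time_measure[OF m] .
qed

lemma sum_dyadic_interval_le: "(\<integral>\<^sup>+j. indicator (dyadic_interval j) t \<partial>scales) <= 1"
proof (cases "\<exists>j. t \<in> dyadic_interval j")
 case True
 then obtain j where j: "t \<in> dyadic_interval j" ..
 have "i = j" if "t \<in> dyadic_interval i" for i
 proof -
  have "4 powr (- real_of_int i - 1) < (4 powr (- real_of_int j) :: real)" "4 powr (- real_of_int j - 1) < (4 powr (- real_of_int i) :: real)"
   using that j less_trans unfolding dyadic_interval_def greaterThanLessThan_iff by metis+
  then show ?thesis by (simp only: powr_less_cancel_iff)
 qed
 then have "(\<integral>\<^sup>+j. indicator (dyadic_interval j) t \<partial>scales) <= (\<integral>\<^sup>+i. indicator {j} i \<partial>scales)"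
  by (intro nn_integral_mono) (auto simp: indicator_def)
 also have "... <= (\<integral>\<^sup>+i. indicator {j} i \<partial>count_space UNIV)"
 proof -
  have "(\<integral>\<^sup>+i. indicator {j} i \<partial>scales) = (\<integral>\<^sup>+i. indicator {j} i * indicator {-1..} i \<partial>count_space UNIV)"
   by (rule nn_integral_count_space_indicator) simp
  also have "... <= (\<integral>\<^sup>+i. indicator {j} i \<partial>count_space UNIV)" by (intro nn_integral_mono) (auto simp: indicator_def)
  finally show ?thesis .
 qed
 also have "... = 1" by (subst nn_integral_indicator) auto
 finally show ?thesis .
qed (simp add: indicator_def)

section \<open>The norm equivalence\<close>

lemma eLp_norm_cong:
 assumes "a \<in> borel_measurable M" "b \<in> borel_measurable M" "!!x. x \<in> space M ==> a x = b x"
 shows "eLp_norm p M a = eLp_norm p M b"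
proof -
 have "esssup M a = esssup M b" by (rule esssup_AE_cong[OF assms(1,2)]) (use assms(3) in auto)
 moreover have "(\<integral>\<^sup>+x. epowr (a x) (enn2real p) \<partial>M) = (\<integral>\<^sup>+x. epowr (b x) (enn2real p) \<partial>M)"
  by (rule nn_integral_cong) (simp add: assms(3))
 ultimately show ?thesis by (simp add: eLp_norm_def)
qed

lemma four_powr_half: "((4::real) powr x) powr (s/2) = 2 powr (s * x)"
proof -
 have "(4::real) = 2 powr 2" by simp
 then have "((4::real) powr x) powr (s/2) = 2 powr (2 * x * (s/2))" by (simp only: powr_powr)
 also have "2 * x * (s/2) = s * x" by simp
 finally show ?thesis .
qed

context dyadic
begin

lemma heat_X_le:
 fixes f :: "'n::finite dist"
 assumes X: "X = dnorm p | (\<exists>r\<ge>1. X = besov_norm \<phi>0 0 p r)"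
  and f: "f \<in> besov_space \<phi>0 s p q" and p: "1 <= p" and q: "1 <= q" and t: "0 < t" shows "X (heat a t f)
   <= (\<integral>\<^sup>+j. dnorm p (piece j (heat a t f)) \<partial>scales)"
 using X
proof
 assume "X = dnorm p"
 then show ?thesis using heat_finite(1)[OF f p q t] by simp
next
 assume "\<exists>r\<ge>1. X = besov_norm \<phi>0 0 p r"
 then show ?thesis by (auto simp: besov_norm_def intro!: eLp_norm_count_space_le)
qed

lemma dyadic_piece_le_X:
 fixes X :: "'n::finite dist => ennreal"
 assumes X: "X = dnorm p | (\<exists>r\<ge>1. X = besov_norm \<phi>0 0 p r)" and p: "1 <= p"
 shows "\<exists>K>0. \<forall>j\<ge>-1. \<forall>u. dnorm p (piece j u) <= ennreal K * X u"
 using X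
proof
 assume "X = dnorm p"
 then show ?thesis using dyadic_piece_le[where 'n='n] p by blast
next
 assume "\<exists>r\<ge>1. X = besov_norm \<phi>0 0 p r"
 then obtain r where r: "1 <= r" "X = besov_norm \<phi>0 0 p r" by blast
 have "dnorm p (piece j u) <= ennreal 1 * X u" if "-1 <= j" for j u unfolding r(2) besov_norm_def
  using eLp_norm_count_space_ge[OF r(1), of j "{-1..}" "%j. dnorm p (piece j u)"] that by simp
 then show ?thesis by (intro exI[of _ 1]) auto
qed

lemma measurable_of_continuous_enn2real:
 assumes "continuous_on {0<..} (%t. enn2real (N t))" "!!t. 0 < t ==> N t < top" shows "N \<in> borel_measurable (tmeas)"
proof -
 have "continuous_on {0<..<4} (%t. enn2real (N t))" by (rule continuous_on_subset[OF assms(1)]) auto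
 then have "(%t. enn2real (N t)) \<in> borel_measurable (tmeas)"
  unfolding measurable_cong_sets[OF sets_time_measure refl] by (rule borel_measurable_continuous_on_restrict)
 then have "(%t. ennreal (enn2real (N t))) \<in> borel_measurable (tmeas)" by (rule measurable_compose) measurable
 moreover have "ennreal (enn2real (N t)) = N t" if "t \<in> space (tmeas)" for t
  using that assms(2) by (auto simp: space_time_measure)
 ultimately show ?thesis using measurable_cong[of "tmeas" "%t. ennreal (enn2real (N t))" N borel] by blast
qed

text \<open>For X = L^p this is continuity. For a Besov norm it suffices that each piece is
  measurable, since the norm over scales is a countable supremum or built from a series.\<close>

lemma heat_X_measurable:
 fixes f :: "'n::finite dist"
 assumes X: "X = dnorm p | (\<exists>r\<ge>1. X = besov_norm \<phi>0 0 p r)"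
  and f: "f \<in> besov_space \<phi>0 s p q" and p: "1 <= p" and q: "1 <= q"
 shows "(%t. X (heat a t f)) \<in> borel_measurable (tmeas)" using X
proof
 assume X: "X = dnorm p"
 show ?thesis unfolding X by (rule measurable_of_continuous_enn2real[OF heat_continuous[OF f p q]])
   (rule order_le_less_trans[OF heat_finite[OF f p q]])
next
 assume "\<exists>r\<ge>1. X = besov_norm \<phi>0 0 p r"
 then obtain r where r: "1 <= r" "X = besov_norm \<phi>0 0 p r" by blast
 let ?A = "%j t. dnorm p (piece j (heat a t f))"
 have Xe: "X (heat a t f) = eLp_norm r (scales) (%j. ?A j t)" for t by (simp add: r(2) besov_norm_def)
 have A: "?A j \<in> borel_measurable (tmeas)" if "-1 <= j" for j
  by (rule measurable_of_continuous_enn2real[OF heat_piece_continuous[OF f p q that] heat_piece_finite[OF f p q _ that]])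
 show ?thesis
 proof (cases "r = top")
  case True
  have "eLp_norm r (scales) (%j. ?A j t) = (SUP j\<in>{-1..}. ?A j t)" for t unfolding True
  proof (rule antisym)
   show "eLp_norm top (scales) (%j. ?A j t) <= (SUP j\<in>{-1..}. ?A j t)"
    by (subst eLp_norm_top_le_iff) (auto simp: AE_count_space intro: SUP_upper)
   show "(SUP j\<in>{-1..}. ?A j t) <= eLp_norm top (scales) (%j. ?A j t)"
    by (intro SUP_least eLp_norm_count_space_ge) auto
  qed
  then show ?thesis unfolding Xe by (simp only:) (intro borel_measurable_SUP A, auto)
 next
  case False
  have "eLp_norm r (scales) (%j. ?A j t) = epowr (\<Sum>k. epowr (?A (int k - 1) t) (enn2real r)) (1 / enn2real r)" for t
   using False by (simp add: eLp_norm_def nn_integral_shift_int)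
  moreover have "(%t. epowr (\<Sum>k. epowr (?A (int k - 1) t) (enn2real r)) (1 / enn2real r)) \<in> borel_measurable (tmeas)"
   by (intro measurable_compose[OF _ borel_measurable_epowr] borel_measurable_suminf_order A) auto
  ultimately show ?thesis unfolding Xe by (simp only:)
 qed
qed

text \<open>With u = t 4^k, the factor t^(-s/2) u^s0 equals u^b 2^(sk) for b = s0 - s/2. The heat
  norm is thus dominated by \<open>heat_kernel\<close> acting on the weighted sequence whose
  sequence norm is the Besov norm.\<close>

theorem heat_norm_upper:
 fixes X :: "'n::finite dist => ennreal"
 assumes X: "X = dnorm p | (\<exists>r\<ge>1. X = besov_norm \<phi>0 0 p r)" and p: "1 <= p" and q: "1 <= q" and s: "s / 2 < s0"
 shows "\<exists>C>0. \<forall>f\<in>besov_space \<phi>0 s p q. heat_norm s s0 q (-1) X f <= ennreal C * besov_norm \<phi>0 s p q f"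
proof -
 let ?b = "s0 - s / 2"
 have b: "0 < ?b" using s by simp
 obtain K where K: "K > 0" "!!j t u. -1 <= j ==> 0 < t ==>
   dnorm p (piece j (heat s0 t (u :: 'n dist)))
    <= ennreal (K * ((t * 4 powr j) powr s0 * exp (- (t * 4 powr j / 32)))) * dnorm p (piece j u)"
  using dyadic_heat_le[of s0, where 'n='n] p by blast
 obtain C1 where C1: "C1 > 0" "!!t. 0 < t ==> (\<integral>\<^sup>+k. ennreal (heat_kernel ?b t k) \<partial>scales) <= ennreal C1"
  using heat_kernel_sum_le[OF b] by blast
 \<comment> \<open>The Schur test takes a single constant for both marginals; the sum dominates each
   of them.\<close>
 define C where "C = C1 + 32 powr ?b * Gamma ?b"
 have G: "0 <= 32 powr ?b * Gamma ?b" using b by (simp add: Gamma_real_nonneg)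
 have C0: "0 < C" using C1(1) G by (simp add: C_def)
 have CC: "ennreal C1 <= ennreal C" "ennreal (32 powr ?b * Gamma ?b) <= ennreal C"
  using C1(1) G by (auto simp: C_def intro!: ennreal_leI)
 have "heat_norm s s0 q (-1) X f <= ennreal (K * C) * besov_norm \<phi>0 s p q f" if f: "f \<in> besov_space \<phi>0 s p q" for f
 proof -
  let ?a = "%k. dnorm p (piece k f)"
  let ?w = "%k. ennreal (2 powr (s * real_of_int k)) * ?a k"
  let ?h = "%t. heat s0 t f"
  obtain B0 where Bf: "!!j. -1 <= j ==> ?a j <= ennreal (B0 * 2 powr (- s * real_of_int j))" by (rule besov_piece_le[OF f q]) blast
  \<comment> \<open>The Schur test acts on real-valued functions. The pieces are finite because f
    lies in the Besov space, so nothing is lost in the conversion.\<close>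
  have w: "ennreal (enn2real (?w k)) = ?w k" if "-1 <= k" for k
   using order_le_less_trans[OF Bf[OF that] ennreal_less_top] by (simp add: ennreal_mult_less_top)
  have "besov_norm \<phi>0 s p q f < top" using f by (simp add: besov_space_def)
  then obtain B where B: "0 <= B" "besov_norm \<phi>0 s p q f = ennreal B" by (cases "besov_norm \<phi>0 s p q f") auto
  have "eLp_norm q (tmeas) (%t. ennreal (t powr (- s / 2)) * X (?h t)) <= ennreal ((K * C) * B)"
  proof (rule schur_test[where \<kappa>="%t k. K * heat_kernel ?b t k" and b="%k. enn2real (?w k)" and N="scales"])
   show "sigma_finite_measure (tmeas)" by (rule sigma_finite_time_measure)
   show "sigma_finite_measure (count_space {-1::int..})" by (rule sigma_finite_measure_count_space)
   show "1 <= q" "0 < K * C" "0 <= B" using q K(1) C0 B(1) by auto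
   have fst: "(%z::real \<times> int. fst z) \<in> borel_measurable (tmeas \<Otimes>\<^sub>M scales)"
    by (rule measurable_compose[OF measurable_fst]) (rule borel_measurable_time_measure, simp)
   have snd: "(%z::real \<times> int. real_of_int (snd z)) \<in> borel_measurable (tmeas \<Otimes>\<^sub>M scales)"
    by (rule measurable_compose[OF measurable_snd]) simp
   show "(%(t, k). K * heat_kernel ?b t k) \<in> borel_measurable (tmeas \<Otimes>\<^sub>M scales)"
    unfolding heat_kernel_def split_beta using fst snd by measurable
   show "0 <= K * heat_kernel ?b t k" for t k using K(1) heat_kernel_nonneg by simp
   have split: "ennreal (K * heat_kernel ?b t k) = ennreal K * ennreal (heat_kernel ?b t k)" for t k
    using K(1) heat_kernel_nonneg by (simp add: ennreal_mult)
   show "(\<integral>\<^sup>+k. ennreal (K * heat_kernel ?b t k) \<partial>scales) <= ennreal (K * C)" if "t \<in> space (tmeas)" for t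
   proof -
    have t: "0 < t" using that by (simp add: space_time_measure)
    show ?thesis unfolding split using K(1) C0 mult_left_mono[OF order_trans[OF C1(2)[OF t] CC(1)], of "ennreal K"]
     by (simp add: nn_integral_cmult ennreal_mult)
   qed
   show "(\<integral>\<^sup>+t. ennreal (K * heat_kernel ?b t k) \<partial>tmeas) <= ennreal (K * C)" for k
   proof -
    have "(%t. ennreal (heat_kernel ?b t k)) \<in> borel_measurable (tmeas)"
     by (rule borel_measurable_time_measure) (simp add: heat_kernel_def)
    then show ?thesis
     unfolding split using K(1) C0 mult_left_mono[OF order_trans[OF heat_kernel_integral_le[OF b] CC(2)], of "ennreal K"]
     by (simp add: nn_integral_cmult ennreal_mult)
   qed
   show "(%k. enn2real (?w k)) \<in> borel_measurable (scales)" by simp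
   show "0 <= enn2real (?w k)" for k by simp
   have "eLp_norm q (scales) (%k. ennreal (enn2real (?w k))) = eLp_norm q (scales) ?w"
    by (rule eLp_norm_cong) (simp, simp, simp only: space_count_space atLeast_iff w)
   then show "eLp_norm q (scales) (%k. ennreal (enn2real (?w k))) <= ennreal B" using B(2) by (simp add: besov_norm_def)
   have "(%t. ennreal (t powr (- s / 2))) \<in> borel_measurable (tmeas)"
    by (rule borel_measurable_time_measure) measurable
   then show "(%t. ennreal (t powr (- s / 2)) * X (?h t)) \<in> borel_measurable (tmeas)"
    using heat_X_measurable[OF X f p q] by (rule borel_measurable_times_ennreal)
   fix t assume "t \<in> space (tmeas)"
   then have t: "0 < t" by (simp add: space_time_measure)
   have "ennreal (t powr (- s / 2)) * X (?h t)
     <= ennreal (t powr (- s / 2)) * (\<integral>\<^sup>+k. dnorm p (piece k (?h t)) \<partial>scales)"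
    by (intro mult_left_mono heat_X_le[OF X f p q t]) simp
   also have "... = (\<integral>\<^sup>+k. ennreal (t powr (- s / 2)) * dnorm p (piece k (?h t)) \<partial>scales)"
    by (simp add: nn_integral_cmult)
   also have "... <= (\<integral>\<^sup>+k. ennreal (K * heat_kernel ?b t k * enn2real (?w k)) \<partial>scales)"
   proof (intro nn_integral_mono)
    fix k :: int assume "k \<in> space (scales)"
    then have k: "-1 <= k" by simp
    let ?x = "t * 4 powr real_of_int k"
    have x0: "0 < ?x" using t by simp
    have "?x powr s0 = ?x powr ?b * ?x powr (s/2)" by (simp add: powr_add[symmetric])
    also have "?x powr (s/2) = t powr (s/2) * 2 powr (s * real_of_int k)" using t by (simp add: powr_mult four_powr_half)
    finally have xs: "?x powr s0 = ?x powr ?b * (t powr (s/2) * 2 powr (s * real_of_int k))" .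
    have tt: "t powr (- s / 2) * t powr (s / 2) = 1" using t by (simp add: powr_add[symmetric])
    have "t powr (- s / 2) * (K * (?x powr s0 * exp (- (?x / 32)))) = (t powr (- s / 2) * t powr (s / 2)) * (K * heat_kernel ?b t k * 2 powr (s * real_of_int k))"
     unfolding xs heat_kernel_def by (simp only: mult_ac)
    then have e: "t powr (- s / 2) * (K * (?x powr s0 * exp (- (?x / 32)))) = K * heat_kernel ?b t k * 2 powr (s * real_of_int k)"
     unfolding tt by simp
    have Kk: "0 <= K * heat_kernel ?b t k" using K(1) heat_kernel_nonneg by simp
    have "ennreal (t powr (- s / 2)) * dnorm p (piece k (?h t))
      <= ennreal (t powr (- s / 2)) * (ennreal (K * (?x powr s0 * exp (- (?x / 32)))) * ?a k)"
     by (intro mult_left_mono K(2)[OF k t]) simp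
    also have "... = ennreal (t powr (- s / 2) * (K * (?x powr s0 * exp (- (?x / 32))))) * ?a k"
     using K(1) by (simp add: ennreal_mult mult.assoc)
    also have "... = ennreal (K * heat_kernel ?b t k) * ?w k" unfolding e ennreal_mult[OF Kk powr_ge_zero] by (rule mult.assoc)
    also have "... = ennreal (K * heat_kernel ?b t k * enn2real (?w k))" unfolding ennreal_mult[OF Kk enn2real_nonneg] w[OF k] ..
    finally show "ennreal (t powr (- s / 2)) * dnorm p (piece k (?h t))
     <= ennreal (K * heat_kernel ?b t k * enn2real (?w k))" .
   qed
   finally show "ennreal (t powr (- s / 2)) * X (?h t) <= (\<integral>\<^sup>+k. ennreal (K * heat_kernel ?b t k * enn2real (?w k)) \<partial>scales)" .
  qed
  then show ?thesis using B K(1) C0 by (simp add: heat_norm_def ennreal_mult)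
 qed
 then show ?thesis using K(1) C0 by (intro exI[of _ "K * C"]) auto
qed

text \<open>At every t in its dyadic interval, the weighted piece j is bounded by the integrand of
  the heat norm. Averaging over the interval yields an integral operator whose kernel is a multiple
  of an indicator, to which the Schur test applies.\<close>

theorem heat_norm_lower:
 fixes X :: "'n::finite dist => ennreal"
 assumes X: "X = dnorm p | (\<exists>r\<ge>1. X = besov_norm \<phi>0 0 p r)" and p: "1 <= p" and q: "1 <= q"
 shows "\<exists>C>0. \<forall>f\<in>besov_space \<phi>0 s p q. besov_norm \<phi>0 s p q f <= ennreal C * heat_norm s s0 q (-1) X f"
proof -
 obtain K1 where K1: "K1 > 0" "!!j t u. -1 <= j ==> t * 4 powr j \<in> {1/4..1} ==>
   dnorm p (piece j (u :: 'n dist))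
    <= ennreal K1 * dnorm p (piece j (heat s0 t u))"
  using dyadic_heat_ge[of s0, where 'n='n] p by blast
 obtain K2 where K2: "K2 > 0" "!!j u. -1 <= j ==> dnorm p (piece j u) <= ennreal K2 * X u"
  using dyadic_piece_le_X[OF X p] by blast
 \<comment> \<open>The first factor bounds u^(s/2) for u in [1/4, 1], whatever the sign of
   s.\<close>
 define K where "K = (1 + (1/4) powr (s/2)) * K1 * K2"
 have K: "K > 0" unfolding K_def using K1(1) K2(1) by (intro mult_pos_pos add_pos_nonneg) auto
 \<comment> \<open>4/3 is the reciprocal of the lower bound 3/4 for the mass of a dyadic interval;
   the upper bound 3 turns up in the final constant 3 c.\<close>
 define c where "c = 4/3 * K"
 have c: "c > 0" using K by (simp add: c_def)
 have "besov_norm \<phi>0 s p q f <= ennreal (3 * c) * heat_norm s s0 q (-1) X f" if f: "f \<in> besov_space \<phi>0 s p q" for f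
 proof (cases "heat_norm s s0 q (-1) X f")
  case top
  then show ?thesis using c by (simp add: ennreal_mult_top)
 next
  case (real B)
  let ?h = "%t. heat s0 t f"
  let ?H = "%t. ennreal (t powr (- s / 2)) * X (?h t)"
  let ?w = "%j. ennreal (2 powr (s * real_of_int j)) * dnorm p (piece j f)"
  have Hm: "?H \<in> borel_measurable (tmeas)"
  proof (rule borel_measurable_times_ennreal[OF _ heat_X_measurable[OF X f p q]])
   show "(%t. ennreal (t powr (- s / 2))) \<in> borel_measurable (tmeas)"
    by (rule borel_measurable_time_measure) measurable
  qed
  have Hf: "ennreal (enn2real (?H t)) = ?H t" if "0 < t" for t
   using order_le_less_trans[OF heat_X_le[OF X f p q that] heat_finite(2)[OF f p q that]] by (simp add: ennreal_mult_less_top)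
  have Im: "(indicator (dyadic_interval j) :: real => ennreal) \<in> borel_measurable (tmeas)" for j
   by (rule borel_measurable_time_measure) (simp add: dyadic_interval_def)
  have split: "ennreal (c * indicator (dyadic_interval j) t) = ennreal c * indicator (dyadic_interval j) t" for j and t :: real
   by (simp add: indicator_def)
  have "eLp_norm q (scales) ?w <= ennreal ((3 * c) * B)"
  proof (rule schur_test[where \<kappa>="%j t. c * indicator (dyadic_interval j) t" and b="%t. enn2real (?H t)" and N="tmeas"])
   show "sigma_finite_measure (tmeas)" by (rule sigma_finite_time_measure)
   show "sigma_finite_measure (count_space {-1::int..})" by (rule sigma_finite_measure_count_space)
   show "1 <= q" "0 < 3 * c" "0 <= B" using q c real(1) by auto
   show "(%(j, t). c * indicator (dyadic_interval j) t) \<in> borel_measurable (scales \<Otimes>\<^sub>M tmeas)"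
   proof (rule measurable_pair_measure_countable1)
    fix j :: int
    show "(%t. case (j, t) of (j, t) => c * indicator (dyadic_interval j) t) \<in> borel_measurable (tmeas)"
     by (rule borel_measurable_time_measure) (simp add: dyadic_interval_def)
   qed simp
   show "0 <= c * indicator (dyadic_interval j) t" for j and t :: real using c by simp
   show "(\<integral>\<^sup>+t. ennreal (c * indicator (dyadic_interval j) t) \<partial>tmeas) <= ennreal (3 * c)" if "j \<in> space (scales)" for j
   proof -
    have "ennreal c * (\<integral>\<^sup>+t. indicator (dyadic_interval j) t \<partial>tmeas) <= ennreal c * 3"
     using that by (intro mult_left_mono time_measure_dyadic_interval) auto
    also have "... = ennreal (3 * c)" using c by (simp add: ennreal_mult mult.commute)
    finally show ?thesis unfolding split nn_integral_cmult[OF Im] .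
   qed
   show "(\<integral>\<^sup>+j. ennreal (c * indicator (dyadic_interval j) t) \<partial>scales) <= ennreal (3 * c)" for t
   proof -
    have "(\<integral>\<^sup>+j. ennreal (c * indicator (dyadic_interval j) t) \<partial>scales) = ennreal c * (\<integral>\<^sup>+j. indicator (dyadic_interval j) t \<partial>scales)"
     unfolding split by (rule nn_integral_cmult) simp
    also have "... <= ennreal c * 1" by (intro mult_left_mono sum_dyadic_interval_le) simp
    also have "... <= ennreal (3 * c)" using c by (simp add: ennreal_leI)
    finally show ?thesis .
   qed
   show "(%t. enn2real (?H t)) \<in> borel_measurable (tmeas)" using Hm by measurable
   show "0 <= enn2real (?H t)" for t by simp
   have "eLp_norm q (tmeas) (%t. ennreal (enn2real (?H t))) = eLp_norm q (tmeas) ?H"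
    by (rule eLp_norm_cong) (use Hm Hf in \<open>auto simp: space_time_measure\<close>)
   then show "eLp_norm q (tmeas) (%t. ennreal (enn2real (?H t))) <= ennreal B" using real(2) by (simp add: heat_norm_def)
   show "?w \<in> borel_measurable (scales)" by simp
   fix j :: int assume "j \<in> space (scales)"
   then have j: "-1 <= j" by simp
   \<comment> \<open>Three estimates are chained: inversion of the heat multiplier at scale j,
     domination of a piece by X, and comparison of 2^(sj) with t^(-s/2).\<close>
   have pt: "?w j <= ennreal (K * enn2real (?H t))" if t: "t \<in> dyadic_interval j" for t
   proof -
    let ?q = "4 powr real_of_int j" and ?a = "dnorm p (piece j f)"
    have q0: "0 < ?q" by simp
    have "1 / (4 * ?q) < t" "t < 1 / ?q" using t by (simp_all add: dyadic_interval_def powr_diff powr_minus_divide)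
    then have x: "t * ?q \<in> {1/4..1}" and t0: "0 < t" using q0 less_trans[of 0 "1 / (4 * ?q)" t] by (auto simp: field_simps)
    have "(t * ?q) powr (s/2) <= 1 + (1/4) powr (s/2)" using powr_le_add[of "1/4" "t * ?q" 1 "s/2"] x by simp
    then have "t powr (- s / 2) * (t * ?q) powr (s/2) <= t powr (- s / 2) * (1 + (1/4) powr (s/2))" by (intro mult_left_mono) auto
    moreover have "t powr (- s / 2) * (t * ?q) powr (s/2) = 2 powr (s * real_of_int j)"
    proof -
     have "t powr (- s / 2) * t powr (s / 2) = 1" using t0 by (simp add: powr_add[symmetric])
     moreover have "(t * ?q) powr (s/2) = t powr (s/2) * 2 powr (s * real_of_int j)" using t0 by (simp add: powr_mult four_powr_half)
     ultimately show ?thesis by (simp add: mult.assoc[symmetric])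
    qed
    ultimately have e: "2 powr (s * real_of_int j) <= t powr (- s / 2) * (1 + (1/4) powr (s/2))" by simp
    have "?a <= ennreal K1 * (ennreal K2 * X (?h t))" by (rule order_trans[OF K1(2)[OF j x] mult_left_mono[OF K2(2)[OF j]]]) simp
    then have "?w j <= ennreal (t powr (- s / 2) * (1 + (1/4) powr (s/2))) * (ennreal K1 * (ennreal K2 * X (?h t)))"
     by (intro mult_mono ennreal_leI e) auto
    also have "... = ennreal K * ?H t"
    proof -
     have n: "0 <= 1 + (1/4) powr (s/2)" by (simp add: add_nonneg_nonneg)
     have "ennreal (t powr (- s / 2) * (1 + (1/4) powr (s/2))) = ennreal (t powr (- s / 2)) * ennreal (1 + (1/4) powr (s/2))"
      by (rule ennreal_mult[OF _ n]) simp
     moreover have "ennreal K = ennreal (1 + (1/4) powr (s/2)) * ennreal K1 * ennreal K2"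
      unfolding K_def using n K1(1) K2(1) by (subst ennreal_mult; (subst ennreal_mult)?) auto
     ultimately show ?thesis by (simp only: mult_ac)
    qed
    also have "... = ennreal (K * enn2real (?H t))" using K Hf[OF t0] by (subst ennreal_mult) auto
    finally show ?thesis .
   qed
   have "?w j = ?w j * (ennreal (4/3) * ennreal (3/4))" by (simp flip: ennreal_mult)
   also have "... = (?w j * ennreal (4/3)) * ennreal (3/4)" by (simp only: mult_ac)
   also have "... <= (?w j * ennreal (4/3)) * (\<integral>\<^sup>+t. indicator (dyadic_interval j) t \<partial>tmeas)"
    by (intro mult_left_mono time_measure_dyadic_interval j) simp
   also have "... = (\<integral>\<^sup>+t. (?w j * ennreal (4/3)) * indicator (dyadic_interval j) t \<partial>tmeas)"
    by (rule nn_integral_cmult[OF Im, symmetric])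
   also have "... <= (\<integral>\<^sup>+t. ennreal (c * indicator (dyadic_interval j) t * enn2real (?H t)) \<partial>tmeas)"
   proof (intro nn_integral_mono)
    fix t
    show "?w j * ennreal (4/3) * indicator (dyadic_interval j) t <= ennreal (c * indicator (dyadic_interval j) t * enn2real (?H t))"
    proof (cases "t \<in> dyadic_interval j")
     case True
     have "?w j * ennreal (4/3) <= ennreal (K * enn2real (?H t)) * ennreal (4/3)" by (intro mult_right_mono pt True) simp
     also have "... = ennreal (c * enn2real (?H t))" using K by (simp add: c_def mult_ac flip: ennreal_mult)
     finally show ?thesis using True by simp
    qed simp
   qed
   finally show "?w j <= (\<integral>\<^sup>+t. ennreal (c * indicator (dyadic_interval j) t * enn2real (?H t)) \<partial>tmeas)" .
  qed
  then show ?thesis using real c by (simp add: besov_norm_def ennreal_mult)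
 qed
 then show ?thesis using c by (intro exI[of _ "3 * c"]) auto
qed

end

theorem theorem1p4:
  fixes \<phi>0 :: "real \<Rightarrow> real" and s s0 :: real and p q :: ennreal and j0 :: int
    and X_norm :: "'n::finite dist \<Rightarrow> ennreal"
  assumes "dyadic_partition \<phi>0"
    and "s0 > s / 2"
    and "1 \<le> p" and "1 \<le> q"
    and "j0 = -1"
    and "X_norm = dist_Lp_norm p \<or> (\<exists>r\<ge>1. X_norm = besov_norm \<phi>0 0 p r)"
  shows "\<exists>C::real. C > 0 \<and>
           (\<forall>f \<in> besov_space \<phi>0 s p q.
              ennreal (1 / C) * besov_norm \<phi>0 s p q f \<le> heat_norm s s0 q j0 X_norm f \<and>
              heat_norm s s0 q j0 X_norm f \<le> ennreal C * besov_norm \<phi>0 s p q f)"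
proof -
  interpret dyadic \<phi>0 by unfold_locales (rule assms(1))
  obtain A where A: "A > 0" "\<And>f :: 'n dist. f \<in> besov_space \<phi>0 s p q \<Longrightarrow> heat_norm s s0 q j0 X_norm f \<le> ennreal A * besov_norm \<phi>0 s p q f"
    using heat_norm_upper[OF assms(6,3,4,2)] assms(5) by blast
  obtain B where B: "B > 0" "\<And>f :: 'n dist. f \<in> besov_space \<phi>0 s p q \<Longrightarrow> besov_norm \<phi>0 s p q f \<le> ennreal B * heat_norm s s0 q j0 X_norm f"
    using heat_norm_lower[OF assms(6,3,4)] assms(5) by blast
  show ?thesis
  \<comment> \<open>A + B dominates both A and B, so it serves as the constant in both
    directions.\<close>
  proof (intro exI[of _ "A + B"] conjI ballI)
    show "0 < A + B" using A(1) B(1) by simp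
    fix f :: "'n dist" assume f: "f \<in> besov_space \<phi>0 s p q"
    have "ennreal (1 / (A + B)) * besov_norm \<phi>0 s p q f \<le> ennreal (1 / (A + B)) * (ennreal B * heat_norm s s0 q j0 X_norm f)"
      by (intro mult_left_mono B(2) f) simp
    also have "\<dots> = ennreal (B / (A + B)) * heat_norm s s0 q j0 X_norm f"
      using A(1) B(1) by (simp add: mult.assoc[symmetric] flip: ennreal_mult)
    also have "\<dots> \<le> 1 * heat_norm s s0 q j0 X_norm f"
      using A(1) B(1) by (intro mult_right_mono) (simp_all add: ennreal_le_1)
    finally show "ennreal (1 / (A + B)) * besov_norm \<phi>0 s p q f \<le> heat_norm s s0 q j0 X_norm f" by simp
    have "ennreal A * besov_norm \<phi>0 s p q f \<le> ennreal (A + B) * besov_norm \<phi>0 s p q f"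
      using B(1) by (intro mult_right_mono ennreal_leI) auto
    with A(2)[OF f] show "heat_norm s s0 q j0 X_norm f \<le> ennreal (A + B) * besov_norm \<phi>0 s p q f" by (rule order_trans)
  qed
qed

end
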